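(* Assume the Generalized Riemann Hypothesis for the $L$-functions $L_k(s)$, $k\ge 1$ (that is, all zeros of $L_k(s)$ in the strip $0<\operatorname{Re}(s)<1$ lie on the line $\operatorname{Re}(s)=1/2$). Then $$\frac{1}{K}\,\#\{1\le k\le K : L_{k}(1/2) \neq 0 \}\ \geq\ \frac{3}{4}+o(1)\qquad\text{as } K\to\infty.$$
   Context: For $k\in\mathbb{Z}$ and a nonzero ideal $\mathfrak{a}=\langle\alpha\rangle$ of $\mathbb{Z}[i]$, put $\Xi_k(\mathfrak{a})=(\alpha/\overline{\alpha})^{2k}$ (independent of the generator $\alpha$) and $N(\mathfrak{a})=\alpha\overline{\alpha}$. The Hecke $L$-function is $L_k(s)=\sum_{\mathfrak{a}\neq 0}\Xi_k(\mathfrak{a})N(\mathfrak{a})^{-s}$ for $\operatorname{Re}(s)>1$; for $k\ne 0$ it continues to an entire function of $s$. *)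

theory Defs
  imports
    "HOL-Complex_Analysis.Complex_Analysis"
    "HOL-Algebra.Ideal"
    "HOL-Library.Landau_Symbols"
begin

definition gauss_ring :: "complex ring" where
  "gauss_ring =
     \<lparr>carrier = {z. Re z \<in> \<int> \<and> Im z \<in> \<int>}, mult = (*), one = 1, zero = 0, add = (+)\<rparr>"

lemma cring_gauss_ring: "cring gauss_ring"
proof (rule cringI)
  show "abelian_group gauss_ring"
  proof (rule abelian_groupI)
    fix x assume "x \<in> carrier gauss_ring"
    then show "\<exists>y\<in>carrier gauss_ring. y \<oplus>\<^bsub>gauss_ring\<^esub> x = \<zero>\<^bsub>gauss_ring\<^esub>"
      by (intro bexI[of _ "- x"]) (auto simp: gauss_ring_def)
  qed (auto simp: gauss_ring_def)
  show "comm_monoid gauss_ring"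
    by (rule comm_monoidI) (auto simp: gauss_ring_def)
qed (auto simp: gauss_ring_def distrib_right)

definition ideal_gen :: "complex set \<Rightarrow> complex" where
  "ideal_gen I = (SOME \<alpha>. \<alpha> \<in> carrier gauss_ring \<and> I = PIdl\<^bsub>gauss_ring\<^esub> \<alpha>)"

text \<open>The ideal character and the ideal norm are read off from a chosen generator; lemmas
  \<open>Xi_PIdl\<close> and \<open>ideal_norm_PIdl\<close> show that the choice does not matter.\<close>

definition Xi :: "int \<Rightarrow> complex set \<Rightarrow> complex" where
  "Xi k I = (ideal_gen I / cnj (ideal_gen I)) powi (2 * k)"

definition ideal_norm :: "complex set \<Rightarrow> complex" where
  "ideal_norm I = ideal_gen I * cnj (ideal_gen I)"

definition nonzero_ideals :: "complex set set" where
  "nonzero_ideals = {I. ideal I gauss_ring \<and> I \<noteq> {\<zero>\<^bsub>gauss_ring\<^esub>}}"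

definition hecke_series :: "int \<Rightarrow> complex \<Rightarrow> complex" where
  "hecke_series k s = (\<Sum>\<^sub>\<infinity>I\<in>nonzero_ideals. Xi k I * ideal_norm I powr (- s))"

text \<open>The entire continuation of the series. It exists only for \<open>k \<noteq> 0\<close>; for \<open>k = 0\<close> the
  series has a pole at \<open>1\<close> and the value is unspecified.\<close>

definition hecke_L :: "int \<Rightarrow> complex \<Rightarrow> complex" where
  "hecke_L k = (THE f. f holomorphic_on UNIV \<and> (\<forall>s. Re s > 1 \<longrightarrow> f s = hecke_series k s))"

lemma gauss_unit_cases:
  assumes "u \<in> carrier gauss_ring" "v \<in> carrier gauss_ring" "u * v = 1"
  shows "u \<in> {1, -1, \<i>, -\<i>}"
proof -
  obtain a b where ab: "Re u = of_int a" "Im u = of_int b"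
    using assms(1) by (auto simp: gauss_ring_def elim!: Ints_cases)
  obtain c d where cd: "Re v = of_int c" "Im v = of_int d"
    using assms(2) by (auto simp: gauss_ring_def elim!: Ints_cases)
  have "(cmod u)\<^sup>2 * (cmod v)\<^sup>2 = 1"
    by (metis assms(3) norm_mult norm_one power_mult_distrib power_one)
  then have "real_of_int ((a\<^sup>2 + b\<^sup>2) * (c\<^sup>2 + d\<^sup>2)) = of_int 1"
    by (simp add: cmod_power2 ab cd)
  then have "(a\<^sup>2 + b\<^sup>2) * (c\<^sup>2 + d\<^sup>2) = 1"
    by (simp only: of_int_eq_iff)
  then have *: "a\<^sup>2 + b\<^sup>2 = 1"
    by (metis abs_of_nonneg sum_power2_ge_zero zmult_eq_1_iff abs_neg_one one_neq_neg_one)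
  have "\<bar>a\<bar> \<le> 1" "\<bar>b\<bar> \<le> 1"
    using * by (metis abs_square_le_1 le_add_same_cancel1 le_add_same_cancel2 zero_le_power2)+
  then have "a \<in> {-1, 0, 1}" "b \<in> {-1, 0, 1}"
    by auto
  then show ?thesis
    using * ab by (auto simp: complex_eq_iff)
qed

lemma PIdl_eq_imp_unit:
  assumes "\<alpha> \<in> carrier gauss_ring" "\<beta> \<in> carrier gauss_ring" "\<alpha> \<noteq> 0"
    and "PIdl\<^bsub>gauss_ring\<^esub> \<alpha> = PIdl\<^bsub>gauss_ring\<^esub> \<beta>"
  obtains u where "u \<in> {1, -1, \<i>, -\<i>}" "\<beta> = u * \<alpha>"
proof -
  interpret cring gauss_ring by (rule cring_gauss_ring)
  have "\<beta> \<in> PIdl\<^bsub>gauss_ring\<^esub> \<alpha>" "\<alpha> \<in> PIdl\<^bsub>gauss_ring\<^esub> \<beta>"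
    using cgenideal_self[OF assms(1)] cgenideal_self[OF assms(2)] assms(4) by auto
  moreover have "x \<otimes>\<^bsub>gauss_ring\<^esub> y = x * y" for x y
    by (simp add: gauss_ring_def)
  ultimately obtain u v where uv: "u \<in> carrier gauss_ring" "v \<in> carrier gauss_ring"
      "\<beta> = u * \<alpha>" "\<alpha> = v * \<beta>"
    unfolding cgenideal_def mem_Collect_eq by metis
  then have "u * v = 1"
    using assms(3) by simp
  with uv gauss_unit_cases that show thesis by blast
qed

lemma ideal_gen_PIdl:
  assumes "\<alpha> \<in> carrier gauss_ring" "\<alpha> \<noteq> 0"
  obtains u where "u \<in> {1, -1, \<i>, -\<i>}" "ideal_gen (PIdl\<^bsub>gauss_ring\<^esub> \<alpha>) = u * \<alpha>"
proof -
  let ?g = "ideal_gen (PIdl\<^bsub>gauss_ring\<^esub> \<alpha>)"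
  have "?g \<in> carrier gauss_ring \<and> PIdl\<^bsub>gauss_ring\<^esub> \<alpha> = PIdl\<^bsub>gauss_ring\<^esub> ?g"
    unfolding ideal_gen_def by (rule someI[of _ \<alpha>]) (use assms in auto)
  with PIdl_eq_imp_unit assms that show thesis by blast
qed

lemma Xi_PIdl:
  assumes "\<alpha> \<in> carrier gauss_ring" "\<alpha> \<noteq> 0"
  shows "Xi k (PIdl\<^bsub>gauss_ring\<^esub> \<alpha>) = (\<alpha> / cnj \<alpha>) powi (2 * k)"
proof -
  obtain u where u: "u \<in> {1, -1, \<i>, -\<i>}" "ideal_gen (PIdl\<^bsub>gauss_ring\<^esub> \<alpha>) = u * \<alpha>"
    using ideal_gen_PIdl[OF assms] .
  have "(u * \<alpha> / cnj (u * \<alpha>))\<^sup>2 = (\<alpha> / cnj \<alpha>)\<^sup>2"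
    using u(1) by (auto simp: power2_eq_square)
  then show ?thesis
    unfolding Xi_def u(2) power_int_mult by simp
qed

lemma ideal_norm_PIdl:
  assumes "\<alpha> \<in> carrier gauss_ring" "\<alpha> \<noteq> 0"
  shows "ideal_norm (PIdl\<^bsub>gauss_ring\<^esub> \<alpha>) = \<alpha> * cnj \<alpha>"
proof -
  obtain u where u: "u \<in> {1, -1, \<i>, -\<i>}" "ideal_gen (PIdl\<^bsub>gauss_ring\<^esub> \<alpha>) = u * \<alpha>"
    using ideal_gen_PIdl[OF assms] .
  then show ?thesis
    unfolding ideal_norm_def by auto
qed

lemma hecke_L_eqI:
  assumes "f holomorphic_on UNIV" "\<And>s. Re s > 1 \<Longrightarrow> f s = hecke_series k s"
  shows "hecke_L k = f"
  unfolding hecke_L_def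
proof (rule the_equality)
  fix g assume g: "g holomorphic_on UNIV \<and> (\<forall>s. Re s > 1 \<longrightarrow> g s = hecke_series k s)"
  show "g = f"
  proof
    fix s
    show "g s = f s"
    proof (rule analytic_continuation_open[of "{s. Re s > 1}" UNIV g f])
      show "{s. Re s > 1} \<noteq> {}"
        by (auto intro!: exI[of _ 2])
    qed (use g assms in \<open>auto simp: open_halfspace_Re_gt\<close>)
  qed
qed (use assms in auto)

end

theory Submission
  imports
    Defs
    "HOL-Number_Theory.Number_Theory"
    "HOL-Probability.Probability"
    "HOL-Real_Asymp.Real_Asymp"
begin

text \<open>The completed function \<open>Lam k s = \<pi>^(-s) \<Gamma>(s + 2k) L_k(s)\<close> is even about \<open>1/2\<close>, so a zero
  there has order at least 2. Write \<open>m = 2\<close> if \<open>L_k(1/2) = 0\<close>, \<open>m = 0\<close> otherwise, and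
  \<open>Lam k s = (s - 1/2)^m G(s)\<close>. By GRH, \<open>G\<close> has no zeros off the critical line, and this forces
  \<open>Re (G'/G) \<ge> 0\<close> to the right of it; no Hadamard product or zero counting is needed. Testing this
  inequality against a Fejer kernel on the line \<open>Re s = 1/2 + \<delta>\<close>, moving the contribution of
  \<open>L_k'/L_k\<close> into the region of absolute convergence and letting \<open>\<delta>\<close> tend to 0 gives
  \<open>m \<le> 2 ln k / L + O(1/L) - (1 / (2 L^2)) S_k\<close>, where \<open>S_k\<close> is the sum of
  \<open>\<Lambda>(\<alpha>) (\<alpha> / cnj \<alpha>)^(2k) |\<alpha>|^(-1) (L - ln |\<alpha>|^2)\<close> over the Gaussian integers with
  \<open>0 < |\<alpha>|^2 \<le> e^L\<close>. Now average over \<open>k \<le> K\<close> with \<open>L\<close> slightly below \<open>2 ln K\<close>. On the axes the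
  character is 1, and the inert primes \<open>p \<equiv> 3 mod 4\<close> and their powers contribute at least
  \<open>L^2 - O(L)\<close> to \<open>S_k\<close>; off the axes the geometric sums over \<open>k\<close> make the contribution
  negligible. Hence the average of \<open>m\<close> is at most \<open>1 - 1/2 + o(1)\<close>, so that at most a proportion
  \<open>1/4 + o(1)\<close> of the central values vanish.\<close>

section \<open>Gaussian integers\<close>

text \<open>On the line Re s = 1/2 + \<delta> the factor (s - 1/2)^m contributes m \<delta> /
  (\<delta>^2 + t^2) to the real part of the logarithmic derivative. This Poisson kernel
  concentrates the mass m pi at t = 0, where the Fejer kernel equals 1; whatever other zeros add has
  the favourable sign and is dropped through Re (G'/G) >= 0. The bound on L comes from the average
  over k. At a + b i off the axes the geometric sum over k is at most (a^2 + b^2) / (2 |a b|), and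
  against the weights these bounds add up to e^(L/2) times a power of L, which has to stay below K.
  Hence L just under 2 ln K, and 2 ln K / L tends to 1. The saving 1/2 is a bias of the family: on
  the axes the characters do not oscillate with k, so the inert primes survive averaging. Their
  density is needed only as a lower bound, and Mertens's elementary method with the character modulo
  4 supplies it. GRH concerns the open strip only. For Re s > 1 the logarithm of the L-function is a
  Dirichlet series, and on Re s = 1 the 3-4-1 inequality excludes zeros.\<close>

datatype gint = Gint (gre: int) (gim: int)

lemma gint_eq_iff: "x = y \<longleftrightarrow> gre x = gre y \<and> gim x = gim y"
  by (cases x; cases y) auto

text \<open>A type of its own, next to the complex carrier of \<open>gauss_ring\<close>, gives
  access to type-class divisibility, \<open>prime_factors\<close> and \<open>multiplicity\<close>;
  \<open>of_gint\<close> leads back to the complex numbers.\<close>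

instantiation gint :: comm_ring_1
begin
definition "0 = Gint 0 0"
definition "1 = Gint 1 0"
definition "x + y = Gint (gre x + gre y) (gim x + gim y)"
definition "x - y = Gint (gre x - gre y) (gim x - gim y)"
definition "- x = Gint (- gre x) (- gim x)"
definition "x * y = Gint (gre x * gre y - gim x * gim y) (gre x * gim y + gim x * gre y)"
instance
  by standard (auto simp: zero_gint_def one_gint_def plus_gint_def minus_gint_def
      uminus_gint_def times_gint_def algebra_simps)
end

lemma gint_sel [simp]:
  "gre 0 = 0" "gim 0 = 0" "gre 1 = 1" "gim 1 = 0"
  "gre (x + y) = gre x + gre y" "gim (x + y) = gim x + gim y"
  "gre (x - y) = gre x - gre y" "gim (x - y) = gim x - gim y"
  "gre (- x) = - gre x" "gim (- x) = - gim x"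
  "gre (x * y) = gre x * gre y - gim x * gim y" "gim (x * y) = gre x * gim y + gim x * gre y"
  by (simp_all add: zero_gint_def one_gint_def plus_gint_def minus_gint_def
      uminus_gint_def times_gint_def)

lemma gint_of_nat_sel [simp]: "gre (of_nat n) = int n" "gim (of_nat n) = 0"
  by (induction n) auto

definition of_gint :: "gint \<Rightarrow> complex" where
  "of_gint x = Complex (of_int (gre x)) (of_int (gim x))"

definition gnorm :: "gint \<Rightarrow> nat" where
  "gnorm x = nat ((gre x)\<^sup>2 + (gim x)\<^sup>2)"

lemma Re_of_gint [simp]: "Re (of_gint x) = of_int (gre x)"
  and Im_of_gint [simp]: "Im (of_gint x) = of_int (gim x)"
  by (simp_all add: of_gint_def)

lemma of_gint_simps [simp]:
  "of_gint 0 = 0" "of_gint 1 = 1" "of_gint (x + y) = of_gint x + of_gint y"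
  "of_gint (x - y) = of_gint x - of_gint y" "of_gint (- x) = - of_gint x"
  "of_gint (x * y) = of_gint x * of_gint y"
  by (simp_all add: complex_eq_iff)

lemma of_gint_eq_iff [simp]: "of_gint x = of_gint y \<longleftrightarrow> x = y"
  by (simp add: complex_eq_iff gint_eq_iff)

lemma of_gint_eq_0_iff [simp]: "of_gint x = 0 \<longleftrightarrow> x = 0"
  using of_gint_eq_iff[of x 0] by (simp del: of_gint_eq_iff)

lemma of_gint_of_nat [simp]: "of_gint (of_nat n) = of_nat n"
  by (simp add: complex_eq_iff)

lemma of_nat_gnorm: "real (gnorm x) = (cmod (of_gint x))\<^sup>2"
  by (simp add: gnorm_def cmod_power2)

lemma gnorm_0 [simp]: "gnorm 0 = 0" and gnorm_1 [simp]: "gnorm 1 = 1"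
  by (simp_all add: gnorm_def)

lemma gnorm_mult: "gnorm (x * y) = gnorm x * gnorm y"
proof -
  have "real (gnorm (x * y)) = real (gnorm x * gnorm y)"
    by (simp add: of_nat_gnorm norm_mult power_mult_distrib)
  then show ?thesis by (simp only: of_nat_eq_iff)
qed

lemma gnorm_power: "gnorm (x ^ n) = gnorm x ^ n"
  by (induction n) (simp_all add: gnorm_mult)

lemma gnorm_eq_0_iff [simp]: "gnorm x = 0 \<longleftrightarrow> x = 0"
proof -
  have "gnorm x = 0 \<longleftrightarrow> real (gnorm x) = 0" by simp
  also have "\<dots> \<longleftrightarrow> x = 0" unfolding of_nat_gnorm by simp
  finally show ?thesis .
qed

lemma gnorm_pos_iff: "gnorm x > 0 \<longleftrightarrow> x \<noteq> 0"
  using gnorm_eq_0_iff[of x] by linarith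

instance gint :: idom
proof
  fix x y :: gint assume "x \<noteq> 0" "y \<noteq> 0"
  then show "x * y \<noteq> 0" by (metis gnorm_eq_0_iff gnorm_mult mult_is_0)
qed

definition gunits :: "gint set" where
  "gunits = {1, Gint 0 1, - 1, Gint 0 (- 1)}"

lemma gnorm_1_cases: "gnorm x = 1 \<Longrightarrow> x \<in> gunits"
proof -
  assume "gnorm x = 1"
  then have *: "(gre x)\<^sup>2 + (gim x)\<^sup>2 = 1" by (simp add: gnorm_def)
  have "(gre x)\<^sup>2 \<le> 1" "(gim x)\<^sup>2 \<le> 1"
    using * by (metis le_add_same_cancel1 le_add_same_cancel2 zero_le_power2)+
  then have "\<bar>gre x\<bar> \<le> 1" "\<bar>gim x\<bar> \<le> 1"
    by (simp_all add: abs_square_le_1)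
  then have "gre x \<in> {-1,0,1}" "gim x \<in> {-1,0,1}" by auto
  then show ?thesis using * by (auto simp: gint_eq_iff gunits_def)
qed

lemma gint_dvd_1_iff: "x dvd 1 \<longleftrightarrow> x \<in> gunits"
proof
  assume "x dvd 1"
  then obtain y where "1 = x * y" by auto
  then have "gnorm x * gnorm y = 1" by (metis gnorm_mult gnorm_1)
  then show "x \<in> gunits" by (intro gnorm_1_cases) auto
next
  assume "x \<in> gunits"
  moreover have "1 = Gint 0 1 * Gint 0 (-1)" "1 = (-1) * (-1 :: gint)"
      "1 = Gint 0 (-1) * Gint 0 1"
    by (simp_all add: gint_eq_iff)
  ultimately show "x dvd 1" unfolding gunits_def by (metis dvd_triv_left dvd_refl empty_iff insert_iff)
qed

section \<open>Euclidean division of Gaussian integers\<close>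

definition round_complex :: "complex \<Rightarrow> gint" where
  "round_complex z = Gint (round (Re z)) (round (Im z))"

lemma round_complex_of_gint [simp]: "round_complex (of_gint x) = x"
  by (simp add: round_complex_def)

text \<open>Each coordinate is off by at most 1/2. That the resulting 1/2 lies below 1 is what makes
  the remainder of a division smaller than the divisor.\<close>

lemma norm_round_complex: "(cmod (z - of_gint (round_complex z)))\<^sup>2 \<le> 1 / 2"
proof -
  have "\<bar>Re z - round (Re z)\<bar> \<le> 1/2" "\<bar>Im z - round (Im z)\<bar> \<le> 1/2"
    using of_int_round_abs_le[of "Re z"] of_int_round_abs_le[of "Im z"] by linarith+
  then have "\<bar>Re z - round (Re z)\<bar>\<^sup>2 \<le> (1/2)\<^sup>2" "\<bar>Im z - round (Im z)\<bar>\<^sup>2 \<le> (1/2)\<^sup>2"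
    by (intro power_mono; simp)+
  then show ?thesis
    unfolding cmod_power2 by (simp add: round_complex_def power_divide)
qed

text \<open>Division rounds the complex quotient to a nearest lattice point.
  \<open>unit_factor\<close> is the unit that belongs to the half-open quadrant of x, so that
  \<open>normalize\<close> moves every nonzero element to positive real and nonnegative imaginary
  part.\<close>

instantiation gint :: normalization_euclidean_semiring
begin
definition "x div y = round_complex (of_gint x / of_gint y)"
definition "x mod (y :: gint) = x - x div y * y"
definition "euclidean_size = gnorm"
definition "unit_factor x =
  (if x = 0 then 0 else if gre x > 0 \<and> gim x \<ge> 0 then 1 else if gre x \<le> 0 \<and> gim x > 0 then Gint 0 1
   else if gre x < 0 \<and> gim x \<le> 0 then - 1 else Gint 0 (- 1))"
definition "normalize (x :: gint) = x div unit_factor x"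
instance
proof
  show "(x :: gint) div 0 = 0" for x
    using round_complex_of_gint[of 0] by (simp add: divide_gint_def)
  show *: "y \<noteq> 0 \<Longrightarrow> x * y div y = x" for x y :: gint
    by (simp add: divide_gint_def)
  have uf: "unit_factor x \<in> gunits" if "x \<noteq> 0" for x :: gint
    using that by (auto simp: unit_factor_gint_def gunits_def)
  show "unit_factor x * normalize x = x" for x :: gint
  proof (cases "x = 0")
    case True then show ?thesis by (simp add: unit_factor_gint_def)
  next
    case False
    then have "unit_factor x dvd 1" using uf gint_dvd_1_iff by blast
    then obtain y where y: "x = y * unit_factor x"
      by (metis dvd_def mult.commute mult.left_commute mult_1)
    have "unit_factor x \<noteq> 0" using uf[OF False] by (auto simp: gint_eq_iff gunits_def)
    then have "normalize x = y" using y * unfolding normalize_gint_def by metis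
    then show ?thesis using y by (simp add: mult.commute)
  qed
  show "normalize (0 :: gint) = 0"
    using round_complex_of_gint[of 0] by (simp add: normalize_gint_def divide_gint_def)
  show "unit_factor (0 :: gint) = 0" by (simp add: unit_factor_gint_def)
  show "x dvd 1 \<Longrightarrow> unit_factor x = x" for x :: gint
    by (auto simp: gint_dvd_1_iff gunits_def unit_factor_gint_def gint_eq_iff)
  show "x \<noteq> 0 \<Longrightarrow> unit_factor x dvd 1" for x :: gint
    using uf gint_dvd_1_iff by blast
  \<comment> \<open>A quarter turn permutes the four half-open quadrants cyclically. Every unit is a
    power of \<open>Gint 0 1\<close>, so this case gives compatibility with all units.\<close>
  have i: "unit_factor (Gint 0 1 * y) = Gint 0 1 * unit_factor y" for y :: gint
    unfolding unit_factor_gint_def by (simp add: gint_eq_iff) linarith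
  show "unit_factor (x * y) = x * unit_factor y" if "x dvd 1" for x y :: gint
  proof -
    have "- 1 = Gint 0 1 * Gint 0 1" "Gint 0 (- 1) = Gint 0 1 * (Gint 0 1 * Gint 0 1)"
      by (simp_all add: gint_eq_iff)
    then show ?thesis
      using that unfolding gint_dvd_1_iff gunits_def by (auto simp: i mult.assoc simp del: mult_minus_left)
  qed
  show "x div y * y + x mod y = x" for x y :: gint
    by (simp add: modulo_gint_def)
  show "euclidean_size (0 :: gint) = 0" by (simp add: euclidean_size_gint_def)
  show "euclidean_size (x mod y) < euclidean_size y" if "y \<noteq> 0" for x y :: gint
  proof -
    have "of_gint (x mod y) = (of_gint x / of_gint y - of_gint (x div y)) * of_gint y"
      using that by (simp add: modulo_gint_def field_simps)
    then have "real (gnorm (x mod y)) =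
        (cmod (of_gint x / of_gint y - of_gint (x div y)))\<^sup>2 * real (gnorm y)"
      by (simp add: of_nat_gnorm norm_mult power_mult_distrib)
    also have "\<dots> \<le> 1 / 2 * real (gnorm y)"
      unfolding divide_gint_def by (intro mult_right_mono norm_round_complex) auto
    also have "\<dots> < real (gnorm y)" using that by (simp add: gnorm_pos_iff)
    finally show ?thesis by (simp add: euclidean_size_gint_def)
  qed
  show "y \<noteq> 0 \<Longrightarrow> euclidean_size x \<le> euclidean_size (x * y)" for x y :: gint
    using gnorm_pos_iff[of y] by (simp add: euclidean_size_gint_def gnorm_mult)
qed
end

section \<open>Norms, prime factorizations and the von Mangoldt function\<close>

lemma gunits_gnorm: "u \<in> gunits \<Longrightarrow> gnorm u = 1"
  by (auto simp: gnorm_def gunits_def)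

lemma gnorm_normalize: "gnorm (normalize x) = gnorm x"
proof (cases "x = 0")
  case False
  have "gnorm x = gnorm (unit_factor x) * gnorm (normalize x)"
    by (simp flip: gnorm_mult)
  moreover have "gnorm (unit_factor x) = 1"
    using False gunits_gnorm gint_dvd_1_iff unit_factor_is_unit by blast
  ultimately show ?thesis by simp
qed auto

lemma gnorm_prod: "gnorm (prod f A) = (\<Prod>x\<in>A. gnorm (f x))"
  by (induction A rule: infinite_finite_induct) (auto simp: gnorm_mult)

text \<open>The von Mangoldt function of the ideal generated by x, as a function of x: the logarithm
  of the norm of p on associates of prime powers of p, and 0 elsewhere, including 0 and the units.
  Each ideal is thereby met four times in sums over elements, which is the origin of the factors 4
  and 1/4 below.\<close>

definition gmangoldt :: "gint \<Rightarrow> real" where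
  "gmangoldt x = (if card (prime_factors x) = 1 then ln (gnorm (the_elem (prime_factors x))) else 0)"

lemma gmangoldt_eq: "prime_factors x = {p} \<Longrightarrow> gmangoldt x = ln (gnorm p)"
  by (simp add: gmangoldt_def)

lemma gmangoldt_nonneg: "gmangoldt x \<ge> 0"
proof (cases "card (prime_factors x) = 1")
  case True
  then obtain p where p: "prime_factors x = {p}" by (auto simp: card_Suc_eq)
  then have "p \<in> prime_factors x" by simp
  then have "p \<noteq> 0" by (meson in_prime_factors_imp_prime not_prime_0)
  then have "gnorm p \<ge> 1" using gnorm_pos_iff[of p] by simp
  then show ?thesis using p by (simp add: gmangoldt_eq)
qed (simp add: gmangoldt_def)

lemma finite_gnorm_le: "finite {x. gnorm x \<le> n}"
proof -
  have "{x. gnorm x \<le> n} \<subseteq> (\<lambda>(a, b). Gint a b) ` ({- int n..int n} \<times> {- int n..int n})"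
  proof
    fix x assume "x \<in> {x. gnorm x \<le> n}"
    then have *: "(gre x)\<^sup>2 + (gim x)\<^sup>2 \<le> int n" by (simp add: gnorm_def)
    have "\<bar>a\<bar> \<le> a\<^sup>2" for a :: int
    proof (cases "a = 0")
      case False
      then have "\<bar>a\<bar> * 1 \<le> \<bar>a\<bar> * \<bar>a\<bar>" by (intro mult_left_mono) auto
      then show ?thesis by (simp add: power2_eq_square)
    qed simp
    from this[of "gre x"] this[of "gim x"] have "\<bar>gre x\<bar> \<le> int n" "\<bar>gim x\<bar> \<le> int n"
      using * zero_le_power2[of "gre x"] zero_le_power2[of "gim x"] by linarith+
    then have "(gre x, gim x) \<in> {- int n..int n} \<times> {- int n..int n}" by auto
    then show "x \<in> (\<lambda>(a, b). Gint a b) ` ({- int n..int n} \<times> {- int n..int n})"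
      by (intro image_eqI[of _ _ "(gre x, gim x)"]) auto
  qed
  then show ?thesis by (rule finite_subset) auto
qed

lemma gnorm_dvd_le: "x dvd y \<Longrightarrow> y \<noteq> 0 \<Longrightarrow> gnorm x \<le> gnorm y"
proof -
  assume *: "x dvd y" "y \<noteq> 0"
  then obtain z where z: "y = x * z" by (elim dvdE)
  then have "gnorm z \<ge> 1" using * gnorm_pos_iff[of z] by simp
  then show ?thesis by (simp add: z gnorm_mult)
qed

lemma finite_gint_divisors: "x \<noteq> 0 \<Longrightarrow> finite {d :: gint. d dvd x}"
  by (rule finite_subset[OF _ finite_gnorm_le[of "gnorm x"]]) (auto intro: gnorm_dvd_le)

lemma card_gunits: "card gunits = 4"
  by (simp add: gint_eq_iff gunits_def)

lemma finite_gunits [simp]: "finite gunits"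
  by (simp add: gunits_def)

lemma prime_factors_unit_power:
  assumes "u \<in> gunits" "prime p" "j > 0"
  shows "prime_factors (u * p ^ j) = {p :: gint}"
proof -
  have "prime_factorization u = {#}"
    using assms(1) gint_dvd_1_iff by (simp add: prime_factorization_unit)
  moreover have "u \<noteq> 0" using assms(1) by (auto simp: gint_eq_iff gunits_def)
  moreover have "p \<noteq> 0" using assms(2) by auto
  ultimately have "prime_factorization (u * p ^ j) = prime_factorization (p ^ j)"
    by (simp add: prime_factorization_mult)
  then show ?thesis using assms
    by (simp add: prime_factorization_prime_power)
qed

lemma normalize_prod_prime_factors:
  fixes x :: "'a :: factorial_semiring"
  assumes "x \<noteq> 0"
  shows "normalize (\<Prod>p\<in>prime_factors x. p ^ multiplicity p x) = normalize x"
proof -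
  have "(\<Prod>p\<in>prime_factors x. p ^ multiplicity p x) =
      (\<Prod>p\<in>prime_factors x. p ^ count (prime_factorization x) p)"
    by (intro prod.cong) (auto simp: count_prime_factorization_prime dest: in_prime_factors_imp_prime)
  also have "\<dots> = prod_mset (prime_factorization x)"
    by (subst prod_mset_multiplicity) simp_all
  finally show ?thesis using assms by (simp add: prod_mset_prime_factorization_weak)
qed

lemma ln_gnorm_eq:
  assumes "x \<noteq> 0"
  shows "ln (gnorm x) = (\<Sum>p\<in>prime_factors x. multiplicity p x * ln (gnorm p))"
proof -
  have pos: "gnorm p > 0" if "p \<in> prime_factors x" for p
    using that gnorm_pos_iff by (metis in_prime_factors_imp_prime not_prime_0)
  have "gnorm x = gnorm (\<Prod>p\<in>prime_factors x. p ^ multiplicity p x)"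
    by (metis normalize_prod_prime_factors[OF assms] gnorm_normalize)
  also have "\<dots> = (\<Prod>p\<in>prime_factors x. gnorm p ^ multiplicity p x)"
    by (simp add: gnorm_prod gnorm_power)
  finally have "ln (gnorm x) = ln (\<Prod>p\<in>prime_factors x. real (gnorm p) ^ multiplicity p x)"
    by simp
  also have "\<dots> = (\<Sum>p\<in>prime_factors x. ln (real (gnorm p) ^ multiplicity p x))"
    by (rule ln_prod) (use pos in auto)
  also have "\<dots> = (\<Sum>p\<in>prime_factors x. multiplicity p x * ln (gnorm p))"
    by (intro sum.cong) (use pos in \<open>auto simp: ln_realpow\<close>)
  finally show ?thesis .
qed

text \<open>The divisors with nonzero value are the products of a unit and p^j with p a prime factor
  of x and j between 1 and the multiplicity of p. Each contributes the logarithm of the norm of p,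
  and the four units produce the factor 4.\<close>

lemma sum_gmangoldt_divisors:
  assumes "x \<noteq> 0"
  shows "(\<Sum>d | d dvd x. gmangoldt d) = 4 * ln (gnorm x)"
proof -
  define A where "A p = (\<lambda>(u, j). u * p ^ j) ` (gunits \<times> {1..multiplicity p x})" for p
  have pf: "prime_factors d = {p}" if pr: "prime p" and dA: "d \<in> A p" for d p
  proof -
    obtain u j where uj: "u \<in> gunits" "j \<in> {1..multiplicity p x}" "d = u * p ^ j"
      using dA unfolding A_def by auto
    from uj(2) have "j > 0" by simp
    then show ?thesis unfolding uj(3) by (rule prime_factors_unit_power[OF uj(1) pr])
  qed
  have Apos: "A p \<subseteq> {d. d dvd x}" if "p \<in> prime_factors x" for p
  proof
    fix d assume "d \<in> A p"
    then obtain u j where d: "u \<in> gunits" "j \<le> multiplicity p x" "d = u * p ^ j"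
      by (auto simp: A_def)
    have "p ^ j dvd x" using d(2) by (simp add: multiplicity_dvd')
    moreover have "u dvd 1" using d gint_dvd_1_iff by blast
    ultimately show "d \<in> {d. d dvd x}" unfolding d(3) by (simp add: mult_unit_dvd_iff')
  qed
  \<comment> \<open>Taking norms recovers the exponent, because \<open>gnorm p > 1\<close>; then the
    unit is determined by cancellation.\<close>
  have card_A: "card (A p) = 4 * multiplicity p x" if "prime p" for p
  proof -
    have "inj_on (\<lambda>(u, j). u * p ^ j) (gunits \<times> {1..multiplicity p x})"
    proof (rule inj_onI, clarify)
      fix u j v l assume uv: "u \<in> gunits" "v \<in> gunits" "u * p ^ j = v * p ^ l"
      have "gnorm p > 1"
      proof (rule ccontr)
        assume "\<not> gnorm p > 1"
        then have "gnorm p = 0 \<or> gnorm p = 1" by linarith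
        then have "p = 0 \<or> p dvd 1" using gnorm_1_cases gint_dvd_1_iff gnorm_eq_0_iff by blast
        then show False using that by (auto dest: not_prime_unit)
      qed
      moreover have "gnorm p ^ j = gnorm p ^ l"
        using uv gunits_gnorm by (metis gnorm_mult gnorm_power mult_1)
      ultimately have "j = l" by simp
      then show "u = v \<and> j = l" using uv(3) that by auto
    qed
    then have "card (A p) = card (gunits \<times> {1..multiplicity p x})"
      unfolding A_def by (rule card_image)
    then show ?thesis by (simp add: card_cartesian_product card_gunits)
  qed
  have "(\<Sum>d | d dvd x. gmangoldt d) = (\<Sum>d\<in>(\<Union>p\<in>prime_factors x. A p). gmangoldt d)"
  proof (rule sum.mono_neutral_right)
    show "finite {d. d dvd x}" by (rule finite_gint_divisors) fact
    show "(\<Union>p\<in>prime_factors x. A p) \<subseteq> {d. d dvd x}" using Apos by blast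
    \<comment> \<open>A divisor with a single prime factor p is associated to a power of p, hence
      equal to a unit times that power.\<close>
    show "\<forall>d\<in>{d. d dvd x} - (\<Union>p\<in>prime_factors x. A p). gmangoldt d = 0"
    proof (clarify, rule ccontr)
      fix d assume d: "d dvd x" "d \<notin> (\<Union>p\<in>prime_factors x. A p)" "gmangoldt d \<noteq> 0"
      then have "card (prime_factors d) = 1" by (auto simp: gmangoldt_def split: if_splits)
      then obtain p where p: "prime_factors d = {p}" by (auto simp: card_Suc_eq)
      have d0: "d \<noteq> 0" using d(1) assms by auto
      have pr: "prime p" "p dvd d" using p by (auto simp: prime_factors_dvd d0)
      have "normalize d = normalize (p ^ multiplicity p d)"
        using normalize_prod_prime_factors[OF d0] p by simp
      then have "d dvd p ^ multiplicity p d" "p ^ multiplicity p d dvd d"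
        by (simp_all add: associatedD1 associatedD2)
      then obtain u v where uv: "p ^ multiplicity p d = d * v" "d = p ^ multiplicity p d * u"
        by (elim dvdE)
      then have "d * (u * v) = d * 1" by (metis mult.assoc mult.commute mult_1_right)
      then have "u * v = 1" using d0 by (metis mult_left_cancel)
      then have "u dvd 1" by (metis dvd_triv_left)
      have du: "d = u * p ^ multiplicity p d" using uv(2) by (simp only: mult.commute)
      have "u \<in> gunits" using \<open>u dvd 1\<close> gint_dvd_1_iff by blast
      moreover note du
      moreover have "multiplicity p d \<le> multiplicity p x"
        using d(1) assms by (simp add: dvd_imp_multiplicity_le)
      moreover have "multiplicity p d > 0"
        using pr d0 by (simp add: prime_multiplicity_gt_zero_iff)
      ultimately have "d \<in> A p"
        unfolding A_def by (intro image_eqI[of _ _ "(u, multiplicity p d)"]) auto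
      moreover have "p \<in> prime_factors x"
        using pr d(1) assms by (auto simp: prime_factors_dvd intro: dvd_trans)
      ultimately show False using d(2) by blast
    qed
  qed
  also have "\<dots> = (\<Sum>p\<in>prime_factors x. \<Sum>d\<in>A p. gmangoldt d)"
  proof (rule sum.UNION_disjoint)
    show "\<forall>p\<in>prime_factors x. finite (A p)" by (simp add: A_def)
    show "\<forall>p\<in>prime_factors x. \<forall>q\<in>prime_factors x. p \<noteq> q \<longrightarrow> A p \<inter> A q = {}"
      using pf by (metis disjoint_iff in_prime_factors_imp_prime singleton_inject)
  qed simp
  also have "\<dots> = (\<Sum>p\<in>prime_factors x. \<Sum>d\<in>A p. ln (gnorm p))"
    by (intro sum.cong) (use pf gmangoldt_eq in \<open>auto dest!: in_prime_factors_imp_prime\<close>)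
  also have "\<dots> = 4 * ln (gnorm x)"
    unfolding ln_gnorm_eq[OF assms] sum_distrib_left
    by (intro sum.cong) (auto simp: card_A dest!: in_prime_factors_imp_prime)
  finally show ?thesis .
qed

lemma gmangoldt_le:
  assumes "x \<noteq> 0" shows "gmangoldt x \<le> ln (gnorm x)"
proof (cases "card (prime_factors x) = 1")
  case True
  then obtain p where p: "prime_factors x = {p}" by (auto simp: card_Suc_eq)
  then have "p \<in> prime_factors x" by simp
  then have pr: "p dvd x" "p \<noteq> 0" using assms by (auto simp: prime_factors_dvd)
  then have "gnorm p \<le> gnorm x" "gnorm p > 0" using gnorm_dvd_le assms gnorm_pos_iff by auto
  then show ?thesis using p by (simp add: gmangoldt_eq)
next
  case False
  have "gnorm x \<ge> 1" using assms gnorm_pos_iff[of x] by simp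
  then show ?thesis using False by (simp add: gmangoldt_def)
qed

text \<open>A factorization into two non-units would give a factor of norm p, so p would be a sum of
  two squares. Squares are 0 or 1 modulo 4, and 3 is not a sum of two of them.\<close>

lemma prime_3_mod_4_gint:
  assumes "prime p" "p mod 4 = 3"
  shows "prime (of_nat p :: gint)"
proof -
  have "prime_elem (of_nat p :: gint)"
  proof (rule irreducible_imp_prime_elem, rule irreducibleI)
    show "(of_nat p :: gint) \<noteq> 0" using assms by (auto simp: gint_eq_iff)
    have np: "gnorm (of_nat p) = p\<^sup>2" by (simp add: gnorm_def nat_power_eq)
    show "\<not> of_nat p dvd (1 :: gint)"
    proof
      assume "of_nat p dvd (1 :: gint)"
      then have "p\<^sup>2 = 1" using gint_dvd_1_iff gunits_gnorm np by metis
      then show False using assms(1) by simp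
    qed
    fix a b :: gint assume ab: "of_nat p = a * b"
    show "a dvd 1 \<or> b dvd 1"
    proof (rule ccontr)
      assume "\<not> (a dvd 1 \<or> b dvd 1)"
      then have ne: "gnorm a \<noteq> 1" "gnorm b \<noteq> 1" using gnorm_1_cases gint_dvd_1_iff by blast+
      have eq: "gnorm a * gnorm b = p\<^sup>2" using ab np by (metis gnorm_mult)
      then obtain i where i: "i \<le> 2" "gnorm a = p ^ i"
        using assms(1) by (metis divides_primepow_nat dvd_triv_left)
      have "i \<noteq> 0" using ne i by auto
      moreover have "i \<noteq> 2" using eq ne i assms(1) by auto
      ultimately have "gnorm a = p" using i by (auto simp: le_Suc_eq numeral_2_eq_2)
      then have "(gre a)\<^sup>2 + (gim a)\<^sup>2 = int p" by (auto simp: gnorm_def)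
      then have "((gre a)\<^sup>2 + (gim a)\<^sup>2) mod 4 = 3" using assms(2) by (metis of_nat_mod of_nat_numeral)
      moreover have "z\<^sup>2 mod 4 = 0 \<or> z\<^sup>2 mod 4 = 1" for z :: int
      proof -
        have "z mod 4 \<in> {0,1,2,3}" by auto
        moreover have "z\<^sup>2 mod 4 = (z mod 4)\<^sup>2 mod 4" by (simp add: power_mod)
        ultimately show ?thesis by auto
      qed
      moreover have "(A + B) mod 4 \<noteq> 3"
        if "A mod 4 = 0 \<or> A mod 4 = 1" "B mod 4 = 0 \<or> B mod 4 = 1" for A B :: int
        using that by presburger
      ultimately show False by blast
    qed
  qed
  moreover have "normalize (of_nat p :: gint) = of_nat p"
  proof -
    have "unit_factor (of_nat p :: gint) = 1" using assms prime_gt_0_nat[of p]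
      by (auto simp: unit_factor_gint_def gint_eq_iff)
    then show ?thesis by (metis mult_1 unit_factor_mult_normalize)
  qed
  ultimately show ?thesis by (simp add: prime_def)
qed

text \<open>A prime power congruent to 3 modulo 4 is a power of a prime p congruent to 3 modulo 4.
  Such a p stays prime among the Gaussian integers and has norm p^2, which explains the factor
  2.\<close>

lemma gmangoldt_of_nat_ge:
  assumes "n mod 4 = 3"
  shows "gmangoldt (of_nat n) \<ge> 2 * mangoldt n"
proof (cases "primepow n")
  case False
  then show ?thesis using gmangoldt_nonneg by (simp add: mangoldt_def)
next
  case True
  then obtain p j where p: "prime p" "j > 0" "n = p ^ j" by (auto simp: primepow_def)
  have "p mod 4 \<noteq> 0" "p mod 4 \<noteq> 2"
  proof -
    have "odd n" using assms by presburger
    then have "odd p" using p by (simp add: even_power)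
    then show "p mod 4 \<noteq> 0" "p mod 4 \<noteq> 2" by presburger+
  qed
  moreover have "p mod 4 \<noteq> 1"
  proof
    assume "p mod 4 = 1"
    then have "n mod 4 = 1" using p by (metis power_mod power_one mod_less one_less_numeral_iff semiring_norm(76))
    then show False using assms by simp
  qed
  ultimately have p4: "p mod 4 = 3" by presburger
  have "prime_factors (1 * of_nat p ^ j) = {of_nat p :: gint}"
    by (rule prime_factors_unit_power) (use p p4 prime_3_mod_4_gint in \<open>auto simp: gunits_def\<close>)
  then have "gmangoldt (of_nat n) = ln (gnorm (of_nat p))"
    using p by (intro gmangoldt_eq) simp
  also have "gnorm (of_nat p) = p\<^sup>2" by (simp add: gnorm_def nat_power_eq)
  finally show ?thesis using p prime_gt_0_nat[of p] by (simp add: ln_realpow)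
qed

section \<open>Primes congruent to 3 modulo 4\<close>

lemma sum_divisors_swap:
  fixes f :: "nat \<Rightarrow> nat \<Rightarrow> 'a :: comm_monoid_add"
  shows "(\<Sum>n\<in>{1..N}. \<Sum>d | d dvd n. f d (n div d)) = (\<Sum>d\<in>{1..N}. \<Sum>m\<in>{1..N div d}. f d m)"
proof -
  have "(\<Sum>n\<in>{1..N}. \<Sum>d | d dvd n. f d (n div d)) =
      (\<Sum>(n, d)\<in>(SIGMA n:{1..N}. {d. d dvd n}). f d (n div d))"
    by (intro sum.Sigma) auto
  also have "\<dots> = (\<Sum>(d, m)\<in>(SIGMA d:{1..N}. {1..N div d}). f d m)"
  proof (rule sum.reindex_bij_witness[of _ "\<lambda>(d, m). (d * m, d)" "\<lambda>(n, d). (d, n div d)"])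
    fix p assume "p \<in> (SIGMA n:{1..N}. {d. d dvd n})"
    then obtain n d where p: "p = (n, d)" "1 \<le> n" "n \<le> N" "d dvd n" by auto
    then have "d \<le> n" "d > 0" by (auto intro: dvd_imp_le Nat.gr0I)
    then show "(case p of (n, d) \<Rightarrow> (d, n div d)) \<in> (SIGMA d:{1..N}. {1..N div d})"
      using p by (auto simp: div_le_mono Suc_le_eq div_greater_zero_iff)
  next
    fix q assume "q \<in> (SIGMA d:{1..N}. {1..N div d})"
    then obtain d m where q: "q = (d, m)" "1 \<le> d" "d \<le> N" "1 \<le> m" "m \<le> N div d" by auto
    then have "d * m \<le> d * (N div d)" by simp
    also have "\<dots> \<le> N" by simp
    finally show "(case q of (d, m) \<Rightarrow> (d * m, d)) \<in> (SIGMA n:{1..N}. {d. d dvd n})"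
      using q by auto
  qed auto
  also have "\<dots> = (\<Sum>d\<in>{1..N}. \<Sum>m\<in>{1..N div d}. f d m)"
    by (intro sum.Sigma[symmetric]) auto
  finally show ?thesis .
qed

section \<open>Elementary estimates of Mertens and Chebyshev\<close>

lemma sum_ln_eq:
  "(\<Sum>n=1..N. ln (real n)) = (\<Sum>d=1..N. mangoldt d * real (N div d))"
proof -
  have "(\<Sum>n=1..N. ln (real n)) = (\<Sum>n=1..N. \<Sum>d | d dvd n. mangoldt d)"
    by (intro sum.cong) (simp_all add: mangoldt_sum)
  also have "\<dots> = (\<Sum>d=1..N. \<Sum>m=1..N div d. mangoldt d)"
    by (rule sum_divisors_swap)
  finally show ?thesis by (simp add: mult.commute)
qed

lemma sum_ln_ge: "(\<Sum>n=1..N. ln (real n)) \<ge> real N * ln (real N) - real N"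
proof (induction N)
  case (Suc N)
  show ?case
  proof (cases "N = 0")
    case False
    have "ln (1 + 1 / real N) \<le> 1 / real N" by (rule ln_add_one_self_le_self) simp
    moreover have "ln (1 + 1 / real N) = ln (real (Suc N)) - ln (real N)"
      using False by (subst ln_divide_pos[symmetric]) (auto simp: field_simps)
    ultimately have "ln (real (Suc N)) - ln (real N) \<le> 1 / real N" by linarith
    then have "real N * (ln (real (Suc N)) - ln (real N)) \<le> 1"
      using False by (simp add: field_simps del: of_nat_Suc)
    then show ?thesis using Suc by (simp add: algebra_simps)
  qed simp
qed simp

lemma of_nat_div_le: "real (m div n) \<le> real m / real n"
proof (cases "n = 0")
  case False
  have "real (m div n * n) \<le> real m" by (subst of_nat_le_iff) (rule div_times_less_eq_dividend)
  then show ?thesis using False by (simp add: pos_le_divide_eq)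
qed simp

text \<open>Both sides come from the logarithm of N!: it is at least N ln N - N, and dropping the
  floors in its expansion over the von Mangoldt function only increases the sum.\<close>

lemma mertens_lower:
  fixes N :: nat
  assumes "N \<ge> 1"
  shows "(\<Sum>d=1..N. mangoldt d / real d) \<ge> ln (real N) - 1"
proof -
  have "real N * ln (real N) - real N \<le> (\<Sum>d=1..N. mangoldt d * real (N div d))"
    using sum_ln_ge[of N] unfolding sum_ln_eq .
  also have "\<dots> \<le> (\<Sum>d=1..N. mangoldt d * (real N / real d))"
    by (intro sum_mono mult_left_mono mangoldt_nonneg of_nat_div_le)
  also have "\<dots> = N * (\<Sum>d=1..N. mangoldt d / real d)"
    by (simp add: sum_distrib_left field_simps)
  finally have "real N * (ln N - 1) \<le> real N * (\<Sum>d=1..N. mangoldt d / real d)"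
    by (simp add: algebra_simps)
  then show ?thesis using assms by simp
qed

text \<open>In the logarithm of the central binomial coefficient each d carries the weight
  floor(2n/d) - 2 floor(n/d), which is never negative and equals 1 for n < d <= 2n. The bound 4^n
  for the coefficient therefore controls the whole dyadic block.\<close>

lemma chebyshev_psi_step:
  "(\<Sum>d=1..2*n. mangoldt d) \<le> (\<Sum>d=1..n. mangoldt d) + (2 * n :: real) * ln 2"
proof -
  have lnf: "ln (fact m) = (\<Sum>k=1..m. ln (real k))" for m
    unfolding fact_prod of_nat_prod by (subst ln_prod) auto
  have "(2 * n choose n) \<le> 2 ^ (2 * n)"
    by (rule binomial_le_pow2)
  then have "real (2 * n choose n) \<le> 2 ^ (2 * n)" by (metis of_nat_le_iff of_nat_numeral of_nat_power)
  then have "ln (real (2 * n choose n)) \<le> ln (2 ^ (2 * n))"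
    by (subst ln_le_cancel_iff) auto
  moreover have "real (2 * n choose n) = fact (2 * n) / (fact n * fact n)"
    by (simp add: binomial_fact)
  ultimately have "ln (fact (2 * n)) - 2 * ln (fact n :: real) \<le> (2 * n) * ln 2"
    by (simp add: ln_div ln_mult ln_realpow)
  moreover have "ln (fact n :: real) = (\<Sum>d=1..2*n. mangoldt d * real (n div d))"
  proof -
    have "(\<Sum>d=1..n. mangoldt d * real (n div d)) = (\<Sum>d=1..2*n. mangoldt d * real (n div d))"
      by (intro sum.mono_neutral_left) auto
    then show ?thesis using lnf sum_ln_eq by simp
  qed
  moreover have "ln (fact (2 * n) :: real) = (\<Sum>d=1..2*n. mangoldt d * real (2 * n div d))"
    using lnf sum_ln_eq by simp
  ultimately have *: "(\<Sum>d=1..2*n. mangoldt d * (real (2 * n div d) - 2 * real (n div d))) \<le> (2 * n) * ln 2"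
    by (simp add: algebra_simps sum_subtractf sum_distrib_left)
  have "(\<Sum>d\<in>{n<..2*n}. mangoldt d) = (\<Sum>d\<in>{n<..2*n}. mangoldt d * (real (2 * n div d) - 2 * real (n div d)))"
  proof (intro sum.cong refl)
    fix d assume d: "d \<in> {n<..2*n}"
    then have "2 * n div d = 1" by (intro div_nat_eqI) auto
    then show "mangoldt d = mangoldt d * (real (2 * n div d) - 2 * real (n div d))"
      using d by simp
  qed
  also have "\<dots> \<le> (\<Sum>d=1..2*n. mangoldt d * (real (2 * n div d) - 2 * real (n div d)))"
  proof (intro sum_mono2)
    fix d :: nat
    have "2 * (n div d) \<le> 2 * n div d"
      by (metis div_mult2_eq div_mult_self_is_m dividend_less_times_div less_mult_imp_div_less
          mult.commute mult_2 add_le_mono div_add1_eq le_add1 mult_2)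
    then have "real (2 * n div d) - 2 * real (n div d) \<ge> 0" by linarith
    then show "0 \<le> mangoldt d * (real (2 * n div d) - 2 * real (n div d))"
      using mangoldt_nonneg by simp
  qed auto
  finally have "(\<Sum>d\<in>{n<..2*n}. mangoldt d) \<le> (2 * n) * ln (2 :: real)" using * by linarith
  moreover have "(\<Sum>d=1..2*n. mangoldt d :: real) = (\<Sum>d=1..n. mangoldt d) + (\<Sum>d\<in>{n<..2*n}. mangoldt d)"
    by (subst sum.union_disjoint[symmetric]) (auto intro!: sum.cong)
  ultimately show ?thesis by linarith
qed

text \<open>Iterates the dyadic step at \<open>n div 2\<close>, using ln 2 < 1. The constant 4
  leaves room for the single extra term when n is odd.\<close>

lemma chebyshev_psi: "(\<Sum>d=1..n. mangoldt d :: real) \<le> 4 * real n"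
proof (induction n rule: less_induct)
  case (less n)
  have ln2: "ln (2 :: real) < 1" by (rule ln_2_less_1)
  show ?case
  proof (cases "n = 0")
    case False
    define m where "m = n div 2"
    have "m < n" using False by (simp add: m_def)
    then have "(\<Sum>d=1..2*m. mangoldt d :: real) \<le> 4 * real m + 2 * real m * ln 2"
      using less[of m] chebyshev_psi_step[of m] by simp
    also have "\<dots> \<le> 4 * real m + 2 * real m"
      using ln2 by (intro add_left_mono) (metis less_eq_real_def mult.right_neutral mult_left_mono of_nat_0_le_iff zero_le_mult_iff zero_le_numeral)
    finally have *: "(\<Sum>d=1..2*m. mangoldt d :: real) \<le> 6 * real m" by simp
    show ?thesis
    proof (cases "even n")
      case True
      then have "n = 2 * m" by (simp add: m_def)
      then show ?thesis using * by simp
    next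
      case False
      then have n: "n = Suc (2 * m)" by (simp add: m_def)
      have "mangoldt n \<le> ln (real n)" by (rule mangoldt_le) (simp add: n)
      also have "\<dots> \<le> real n - 1" by (rule ln_le_minus_one) (simp add: n)
      finally have "mangoldt (Suc (2 * m)) \<le> 2 * real m" using n by simp
      then show ?thesis using * unfolding n by simp
    qed
  qed simp
qed

section \<open>Mertens's method for the nonprincipal Dirichlet character modulo 4\<close>

definition chi4 :: "nat \<Rightarrow> real" where
  "chi4 n = (if n mod 4 = 1 then 1 else if n mod 4 = 3 then -1 else 0)"

lemma chi4_mult: "chi4 (m * n) = chi4 m * chi4 n"
proof -
  have "(m * n) mod 4 = ((m mod 4) * (n mod 4)) mod 4" by (simp add: mod_mult_eq)
  moreover have "m mod 4 = 0 \<or> m mod 4 = 1 \<or> m mod 4 = 2 \<or> m mod 4 = 3"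
    "n mod 4 = 0 \<or> n mod 4 = 1 \<or> n mod 4 = 2 \<or> n mod 4 = 3" by presburger+
  ultimately show ?thesis unfolding chi4_def by (elim disjE) simp_all
qed

text \<open>Leibniz's criterion: the nonzero values of \<open>chi4\<close> alternate, and
  \<open>s a\<close> is the sign of the first nonzero value after a. With this sign the sum lies
  between 0 and its largest possible first term.\<close>

lemma alternating_chi4_bound:
  fixes g :: "nat \<Rightarrow> real"
  assumes "\<And>i. i \<ge> Suc a \<Longrightarrow> g (Suc i) \<le> g i" "\<And>i. i \<ge> Suc a \<Longrightarrow> g i \<ge> 0"
  defines "s \<equiv> (\<lambda>a. if a mod 4 = 0 \<or> a mod 4 = 3 then 1 else -1 :: real)"
  shows "0 \<le> s a * (\<Sum>m\<in>{a<..a+n}. chi4 m * g m) \<and> s a * (\<Sum>m\<in>{a<..a+n}. chi4 m * g m) \<le> g (Suc a)"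
  using assms(1,2)
proof (induction n arbitrary: a)
  case 0
  then show ?case by simp
next
  case (Suc n)
  define T where "T = (\<Sum>m\<in>{Suc a<..Suc a+n}. chi4 m * g m)"
  have "{a<..a + Suc n} = insert (Suc a) {Suc a<..Suc a+n}" by auto
  then have eq: "(\<Sum>m\<in>{a<..a+Suc n}. chi4 m * g m) = chi4 (Suc a) * g (Suc a) + T"
    by (simp add: T_def)
  have IH: "0 \<le> s (Suc a) * T" "s (Suc a) * T \<le> g (Suc (Suc a))"
    unfolding T_def using Suc.IH[of "Suc a"] Suc.prems by auto
  have g: "g (Suc (Suc a)) \<le> g (Suc a)" using Suc.prems(1)[of "Suc a"] by simp
  have "a mod 4 = 0 \<or> a mod 4 = 1 \<or> a mod 4 = 2 \<or> a mod 4 = 3" by presburger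
  moreover have "Suc a mod 4 = (a mod 4 + 1) mod 4" by presburger
  ultimately have "(chi4 (Suc a) = 0 \<and> s (Suc a) = s a) \<or> (chi4 (Suc a) = s a \<and> s (Suc a) = - s a)"
    and s: "s a = 1 \<or> s a = -1"
    unfolding s_def chi4_def by auto
  then consider "chi4 (Suc a) = 0" "s (Suc a) = s a" | "chi4 (Suc a) = s a" "s (Suc a) = - s a"
    by blast
  then show ?case
  proof cases
    case 1
    then show ?thesis unfolding eq using IH g by simp
  next
    case 2
    have "s a * (s a * g (Suc a) + T) = g (Suc a) - s (Suc a) * T"
      using s 2(2) by (auto simp: algebra_simps)
    then show ?thesis unfolding eq 2(1) using IH g by simp
  qed
qed

lemma abs_sum_chi4_le:
  fixes g :: "nat \<Rightarrow> real"
  assumes "\<And>i. i \<ge> Suc a \<Longrightarrow> g (Suc i) \<le> g i" "\<And>i. i \<ge> Suc a \<Longrightarrow> g i \<ge> 0" "a \<le> b"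
  shows "\<bar>\<Sum>m\<in>{a<..b}. chi4 m * g m\<bar> \<le> g (Suc a)"
  using alternating_chi4_bound[of a g "b - a"] assms by (auto split: if_splits)

lemma ln_over_decreasing:
  assumes "i \<ge> 3" shows "ln (real (Suc i)) / real (Suc i) \<le> ln (real i) / real i"
proof -
  have "exp 1 \<le> real i" using exp_le assms by linarith
  then have "1 \<le> ln (real i)" using assms by (subst ln_ge_iff) auto
  have "ln (1 + 1 / real i) \<le> 1 / real i" by (rule ln_add_one_self_le_self) simp
  moreover have "ln (1 + 1 / real i) = ln (real (Suc i)) - ln (real i)"
    using assms by (subst ln_divide_pos[symmetric]) (auto simp: field_simps)
  ultimately have "ln (real (Suc i)) - ln (real i) \<le> 1 / real i" by linarith
  then have "real i * ln (real (Suc i)) \<le> real i * ln (real i) + 1"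
    using assms by (simp add: field_simps del: of_nat_Suc)
  also have "\<dots> \<le> real (Suc i) * ln (real i)" using \<open>1 \<le> ln (real i)\<close> by (simp add: algebra_simps)
  finally show ?thesis using assms by (simp add: field_simps)
qed

text \<open>The convolution of \<open>chi4\<close> times the von Mangoldt function with
  \<open>chi4\<close> is \<open>chi4\<close> times the logarithm. Summed with weights 1/n it gives
  an identity in which the partial sums M of L(1, chi4) multiply the wanted sum A. The alternating
  bound makes M nearly constant, so A * M N stays bounded, and M N >= 1/2 allows the
  division.\<close>

lemma sum_chi4_mangoldt_le:
  assumes "N \<ge> 1"
  shows "(\<Sum>d=1..N. chi4 d * mangoldt d / real d) \<le> 10"
proof -
  define M where "M n = (\<Sum>m=1..n. chi4 m / real m)" for n
  define A where "A = (\<Sum>d=1..N. chi4 d * mangoldt d / real d)"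
  define B where "B = (\<Sum>n=1..N. chi4 n * ln (real n) / real n)"
  have Mdiff: "\<bar>M b - M a\<bar> \<le> 1 / real (Suc a)" if "a \<le> b" for a b
  proof -
    have "\<bar>\<Sum>m\<in>{a<..b}. chi4 m * (1 / real m)\<bar> \<le> 1 / real (Suc a)"
      by (rule abs_sum_chi4_le) (use that in \<open>auto simp: field_simps\<close>)
    moreover have "M b = M a + (\<Sum>m\<in>{a<..b}. chi4 m / real m)"
      unfolding M_def using that by (subst sum.union_disjoint[symmetric]) (auto intro!: sum.cong)
    ultimately show ?thesis by simp
  qed
  \<comment> \<open>The first term 1 and a tail of at most 1/2 keep M N away from 0. This is the
    nonvanishing of L(1, chi4) in explicit form.\<close>
  have "M 1 = 1" by (simp add: M_def chi4_def)
  moreover have "\<bar>M N - M 1\<bar> \<le> 1 / 2" using Mdiff[of 1 N] assms by simp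
  ultimately have MN: "M N \<ge> 1 / 2" by linarith
  have "B = (\<Sum>n=1..N. \<Sum>d | d dvd n. chi4 d * mangoldt d / real d * (chi4 (n div d) / real (n div d)))"
    unfolding B_def
  proof (intro sum.cong refl)
    fix n assume n: "n \<in> {1..N}"
    have "chi4 n * ln (real n) / real n = (\<Sum>d | d dvd n. mangoldt d * (chi4 n / real n))"
      unfolding sum_distrib_right[symmetric] using n by (subst mangoldt_sum) auto
    also have "\<dots> = (\<Sum>d | d dvd n. chi4 d * mangoldt d / real d * (chi4 (n div d) / real (n div d)))"
    proof (intro sum.cong refl)
      fix d assume "d \<in> {d. d dvd n}"
      then obtain e where e: "n = d * e" by auto
      then have "d \<noteq> 0" using n by auto
      then show "mangoldt d * (chi4 n / real n) = chi4 d * mangoldt d / real d * (chi4 (n div d) / real (n div d))"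
        using e by (simp add: chi4_mult)
    qed
    finally show "chi4 n * ln (real n) / real n = \<dots>" .
  qed
  also have "\<dots> = (\<Sum>d=1..N. chi4 d * mangoldt d / real d * M (N div d))"
    unfolding M_def sum_distrib_left by (rule sum_divisors_swap)
  finally have B: "B = (\<Sum>d=1..N. chi4 d * mangoldt d / real d * M (N div d))" .
  \<comment> \<open>Replacing M (N div d) by M N costs at most d / N, which cancels the 1 / d of the
    term; what remains is Chebyshev's sum divided by N.\<close>
  have "A * M N - B = (\<Sum>d=1..N. chi4 d * mangoldt d / real d * (M N - M (N div d)))"
    unfolding A_def B sum_distrib_right sum_subtractf[symmetric]
    by (intro sum.cong) (auto simp: right_diff_distrib)
  also have "\<dots> \<le> (\<Sum>d=1..N. mangoldt d / real N)"
  proof (intro sum_mono)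
    fix d assume d: "d \<in> {1..N}"
    have "N < d * Suc (N div d)" using d dividend_less_times_div[of d N] by simp
    then have "1 / real (Suc (N div d)) \<le> real d / real N"
      using assms by (simp add: field_simps flip: of_nat_mult del: of_nat_Suc)
    with Mdiff[of "N div d" N] have M: "\<bar>M N - M (N div d)\<bar> \<le> real d / real N" by simp
    have "\<bar>chi4 d\<bar> \<le> 1" by (simp add: chi4_def)
    have "chi4 d * mangoldt d / real d * (M N - M (N div d)) \<le>
        \<bar>chi4 d\<bar> * mangoldt d / real d * \<bar>M N - M (N div d)\<bar>"
      using abs_ge_self[of "chi4 d * mangoldt d / real d * (M N - M (N div d))"]
      by (simp add: abs_mult)
    also have "\<dots> \<le> 1 * mangoldt d / real d * (real d / real N)"
      using \<open>\<bar>chi4 d\<bar> \<le> 1\<close> M by (intro mult_mono divide_right_mono mangoldt_nonneg) (auto simp: mangoldt_nonneg)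
    finally show "chi4 d * mangoldt d / real d * (M N - M (N div d)) \<le> mangoldt d / real N"
      using d by simp
  qed
  also have "\<dots> \<le> 4" using chebyshev_psi[of N] assms
    by (simp add: field_simps flip: sum_divide_distrib)
  finally have AM: "A * M N \<le> 4 + B" by simp
  \<comment> \<open>The function ln m / m decreases only from 3 on. The terms m = 1 and m = 2 vanish
    because ln 1 = 0 and \<open>chi4 2 = 0\<close>.\<close>
  have "B \<le> 1"
  proof (cases "N \<ge> 2")
    case True
    have "\<bar>\<Sum>m\<in>{2<..N}. chi4 m * (ln (real m) / real m)\<bar> \<le> ln (real (Suc 2)) / real (Suc 2)"
      by (rule abs_sum_chi4_le) (use True ln_over_decreasing in auto)
    also have "\<dots> \<le> 1" using ln_le_minus_one[of 3] by simp
    finally have "(\<Sum>m\<in>{2<..N}. chi4 m * ln (real m) / real m) \<le> 1" by simp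
    moreover have "{1..N} = insert 1 (insert 2 {2<..N})" using True by auto
    ultimately show ?thesis by (simp add: B_def chi4_def)
  next
    case False
    then have "N = 1" using assms by simp
    then show ?thesis by (simp add: B_def)
  qed
  with AM have "A * M N \<le> 5" by simp
  show ?thesis
  proof (rule ccontr)
    assume "\<not> ?thesis"
    then have "A > 10" by (simp add: A_def)
    then have "10 * (1 / 2) < A * M N" using MN by (intro mult_less_le_imp_less) auto
    then show False using \<open>A * M N \<le> 5\<close> by simp
  qed
qed

text \<open>The even prime powers are the powers of 2, so the sum is dominated by ln 2 times a
  geometric series.\<close>

lemma sum_mangoldt_even_le:
  "(\<Sum>d | d \<in> {1..N} \<and> even d. mangoldt d / real d) \<le> 1"
proof -
  have "(\<Sum>d | d \<in> {1..N} \<and> even d. mangoldt d / real d) =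
      (\<Sum>d | d \<in> {1..N} \<and> even d \<and> primepow d. mangoldt d / real d)"
    by (intro sum.mono_neutral_right) (auto simp: mangoldt_def)
  also have "\<dots> \<le> (\<Sum>d\<in>(\<lambda>j. 2 ^ j) ` {1..N}. mangoldt d / real d)"
  proof (intro sum_mono2)
    show "{d \<in> {1..N}. even d \<and> primepow d} \<subseteq> (\<lambda>j. 2 ^ j) ` {1..N}"
    proof
      fix d assume d: "d \<in> {d \<in> {1..N}. even d \<and> primepow d}"
      then obtain p j where p: "prime p" "j > 0" "d = p ^ j" by (auto simp: primepow_def)
      then have "even p" using d by (simp add: even_power)
      then have "p = 2" using p primes_dvd_imp_eq two_is_prime_nat by blast
      moreover have "j \<le> N"
      proof -
        have "j < (2::nat) ^ j" by (rule less_exp)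
        also have "2 ^ j \<le> N" using p d \<open>p = 2\<close> by auto
        finally show ?thesis by simp
      qed
      ultimately show "d \<in> (\<lambda>j. 2 ^ j) ` {1..N}" using p by auto
    qed
  qed (auto simp: mangoldt_nonneg)
  also have "\<dots> = (\<Sum>j=1..N. mangoldt (2 ^ j) / real (2 ^ j))"
    by (subst sum.reindex) (auto intro!: inj_onI)
  also have "\<dots> = ln 2 * (\<Sum>j=1..N. (1/2) ^ j)"
    unfolding sum_distrib_left by (intro sum.cong) (auto simp: power_divide)
  also have "(\<Sum>j=1..N. (1/2 :: real) ^ j) = 1 - (1/2) ^ N"
    by (induction N) (auto simp: field_simps)
  also have "ln 2 * (1 - (1/2 :: real) ^ N) \<le> 1 * 1"
    by (intro mult_mono) (use ln_2_less_1 in \<open>auto simp: power_le_one\<close>)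
  finally show ?thesis by simp
qed

text \<open>The factor 1 - chi4 d is 2 on the class of 3, 0 on the class of 1 and 1 on even d. The
  constant is half of 1 + 10 + 1, the errors of the three preceding estimates.\<close>

lemma sum_mangoldt_3_mod_4:
  fixes N :: nat
  assumes "N \<ge> 1"
  shows "(\<Sum>d | d \<in> {1..N} \<and> d mod 4 = 3. mangoldt d / real d) \<ge> ln (real N) / 2 - 6"
proof -
  have "(\<Sum>d=1..N. mangoldt d / real d) - (\<Sum>d=1..N. chi4 d * mangoldt d / real d) =
      (\<Sum>d=1..N. (1 - chi4 d) * (mangoldt d / real d))"
    unfolding sum_subtractf[symmetric] by (intro sum.cong) (auto simp: algebra_simps diff_divide_distrib)
  also have "\<dots> = (\<Sum>d=1..N. (if d mod 4 = 3 then 2 * (mangoldt d / real d) else 0) +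
      (if even d then mangoldt d / real d else 0))"
  proof (intro sum.cong refl)
    fix d :: nat
    have "(even d \<and> d mod 4 \<noteq> 1 \<and> d mod 4 \<noteq> 3) \<or> (odd d \<and> d mod 4 = 1) \<or> (odd d \<and> d mod 4 = 3)"
      by presburger
    then show "(1 - chi4 d) * (mangoldt d / real d) =
        (if d mod 4 = 3 then 2 * (mangoldt d / real d) else 0) +
        (if even d then mangoldt d / real d else 0)"
      by (auto simp: chi4_def)
  qed
  also have "\<dots> = 2 * (\<Sum>d | d \<in> {1..N} \<and> d mod 4 = 3. mangoldt d / real d) +
      (\<Sum>d | d \<in> {1..N} \<and> even d. mangoldt d / real d)"
    by (simp only: sum.distrib sum_distrib_left sum.inter_filter finite_atLeastAtMost)
      (rule arg_cong2[where f = "(+)"]; rule sum.cong; simp)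
  finally show ?thesis
    using mertens_lower[OF assms] sum_chi4_mangoldt_le[OF assms] sum_mangoldt_even_le[of N] by linarith
qed

text \<open>The weight \<open>Y - ln d\<close> is the integral of the indicator of \<open>ln d \<le> y\<close> over \<open>0 \<le> y \<le> Y\<close>.\<close>

lemma weighted_sum_mangoldt_3_mod_4:
  assumes "Y \<ge> 0"
  shows "(\<Sum>d | real d \<le> exp Y \<and> d mod 4 = 3. mangoldt d / real d * (Y - ln d)) \<ge> Y\<^sup>2 / 4 - 7 * Y"
proof -
  define D where "D = {d :: nat. real d \<le> exp Y \<and> d mod 4 = 3}"
  have fin: "finite D"
    by (rule finite_subset[of _ "{..nat \<lfloor>exp Y\<rfloor>}"]) (auto simp: D_def le_nat_floor)
  have I1: "((\<lambda>y. \<Sum>d\<in>D. mangoldt d / real d * (if ln (real d) \<le> y then 1 else 0)) has_integral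
      (\<Sum>d\<in>D. mangoldt d / real d * (Y - ln d))) {0..Y}"
  proof (intro has_integral_sum fin has_integral_mult_right)
    fix d assume d: "d \<in> D"
    then have "real d > 0" by (auto simp: D_def intro!: Nat.gr0I)
    then have "ln (real d) \<le> Y" "0 \<le> ln (real d)"
      using d by (auto simp: D_def ln_ge_iff ln_le_cancel_iff[of _ "exp Y", simplified])
    have "((\<lambda>y. 1 :: real) has_integral (Y - ln d)) {ln (real d)..Y}"
      using has_integral_const_real[of "1::real" "ln (real d)" Y] \<open>ln (real d) \<le> Y\<close> by simp
    then have "((\<lambda>y. if y \<in> {ln (real d)..Y} then 1 else 0 :: real) has_integral (Y - ln d)) {0..Y}"
      by (subst has_integral_restrict) (use \<open>0 \<le> ln (real d)\<close> in auto)
    then show "((\<lambda>y. if ln (real d) \<le> y then 1 else 0 :: real) has_integral (Y - ln d)) {0..Y}"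
      by (rule has_integral_eq[rotated]) auto
  qed
  have I2: "((\<lambda>y. y / 2 - 7) has_integral (Y\<^sup>2 / 4 - 7 * Y - (0\<^sup>2 / 4 - 7 * 0))) {0..Y}"
    by (rule fundamental_theorem_of_calculus)
      (use assms in \<open>auto intro!: derivative_eq_intros simp flip: has_real_derivative_iff_has_vector_derivative\<close>)
  have le: "y / 2 - 7 \<le> (\<Sum>d\<in>D. mangoldt d / real d * (if ln (real d) \<le> y then 1 else 0))"
    if y: "y \<in> {0..Y}" for y
  proof -
    \<comment> \<open>Rounding exp y down to an integer lowers the logarithm by at most ln 2, which
      turns the constant 6 into 7.\<close>
    define N where "N = nat \<lfloor>exp y\<rfloor>"
    have e1: "exp y \<ge> 1" using y by simp
    then have N1: "N \<ge> 1" by (simp add: N_def le_nat_floor)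
    have "exp y < real N + 1" using e1 by (simp add: N_def)
    then have "exp y \<le> 2 * real N" using N1 by simp
    then have "y \<le> ln (2 * real N)" using N1 by (subst ln_ge_iff) auto
    then have "ln (real N) \<ge> y - ln 2" using N1 by (simp add: ln_mult)
    then have "y / 2 - 7 \<le> ln (real N) / 2 - 6" using ln_2_less_1 by simp
    also have "\<dots> \<le> (\<Sum>d | d \<in> {1..N} \<and> d mod 4 = 3. mangoldt d / real d)"
      using sum_mangoldt_3_mod_4[OF N1] .
    also have "\<dots> = (\<Sum>d\<in>D. if ln (real d) \<le> y then mangoldt d / real d else 0)"
    proof -
      have "{d. d \<in> {1..N} \<and> d mod 4 = 3} = {d \<in> D. ln (real d) \<le> y}"
      proof -
        have "d \<le> N \<longleftrightarrow> real d \<le> exp y" for d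
          unfolding N_def using e1 by (simp add: le_nat_floor le_nat_iff le_floor_iff)
        moreover have "d > 0" if "d mod 4 = 3" for d :: nat using that by (auto intro!: Nat.gr0I)
        moreover have "exp y \<le> exp Y" using y by simp
        ultimately show ?thesis
          unfolding D_def by (auto simp: Suc_le_eq ln_le_cancel_iff[of _ "exp y", simplified] intro: order_trans)
      qed
      then show ?thesis using fin by (simp add: sum.inter_filter)
    qed
    also have "\<dots> = (\<Sum>d\<in>D. mangoldt d / real d * (if ln (real d) \<le> y then 1 else 0))"
      by (intro sum.cong) auto
    finally show ?thesis .
  qed
  have "Y\<^sup>2 / 4 - 7 * Y - (0\<^sup>2 / 4 - 7 * 0) \<le> (\<Sum>d\<in>D. mangoldt d / real d * (Y - ln d))"
    by (rule has_integral_le[OF I2 I1 le])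
  then show ?thesis by (simp add: D_def)
qed

section \<open>The digamma function on vertical lines\<close>

text \<open>The value zeta(3/2); it appears because each term of the digamma series is compared with
  n^(-3/2).\<close>

definition zeta32 :: real where
  "zeta32 = (\<Sum>n. real (Suc n) powr (- 3 / 2))"

lemma summable_zeta32: "summable (\<lambda>n. real (Suc n) powr (- 3 / 2))"
  using summable_real_powr_iff[of "- 3 / 2"] by (subst summable_Suc_iff) simp

lemma zeta32_nonneg: "zeta32 \<ge> 0"
  unfolding zeta32_def by (intro suminf_nonneg summable_zeta32) auto

lemma Digamma_diff_sums:
  assumes "x > 0"
  shows "(\<lambda>n. inverse (complex_of_real (x + real n)) - inverse (Complex x y + of_nat n)) sums
           (Digamma (Complex x y) - of_real (Digamma x))"
proof -
  have nz: "Complex x y \<noteq> 0" "complex_of_real x \<noteq> 0"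
    using assms by (auto simp: complex_eq_iff)
  have "(\<lambda>n. (inverse (of_nat (Suc n)) - inverse (Complex x y + of_nat n)) -
          (inverse (of_nat (Suc n)) - inverse (of_real x + of_nat n))) sums
        ((\<Sum>n. inverse (of_nat (Suc n)) - inverse (Complex x y + of_nat n)) -
         (\<Sum>n. inverse (of_nat (Suc n)) - inverse (of_real x + of_nat n :: complex)))"
    by (intro sums_diff summable_sums summable_Digamma nz)
  moreover have "of_real (Digamma x) = Digamma (complex_of_real x)"
    using assms by (simp add: Polygamma_of_real)
  ultimately show ?thesis by (simp add: Digamma_def)
qed

text \<open>By the arithmetic-geometric mean |a + i y| >= sqrt (a |y|), so each term |y| / (a |a + i
  y|) is at most sqrt |y| a^(-3/2). The growth sqrt |y| is far from sharp, but it is integrable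
  against the Fejer kernel, and its primitive |y|^(3/2) stays below the order 2 that the auxiliary
  factor of the Phragmen-Lindelof argument tolerates.\<close>

lemma norm_Digamma_diff_le:
  assumes "x \<ge> 1"
  shows "cmod (Digamma (Complex x y) - of_real (Digamma x)) \<le> zeta32 * sqrt \<bar>y\<bar>"
proof -
  define f where "f n = inverse (complex_of_real (x + real n)) - inverse (Complex x y + of_nat n)" for n
  have f: "cmod (f n) \<le> sqrt \<bar>y\<bar> * real (Suc n) powr (- 3 / 2)" for n
  proof -
    define a where "a = x + real n"
    have a: "a \<ge> real (Suc n)" "a > 0" using assms by (simp_all add: a_def)
    have eq: "Complex x y + of_nat n = Complex a y" by (simp add: a_def complex_eq_iff)
    have nz: "Complex a y \<noteq> 0" using a by (simp add: complex_eq_iff)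
    have "f n = (Complex a y - of_real a) / (of_real a * Complex a y)"
      unfolding f_def eq a_def[symmetric] using nz a by (simp add: field_simps)
    also have "Complex a y - of_real a = \<i> * of_real y" by (simp add: complex_eq_iff)
    finally have 1: "cmod (f n) = \<bar>y\<bar> / (a * cmod (Complex a y))"
      using a by (simp add: norm_divide norm_mult)
    have "0 \<le> (a - \<bar>y\<bar>)\<^sup>2" by simp
    then have "2 * (a * \<bar>y\<bar>) \<le> a\<^sup>2 + y\<^sup>2" by (simp add: power2_diff)
    moreover have "0 \<le> a * \<bar>y\<bar>" using a by simp
    ultimately have "a * \<bar>y\<bar> \<le> a\<^sup>2 + y\<^sup>2" by linarith
    then have "sqrt (a * \<bar>y\<bar>) \<le> cmod (Complex a y)" by (simp add: cmod_def)
    then have 2: "\<bar>y\<bar> / (a * cmod (Complex a y)) \<le> \<bar>y\<bar> / (a * sqrt (a * \<bar>y\<bar>))" if "y \<noteq> 0"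
      using a that nz by (intro divide_left_mono mult_left_mono mult_pos_pos) auto
    have 3: "\<bar>y\<bar> / (a * sqrt (a * \<bar>y\<bar>)) = sqrt \<bar>y\<bar> * a powr (- 3 / 2)" if "y \<noteq> 0"
    proof -
      have "a powr (3 / 2) = a powr 1 * a powr (1/2)"
        by (subst powr_add[symmetric]) simp
      then have "a powr (- 3 / 2) = 1 / (a powr 1 * a powr (1/2))"
        using powr_minus[of a "3 / 2"] by (simp add: inverse_eq_divide)
      also have "a powr 1 * a powr (1/2) = a * sqrt a" using a by (simp add: powr_half_sqrt)
      finally have "a powr (- 3 / 2) = 1 / (a * sqrt a)" .
      moreover have "\<bar>y\<bar> / (a * sqrt (a * \<bar>y\<bar>)) =
          (sqrt \<bar>y\<bar> * sqrt \<bar>y\<bar>) / (a * (sqrt a * sqrt \<bar>y\<bar>))"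
        by (simp add: real_sqrt_mult)
      moreover have "\<dots> = sqrt \<bar>y\<bar> * (1 / (a * sqrt a))"
      proof -
        have "(r * r) / (a * (b * r)) = r * (1 / (a * b))" if "r \<noteq> 0" for r b :: real
          using that by simp
        then show ?thesis by (metis that real_sqrt_eq_0_iff abs_eq_0)
      qed
      ultimately show ?thesis by (simp add: real_sqrt_mult)
    qed
    have 4: "a powr (- 3 / 2) \<le> real (Suc n) powr (- 3 / 2)"
      using a by (intro powr_mono2') auto
    show ?thesis
    proof (cases "y = 0")
      case True
      then show ?thesis using 1 by simp
    next
      case False
      have "cmod (f n) \<le> sqrt \<bar>y\<bar> * a powr (- 3 / 2)" using 1 2 3 False by simp
      also have "\<dots> \<le> sqrt \<bar>y\<bar> * real (Suc n) powr (- 3 / 2)"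
        using 4 by (intro mult_left_mono) auto
      finally show ?thesis .
    qed
  qed
  have s: "summable (\<lambda>n. sqrt \<bar>y\<bar> * real (Suc n) powr (- 3 / 2))"
    by (intro summable_mult summable_zeta32)
  have "Digamma (Complex x y) - of_real (Digamma x) = suminf f"
    using Digamma_diff_sums[of x y] assms unfolding f_def by (simp add: sums_iff)
  also have "cmod (suminf f) \<le> (\<Sum>n. sqrt \<bar>y\<bar> * real (Suc n) powr (- 3 / 2))"
    by (intro norm_suminf_le f s)
  also have "\<dots> = zeta32 * sqrt \<bar>y\<bar>"
    unfolding zeta32_def using suminf_mult[OF summable_zeta32] by (simp add: mult.commute)
  finally show ?thesis .
qed

text \<open>Termwise: the real part of 1 / (a + i y) is at most 1 / a, so every term of the
  difference series has nonnegative real part.\<close>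

lemma Re_Digamma_ge:
  assumes "x > 0"
  shows "Re (Digamma (Complex x y)) \<ge> Digamma x"
proof -
  have "(\<lambda>n. Re (inverse (complex_of_real (x + real n)) - inverse (Complex x y + of_nat n))) sums
      Re (Digamma (Complex x y) - of_real (Digamma x))"
    by (intro sums_Re Digamma_diff_sums assms)
  then have "0 \<le> Re (Digamma (Complex x y) - of_real (Digamma x))"
  proof (rule sums_le[OF _ sums_zero, rotated])
    fix n
    define a where "a = x + real n"
    have a: "a > 0" using assms by (simp add: a_def)
    have eq: "Complex x y + of_nat n = Complex a y" by (simp add: a_def complex_eq_iff)
    have "Re (inverse (complex_of_real a) - inverse (Complex a y)) = 1 / a - a / (a\<^sup>2 + y\<^sup>2)"
      using a by (simp add: Re_divide inverse_eq_divide power2_eq_square)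
    moreover have "a / (a\<^sup>2 + y\<^sup>2) \<le> 1 / a"
      using a by (simp add: field_simps power2_eq_square add_pos_nonneg)
    ultimately show "0 \<le> Re (inverse (complex_of_real (x + real n)) - inverse (Complex x y + of_nat n))"
      unfolding eq a_def[symmetric] by simp
  qed
  then show ?thesis by simp
qed

lemma harm_le_ln: "n \<ge> 1 \<Longrightarrow> harm n \<le> 1 + ln (real n)"
proof (induction n rule: nat_induct_at_least)
  case base
  then show ?case by (simp add: harm_def)
next
  case (Suc n)
  have "ln (real n / real (Suc n)) \<le> real n / real (Suc n) - 1"
    using Suc by (intro ln_le_minus_one) auto
  moreover have "ln (real n / real (Suc n)) = ln (real n) - ln (real (Suc n))"
    using Suc by (intro ln_divide_pos) auto
  moreover have "real n / real (Suc n) - 1 = - inverse (real (Suc n))"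
    by (simp add: field_simps)
  ultimately have "inverse (real (Suc n)) \<le> ln (real (Suc n)) - ln (real n)"
    by linarith
  then show ?case using Suc by (simp add: harm_Suc)
qed

text \<open>Monotonicity reduces to the integer 2k + 1, where the digamma function is a harmonic
  number minus Euler's constant. The constant 2 covers 1 + ln 2.\<close>

lemma Digamma_le_ln:
  assumes "0 < x" "x \<le> 2 * real k + 1" "k \<ge> 1"
  shows "Digamma x \<le> 2 + ln (real k)"
proof -
  have "Digamma x \<le> Digamma (of_nat (Suc (2 * k)) :: real)"
    by (intro Digamma_real_mono) (use assms in auto)
  also have "\<dots> = harm (2 * k) - euler_mascheroni" by (rule Digamma_of_nat)
  also have "\<dots> \<le> harm (2 * k)" using euler_mascheroni_pos by simp
  also have "\<dots> \<le> 1 + ln (real (2 * k))" by (rule harm_le_ln) (use assms in auto)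
  also have "ln (real (2 * k)) = ln 2 + ln (real k)" using assms by (simp add: ln_mult)
  finally show ?thesis using ln_2_less_1 by simp
qed

lemma Digamma_at_top: "\<exists>x0>0. \<forall>x\<ge>x0. Digamma x \<ge> (B :: real)"
proof -
  have "filterlim (\<lambda>n. harm n :: real) at_top sequentially" by (rule harm_at_top)
  then obtain n where n: "harm n \<ge> B + euler_mascheroni"
    by (metis filterlim_at_top eventually_happens' sequentially_bot)
  show ?thesis
  proof (intro exI[of _ "real (Suc n)"] conjI allI impI)
    fix x assume x: "real (Suc n) \<le> x"
    have "B \<le> Digamma (of_nat (Suc n) :: real)" unfolding Digamma_of_nat using n by simp
    also have "\<dots> \<le> Digamma x" by (intro Digamma_real_mono) (use x in auto)
    finally show "B \<le> Digamma x" .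
  qed auto
qed

section \<open>Theta inversion\<close>

text \<open>Termwise integration over an arbitrary countable index set, by transport along an
  enumeration \<open>e\<close>. It is used for sums over integers and over Gaussian integers
  alike.\<close>

lemma has_sum_integral:
  fixes f :: "'i \<Rightarrow> 'a \<Rightarrow> 'b :: {banach, second_countable_topology}"
  assumes I: "countable I" "infinite I"
    and int: "\<And>i. i \<in> I \<Longrightarrow> integrable M (f i)"
    and sm: "\<And>x. x \<in> space M \<Longrightarrow> (\<lambda>i. norm (f i x)) summable_on I"
    and smi: "(\<lambda>i. \<integral>x. norm (f i x) \<partial>M) summable_on I"
  shows "integrable M (\<lambda>x. \<Sum>\<^sub>\<infinity>i\<in>I. f i x)"
    and "((\<lambda>i. \<integral>x. f i x \<partial>M) has_sum (\<integral>x. (\<Sum>\<^sub>\<infinity>i\<in>I. f i x) \<partial>M)) I"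
proof -
  define e where "e = from_nat_into I"
  have e: "bij_betw e UNIV I" unfolding e_def using I by (rule bij_betw_from_nat_into)
  have eI: "e n \<in> I" for n using e by (auto simp: bij_betw_def)
  have s1: "summable (\<lambda>n. norm (f (e n) x))" if "x \<in> space M" for x
    using sm[OF that] summable_on_reindex_bij_betw[OF e, of "\<lambda>i. norm (f i x)"]
    by (intro summable_on_imp_summable) simp
  have s2: "summable (\<lambda>n. \<integral>x. norm (f (e n) x) \<partial>M)"
    using smi summable_on_reindex_bij_betw[OF e, of "\<lambda>i. \<integral>x. norm (f i x) \<partial>M"]
    by (intro summable_on_imp_summable) simp
  have eq: "(\<Sum>\<^sub>\<infinity>i\<in>I. f i x) = (\<Sum>n. f (e n) x)" if "x \<in> space M" for x
  proof -
    have "(\<Sum>\<^sub>\<infinity>i\<in>I. f i x) = (\<Sum>\<^sub>\<infinity>n. f (e n) x)"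
      by (rule infsum_reindex_bij_betw[OF e, symmetric])
    also have "\<dots> = (\<Sum>n. f (e n) x)"
      by (rule infsumI, rule norm_summable_imp_has_sum[OF s1[OF that]],
          rule summable_sums[OF summable_norm_cancel[OF s1[OF that]]])
    finally show ?thesis .
  qed
  have i: "integrable M (f (e n))" for n using int eI by blast
  have "integrable M (\<lambda>x. \<Sum>n. f (e n) x)"
    by (rule integrable_suminf[OF i]) (use s1 s2 in auto)
  then show "integrable M (\<lambda>x. \<Sum>\<^sub>\<infinity>i\<in>I. f i x)"
    by (subst Bochner_Integration.integrable_cong[OF refl eq])
  have "(\<lambda>n. \<integral>x. f (e n) x \<partial>M) sums (\<integral>x. (\<Sum>n. f (e n) x) \<partial>M)"
    by (rule sums_integral[OF i]) (use s1 s2 in auto)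
  moreover have "summable (\<lambda>n. norm (\<integral>x. f (e n) x \<partial>M))"
    by (rule summable_comparison_test'[OF s2]) simp
  ultimately have "((\<lambda>n. \<integral>x. f (e n) x \<partial>M) has_sum (\<integral>x. (\<Sum>n. f (e n) x) \<partial>M)) UNIV"
    by (intro norm_summable_imp_has_sum)
  moreover have "(\<integral>x. (\<Sum>n. f (e n) x) \<partial>M) = (\<integral>x. (\<Sum>\<^sub>\<infinity>i\<in>I. f i x) \<partial>M)"
    by (intro Bochner_Integration.integral_cong) (simp_all add: eq)
  ultimately show "((\<lambda>i. \<integral>x. f i x \<partial>M) has_sum (\<integral>x. (\<Sum>\<^sub>\<infinity>i\<in>I. f i x) \<partial>M)) I"
    using has_sum_reindex_bij_betw[OF e, of "\<lambda>i. \<integral>x. f i x \<partial>M"] by simp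
qed

text \<open>Expanding each exponential and exchanging the two absolutely convergent sums yields a
  power series in w. The same computation serves the theta functions, whose Taylor coefficients are
  compared later, and the differentiation of Dirichlet series.\<close>

lemma exp_sum_sums:
  fixes c b :: "'i \<Rightarrow> complex"
  assumes sm: "(\<lambda>i. norm (c i) * exp (norm (b i) * norm w)) summable_on A"
  shows "(\<lambda>j. (\<Sum>\<^sub>\<infinity>i\<in>A. c i * b i ^ j) / fact j * w ^ j) sums (\<Sum>\<^sub>\<infinity>i\<in>A. c i * exp (b i * w))"
    and "(\<lambda>i. c i * exp (b i * w)) summable_on A"
proof -
  define f where "f = (\<lambda>(i, j). c i * ((b i * w) ^ j /\<^sub>R fact j))"
  have exps: "((\<lambda>j. z ^ j /\<^sub>R fact j) has_sum exp z) UNIV" for z :: complex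
  proof (rule norm_summable_imp_has_sum)
    show "summable (\<lambda>j. norm (z ^ j /\<^sub>R fact j))"
      using summable_norm_exp[of z] by simp
    show "(\<lambda>j. z ^ j /\<^sub>R fact j) sums exp z" by (rule exp_converges)
  qed
  have expr: "((\<lambda>j. r ^ j /\<^sub>R fact j) has_sum exp r) UNIV" if "r \<ge> 0" for r :: real
    by (rule norm_summable_imp_has_sum) (use exp_converges[of r] summable_norm_exp[of r] in auto)
  have "(\<lambda>p. norm (f p)) summable_on A \<times> UNIV"
  proof (rule summable_on_SigmaI)
    fix i assume "i \<in> A"
    have "((\<lambda>j. norm (c i) * ((norm (b i) * norm w) ^ j /\<^sub>R fact j)) has_sum
        norm (c i) * exp (norm (b i) * norm w)) UNIV"
      by (intro has_sum_cmult_right expr) simp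
    then show "((\<lambda>j. norm (f (i, j))) has_sum norm (c i) * exp (norm (b i) * norm w)) UNIV"
      by (simp add: f_def norm_mult norm_power mult_ac)
  qed (use sm in auto)
  then have fs: "f summable_on A \<times> UNIV" by (rule abs_summable_summable)
  have row: "((\<lambda>j. f (i, j)) has_sum c i * exp (b i * w)) UNIV" for i
    unfolding f_def using has_sum_cmult_right[OF exps[of "b i * w"], of "c i"] by simp
  have S: "((\<lambda>i. c i * exp (b i * w)) has_sum infsum f (A \<times> UNIV)) A"
    by (rule has_sum_SigmaD[OF has_sum_infsum[OF fs]]) (rule row)
  then show "(\<lambda>i. c i * exp (b i * w)) summable_on A" by (rule has_sum_imp_summable)
  have S': "infsum f (A \<times> UNIV) = (\<Sum>\<^sub>\<infinity>i\<in>A. c i * exp (b i * w))"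
    using S by (simp add: infsumI)
  have fs': "((\<lambda>(j, i). f (i, j)) has_sum infsum f (A \<times> UNIV)) (UNIV \<times> A)"
    by (rule has_sum_swap[THEN iffD1, OF has_sum_infsum[OF fs]])
  have col: "((\<lambda>i. f (i, j)) has_sum (\<Sum>\<^sub>\<infinity>i\<in>A. c i * b i ^ j) / fact j * w ^ j) A" for j
  proof -
    have "(\<lambda>i. (\<lambda>(j, i). f (i, j)) (j, i)) summable_on A"
      by (rule summable_on_SigmaD1[where A = UNIV and B = "\<lambda>_. A"])
        (use has_sum_imp_summable[OF fs'] in auto)
    then have "((\<lambda>i. f (i, j)) has_sum (\<Sum>\<^sub>\<infinity>i\<in>A. f (i, j))) A" by simp
    moreover have "(\<Sum>\<^sub>\<infinity>i\<in>A. f (i, j)) = (\<Sum>\<^sub>\<infinity>i\<in>A. (w ^ j / fact j) * (c i * b i ^ j))"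
      by (intro infsum_cong) (simp add: f_def power_mult_distrib scaleR_conv_of_real field_simps)
    moreover have "\<dots> = (\<Sum>\<^sub>\<infinity>i\<in>A. c i * b i ^ j) / fact j * w ^ j"
      by (subst infsum_cmult_right') (simp add: field_simps)
    ultimately show ?thesis by simp
  qed
  have "((\<lambda>j. (\<Sum>\<^sub>\<infinity>i\<in>A. c i * b i ^ j) / fact j * w ^ j) has_sum infsum f (A \<times> UNIV)) UNIV"
    by (rule has_sum_SigmaD[OF fs']) (use col in auto)
  then show "(\<lambda>j. (\<Sum>\<^sub>\<infinity>i\<in>A. c i * b i ^ j) / fact j * w ^ j) sums (\<Sum>\<^sub>\<infinity>i\<in>A. c i * exp (b i * w))"
    unfolding S' by (rule has_sum_imp_sums)
qed

lemma exp_sum_holomorphic: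
  fixes c b :: "'i \<Rightarrow> complex"
  assumes sm: "\<And>R. (\<lambda>i. norm (c i) * exp (norm (b i) * R)) summable_on A"
  shows "(\<lambda>w. \<Sum>\<^sub>\<infinity>i\<in>A. c i * exp (b i * w)) holomorphic_on UNIV"
proof -
  have "(\<lambda>w. \<Sum>\<^sub>\<infinity>i\<in>A. c i * exp (b i * w)) holomorphic_on ball 0 r" for r
  proof (rule power_series_holomorphic)
    fix w :: complex
    show "(\<lambda>j. (\<Sum>\<^sub>\<infinity>i\<in>A. c i * b i ^ j) / fact j * (w - 0) ^ j) sums (\<Sum>\<^sub>\<infinity>i\<in>A. c i * exp (b i * w))"
      using exp_sum_sums(1)[OF sm] by simp
  qed
  then have "\<exists>e>0. (\<lambda>w. \<Sum>\<^sub>\<infinity>i\<in>A. c i * exp (b i * w)) holomorphic_on ball 0 (norm z + e)" for z :: complex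
    by (intro exI[of _ 1]) auto
  then have "(\<lambda>w. \<Sum>\<^sub>\<infinity>i\<in>A. c i * exp (b i * w)) field_differentiable at z" for z :: complex
    using holomorphic_on_imp_differentiable_at[of _ "ball 0 (norm z + 1)" z]
      \<open>\<And>r. (\<lambda>w. \<Sum>\<^sub>\<infinity>i\<in>A. c i * exp (b i * w)) holomorphic_on ball 0 r\<close> by simp
  then show ?thesis by (simp add: holomorphic_on_def field_differentiable_at_within)
qed

section \<open>The Jacobi theta function\<close>

lemma summable_on_int_exp: "(\<lambda>n::int. exp (- \<bar>real_of_int n\<bar>)) summable_on UNIV"
proof -
  have nat: "(\<lambda>n::nat. exp (- real n)) summable_on UNIV"
  proof -
    have "summable (\<lambda>n::nat. exp (-1 :: real) ^ n)" by (intro summable_geometric) simp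
    then show ?thesis
      by (intro norm_summable_imp_summable_on) (simp add: exp_of_nat_mult[symmetric])
  qed
  have "(\<lambda>n::int. exp (- \<bar>real_of_int n\<bar>)) summable_on (range int)"
    by (subst summable_on_reindex) (use nat in \<open>auto simp: o_def inj_on_def\<close>)
  moreover have "(\<lambda>n::int. exp (- \<bar>real_of_int n\<bar>)) summable_on (range (\<lambda>n. - int n))"
    by (subst summable_on_reindex) (use nat in \<open>auto simp: o_def inj_on_def\<close>)
  moreover have "UNIV = range int \<union> range (\<lambda>n. - int n)"
  proof -
    have "n \<in> range int \<union> range (\<lambda>n. - int n)" for n :: int
      by (cases n rule: int_cases2) auto
    then show ?thesis by blast
  qed
  ultimately show ?thesis by (metis summable_on_union)
qed

lemma summable_on_int_gauss:
  assumes "t > 0"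
  shows "(\<lambda>n::int. exp (- t * (real_of_int n)\<^sup>2 + R * \<bar>real_of_int n\<bar>)) summable_on UNIV"
proof (rule summable_on_comparison_test)
  show "(\<lambda>n::int. exp ((R + 1)\<^sup>2 / (4 * t)) * exp (- \<bar>real_of_int n\<bar>)) summable_on UNIV"
    by (intro summable_on_cmult_right summable_on_int_exp)
  fix n :: int
  \<comment> \<open>Completing the square for slope R + 1 instead of R leaves the summable factor
    exp (-|n|).\<close>
  have "0 \<le> (2 * t * \<bar>real_of_int n\<bar> - (R + 1))\<^sup>2 / (4 * t)" using assms by simp
  also have "\<dots> = t * (real_of_int n)\<^sup>2 - (R + 1) * \<bar>real_of_int n\<bar> + (R + 1)\<^sup>2 / (4 * t)"
    using assms by (simp add: field_simps power2_eq_square)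
  finally have "- t * (real_of_int n)\<^sup>2 + R * \<bar>real_of_int n\<bar> \<le> (R + 1)\<^sup>2 / (4 * t) + - \<bar>real_of_int n\<bar>"
    by (simp add: algebra_simps)
  then show "exp (- t * (real_of_int n)\<^sup>2 + R * \<bar>real_of_int n\<bar>) \<le>
      exp ((R + 1)\<^sup>2 / (4 * t)) * exp (- \<bar>real_of_int n\<bar>)"
    by (simp flip: exp_add)
qed auto

text \<open>Jacobi's theta function at tau = i t, with general argument z: the dependence on z is
  what later produces harmonic coefficients.\<close>

definition jtheta :: "real \<Rightarrow> complex \<Rightarrow> complex" where
  "jtheta t z = (\<Sum>\<^sub>\<infinity>n::int. exp (- of_real (pi * t * (of_int n)\<^sup>2)) * exp (2 * pi * \<i> * of_int n * z))"

lemma jtheta_norm_summable: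
  assumes "t > 0"
  shows "(\<lambda>n::int. norm (exp (- of_real (pi * t * (of_int n)\<^sup>2)) :: complex) *
           exp (norm (2 * pi * \<i> * of_int n) * R)) summable_on UNIV"
proof -
  have "(\<lambda>n::int. exp (- (pi * t) * (real_of_int n)\<^sup>2 + (2 * pi * R) * \<bar>real_of_int n\<bar>)) summable_on UNIV"
    by (rule summable_on_int_gauss) (use assms in auto)
  then show ?thesis
    by (rule summable_on_cong[THEN iffD1, rotated]) (simp add: norm_mult exp_add[symmetric] mult_ac)
qed

lemma jtheta_has_sum:
  assumes "t > 0"
  shows "((\<lambda>n::int. exp (- of_real (pi * t * (of_int n)\<^sup>2)) * exp (2 * pi * \<i> * of_int n * z))
            has_sum jtheta t z) UNIV"
  unfolding jtheta_def
  by (intro has_sum_infsum exp_sum_sums(2) jtheta_norm_summable assms)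

lemma jtheta_holomorphic: "t > 0 \<Longrightarrow> jtheta t holomorphic_on UNIV"
  unfolding jtheta_def [abs_def] by (intro exp_sum_holomorphic jtheta_norm_summable)

lemma jtheta_minus: "jtheta t (- z) = jtheta t z"
proof -
  have "bij (uminus :: int \<Rightarrow> int)" by (rule bij_uminus)
  then show ?thesis
    unfolding jtheta_def
    by (subst infsum_reindex_bij_betw[symmetric, of uminus UNIV UNIV]) auto
qed

lemma jtheta_real_has_sum:
  assumes "t > 0"
  shows "((\<lambda>n::int. exp (- pi * t * (of_int n)\<^sup>2) * cos (2 * pi * of_int n * x)) has_sum
           Re (jtheta t (of_real x))) UNIV"
proof -
  have "((\<lambda>n::int. Re (exp (- of_real (pi * t * (of_int n)\<^sup>2)) * exp (2 * pi * \<i> * of_int n * of_real x)))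
      has_sum Re (jtheta t (of_real x))) UNIV"
    by (rule has_sum_Re[OF jtheta_has_sum[OF assms]])
  moreover have "Re (exp (- of_real (pi * t * (of_int n)\<^sup>2)) * exp (2 * pi * \<i> * of_int n * of_real x)) =
      exp (- pi * t * (of_int n)\<^sup>2) * cos (2 * pi * of_int n * x)" for n :: int
  proof -
    have "exp (- of_real (pi * t * (of_int n)\<^sup>2) :: complex) = of_real (exp (- pi * t * (of_int n)\<^sup>2))"
      by (simp flip: exp_of_real)
    moreover have "exp (2 * pi * \<i> * of_int n * of_real x) = cis (2 * pi * of_int n * x)"
      by (simp add: cis_conv_exp mult_ac)
    ultimately show ?thesis by simp
  qed
  ultimately show ?thesis by simp
qed

text \<open>Completing the square shows that this side of the inversion formula is the periodized
  Gaussian, which makes it 1-periodic and its cosine coefficients computable.\<close>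

lemma jtheta_dual_has_sum:
  assumes "t > 0"
  shows "((\<lambda>n::int. exp (- pi * (of_int n + x)\<^sup>2 / t)) has_sum
           exp (- pi * x\<^sup>2 / t) * Re (jtheta (1 / t) (\<i> * of_real (x / t)))) UNIV"
proof -
  have "((\<lambda>n::int. exp (- pi * x\<^sup>2 / t) *
        Re (exp (- of_real (pi * (1 / t) * (of_int n)\<^sup>2)) * exp (2 * pi * \<i> * of_int n * (\<i> * of_real (x / t)))))
      has_sum exp (- pi * x\<^sup>2 / t) * Re (jtheta (1 / t) (\<i> * of_real (x / t)))) UNIV"
    by (intro has_sum_cmult_right has_sum_Re jtheta_has_sum) (use assms in auto)
  moreover have "exp (- pi * x\<^sup>2 / t) * Re (exp (- of_real (pi * (1 / t) * (of_int n)\<^sup>2)) *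
      exp (2 * pi * \<i> * of_int n * (\<i> * of_real (x / t)))) = exp (- pi * (of_int n + x)\<^sup>2 / t)" for n :: int
  proof -
    have "exp (- of_real (pi * (1 / t) * (of_int n)\<^sup>2)) * exp (2 * pi * \<i> * of_int n * (\<i> * of_real (x / t))) =
        complex_of_real (exp (- (pi * (1 / t) * (of_int n)\<^sup>2) - 2 * pi * of_int n * (x / t)))"
      by (simp add: exp_of_real[symmetric] exp_add[symmetric] algebra_simps del: exp_of_real)
    then have "exp (- pi * x\<^sup>2 / t) * Re (exp (- of_real (pi * (1 / t) * (of_int n)\<^sup>2)) *
      exp (2 * pi * \<i> * of_int n * (\<i> * of_real (x / t)))) =
      exp (- pi * x\<^sup>2 / t) * exp (- (pi * (1 / t) * (of_int n)\<^sup>2) - 2 * pi * of_int n * (x / t))"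
      by simp
    also have "\<dots> = exp (- pi * (of_int n + x)\<^sup>2 / t)"
      unfolding exp_add[symmetric] using assms
      by (intro arg_cong[of _ _ exp]) (simp add: field_simps power2_eq_square)
    finally show ?thesis .
  qed
  ultimately show ?thesis by simp
qed

text \<open>The Fourier transform of a Gaussian, read off from the characteristic function of the
  standard normal distribution; \<open>c\<close> is the scaling that turns x^2 / 2 into pi x^2 /
  t.\<close>

lemma gauss_cos_integral:
  assumes "t > 0"
  shows "integrable lborel (\<lambda>x. exp (- pi * x\<^sup>2 / t) * cos (2 * pi * m * x))"
    and "(\<integral>x. exp (- pi * x\<^sup>2 / t) * cos (2 * pi * m * x) \<partial>lborel) = sqrt t * exp (- pi * t * m\<^sup>2)"
proof -
  define c where "c = sqrt (2 * pi / t)"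
  define u where "u = 2 * pi * m / c"
  have c: "c > 0" "c\<^sup>2 = 2 * pi / t" using assms by (simp_all add: c_def)
  interpret N: real_distribution std_normal_distribution
    by (rule real_dist_normal_dist)
  have iexp: "integrable std_normal_distribution (\<lambda>x. iexp (u * x))"
    by (intro N.integrable_const_bound[where B = 1]) auto
  have Re: "Re (iexp (u * x)) = cos (u * x)" for x
    by (metis cis_conv_exp cis.simps(1))
  have icos: "integrable std_normal_distribution (\<lambda>x. cos (u * x))"
    using integrable_Re[OF iexp] unfolding Re .
  have val: "(\<integral>x. cos (u * x) \<partial>std_normal_distribution) = exp (- (u\<^sup>2) / 2)"
    using char_std_normal_distribution[THEN fun_cong, of u] integral_Re[OF iexp]
    unfolding char_def Re by simp
  have den: "integrable lborel (\<lambda>x. std_normal_density x * cos (u * x))"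
    "(\<integral>x. std_normal_density x * cos (u * x) \<partial>lborel) = exp (- (u\<^sup>2) / 2)"
    using icos val by (simp_all add: integrable_density integral_density)
  have eq: "std_normal_density (0 + c * x) * cos (u * (0 + c * x)) =
      (1 / sqrt (2 * pi)) * (exp (- pi * x\<^sup>2 / t) * cos (2 * pi * m * x))" for x
  proof -
    have A: "- (c * x)\<^sup>2 / 2 = - pi * x\<^sup>2 / t" using c by (simp add: power_mult_distrib)
    have B: "u * (c * x) = 2 * pi * m * x" using c by (simp add: u_def)
    show ?thesis unfolding add_0 B normal_density_def using A by simp
  qed
  have "integrable lborel (\<lambda>x. std_normal_density (0 + c * x) * cos (u * (0 + c * x)))"
    by (rule lborel_integrable_real_affine[OF den(1)]) (use c in simp)
  then show "integrable lborel (\<lambda>x. exp (- pi * x\<^sup>2 / t) * cos (2 * pi * m * x))"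
    unfolding eq using integrable_mult_right[of "sqrt (2 * pi)"] by fastforce
  have "exp (- (u\<^sup>2) / 2) = \<bar>c\<bar> *\<^sub>R (\<integral>x. std_normal_density (0 + c * x) * cos (u * (0 + c * x)) \<partial>lborel)"
    unfolding den(2)[symmetric] by (rule lborel_integral_real_affine) (use c in simp)
  also have "\<dots> = (c / sqrt (2 * pi)) * (\<integral>x. exp (- pi * x\<^sup>2 / t) * cos (2 * pi * m * x) \<partial>lborel)"
    unfolding eq using c by simp
  also have "c / sqrt (2 * pi) = 1 / sqrt t"
    unfolding c_def using assms by (simp add: real_sqrt_divide)
  finally have "(\<integral>x. exp (- pi * x\<^sup>2 / t) * cos (2 * pi * m * x) \<partial>lborel) = sqrt t * exp (- (u\<^sup>2) / 2)"
    using assms by simp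
  also have "- (u\<^sup>2) / 2 = - pi * t * m\<^sup>2"
    using c assms by (simp add: u_def power_divide power_mult_distrib power2_eq_square)
  finally show "(\<integral>x. exp (- pi * x\<^sup>2 / t) * cos (2 * pi * m * x) \<partial>lborel) = sqrt t * exp (- pi * t * m\<^sup>2)" .
qed

text \<open>Vanishing cosine coefficients make f orthogonal to every polynomial in cos (2 pi x). On
  [0, 1/2] this cosine is injective, so by Stone-Weierstrass such polynomials approximate f
  uniformly, and the integral of f^2 is 0.\<close>

lemma even_periodic_fourier_unique:
  fixes f :: "real \<Rightarrow> real"
  assumes cont: "continuous_on UNIV f" and per: "\<And>x. f (x + 1) = f x" and ev: "\<And>x. f (- x) = f x"
    and coeff: "\<And>m::nat. integral {0..1} (\<lambda>x. f x * cos (2 * pi * real m * x)) = 0"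
  shows "f x = 0"
proof -
  have cont': "continuous_on A f" for A using cont continuous_on_subset by blast
  have refl1: "f (1 - x) = f x" for x using per[of "- x"] ev[of x] by (simp add: add.commute)
  have int: "g integrable_on {0..1}" if "continuous_on UNIV g" for g :: "real \<Rightarrow> real"
    by (rule integrable_continuous_real) (use that continuous_on_subset in blast)
  \<comment> \<open>A product of two cosines is half a sum of two cosines, so each additional power
    of cos (2 pi x) only shifts the frequency m.\<close>
  have pow: "integral {0..1} (\<lambda>x. f x * cos (2 * pi * x) ^ n * cos (2 * pi * real m * x)) = 0" for n m
  proof (induction n arbitrary: m)
    case 0
    then show ?case using coeff by simp
  next
    case (Suc n)
    define g where "g k x = f x * cos (2 * pi * x) ^ n * cos (2 * pi * real k * x)" for k x
    have gi: "g k integrable_on {0..1}" for k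
      unfolding g_def by (intro int continuous_intros cont)
    have "\<exists>k l. \<forall>x. cos (2 * pi * x) * cos (2 * pi * real m * x) =
        (cos (2 * pi * real k * x) + cos (2 * pi * real l * x)) / 2"
    proof (cases m)
      case 0
      then show ?thesis by (intro exI[of _ 1]) simp
    next
      case (Suc l)
      show ?thesis
      proof (rule exI[of _ l], rule exI[of _ "Suc m"], rule allI)
        fix x
        have "cos (2 * pi * real l * x) = cos (2 * pi * real m * x - 2 * pi * x)"
          "cos (2 * pi * real (Suc m) * x) = cos (2 * pi * real m * x + 2 * pi * x)"
          by (simp_all add: Suc algebra_simps)
        then show "cos (2 * pi * x) * cos (2 * pi * real m * x) =
            (cos (2 * pi * real l * x) + cos (2 * pi * real (Suc m) * x)) / 2"
          by (simp add: cos_add cos_diff)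
      qed
    qed
    then obtain k l where kl: "\<And>x. cos (2 * pi * x) * cos (2 * pi * real m * x) =
        (cos (2 * pi * real k * x) + cos (2 * pi * real l * x)) / 2" by blast
    have "f x * cos (2 * pi * x) ^ Suc n * cos (2 * pi * real m * x) = (g k x + g l x) / 2" for x
    proof -
      have "f x * cos (2 * pi * x) ^ Suc n * cos (2 * pi * real m * x) =
          f x * cos (2 * pi * x) ^ n * (cos (2 * pi * x) * cos (2 * pi * real m * x))"
        by (simp add: mult_ac)
      then show ?thesis unfolding kl g_def by (simp add: algebra_simps add_divide_distrib)
    qed
    then have "integral {0..1} (\<lambda>x. f x * cos (2 * pi * x) ^ Suc n * cos (2 * pi * real m * x)) =
        integral {0..1} (\<lambda>x. (g k x + g l x) / 2)" by presburger
    also have "\<dots> = (integral {0..1} (g k) + integral {0..1} (g l)) / 2"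
      using gi by (simp add: integral_add)
    also have "\<dots> = 0" using Suc.IH unfolding g_def by simp
    finally show ?case .
  qed
  have poly: "integral {0..1} (\<lambda>x. f x * p (cos (2 * pi * x))) = 0"
    if rp: "real_polynomial_function p" for p
  proof -
    obtain a n where p: "p = (\<lambda>x. \<Sum>i\<le>n. a i * x ^ i)"
      using rp unfolding real_polynomial_function_iff_sum by blast
    have "integral {0..1} (\<lambda>x. f x * p (cos (2 * pi * x))) =
        integral {0..1} (\<lambda>x. \<Sum>i\<le>n. a i * (f x * cos (2 * pi * x) ^ i))"
      unfolding p by (simp add: sum_distrib_left mult_ac)
    also have "\<dots> = (\<Sum>i\<le>n. integral {0..1} (\<lambda>x. a i * (f x * cos (2 * pi * x) ^ i)))"
      by (intro integral_sum int continuous_intros cont) auto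
    also have "\<dots> = 0" using pow[of _ 0] by simp
    finally show ?thesis .
  qed
  have fint: "(\<lambda>x. f x * f x) integrable_on {0..1}" by (intro int continuous_intros cont)
  have small: "integral {0..1} (\<lambda>x. f x * f x) \<le> e * M"
    if e: "e > 0" and M: "\<And>x. x \<in> {0..1} \<Longrightarrow> \<bar>f x\<bar> \<le> M" for e M
  proof -
    define P where "P = (\<lambda>g :: real \<Rightarrow> real. \<exists>p. real_polynomial_function p \<and> g = (\<lambda>x. p (cos (2 * pi * x))))"
    have "\<exists>g. P g \<and> (\<forall>x\<in>{0..1/2}. \<bar>f x - g x\<bar> < e)"
    proof (rule Stone_Weierstrass_HOL)
      show "P (\<lambda>x. c)" for c
        unfolding P_def by (intro exI[of _ "\<lambda>x. c"]) auto
      show "continuous_on {0..1/2} g" if "P g" for g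
      proof -
        obtain p where p: "real_polynomial_function p" "g = (\<lambda>x. p (cos (2 * pi * x)))"
          using \<open>P g\<close> unfolding P_def by blast
        have "continuous_on UNIV p"
          using p(1) by (simp add: continuous_at_imp_continuous_on continuous_real_polymonial_function)
        then have "continuous_on {0..1/2} (p \<circ> (\<lambda>x. cos (2 * pi * x)))"
          by (intro continuous_on_compose continuous_intros) (auto elim: continuous_on_subset)
        then show ?thesis by (simp add: p(2) o_def)
      qed
      show "P (\<lambda>x. g x + h x)" if "P g \<and> P h" for g h
        using that unfolding P_def by (blast intro: real_polynomial_function.intros)
      show "P (\<lambda>x. g x * h x)" if "P g \<and> P h" for g h
        using that unfolding P_def by (blast intro: real_polynomial_function.intros)
      show "\<exists>g. P g \<and> g x \<noteq> g y" if "x \<in> {0..1/2} \<and> y \<in> {0..1/2} \<and> x \<noteq> y" for x y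
      proof -
        have "cos (2 * pi * x) \<noteq> cos (2 * pi * y)"
        proof
          assume "cos (2 * pi * x) = cos (2 * pi * y)"
          then have "2 * pi * x = 2 * pi * y"
            by (rule cos_inj_pi[rotated 4]) (use that in auto)
          then show False using that by simp
        qed
        moreover have "P (\<lambda>x. cos (2 * pi * x))"
          unfolding P_def
          by (intro exI[of _ "\<lambda>x. x"]) (auto intro: real_polynomial_function.intros bounded_linear_ident)
        ultimately show ?thesis by blast
      qed
    qed (use e cont' in auto)
    then obtain p where p: "real_polynomial_function p"
      "\<And>x. x \<in> {0..1/2} \<Longrightarrow> \<bar>f x - p (cos (2 * pi * x))\<bar> < e" unfolding P_def by blast
    \<comment> \<open>Evenness and periodicity make both functions invariant under x -> 1 - x, which
      carries the approximation from [0, 1/2] to [1/2, 1].\<close>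
    have pe: "\<bar>f x - p (cos (2 * pi * x))\<bar> < e" if "x \<in> {0..1}" for x
    proof (cases "x \<le> 1 / 2")
      case False
      have "cos (2 * pi * (1 - x)) = cos (2 * pi * x)" by (simp add: algebra_simps cos_diff)
      then show ?thesis using p(2)[of "1 - x"] that False refl1[of x] by simp
    qed (use p(2) that in auto)
    have "continuous_on UNIV p"
      using p(1) by (simp add: continuous_at_imp_continuous_on continuous_real_polymonial_function)
    then have pc: "continuous_on UNIV (\<lambda>x. p (cos (2 * pi * x)))"
      by (rule continuous_on_compose2) (auto intro!: continuous_intros)
    have "integral {0..1} (\<lambda>x. f x * f x) =
        integral {0..1} (\<lambda>x. f x * (f x - p (cos (2 * pi * x))) + f x * p (cos (2 * pi * x)))"
      by (simp add: algebra_simps)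
    also have "\<dots> = integral {0..1} (\<lambda>x. f x * (f x - p (cos (2 * pi * x)))) +
        integral {0..1} (\<lambda>x. f x * p (cos (2 * pi * x)))"
      by (intro integral_add int continuous_intros cont pc)
    also have "\<dots> = integral {0..1} (\<lambda>x. f x * (f x - p (cos (2 * pi * x))))"
      using poly[OF p(1)] by simp
    also have "\<dots> \<le> integral {0..1} (\<lambda>x::real. e * M)"
    proof (rule Henstock_Kurzweil_Integration.integral_le)
      show "(\<lambda>x. f x * (f x - p (cos (2 * pi * x)))) integrable_on {0..1}"
        by (intro int continuous_intros cont pc)
      show "(\<lambda>x::real. e * M) integrable_on {0..1}" by (intro int continuous_intros)
      fix x :: real assume x: "x \<in> {0..1}"
      have "f x * (f x - p (cos (2 * pi * x))) \<le> \<bar>f x\<bar> * \<bar>f x - p (cos (2 * pi * x))\<bar>"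
        by (metis abs_ge_self abs_mult)
      also have "\<dots> \<le> M * e" using M[OF x] pe[OF x] by (intro mult_mono) auto
      finally show "f x * (f x - p (cos (2 * pi * x))) \<le> e * M" by (simp add: mult.commute)
    qed
    also have "\<dots> = e * M" by simp
    finally show ?thesis .
  qed
  have "compact (f ` {0..1})" by (intro compact_continuous_image cont') auto
  then obtain M where "\<forall>y\<in>f ` {0..1}. norm y \<le> M"
    using compact_imp_bounded[of "f ` {0..1}"] unfolding bounded_iff by blast
  then have M: "\<bar>f x\<bar> \<le> M" if "x \<in> {0..1}" for x using that by auto
  have M0: "M \<ge> 0" using M[of 0] by simp
  have "integral {0..1} (\<lambda>x. f x * f x) \<le> 0"
  proof (rule field_le_epsilon)
    fix e :: real assume "e > 0"
    have "integral {0..1} (\<lambda>x. f x * f x) \<le> e / (M + 1) * M"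
      using small[of "e / (M + 1)" M] M M0 \<open>e > 0\<close> by simp
    also have "\<dots> \<le> e" using M0 \<open>e > 0\<close> by (simp add: field_simps)
    finally show "integral {0..1} (\<lambda>x. f x * f x) \<le> 0 + e" by simp
  qed
  moreover have "integral {0..1} (\<lambda>x. f x * f x) \<ge> 0" by (rule integral_nonneg[OF fint]) simp
  ultimately have "integral {0..1} (\<lambda>x. f x * f x) = 0" by simp
  moreover have "integral {0..1} (\<lambda>x. f x * f x) = 0 \<longleftrightarrow> (\<forall>x\<in>{0..1}. f x * f x = 0)"
    by (rule integral_eq_0_iff) (auto intro!: continuous_on_mult cont')
  ultimately have z: "f x = 0" if "x \<in> {0..1}" for x using that by simp
  have pern: "f (x + real n) = f x" for x n
  proof (induction n)
    case (Suc n)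
    have "f (x + real (Suc n)) = f ((x + real n) + 1)" by (simp add: add_ac)
    then show ?case using per Suc by simp
  qed simp
  have "f x = f (frac x)"
  proof (cases "\<lfloor>x\<rfloor> \<ge> 0")
    case True
    then show ?thesis using pern[of "frac x" "nat \<lfloor>x\<rfloor>"] by (simp add: frac_def)
  next
    case False
    then show ?thesis using pern[of x "nat (- \<lfloor>x\<rfloor>)"] by (simp add: frac_def)
  qed
  also have "\<dots> = 0" using frac_ge_0[of x] frac_lt_1[of x] by (intro z) auto
  finally show ?thesis .
qed

lemma has_sum_integral_unit_interval:
  fixes f :: "'i \<Rightarrow> real \<Rightarrow> real"
  assumes I: "countable I" "infinite I"
    and cont: "\<And>i. i \<in> I \<Longrightarrow> continuous_on {0..1} (f i)"
    and bound: "\<And>i x. i \<in> I \<Longrightarrow> x \<in> {0..1} \<Longrightarrow> \<bar>f i x\<bar> \<le> B i"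
    and B: "B summable_on I"
  shows "((\<lambda>i. integral {0..1} (f i)) has_sum integral {0..1} (\<lambda>x. \<Sum>\<^sub>\<infinity>i\<in>I. f i x)) I"
proof -
  define F where "F i x = indicator {0..1} x *\<^sub>R f i x" for i x
  have si: "set_integrable lborel {0..1} (f i)" if "i \<in> I" for i
    unfolding set_integrable_def by (rule borel_integrable_compact) (use cont that in auto)
  have Fi: "integrable lborel (F i)" if "i \<in> I" for i
    using si[OF that] unfolding F_def set_integrable_def .
  have FB: "norm (F i x) \<le> indicator {0..1} x * B i" if "i \<in> I" for i x
    using bound[OF that, of x] by (auto simp: F_def indicator_def)
  have B0: "B i \<ge> 0" if "i \<in> I" for i using bound[OF that, of 0] by simp
  have FB': "norm (F i x) \<le> B i" if "i \<in> I" for i x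
    using FB[OF that, of x] B0[OF that] by (cases "x \<in> {0..1}") auto
  have 1: "(\<lambda>i. norm (F i x)) summable_on I" for x
    by (rule Infinite_Sum.abs_summable_on_comparison_test'[OF B]) (rule FB')
  have 2: "(\<lambda>i. \<integral>x. norm (F i x) \<partial>lborel) summable_on I"
  proof (rule summable_on_comparison_test[OF B])
    fix i assume i: "i \<in> I"
    have "(\<integral>x. norm (F i x) \<partial>lborel) \<le> (\<integral>x. indicator {0..1::real} x * B i \<partial>lborel)"
      by (rule Bochner_Integration.integral_mono) (use Fi[OF i] FB[OF i] in auto)
    then show "(\<integral>x. norm (F i x) \<partial>lborel) \<le> B i" by simp
  qed simp
  note H = has_sum_integral[OF I Fi 1 2]
  have E1: "(\<integral>x. F i x \<partial>lborel) = integral {0..1} (f i)" if "i \<in> I" for i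
    using set_borel_integral_eq_integral(2)[OF si[OF that]]
    unfolding F_def set_lebesgue_integral_def .
  have E2: "(\<integral>x. (\<Sum>\<^sub>\<infinity>i\<in>I. F i x) \<partial>lborel) = integral {0..1} (\<lambda>x. \<Sum>\<^sub>\<infinity>i\<in>I. f i x)"
  proof -
    have eq: "(\<lambda>x. \<Sum>\<^sub>\<infinity>i\<in>I. F i x) = (\<lambda>x. indicator {0..1} x *\<^sub>R (\<Sum>\<^sub>\<infinity>i\<in>I. f i x))"
      by (auto simp: F_def indicator_def)
    have "set_integrable lborel {0..1} (\<lambda>x. \<Sum>\<^sub>\<infinity>i\<in>I. f i x)"
      using H(1) unfolding eq set_integrable_def .
    then show ?thesis
      using set_borel_integral_eq_integral(2) unfolding eq set_lebesgue_integral_def by blast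
  qed
  have "((\<lambda>i. \<integral>x. F i x \<partial>lborel) has_sum integral {0..1} (\<lambda>x. \<Sum>\<^sub>\<infinity>i\<in>I. f i x)) I"
    using H(2) unfolding E2 .
  then show ?thesis by (rule has_sum_cong[THEN iffD1, rotated]) (rule E1)
qed

text \<open>The line is cut into the half-open unit intervals from n to n + 1, and each piece is
  translated to [0, 1]. At every point only one piece is nonzero, so the exchange with the integral
  is dominated by the norm of g.\<close>

lemma periodization_has_sum:
  fixes g :: "real \<Rightarrow> real"
  assumes g: "integrable lborel g" and cont: "continuous_on UNIV g"
  shows "((\<lambda>n::int. integral {0..1} (\<lambda>x. g (of_int n + x))) has_sum (\<integral>x. g x \<partial>lborel)) UNIV"
proof -
  define F where "F n x = indicator {real_of_int n..<real_of_int n + 1} x * g x" for n x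
  have Fi: "integrable lborel (F n)" for n
    unfolding F_def using integrable_mult_indicator[OF _ g, of "{real_of_int n..<real_of_int n + 1}"] by simp
  have Ffloor: "F n x = (if n = \<lfloor>x\<rfloor> then g x else 0)" for n x
  proof -
    have "n = \<lfloor>x\<rfloor> \<longleftrightarrow> real_of_int n \<le> x \<and> x < real_of_int n + 1" by linarith
    then show ?thesis by (simp add: F_def indicator_def)
  qed
  have sumF: "((\<lambda>n. F n x) has_sum g x) UNIV" for x
    unfolding Ffloor by (rule has_sum_finite_neutralI[of "{\<lfloor>x\<rfloor>}"]) auto
  have 1: "(\<lambda>n. norm (F n x)) summable_on UNIV" for x
    unfolding Ffloor by (rule finite_nonzero_values_imp_summable_on)
      (rule finite_subset[of _ "{\<lfloor>x\<rfloor>}"], auto)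
  have 2: "(\<lambda>n. \<integral>x. norm (F n x) \<partial>lborel) summable_on UNIV"
  proof (rule nonneg_bdd_above_summable_on)
    show "bdd_above (sum (\<lambda>n. \<integral>x. norm (F n x) \<partial>lborel) ` {X. X \<subseteq> UNIV \<and> finite X})"
    proof (rule bdd_aboveI2)
      fix X :: "int set" assume "X \<in> {X. X \<subseteq> UNIV \<and> finite X}"
      then have X: "finite X" by simp
      have "(\<Sum>n\<in>X. \<integral>x. norm (F n x) \<partial>lborel) = (\<integral>x. (\<Sum>n\<in>X. norm (F n x)) \<partial>lborel)"
        using Fi by (subst Bochner_Integration.integral_sum) auto
      also have "\<dots> \<le> (\<integral>x. norm (g x) \<partial>lborel)"
      proof (rule Bochner_Integration.integral_mono)
        show "integrable lborel (\<lambda>x. \<Sum>n\<in>X. norm (F n x))" using Fi by auto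
        show "integrable lborel (\<lambda>x. norm (g x))" using g by auto
        show "(\<Sum>n\<in>X. norm (F n x)) \<le> norm (g x)" for x
        proof -
          have "norm (F n x) = (if n = \<lfloor>x\<rfloor> then \<bar>g x\<bar> else 0)" for n by (simp add: Ffloor)
          then show ?thesis using X by simp
        qed
      qed
      finally show "(\<Sum>n\<in>X. \<integral>x. norm (F n x) \<partial>lborel) \<le> (\<integral>x. norm (g x) \<partial>lborel)" .
    qed
  qed simp
  have "((\<lambda>n. \<integral>x. F n x \<partial>lborel) has_sum (\<integral>x. (\<Sum>\<^sub>\<infinity>n\<in>UNIV. F n x) \<partial>lborel)) UNIV"
    by (rule has_sum_integral(2)[OF _ _ Fi 1 2]) (auto simp: infinite_UNIV_int)
  moreover have "(\<Sum>\<^sub>\<infinity>n\<in>UNIV. F n x) = g x" for x using sumF by (rule infsumI)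
  moreover have "(\<integral>x. F n x \<partial>lborel) = integral {0..1} (\<lambda>x. g (of_int n + x))" for n
  proof -
    have "(\<integral>x. F n x \<partial>lborel) = (\<integral>x. F n (of_int n + 1 * x) \<partial>lborel)"
      using lborel_integral_real_affine[of 1 "F n" "of_int n"] by simp
    also have "\<dots> = (\<integral>x. indicator {0..1} x *\<^sub>R g (of_int n + x) \<partial>lborel)"
    proof (rule integral_cong_AE)
      show "AE x in lborel. F n (of_int n + 1 * x) = indicator {0..1} x *\<^sub>R g (of_int n + x)"
        using AE_lborel_singleton[of 1] by eventually_elim (auto simp: F_def indicator_def)
      show "(\<lambda>x. F n (of_int n + 1 * x)) \<in> borel_measurable lborel"
        using lborel_integrable_real_affine[OF Fi, of 1] by auto
      have "continuous_on UNIV (\<lambda>x. g (of_int n + x))"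
        by (intro continuous_on_compose2[OF cont] continuous_intros) auto
      then have "(\<lambda>x. g (of_int n + x)) \<in> borel_measurable borel"
        by (rule borel_measurable_continuous_onI)
      then show "(\<lambda>x. indicator {0..1} x *\<^sub>R g (of_int n + x)) \<in> borel_measurable lborel"
        by simp
    qed
    also have "\<dots> = integral {0..1} (\<lambda>x. g (of_int n + x))"
    proof -
      have "continuous_on {0..1} (\<lambda>x. g (of_int n + x))"
        by (intro continuous_on_compose2[OF cont] continuous_intros) auto
      then have "set_integrable lborel {0..1} (\<lambda>x. g (of_int n + x))"
        unfolding set_integrable_def by (intro borel_integrable_compact) auto
      from set_borel_integral_eq_integral(2)[OF this] show ?thesis
        unfolding set_lebesgue_integral_def .
    qed
    finally show ?thesis .
  qed
  ultimately show ?thesis by simp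
qed

section \<open>Cosine coefficients of the two sides of the theta inversion formula\<close>

lemma integral_cos_int:
  "integral {0..1} (\<lambda>x. cos (2 * pi * of_int j * x)) = (if j = 0 then 1 else 0)"
proof (cases "j = 0")
  case False
  have "((\<lambda>x. cos (2 * pi * of_int j * x)) has_integral
      (sin (2 * pi * of_int j * 1) / (2 * pi * of_int j) - sin (2 * pi * of_int j * 0) / (2 * pi * of_int j))) {0..1}"
    by (rule fundamental_theorem_of_calculus)
      (use False in \<open>auto intro!: derivative_eq_intros simp flip: has_real_derivative_iff_has_vector_derivative\<close>)
  moreover have "sin (2 * pi * of_int j) = 0"
    by (metis sin_int_2pin)
  ultimately show ?thesis using False by (simp add: integral_unique)
qed simp

lemma integral_cos_cos_int:
  "integral {0..1} (\<lambda>x. cos (2 * pi * of_int n * x) * cos (2 * pi * of_int m * x)) =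
     (if n = m then 1 / 2 else 0) + (if n = - m then 1 / 2 else 0)"
proof -
  have int: "(\<lambda>x. cos (2 * pi * of_int j * x)) integrable_on {0..1}" for j
    by (intro integrable_continuous_real continuous_intros)
  have "cos (2 * pi * of_int n * x) * cos (2 * pi * of_int m * x) =
      cos (2 * pi * of_int (n - m) * x) / 2 + cos (2 * pi * of_int (n + m) * x) / 2" for x
  proof -
    have "2 * pi * of_int (n - m) * x = 2 * pi * of_int n * x - 2 * pi * of_int m * x"
      "2 * pi * of_int (n + m) * x = 2 * pi * of_int n * x + 2 * pi * of_int m * x"
      by (simp_all add: algebra_simps)
    then show ?thesis by (simp only: cos_add cos_diff) (simp add: field_simps)
  qed
  then have "integral {0..1} (\<lambda>x. cos (2 * pi * of_int n * x) * cos (2 * pi * of_int m * x)) =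
      integral {0..1} (\<lambda>x. cos (2 * pi * of_int (n - m) * x) / 2 + cos (2 * pi * of_int (n + m) * x) / 2)"
    by presburger
  also have "\<dots> = integral {0..1} (\<lambda>x. cos (2 * pi * of_int (n - m) * x)) / 2 +
      integral {0..1} (\<lambda>x. cos (2 * pi * of_int (n + m) * x)) / 2"
    by (subst Henstock_Kurzweil_Integration.integral_add) (use int in \<open>auto simp del: of_int_diff of_int_add\<close>)
  also have "\<dots> = (if n = m then 1 / 2 else 0) + (if n = - m then 1 / 2 else 0)"
    unfolding integral_cos_int by auto
  finally show ?thesis .
qed

text \<open>Only the frequencies m and -m survive and each contributes one half. For m = 0 they
  coincide and both halves come from the same term, so the formula is uniform in m.\<close>

lemma integral_jtheta_cos:
  assumes t: "t > 0"
  shows "integral {0..1} (\<lambda>x. Re (jtheta t (of_real x)) * cos (2 * pi * real m * x)) = exp (- pi * t * (real m)\<^sup>2)"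
proof -
  define f where "f n x = exp (- pi * t * (of_int n)\<^sup>2) * cos (2 * pi * of_int n * x) * cos (2 * pi * real m * x)"
    for n :: int and x
  have "((\<lambda>n. f n x) has_sum Re (jtheta t (of_real x)) * cos (2 * pi * real m * x)) UNIV" for x
    unfolding f_def by (intro has_sum_cmult_left jtheta_real_has_sum t)
  then have eq: "(\<Sum>\<^sub>\<infinity>n. f n x) = Re (jtheta t (of_real x)) * cos (2 * pi * real m * x)" for x
    by (rule infsumI)
  have "((\<lambda>n. integral {0..1} (f n)) has_sum integral {0..1} (\<lambda>x. \<Sum>\<^sub>\<infinity>n. f n x)) UNIV"
  proof (rule has_sum_integral_unit_interval)
    show "(\<lambda>n. exp (- pi * t * (real_of_int n)\<^sup>2)) summable_on UNIV"
      using summable_on_int_gauss[of "pi * t" 0] t by simp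
    show "\<bar>f n x\<bar> \<le> exp (- pi * t * (real_of_int n)\<^sup>2)" for n x
    proof -
      have "\<bar>cos (2 * pi * of_int n * x)\<bar> * \<bar>cos (2 * pi * real m * x)\<bar> \<le> 1 * 1"
        by (intro mult_mono) auto
      then show ?thesis unfolding f_def abs_mult by (simp add: mult.assoc)
    qed
    show "continuous_on {0..1} (f n)" for n unfolding f_def by (intro continuous_intros)
  qed (auto simp: infinite_UNIV_int)
  moreover have "((\<lambda>n. integral {0..1} (f n)) has_sum exp (- pi * t * (real m)\<^sup>2)) UNIV"
  proof -
    have "integral {0..1} (f n) = exp (- pi * t * (of_int n)\<^sup>2) *
        ((if n = int m then 1 / 2 else 0) + (if n = - int m then 1 / 2 else 0))" for n
      using integral_cos_cos_int[of n "int m"] unfolding f_def mult.assoc by simp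
    then have "integral {0..1} (f n) = (if n = int m then exp (- pi * t * (real m)\<^sup>2) / 2 else 0) +
        (if n = - int m then exp (- pi * t * (real m)\<^sup>2) / 2 else 0)" for n
      by (auto simp: algebra_simps)
    moreover have "((\<lambda>n. (if n = a then r else 0)) has_sum r) UNIV" for a :: int and r :: real
      by (rule has_sum_finite_neutralI[of "{a}"]) auto
    ultimately have "((\<lambda>n. integral {0..1} (f n)) has_sum
        (exp (- pi * t * (real m)\<^sup>2) / 2 + exp (- pi * t * (real m)\<^sup>2) / 2)) UNIV"
      by (simp only:) (intro has_sum_add)
    then show ?thesis by simp
  qed
  ultimately show ?thesis unfolding eq by (rule has_sum_unique)
qed

text \<open>Poisson summation: because the cosine has period 1, the coefficient of the periodized
  Gaussian over [0, 1] is the Fourier integral of the Gaussian over the line.\<close>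

lemma integral_jtheta_dual_cos:
  assumes t: "t > 0"
  shows "integral {0..1} (\<lambda>x. exp (- pi * x\<^sup>2 / t) * Re (jtheta (1 / t) (\<i> * of_real (x / t))) *
           cos (2 * pi * real m * x)) = sqrt t * exp (- pi * t * (real m)\<^sup>2)"
proof -
  define f where "f n x = exp (- pi * (of_int n + x)\<^sup>2 / t) * cos (2 * pi * real m * x)" for n :: int and x
  define g where "g x = exp (- pi * x\<^sup>2 / t) * cos (2 * pi * real m * x)" for x
  have "((\<lambda>n. f n x) has_sum exp (- pi * x\<^sup>2 / t) * Re (jtheta (1 / t) (\<i> * of_real (x / t))) *
           cos (2 * pi * real m * x)) UNIV" for x
    unfolding f_def by (intro has_sum_cmult_left jtheta_dual_has_sum t)
  then have eq: "(\<Sum>\<^sub>\<infinity>n. f n x) = exp (- pi * x\<^sup>2 / t) * Re (jtheta (1 / t) (\<i> * of_real (x / t))) *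
           cos (2 * pi * real m * x)" for x
    by (rule infsumI)
  have "((\<lambda>n. integral {0..1} (f n)) has_sum integral {0..1} (\<lambda>x. \<Sum>\<^sub>\<infinity>n. f n x)) UNIV"
  proof (rule has_sum_integral_unit_interval)
    show "(\<lambda>n. exp (- (pi / t) * (real_of_int n)\<^sup>2 + (2 * pi / t) * \<bar>real_of_int n\<bar>)) summable_on UNIV"
      by (rule summable_on_int_gauss) (use t in simp)
    show "\<bar>f n x\<bar> \<le> exp (- (pi / t) * (real_of_int n)\<^sup>2 + (2 * pi / t) * \<bar>real_of_int n\<bar>)"
      if x: "x \<in> {0..1}" for n x
    proof -
      have "\<bar>real_of_int n * x\<bar> \<le> \<bar>real_of_int n\<bar>"
        using x unfolding abs_mult by (simp add: mult_left_le)
      moreover have "0 \<le> x\<^sup>2" by simp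
      ultimately have "(real_of_int n)\<^sup>2 - 2 * \<bar>real_of_int n\<bar> \<le> (of_int n + x)\<^sup>2"
        unfolding power2_sum by linarith
      then have "(pi / t) * ((real_of_int n)\<^sup>2 - 2 * \<bar>real_of_int n\<bar>) \<le> (pi / t) * (of_int n + x)\<^sup>2"
        using t by (intro mult_left_mono) auto
      then have "- pi * (of_int n + x)\<^sup>2 / t \<le> - (pi / t) * (real_of_int n)\<^sup>2 + (2 * pi / t) * \<bar>real_of_int n\<bar>"
        by (simp add: algebra_simps)
      then have "exp (- pi * (of_int n + x)\<^sup>2 / t) * \<bar>cos (2 * pi * real m * x)\<bar> \<le>
          exp (- (pi / t) * (real_of_int n)\<^sup>2 + (2 * pi / t) * \<bar>real_of_int n\<bar>) * 1"
        by (intro mult_mono) auto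
      then show ?thesis unfolding f_def abs_mult by simp
    qed
    show "continuous_on {0..1} (f n)" for n unfolding f_def using t by (intro continuous_intros) auto
  qed (auto simp: infinite_UNIV_int)
  moreover have "((\<lambda>n. integral {0..1} (f n)) has_sum sqrt t * exp (- pi * t * (real m)\<^sup>2)) UNIV"
  proof -
    have "f n x = g (of_int n + x)" for n x
    proof -
      have "cos (2 * pi * real m * (of_int n + x)) = cos (2 * pi * real m * x)"
      proof -
        have "2 * pi * real m * (of_int n + x) = 2 * pi * real m * x + 2 * pi * of_int (int m * n)"
          by (simp add: algebra_simps)
        then show ?thesis unfolding cos_add by (metis (no_types, opaque_lifting) cos_int_2pin diff_zero mult.right_neutral mult_zero_right sin_int_2pin cos_add mult.commute)
      qed
      then show ?thesis by (simp add: f_def g_def)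
    qed
    then have "f n = (\<lambda>x. g (of_int n + x))" for n by blast
    moreover have "((\<lambda>n::int. integral {0..1} (\<lambda>x. g (of_int n + x))) has_sum (\<integral>x. g x \<partial>lborel)) UNIV"
      by (rule periodization_has_sum)
        (use t gauss_cos_integral(1)[OF t] in \<open>auto simp: g_def [abs_def] intro!: continuous_intros\<close>)
    ultimately show ?thesis using gauss_cos_integral(2)[OF t, of "real m"] by (simp add: g_def)
  qed
  ultimately show ?thesis unfolding eq by (rule has_sum_unique)
qed

lemma jtheta_add_1: "jtheta t (z + 1) = jtheta t z"
proof -
  have "exp (2 * pi * \<i> * of_int n * (z + 1)) = exp (2 * pi * \<i> * of_int n * z)" for n :: int
  proof -
    have "2 * pi * \<i> * of_int n * (z + 1) = 2 * pi * \<i> * of_int n * z + 2 * of_int n * pi * \<i>"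
      by (simp add: algebra_simps)
    then have "exp (2 * pi * \<i> * of_int n * (z + 1)) = exp (2 * pi * \<i> * of_int n * z) * exp (2 * of_int n * pi * \<i>)"
      by (simp only: exp_add)
    moreover have "exp (2 * of_int n * pi * \<i>) = cis (2 * pi * of_int n)"
      by (simp add: cis_conv_exp mult_ac)
    ultimately show ?thesis by (simp add: cis_multiple_2pi)
  qed
  then show ?thesis by (simp add: jtheta_def)
qed

text \<open>Both sides are continuous, even and 1-periodic and have the same cosine
  coefficients.\<close>

lemma jtheta_inversion_real:
  assumes t: "t > 0"
  shows "exp (- pi * x\<^sup>2 / t) * Re (jtheta (1 / t) (\<i> * of_real (x / t))) = sqrt t * Re (jtheta t (of_real x))"
proof -
  define E where "E x = exp (- pi * x\<^sup>2 / t) * Re (jtheta (1 / t) (\<i> * of_real (x / t)))" for x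
  have c: "continuous_on UNIV (jtheta s)" if "s > 0" for s
    using jtheta_holomorphic[OF that] holomorphic_on_imp_continuous_on by blast
  have contE: "continuous_on UNIV E"
    unfolding E_def by (intro continuous_intros continuous_on_compose2[OF c]) (use t in auto)
  have contT: "continuous_on UNIV (\<lambda>x. Re (jtheta t (of_real x)))"
    by (intro continuous_intros continuous_on_compose2[OF c]) (use t in auto)
  have perE: "E (x + 1) = E x" for x
  proof -
    have "((\<lambda>n::int. exp (- pi * (of_int (n + 1) + x)\<^sup>2 / t)) has_sum E x) UNIV"
      using jtheta_dual_has_sum[OF t, of x] unfolding E_def
      by (subst has_sum_reindex_bij_betw[where g = "\<lambda>n. n + 1" and f = "\<lambda>n. exp (- pi * (of_int n + x)\<^sup>2 / t)"])
        (auto intro: bij_betw_byWitness[of _ "\<lambda>n. n - 1"])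
    moreover have "((\<lambda>n::int. exp (- pi * (of_int (n + 1) + x)\<^sup>2 / t)) has_sum E (x + 1)) UNIV"
      using jtheta_dual_has_sum[OF t, of "x + 1"] unfolding E_def by (simp add: add_ac)
    ultimately show ?thesis by (metis has_sum_unique)
  qed
  have evE: "E (- x) = E x" for x
    using jtheta_minus[of "1 / t" "\<i> * of_real (x / t)"] by (simp add: E_def)
  have "E x - sqrt t * Re (jtheta t (of_real x)) = 0"
  proof (rule even_periodic_fourier_unique[where f = "\<lambda>x. E x - sqrt t * Re (jtheta t (of_real x))" and x = x])
    show "continuous_on UNIV (\<lambda>x. E x - sqrt t * Re (jtheta t (of_real x)))"
      by (intro continuous_intros contE contT)
    show "E (x + 1) - sqrt t * Re (jtheta t (of_real (x + 1))) = E x - sqrt t * Re (jtheta t (of_real x))" for x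
      using perE jtheta_add_1 by simp
    show "E (- x) - sqrt t * Re (jtheta t (of_real (- x))) = E x - sqrt t * Re (jtheta t (of_real x))" for x
      using evE jtheta_minus by simp
    fix m :: nat
    have i1: "(\<lambda>x. E x * cos (2 * pi * real m * x)) integrable_on {0..1}"
      by (intro integrable_continuous_real continuous_intros continuous_on_subset[OF contE]) auto
    have i2: "(\<lambda>x. Re (jtheta t (of_real x)) * cos (2 * pi * real m * x)) integrable_on {0..1}"
      by (intro integrable_continuous_real continuous_on_mult continuous_on_subset[OF contT] continuous_intros) auto
    have "integral {0..1} (\<lambda>x. (E x - sqrt t * Re (jtheta t (of_real x))) * cos (2 * pi * real m * x)) =
        integral {0..1} (\<lambda>x. E x * cos (2 * pi * real m * x) - sqrt t * (Re (jtheta t (of_real x)) * cos (2 * pi * real m * x)))"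
      by (simp add: algebra_simps)
    also have "\<dots> = integral {0..1} (\<lambda>x. E x * cos (2 * pi * real m * x)) -
        sqrt t * integral {0..1} (\<lambda>x. Re (jtheta t (of_real x)) * cos (2 * pi * real m * x))"
      by (subst Henstock_Kurzweil_Integration.integral_diff) (use i1 i2 in \<open>auto intro: integrable_on_mult_right\<close>)
    also have "\<dots> = 0" using integral_jtheta_cos[OF t, of m] integral_jtheta_dual_cos[OF t, of m]
      unfolding E_def by simp
    finally show "integral {0..1} (\<lambda>x. (E x - sqrt t * Re (jtheta t (of_real x))) * cos (2 * pi * real m * x)) = 0" .
  qed
  then show ?thesis by (simp add: E_def)
qed

lemma jtheta_cnj: "jtheta t (cnj z) = cnj (jtheta t z)"
proof -
  have "cnj (jtheta t z) = (\<Sum>\<^sub>\<infinity>n::int. exp (- of_real (pi * t * (of_int n)\<^sup>2)) * exp (2 * pi * \<i> * of_int n * (- cnj z)))"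
    unfolding jtheta_def infsum_cnj[symmetric] by (simp add: exp_cnj)
  also have "\<dots> = jtheta t (- cnj z)" by (simp add: jtheta_def)
  finally show ?thesis by (simp add: jtheta_minus)
qed

lemma jtheta_real_in_Reals: "jtheta t (of_real x) \<in> \<real>"
  using jtheta_cnj[of t "of_real x"] by (simp add: Reals_cnj_iff)

lemma jtheta_imag_in_Reals: "jtheta t (\<i> * of_real x) \<in> \<real>"
  using jtheta_cnj[of t "\<i> * of_real x"] jtheta_minus[of t "\<i> * of_real x"] by (simp add: Reals_cnj_iff)

text \<open>Both sides are entire. On the real axis the theta values involved are real, so the
  identity of real parts is the full identity there, and the identity theorem extends it to all
  z.\<close>

theorem jtheta_inversion:
  assumes t: "t > 0"
  shows "exp (- of_real (pi / t) * z\<^sup>2) * jtheta (1 / t) (\<i> * z / of_real t) = of_real (sqrt t) * jtheta t z"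
proof -
  define F where "F z = exp (- of_real (pi / t) * z\<^sup>2) * jtheta (1 / t) (\<i> * z / of_real t) -
      of_real (sqrt t) * jtheta t z" for z
  have hol: "(\<lambda>z. jtheta s (f z)) holomorphic_on UNIV" if "f holomorphic_on UNIV" "s > 0" for f s
    using holomorphic_on_compose_gen[OF that(1) jtheta_holomorphic[OF that(2)]] by (simp add: o_def)
  have "F holomorphic_on UNIV"
    unfolding F_def by (intro holomorphic_intros hol) (use t in auto)
  moreover have "F z = 0" if "z \<in> \<real>" for z
  proof -
    obtain x where x: "z = of_real x" using \<open>z \<in> \<real>\<close> by (rule Reals_cases)
    have "exp (- of_real (pi / t) * z\<^sup>2) = complex_of_real (exp (- pi * x\<^sup>2 / t))"
      by (simp add: x flip: exp_of_real)
    moreover have "jtheta (1 / t) (\<i> * z / of_real t) = of_real (Re (jtheta (1 / t) (\<i> * of_real (x / t))))"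
      using of_real_Re[OF jtheta_imag_in_Reals[of "1 / t" "x / t"]] by (simp add: x)
    moreover have "jtheta t z = of_real (Re (jtheta t (of_real x)))"
      using of_real_Re[OF jtheta_real_in_Reals[of t x]] by (simp add: x)
    ultimately show ?thesis
      unfolding F_def using jtheta_inversion_real[OF t, of x] by (metis diff_self of_real_mult)
  qed
  moreover have "(0 :: complex) islimpt \<real>"
  proof (rule islimpt_approachable[THEN iffD2], intro allI impI)
    fix e :: real assume "e > 0"
    then show "\<exists>x'\<in>\<real>. x' \<noteq> 0 \<and> dist x' (0 :: complex) < e"
      by (intro bexI[of _ "of_real (e / 2)"]) auto
  qed
  ultimately have "F z = 0"
    by (intro analytic_continuation[of F UNIV \<real> 0 z]) auto
  then show ?thesis by (simp add: F_def)
qed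

section \<open>The completed L-function\<close>

lemma nonneg_term_le_sums:
  fixes f :: "nat \<Rightarrow> real"
  assumes "f sums s" "\<And>n. f n \<ge> 0"
  shows "f j \<le> s"
  using sum_le_suminf[of f "{j}"] assms by (auto simp: sums_iff)

section \<open>Summation over the Gaussian lattice and its theta series\<close>

lemma bij_betw_Gint: "bij_betw (\<lambda>(a, b). Gint a b) (UNIV \<times> UNIV) UNIV"
  by (rule bij_betw_byWitness[of _ "\<lambda>x. (gre x, gim x)"]) auto

lemma has_sum_gint_iff:
  "((\<lambda>p. f (case p of (a, b) \<Rightarrow> Gint a b)) has_sum S) (UNIV \<times> UNIV) \<longleftrightarrow> (f has_sum S) UNIV"
  by (rule has_sum_reindex_bij_betw[OF bij_betw_Gint])

lemma summable_on_gint_iff: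
  "(\<lambda>p. f (case p of (a, b) \<Rightarrow> Gint a b)) summable_on (UNIV \<times> UNIV) \<longleftrightarrow> f summable_on UNIV"
  by (rule summable_on_reindex_bij_betw[OF bij_betw_Gint])

lemma countable_gint: "countable (A :: gint set)"
proof -
  have "countable (UNIV :: gint set)"
  proof -
    have "(UNIV :: gint set) = (\<lambda>(a, b). Gint a b) ` (UNIV \<times> UNIV)"
      using bij_betw_Gint by (simp only: bij_betw_def)
    then show ?thesis by (metis countable_image countableI_type)
  qed
  then show ?thesis by (rule countable_subset[rotated]) simp
qed

lemma infinite_gint: "infinite (UNIV :: gint set)"
proof
  assume "finite (UNIV :: gint set)"
  then have "finite (range (\<lambda>n::int. Gint n 0))" by (rule finite_subset[rotated]) simp
  then have "finite (UNIV :: int set)" by (rule finite_imageD) (auto intro: injI)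
  then show False by (simp add: infinite_UNIV_int)
qed

lemma real_gnorm: "real (gnorm x) = (of_int (gre x))\<^sup>2 + (of_int (gim x))\<^sup>2"
  by (simp add: of_nat_gnorm cmod_power2)

lemma summable_on_gint_gauss:
  assumes "t > 0"
  shows "(\<lambda>x. exp (- t * real (gnorm x) + R * cmod (of_gint x))) summable_on UNIV"
proof (rule summable_on_comparison_test)
  define g where "g n = exp (- t * (real_of_int n)\<^sup>2 + \<bar>R\<bar> * \<bar>real_of_int n\<bar>)" for n :: int
  have g: "g summable_on UNIV" unfolding g_def by (rule summable_on_int_gauss[OF assms])
  have "(\<lambda>(a, b). g a * g b) summable_on (UNIV \<times> UNIV)"
  proof (rule summable_on_SigmaI)
    show "((\<lambda>b. (\<lambda>(a, b). g a * g b) (a, b)) has_sum g a * infsum g UNIV) UNIV" for a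
      using g by (auto intro: has_sum_cmult_right)
    show "(\<lambda>a. g a * infsum g UNIV) summable_on UNIV" by (intro summable_on_cmult_left g)
  qed (auto simp: g_def)
  moreover have "(\<lambda>(a, b). g a * g b) =
      (\<lambda>p. (\<lambda>x. g (gre x) * g (gim x)) (case p of (a, b) \<Rightarrow> Gint a b))" by auto
  ultimately show "(\<lambda>x. g (gre x) * g (gim x)) summable_on UNIV"
    using summable_on_gint_iff[of "\<lambda>x. g (gre x) * g (gim x)"] by argo
  fix x :: gint
  have "R * cmod (of_gint x) \<le> \<bar>R\<bar> * cmod (of_gint x)" by (intro mult_right_mono) auto
  also have "\<dots> \<le> \<bar>R\<bar> * (\<bar>of_int (gre x)\<bar> + \<bar>of_int (gim x)\<bar>)"
    using cmod_le[of "of_gint x"] by (intro mult_left_mono) auto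
  finally have "- t * real (gnorm x) + R * cmod (of_gint x) \<le>
      (- t * (of_int (gre x))\<^sup>2 + \<bar>R\<bar> * \<bar>of_int (gre x)\<bar>) + (- t * (of_int (gim x))\<^sup>2 + \<bar>R\<bar> * \<bar>of_int (gim x)\<bar>)"
    by (simp add: real_gnorm algebra_simps)
  then show "exp (- t * real (gnorm x) + R * cmod (of_gint x)) \<le> g (gre x) * g (gim x)"
    by (simp add: g_def flip: exp_add)
qed auto

text \<open>Hecke's theta series with the harmonic polynomial z^j; for j = 4k its Mellin transform
  is the completed L-function. The point x = 0 contributes only for j = 0.\<close>

definition gtheta :: "nat \<Rightarrow> real \<Rightarrow> complex" where
  "gtheta j t = (\<Sum>\<^sub>\<infinity>x. of_real (exp (- (pi * t * real (gnorm x)))) * of_gint x ^ j)"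

lemma gint_exp_summable:
  assumes "t > 0"
  shows "(\<lambda>x. norm (complex_of_real (exp (- (pi * t * real (gnorm x))))) *
           exp (norm (2 * pi * \<i> * of_gint x) * R)) summable_on UNIV"
proof -
  have "(\<lambda>x. exp (- (pi * t) * real (gnorm x) + (2 * pi * R) * cmod (of_gint x))) summable_on UNIV"
    by (rule summable_on_gint_gauss) (use assms in auto)
  then show ?thesis
    by (rule summable_on_cong[THEN iffD1, rotated]) (simp add: norm_mult exp_add[symmetric] mult_ac)
qed

text \<open>For x = a + b i the norm is a^2 + b^2 and i x w = i a w + i b (i w), so the lattice sum
  splits into one sum over a at w and one over b at i w.\<close>

lemma gint_theta_factor:
  assumes t: "t > 0"
  shows "(\<Sum>\<^sub>\<infinity>x. of_real (exp (- (pi * t * real (gnorm x)))) * exp (2 * pi * \<i> * of_gint x * w)) =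
           jtheta t w * jtheta t (\<i> * w)"
proof -
  define f where "f x = of_real (exp (- (pi * t * real (gnorm x)))) * exp (2 * pi * \<i> * of_gint x * w)" for x
  define g where "g z n = exp (- of_real (pi * t * (of_int n)\<^sup>2)) * exp (2 * pi * \<i> * of_int n * z)"
    for z :: complex and n :: int
  have g: "(g z has_sum jtheta t z) UNIV" for z unfolding g_def by (rule jtheta_has_sum[OF t])
  have f: "f (Gint a b) = g w a * g (\<i> * w) b" for a b
  proof -
    have "of_gint (Gint a b) = of_int a + \<i> * of_int b" by (simp add: complex_eq_iff)
    then have "2 * pi * \<i> * of_gint (Gint a b) * w = 2 * pi * \<i> * of_int a * w + 2 * pi * \<i> * of_int b * (\<i> * w)"
      by (simp add: algebra_simps)
    moreover have "complex_of_real (exp (- (pi * t * real (gnorm (Gint a b))))) =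
        exp (- of_real (pi * t * (of_int a)\<^sup>2)) * exp (- of_real (pi * t * (of_int b)\<^sup>2))"
      by (simp add: real_gnorm exp_add[symmetric] algebra_simps flip: exp_of_real)
    ultimately show ?thesis by (simp add: f_def g_def exp_add)
  qed
  have "f summable_on UNIV"
    unfolding f_def by (rule exp_sum_sums(2)[OF gint_exp_summable[OF t]])
  then have s: "(\<lambda>p. f (case p of (a, b) \<Rightarrow> Gint a b)) summable_on (UNIV \<times> UNIV)"
    by (simp only: summable_on_gint_iff)
  have "((\<lambda>p. f (case p of (a, b) \<Rightarrow> Gint a b)) has_sum jtheta t w * jtheta t (\<i> * w)) (UNIV \<times> UNIV)"
  proof (rule has_sum_SigmaI[OF _ _ s])
    show "((\<lambda>b. f (case (a, b) of (a, b) \<Rightarrow> Gint a b)) has_sum g w a * jtheta t (\<i> * w)) UNIV" for a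
      using has_sum_cmult_right[OF g[of "\<i> * w"], of "g w a"] by (simp add: f)
    show "((\<lambda>a. g w a * jtheta t (\<i> * w)) has_sum jtheta t w * jtheta t (\<i> * w)) UNIV"
      by (intro has_sum_cmult_left g)
  qed
  then have "(f has_sum jtheta t w * jtheta t (\<i> * w)) UNIV" by (simp only: has_sum_gint_iff)
  then show ?thesis unfolding f_def by (rule infsumI)
qed

text \<open>In the product \<open>jtheta t w * jtheta t (i w)\<close> the Gaussian factors of the two inversion
  formulas cancel, and comparing Taylor coefficients at \<open>w = 0\<close> yields the inversion formula for the
  theta series with harmonic coefficients.\<close>

lemma gtheta_inversion:
  assumes t: "t > 0"
  shows "gtheta j t = (- 1) ^ j * of_real (1 / t ^ Suc j) * gtheta j (1 / t)"
proof -
  define P where "P t w = (\<Sum>\<^sub>\<infinity>x. of_real (exp (- (pi * t * real (gnorm x)))) * exp (2 * pi * \<i> * of_gint x * w))"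
    for t w
  have P_inv: "P t w = of_real (1 / t) * P (1 / t) (- w / of_real t)" for w
  proof -
    have J: "jtheta t z = of_real (1 / sqrt t) * exp (- of_real (pi / t) * z\<^sup>2) * jtheta (1 / t) (\<i> * z / of_real t)" for z
    proof -
      have "of_real (1 / sqrt t) * (of_real (sqrt t) * jtheta t z) = jtheta t z" using t by simp
      then show ?thesis unfolding jtheta_inversion[OF t, symmetric] by (simp add: mult_ac)
    qed
    have "P t w = jtheta t w * jtheta t (\<i> * w)" unfolding P_def by (rule gint_theta_factor[OF t])
    also have "\<dots> = of_real (1 / sqrt t * (1 / sqrt t)) *
        (exp (- of_real (pi / t) * w\<^sup>2) * exp (- of_real (pi / t) * (\<i> * w)\<^sup>2)) *
        (jtheta (1 / t) (\<i> * w / of_real t) * jtheta (1 / t) (\<i> * (\<i> * w) / of_real t))"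
      by (subst (1 2) J) (simp only: of_real_mult mult_ac)
    also have "1 / sqrt t * (1 / sqrt t) = 1 / t" using t by simp
    also have "exp (- of_real (pi / t) * w\<^sup>2) * exp (- of_real (pi / t) * (\<i> * w)\<^sup>2) = 1"
      by (simp add: exp_add[symmetric] power_mult_distrib)
    also have "\<i> * (\<i> * w) / of_real t = - w / of_real t" by (simp add: mult.assoc[symmetric])
    also have "jtheta (1 / t) (\<i> * w / of_real t) = jtheta (1 / t) (\<i> * (- w / of_real t))"
      using jtheta_minus[of "1 / t" "\<i> * w / of_real t"] by simp
    also have "of_real (1 / t) * 1 * (jtheta (1 / t) (\<i> * (- w / of_real t)) * jtheta (1 / t) (- w / of_real t)) =
        of_real (1 / t) * P (1 / t) (- w / of_real t)"
      unfolding P_def using gint_theta_factor[of "1 / t" "- w / of_real t"] t by (simp add: mult_ac)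
    finally show ?thesis .
  qed
  define a where "a j t = (\<Sum>\<^sub>\<infinity>x. of_real (exp (- (pi * t * real (gnorm x)))) * (2 * pi * \<i> * of_gint x) ^ j) / fact j"
    for j t
  have a: "a j t = (2 * pi * \<i>) ^ j / fact j * gtheta j t" for j t
  proof -
    have "(\<Sum>\<^sub>\<infinity>x. complex_of_real (exp (- (pi * t * real (gnorm x)))) * (2 * pi * \<i> * of_gint x) ^ j) =
        (\<Sum>\<^sub>\<infinity>x. (2 * pi * \<i>) ^ j * (complex_of_real (exp (- (pi * t * real (gnorm x)))) * of_gint x ^ j))"
      by (intro infsum_cong) (simp add: power_mult_distrib mult_ac)
    also have "\<dots> = (2 * pi * \<i>) ^ j * gtheta j t"
      unfolding gtheta_def by (rule infsum_cmult_right')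
    finally show ?thesis by (simp add: a_def)
  qed
  have sums: "(\<lambda>j. a j t * w ^ j) sums P t w" if "t > 0" for t w
    unfolding a_def P_def by (rule exp_sum_sums(1)[OF gint_exp_summable[OF that]])
  have "(P t) has_fps_expansion Abs_fps (\<lambda>j. a j t)"
    by (rule has_fps_expansionI) (simp add: sums[OF t])
  moreover have "(P t) has_fps_expansion Abs_fps (\<lambda>j. of_real (1 / t) * a j (1 / t) * (- 1 / of_real t) ^ j)"
  proof (rule has_fps_expansionI, rule always_eventually, rule allI)
    fix u
    have "(\<lambda>j. of_real (1 / t) * (a j (1 / t) * (- u / of_real t) ^ j)) sums (of_real (1 / t) * P (1 / t) (- u / of_real t))"
      by (intro sums_mult sums) (use t in simp)
    moreover have "of_real (1 / t) * (a j (1 / t) * (- u / of_real t) ^ j) =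
        of_real (1 / t) * a j (1 / t) * (- 1 / of_real t) ^ j * u ^ j" for j
    proof -
      have "- u / of_real t = (- 1 / of_real t) * u" by simp
      then show ?thesis by (simp only: power_mult_distrib mult.assoc)
    qed
    ultimately show "(\<lambda>j. fps_nth (Abs_fps (\<lambda>j. of_real (1 / t) * a j (1 / t) * (- 1 / of_real t) ^ j)) j * u ^ j) sums P t u"
      by (simp only: P_inv fps_nth_Abs_fps)
  qed
  ultimately have "Abs_fps (\<lambda>j. a j t) = Abs_fps (\<lambda>j. of_real (1 / t) * a j (1 / t) * (- 1 / of_real t) ^ j)"
    by (rule fps_expansion_unique_complex)
  then have "a j t = of_real (1 / t) * a j (1 / t) * (- 1 / of_real t) ^ j"
    by (metis fps_nth_Abs_fps)
  then have "(2 * pi * \<i>) ^ j / fact j * gtheta j t =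
      (2 * pi * \<i>) ^ j / fact j * (of_real (1 / t) * gtheta j (1 / t) * (- 1 / of_real t) ^ j)"
    unfolding a by (simp add: mult_ac)
  then have "gtheta j t = of_real (1 / t) * gtheta j (1 / t) * (- 1 / of_real t) ^ j"
    by (subst (asm) mult_left_cancel) auto
  also have "(- 1 / complex_of_real t) ^ j = (- 1) ^ j / of_real (t ^ j)"
    by (simp only: power_divide of_real_power)
  finally show ?thesis by (simp add: field_simps)
qed

lemma gint_power_exp_summable:
  assumes "t > 0"
  shows "(\<lambda>x. exp (- (t * real (gnorm x))) * cmod (of_gint x) ^ j) summable_on UNIV"
proof (rule summable_on_comparison_test)
  show "(\<lambda>x. fact j * exp (- t * real (gnorm x) + 1 * cmod (of_gint x))) summable_on UNIV"
    by (intro summable_on_cmult_right summable_on_gint_gauss assms)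
  fix x :: gint
  have "cmod (of_gint x) ^ j / fact j \<le> exp (cmod (of_gint x))"
  proof -
    have "(\<lambda>n. cmod (of_gint x) ^ n /\<^sub>R fact n) sums exp (cmod (of_gint x))" by (rule exp_converges)
    then have "cmod (of_gint x) ^ j /\<^sub>R fact j \<le> exp (cmod (of_gint x))"
      by (rule nonneg_term_le_sums) auto
    then show ?thesis by (simp add: divide_inverse mult.commute)
  qed
  then have "cmod (of_gint x) ^ j \<le> fact j * exp (cmod (of_gint x))" by (simp add: field_simps)
  then have "exp (- (t * real (gnorm x))) * cmod (of_gint x) ^ j \<le>
      exp (- (t * real (gnorm x))) * (fact j * exp (cmod (of_gint x)))" by (intro mult_left_mono) auto
  then show "exp (- (t * real (gnorm x))) * cmod (of_gint x) ^ j \<le>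
      fact j * exp (- t * real (gnorm x) + 1 * cmod (of_gint x))"
    unfolding exp_add by (simp add: mult_ac)
qed auto

text \<open>For j > 0 the origin drops out, and every other point has norm at least 1, so exp (1 -
  t) can be pulled out of each term relative to t = 1. Values t < 1 are reached through the
  inversion formula.\<close>

lemma gtheta_bound:
  assumes "j > 0"
  obtains C where "C \<ge> 0" "\<And>t. t \<ge> 1 \<Longrightarrow> cmod (gtheta j t) \<le> C * exp (1 - t)"
proof
  define C where "C = (\<Sum>\<^sub>\<infinity>x. exp (- (pi * real (gnorm x))) * cmod (of_gint x) ^ j)"
  show "C \<ge> 0" unfolding C_def by (intro infsum_nonneg) auto
  fix t :: real assume t: "t \<ge> 1"
  have s1: "((\<lambda>x. exp (1 - t) * (exp (- (pi * real (gnorm x))) * cmod (of_gint x) ^ j)) has_sum exp (1 - t) * C) UNIV"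
    unfolding C_def by (intro has_sum_cmult_right has_sum_infsum gint_power_exp_summable) auto
  have le: "cmod (of_real (exp (- (pi * t * real (gnorm x)))) * of_gint x ^ j) \<le>
      exp (1 - t) * (exp (- (pi * real (gnorm x))) * cmod (of_gint x) ^ j)" for x
  proof (cases "x = 0")
    case False
    then have "real (gnorm x) \<ge> 1" using gnorm_pos_iff[of x] by simp
    then have "1 * (t - 1) \<le> (pi * real (gnorm x)) * (t - 1)"
      using t pi_ge_two mult_mono[of 1 pi 1 "real (gnorm x)"] by (intro mult_right_mono) auto
    then have "- (pi * t * real (gnorm x)) \<le> (1 - t) + - (pi * real (gnorm x))" by (simp add: algebra_simps)
    then have "exp (- (pi * t * real (gnorm x))) \<le> exp (1 - t) * exp (- (pi * real (gnorm x)))"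
      by (simp flip: exp_add)
    then have "exp (- (pi * t * real (gnorm x))) * cmod (of_gint x) ^ j \<le>
        exp (1 - t) * exp (- (pi * real (gnorm x))) * cmod (of_gint x) ^ j"
      by (intro mult_right_mono) auto
    then show ?thesis by (simp add: norm_mult norm_power mult.assoc)
  qed (use assms in \<open>simp add: power_0_left\<close>)
  have "(\<lambda>x. norm (of_real (exp (- (pi * t * real (gnorm x)))) * of_gint x ^ j)) summable_on UNIV"
    by (rule summable_on_comparison_test[OF has_sum_imp_summable[OF s1]]) (use le in auto)
  then have "(\<lambda>x. of_real (exp (- (pi * t * real (gnorm x)))) * of_gint x ^ j) summable_on UNIV"
    by (rule abs_summable_summable)
  from norm_infsum_le[OF has_sum_infsum[OF this] s1 le]
  show "cmod (gtheta j t) \<le> C * exp (1 - t)" by (simp add: gtheta_def mult.commute)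
qed

lemma gtheta_cnj: "cnj (gtheta j t) = gtheta j t"
proof -
  have "bij (\<lambda>x. Gint (gre x) (- gim x))"
    by (rule bij_betw_byWitness[of _ "\<lambda>x. Gint (gre x) (- gim x)"]) auto
  then have "gtheta j t = (\<Sum>\<^sub>\<infinity>x. of_real (exp (- (pi * t * real (gnorm (Gint (gre x) (- gim x)))))) *
      of_gint (Gint (gre x) (- gim x)) ^ j)"
    unfolding gtheta_def by (subst infsum_reindex_bij_betw[symmetric, of "\<lambda>x. Gint (gre x) (- gim x)" UNIV UNIV]) auto
  moreover have "of_gint (Gint (gre x) (- gim x)) = cnj (of_gint x)" for x by (simp add: complex_eq_iff)
  moreover have "gnorm (Gint (gre x) (- gim x)) = gnorm x" for x by (simp add: gnorm_def)
  ultimately show ?thesis unfolding gtheta_def infsum_cnj[symmetric] by simp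
qed

section \<open>Laplace transforms of kernels with Gaussian decay\<close>

lemma integrable_exp_gauss: "integrable lborel (\<lambda>x. exp (B * \<bar>x\<bar> - x\<^sup>2 / 2) :: real)"
proof (rule Bochner_Integration.integrable_bound)
  have *: "integrable lborel (\<lambda>x. exp (B * x - x\<^sup>2 / 2) :: real)" for B
  proof -
    have "integrable lborel (\<lambda>x. (sqrt (2 * pi) * exp (B\<^sup>2 / 2)) * normal_density B 1 x)"
      by (intro integrable_mult_right integrable_normal_density) simp
    moreover have "(sqrt (2 * pi) * exp (B\<^sup>2 / 2)) * normal_density B 1 x = exp (B * x - x\<^sup>2 / 2)" for x
      by (simp add: normal_density_def exp_add[symmetric] power2_diff field_simps)
    ultimately show ?thesis by simp
  qed
  show "integrable lborel (\<lambda>x. exp (B * x - x\<^sup>2 / 2) + exp (- B * x - x\<^sup>2 / 2) :: real)"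
    by (intro Bochner_Integration.integrable_add *)
  show "AE x in lborel. norm (exp (B * \<bar>x\<bar> - x\<^sup>2 / 2)) \<le> norm (exp (B * x - x\<^sup>2 / 2) + exp (- B * x - x\<^sup>2 / 2) :: real)"
  proof (rule AE_I2)
    fix x :: real
    show "norm (exp (B * \<bar>x\<bar> - x\<^sup>2 / 2)) \<le> norm (exp (B * x - x\<^sup>2 / 2) + exp (- B * x - x\<^sup>2 / 2))"
      by (cases "x \<ge> 0") (auto simp: abs_of_nonneg add_nonneg_nonneg)
  qed
qed auto

text \<open>The kernel of interest decays doubly exponentially. A Gaussian majorant already makes
  the two-sided Laplace transform entire and bounded on vertical strips.\<close>

context
  fixes \<Phi> :: "real \<Rightarrow> complex" and A C :: real
  assumes meas: "\<Phi> \<in> borel_measurable borel"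
    and bound: "\<And>x. norm (\<Phi> x) \<le> C * exp (A * \<bar>x\<bar> - x\<^sup>2 / 2)"
begin

lemma laplace_norm_integrable: "integrable lborel (\<lambda>x. norm (\<Phi> x) * exp (R * \<bar>x\<bar>))"
proof (rule Bochner_Integration.integrable_bound)
  show "integrable lborel (\<lambda>x. C * exp ((A + R) * \<bar>x\<bar> - x\<^sup>2 / 2))"
    by (intro integrable_mult_right integrable_exp_gauss)
  show "AE x in lborel. norm (norm (\<Phi> x) * exp (R * \<bar>x\<bar>)) \<le> norm (C * exp ((A + R) * \<bar>x\<bar> - x\<^sup>2 / 2))"
  proof (rule AE_I2)
    fix x :: real
    have "norm (\<Phi> x) * exp (R * \<bar>x\<bar>) \<le> C * exp (A * \<bar>x\<bar> - x\<^sup>2 / 2) * exp (R * \<bar>x\<bar>)"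
      by (intro mult_right_mono bound) auto
    also have "\<dots> = C * exp ((A + R) * \<bar>x\<bar> - x\<^sup>2 / 2)"
      by (simp add: mult.assoc exp_add[symmetric] algebra_simps)
    finally show "norm (norm (\<Phi> x) * exp (R * \<bar>x\<bar>)) \<le> norm (C * exp ((A + R) * \<bar>x\<bar> - x\<^sup>2 / 2))" by simp
  qed
qed (use meas in measurable)

lemma laplace_integrable: "integrable lborel (\<lambda>x. \<Phi> x * exp (w * of_real x))"
proof (rule Bochner_Integration.integrable_bound[OF laplace_norm_integrable[of "norm w"]])
  show "AE x in lborel. norm (\<Phi> x * exp (w * of_real x)) \<le> norm (norm (\<Phi> x) * exp (norm w * \<bar>x\<bar>))"
  proof (rule AE_I2)
    fix x :: real
    have "norm (exp (w * of_real x)) \<le> exp (norm (w * of_real x))" by (rule norm_exp)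
    then show "norm (\<Phi> x * exp (w * of_real x)) \<le> norm (norm (\<Phi> x) * exp (norm w * \<bar>x\<bar>))"
      by (simp add: norm_mult mult_left_mono)
  qed
qed (use meas in measurable)

lemma laplace_bound:
  assumes "\<bar>Re w\<bar> \<le> R"
  shows "norm (\<integral>x. \<Phi> x * exp (w * of_real x) \<partial>lborel) \<le> (\<integral>x. norm (\<Phi> x) * exp (R * \<bar>x\<bar>) \<partial>lborel)"
proof -
  have "norm (\<integral>x. \<Phi> x * exp (w * of_real x) \<partial>lborel) \<le> (\<integral>x. norm (\<Phi> x * exp (w * of_real x)) \<partial>lborel)"
    by (rule integral_norm_bound)
  also have "\<dots> \<le> (\<integral>x. norm (\<Phi> x) * exp (R * \<bar>x\<bar>) \<partial>lborel)"
  proof (rule Bochner_Integration.integral_mono)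
    show "integrable lborel (\<lambda>x. norm (\<Phi> x * exp (w * of_real x)))" by (intro integrable_norm laplace_integrable)
    fix x :: real
    have "Re w * x \<le> \<bar>Re w\<bar> * \<bar>x\<bar>" by (metis abs_ge_self abs_mult)
    also have "\<dots> \<le> R * \<bar>x\<bar>" using assms by (intro mult_right_mono) auto
    finally show "norm (\<Phi> x * exp (w * of_real x)) \<le> norm (\<Phi> x) * exp (R * \<bar>x\<bar>)"
      by (simp add: norm_mult mult_left_mono)
  qed (rule laplace_norm_integrable)
  finally show ?thesis .
qed

text \<open>The exponential is expanded and integrated term by term; the partial sums of norms are
  dominated by \<open>laplace_norm_integrable\<close>, and the result is an everywhere convergent
  power series in w.\<close>

lemma laplace_holomorphic: "(\<lambda>w. \<integral>x. \<Phi> x * exp (w * of_real x) \<partial>lborel) holomorphic_on UNIV"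
proof -
  define a where "a j = (\<integral>x. \<Phi> x * (of_real x ^ j /\<^sub>R fact j) \<partial>lborel)" for j
  have sums: "(\<lambda>j. a j * w ^ j) sums (\<integral>x. \<Phi> x * exp (w * of_real x) \<partial>lborel)" for w
  proof -
    define f where "f j x = \<Phi> x * ((w * of_real x) ^ j /\<^sub>R fact j)" for j x
    have nf: "norm (f j x) = norm (\<Phi> x) * ((norm w * \<bar>x\<bar>) ^ j /\<^sub>R fact j)" for j x
      by (simp add: f_def norm_mult norm_power)
    have fs: "(\<lambda>j. norm (\<Phi> x) * ((norm w * \<bar>x\<bar>) ^ j /\<^sub>R fact j)) sums (norm (\<Phi> x) * exp (norm w * \<bar>x\<bar>))" for x
      by (intro sums_mult exp_converges)
    have mf: "f j \<in> borel_measurable borel" for j unfolding f_def using meas by measurable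
    have fi: "integrable lborel (f j)" for j
    proof (rule Bochner_Integration.integrable_bound[OF laplace_norm_integrable[of "norm w"]])
      show "AE x in lborel. norm (f j x) \<le> norm (norm (\<Phi> x) * exp (norm w * \<bar>x\<bar>))"
      proof (rule AE_I2)
        fix x
        have "norm (f j x) \<le> norm (\<Phi> x) * exp (norm w * \<bar>x\<bar>)"
          unfolding nf by (rule nonneg_term_le_sums[OF fs]) auto
        then show "norm (f j x) \<le> norm (norm (\<Phi> x) * exp (norm w * \<bar>x\<bar>))" by simp
      qed
    qed (use mf in simp)
    have "(\<lambda>j. \<integral>x. f j x \<partial>lborel) sums (\<integral>x. (\<Sum>j. f j x) \<partial>lborel)"
    proof (rule sums_integral[OF fi])
      show "AE x in lborel. summable (\<lambda>j. norm (f j x))"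
        unfolding nf by (rule AE_I2) (rule sums_summable[OF fs])
      show "summable (\<lambda>j. \<integral>x. norm (f j x) \<partial>lborel)"
      proof (rule summableI_nonneg_bounded)
        fix n
        have "(\<Sum>j<n. \<integral>x. norm (f j x) \<partial>lborel) = (\<integral>x. (\<Sum>j<n. norm (f j x)) \<partial>lborel)"
          using fi by (subst Bochner_Integration.integral_sum) auto
        also have "\<dots> \<le> (\<integral>x. norm (\<Phi> x) * exp (norm w * \<bar>x\<bar>) \<partial>lborel)"
        proof (rule Bochner_Integration.integral_mono)
          show "integrable lborel (\<lambda>x. \<Sum>j<n. norm (f j x))" using fi by auto
          show "(\<Sum>j<n. norm (f j x)) \<le> norm (\<Phi> x) * exp (norm w * \<bar>x\<bar>)" for x
            unfolding nf sums_unique[OF fs] by (rule sum_le_suminf[OF sums_summable[OF fs]]) auto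
        qed (rule laplace_norm_integrable)
        finally show "(\<Sum>j<n. \<integral>x. norm (f j x) \<partial>lborel) \<le> (\<integral>x. norm (\<Phi> x) * exp (norm w * \<bar>x\<bar>) \<partial>lborel)" .
      qed simp
    qed
    moreover have "(\<integral>x. f j x \<partial>lborel) = a j * w ^ j" for j
    proof -
      have "f j x = (\<Phi> x * (of_real x ^ j /\<^sub>R fact j)) * w ^ j" for x
        by (simp add: f_def power_mult_distrib)
      then show ?thesis unfolding a_def by simp
    qed
    moreover have "(\<Sum>j. f j x) = \<Phi> x * exp (w * of_real x)" for x
      unfolding f_def by (intro sums_unique[symmetric] sums_mult exp_converges)
    ultimately show ?thesis by simp
  qed
  have hol: "(\<lambda>w. \<integral>x. \<Phi> x * exp (w * of_real x) \<partial>lborel) holomorphic_on ball 0 r" for r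
    by (rule power_series_holomorphic[where a = a]) (use sums in simp)
  have "(\<lambda>w. \<integral>x. \<Phi> x * exp (w * of_real x) \<partial>lborel) field_differentiable at z" for z
    by (rule holomorphic_on_imp_differentiable_at[OF hol[of "norm z + 1"]]) auto
  then show ?thesis by (simp add: holomorphic_on_def field_differentiable_at_within)
qed

end

section \<open>Convergence of the series of norms\<close>

lemma powr_sum_le:
  assumes "\<tau> > 1"
  shows "(\<Sum>n=1..N. real n powr (- \<tau>)) \<le> 1 + 1 / (\<tau> - 1)"
proof -
  have "(\<Sum>n=1..N. real n powr (- \<tau>)) \<le> 1 + (1 - real N powr (1 - \<tau>)) / (\<tau> - 1)" if "N \<ge> 1" for N
    using that
  proof (induction N rule: nat_induct_at_least)
    case (Suc N)
    have "\<exists>z>real N. z < real (Suc N) \<and> real (Suc N) powr (1 - \<tau>) - real N powr (1 - \<tau>) =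
        (real (Suc N) - real N) * ((1 - \<tau>) * z powr (- \<tau>))"
    proof (rule MVT2)
      fix x assume "real N \<le> x"
      then have "x > 0" using Suc by simp
      then show "((\<lambda>x. x powr (1 - \<tau>)) has_real_derivative (1 - \<tau>) * x powr (- \<tau>)) (at x)"
        using has_real_derivative_powr[of x "1 - \<tau>"] by simp
    qed simp
    then obtain z where z: "z > real N" "z < real (Suc N)"
      "real (Suc N) powr (1 - \<tau>) - real N powr (1 - \<tau>) = (1 - \<tau>) * z powr (- \<tau>)" by auto
    have "real (Suc N) powr (- \<tau>) \<le> z powr (- \<tau>)"
      using z Suc assms by (intro powr_mono2') auto
    then have "(\<tau> - 1) * real (Suc N) powr (- \<tau>) \<le> (\<tau> - 1) * z powr (- \<tau>)"
      using assms by (intro mult_left_mono) auto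
    also have "\<dots> = real N powr (1 - \<tau>) - real (Suc N) powr (1 - \<tau>)" using z(3) by (simp add: algebra_simps)
    finally have "real (Suc N) powr (- \<tau>) \<le> (real N powr (1 - \<tau>) - real (Suc N) powr (1 - \<tau>)) / (\<tau> - 1)"
      using assms by (simp add: field_simps)
    then show ?case using Suc by (simp add: diff_divide_distrib)
  qed simp
  moreover have "(1 - real N powr (1 - \<tau>)) / (\<tau> - 1) \<le> 1 / (\<tau> - 1)"
    using assms by (intro divide_right_mono) auto
  ultimately have "(\<Sum>n=1..N. real n powr (- \<tau>)) \<le> 1 + 1 / (\<tau> - 1)" if "N \<ge> 1" for N
    using that assms by (smt (verit) divide_right_mono powr_ge_zero)
  then show ?thesis using assms by (cases "N \<ge> 1") auto
qed

text \<open>By the symmetry of a and b it suffices to sum over |b| <= |a|, where the row of a has at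
  most 3 |a| points, all of norm at least a^2. The factor 12 collects the two halves, the 3 and the
  two signs of a. The explicit order 1 / (\<sigma> - 1) is what the 3-4-1 argument requires.\<close>

lemma finite_sum_gnorm_powr_le:
  assumes \<sigma>: "\<sigma> > 1" and F: "finite F"
  shows "(\<Sum>x\<in>F. real (gnorm x) powr (- \<sigma>)) \<le> 12 * (1 + 1 / (2 * \<sigma> - 2))"
proof -
  define \<tau> where "\<tau> = 2 * \<sigma> - 1"
  have \<tau>: "\<tau> > 1" using \<sigma> by (simp add: \<tau>_def)
  define h where "h a b = (real_of_int a ^ 2 + real_of_int b ^ 2) powr (- \<sigma>)" for a b :: int
  have h0: "h a b \<ge> 0" for a b by (simp add: h_def)
  define N where "N = nat (Max (insert 0 ((\<lambda>x. \<bar>gre x\<bar>) ` F \<union> (\<lambda>x. \<bar>gim x\<bar>) ` F)))"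
  have N: "\<bar>gre x\<bar> \<le> int N" "\<bar>gim x\<bar> \<le> int N" if "x \<in> F" for x
    unfolding N_def using F that by (auto intro!: Max_ge simp: le_nat_iff)
  let ?I = "{- int N..int N}"
  have row: "(\<Sum>b\<in>{b \<in> ?I. \<bar>b\<bar> \<le> \<bar>a\<bar>}. h a b) \<le> 3 * real_of_int \<bar>a\<bar> powr (- \<tau>)" for a
  proof (cases "a = 0")
    \<comment> \<open>The row a = 0 consists of the origin alone, where \<open>0 powr _\<close> is
      0.\<close>
    case True
    have "(\<Sum>b\<in>{b \<in> ?I. \<bar>b\<bar> \<le> \<bar>a\<bar>}. h a b) \<le> (\<Sum>b\<in>{0}. h a b)"
      by (rule sum_mono2) (use True h0 in auto)
    then show ?thesis using True by (simp add: h_def)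
  next
    case False
    have "(\<Sum>b\<in>{b \<in> ?I. \<bar>b\<bar> \<le> \<bar>a\<bar>}. h a b) \<le> (\<Sum>b\<in>{- \<bar>a\<bar>..\<bar>a\<bar>}. h a b)"
      by (rule sum_mono2) (use h0 in auto)
    also have "\<dots> \<le> (\<Sum>b\<in>{- \<bar>a\<bar>..\<bar>a\<bar>}. (real_of_int \<bar>a\<bar> ^ 2) powr (- \<sigma>))"
      unfolding h_def using False \<sigma> by (intro sum_mono powr_mono2') auto
    also have "real_of_int \<bar>a\<bar> ^ 2 = real_of_int \<bar>a\<bar> powr 2"
      using False by (simp add: powr_numeral)
    also have "(real_of_int \<bar>a\<bar> powr 2) powr (- \<sigma>) = real_of_int \<bar>a\<bar> powr (- 2 * \<sigma>)"
      unfolding powr_powr by simp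
    also have "(\<Sum>b\<in>{- \<bar>a\<bar>..\<bar>a\<bar>}. real_of_int \<bar>a\<bar> powr (- 2 * \<sigma>)) =
        (2 * real_of_int \<bar>a\<bar> + 1) * real_of_int \<bar>a\<bar> powr (- 2 * \<sigma>)"
      by simp
    also have "\<dots> \<le> (3 * real_of_int \<bar>a\<bar>) * real_of_int \<bar>a\<bar> powr (- 2 * \<sigma>)"
      using False by (intro mult_right_mono) auto
    also have "\<dots> = 3 * real_of_int \<bar>a\<bar> powr (- \<tau>)"
      using False by (simp add: \<tau>_def powr_diff powr_minus field_simps)
    finally show ?thesis .
  qed
  have tot: "(\<Sum>a\<in>?I. real_of_int \<bar>a\<bar> powr (- \<tau>)) \<le> 2 * (1 + 1 / (\<tau> - 1))"
  proof -
    have "?I = int ` {1..N} \<union> (\<lambda>n. - int n) ` {1..N} \<union> {0}"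
    proof (intro equalityI subsetI)
      fix a assume "a \<in> ?I"
      then show "a \<in> int ` {1..N} \<union> (\<lambda>n. - int n) ` {1..N} \<union> {0}"
        by (cases a rule: int_cases2) auto
    qed auto
    then have "(\<Sum>a\<in>?I. real_of_int \<bar>a\<bar> powr (- \<tau>)) \<le> (\<Sum>a\<in>int ` {1..N} \<union> (\<lambda>n. - int n) ` {1..N}. real_of_int \<bar>a\<bar> powr (- \<tau>))
        + (\<Sum>a\<in>{0}. real_of_int \<bar>a\<bar> powr (- \<tau>))"
      by (subst sum.union_disjoint[symmetric]) auto
    also have "\<dots> = (\<Sum>a\<in>int ` {1..N}. real_of_int \<bar>a\<bar> powr (- \<tau>)) + (\<Sum>a\<in>(\<lambda>n. - int n) ` {1..N}. real_of_int \<bar>a\<bar> powr (- \<tau>))"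
      by (subst sum.union_disjoint) auto
    also have "\<dots> = 2 * (\<Sum>n=1..N. real n powr (- \<tau>))"
      by (subst (1 2) sum.reindex) (auto intro: inj_onI)
    also have "\<dots> \<le> 2 * (1 + 1 / (\<tau> - 1))" by (intro mult_left_mono powr_sum_le[OF \<tau>]) auto
    finally show ?thesis .
  qed
  have "(\<Sum>x\<in>F. real (gnorm x) powr (- \<sigma>)) = (\<Sum>(a, b)\<in>(\<lambda>x. (gre x, gim x)) ` F. h a b)"
    by (subst sum.reindex) (auto intro!: inj_onI simp: gint_eq_iff h_def real_gnorm)
  also have "\<dots> \<le> (\<Sum>(a, b)\<in>?I \<times> ?I. h a b)"
  proof (rule sum_mono2)
    show "(\<lambda>x. (gre x, gim x)) ` F \<subseteq> ?I \<times> ?I"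
    proof (rule image_subsetI)
      fix x assume "x \<in> F"
      from N[OF this] show "(gre x, gim x) \<in> ?I \<times> ?I" by (simp add: abs_le_iff)
    qed
  qed (use h0 in auto)
  also have "\<dots> = (\<Sum>a\<in>?I. \<Sum>b\<in>?I. h a b)" by (simp add: sum.cartesian_product)
  also have "\<dots> \<le> (\<Sum>a\<in>?I. (\<Sum>b\<in>?I. (if \<bar>b\<bar> \<le> \<bar>a\<bar> then h a b else 0) + (if \<bar>a\<bar> \<le> \<bar>b\<bar> then h b a else 0)))"
    by (intro sum_mono) (auto simp: h_def add.commute)
  also have "\<dots> = (\<Sum>a\<in>?I. \<Sum>b\<in>?I. (if \<bar>b\<bar> \<le> \<bar>a\<bar> then h a b else 0)) +
      (\<Sum>a\<in>?I. \<Sum>b\<in>?I. (if \<bar>a\<bar> \<le> \<bar>b\<bar> then h b a else 0))"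
    by (simp add: sum.distrib)
  also have "(\<Sum>a\<in>?I. \<Sum>b\<in>?I. (if \<bar>a\<bar> \<le> \<bar>b\<bar> then h b a else 0)) =
      (\<Sum>a\<in>?I. \<Sum>b\<in>?I. (if \<bar>b\<bar> \<le> \<bar>a\<bar> then h a b else 0))"
    by (rule sum.swap)
  also have "(\<Sum>a\<in>?I. \<Sum>b\<in>?I. (if \<bar>b\<bar> \<le> \<bar>a\<bar> then h a b else 0)) = (\<Sum>a\<in>?I. \<Sum>b\<in>{b \<in> ?I. \<bar>b\<bar> \<le> \<bar>a\<bar>}. h a b)"
    by (intro sum.cong refl sum.inter_filter[symmetric]) auto
  also have "(\<Sum>a\<in>?I. \<Sum>b\<in>{b \<in> ?I. \<bar>b\<bar> \<le> \<bar>a\<bar>}. h a b) + (\<Sum>a\<in>?I. \<Sum>b\<in>{b \<in> ?I. \<bar>b\<bar> \<le> \<bar>a\<bar>}. h a b) \<le>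
      2 * (3 * (2 * (1 + 1 / (\<tau> - 1))))"
  proof -
    have "(\<Sum>a\<in>?I. \<Sum>b\<in>{b \<in> ?I. \<bar>b\<bar> \<le> \<bar>a\<bar>}. h a b) \<le> (\<Sum>a\<in>?I. 3 * real_of_int \<bar>a\<bar> powr (- \<tau>))"
      by (intro sum_mono row)
    also have "\<dots> \<le> 3 * (2 * (1 + 1 / (\<tau> - 1)))"
      unfolding sum_distrib_left[symmetric] using tot by simp
    finally show ?thesis by simp
  qed
  finally show ?thesis by (simp add: \<tau>_def algebra_simps)
qed

lemma gnorm_powr_summable:
  assumes "\<sigma> > 1"
  shows "(\<lambda>x. real (gnorm x) powr (- \<sigma>)) summable_on UNIV"
  by (rule nonneg_bdd_above_summable_on)
    (auto intro!: bdd_aboveI2 finite_sum_gnorm_powr_le[OF assms])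

lemma gnorm_powr_infsum_le:
  assumes "\<sigma> > 1"
  shows "(\<Sum>\<^sub>\<infinity>x. real (gnorm x) powr (- \<sigma>)) \<le> 12 * (1 + 1 / (2 * \<sigma> - 2))"
  by (rule infsum_le_finite_sums[OF gnorm_powr_summable[OF assms]])
    (rule finite_sum_gnorm_powr_le[OF assms])

text \<open>Euler's integral after the substitution t = exp x, carried out separately for real and
  imaginary part, followed by the translation of x by ln c.\<close>

lemma Gamma_exp_integral:
  assumes z: "Re z > 0" and c: "c > 0"
  shows "integrable lborel (\<lambda>x. exp (z * of_real x) * of_real (exp (- (c * exp x))))"
    and "(\<integral>x. exp (z * of_real x) * of_real (exp (- (c * exp x))) \<partial>lborel) = of_real c powr (- z) * Gamma z"
proof -
  define g where "g x = exp (z * of_real x) * of_real (exp (- exp x))" for x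
  define G where "G t = complex_of_real t powr (z - 1) / of_real (exp t)" for t
  have Gi: "G absolutely_integrable_on {0<..}" unfolding G_def by (rule absolutely_integrable_Gamma_integral'[OF z])
  have Gv: "(G has_integral Gamma z) {0<..}" unfolding G_def by (rule Gamma_integral_complex'[OF z])
  have gG: "g x = of_real (exp x) * G (exp x)" for x
  proof -
    have "complex_of_real (exp x) powr (z - 1) = exp ((z - 1) * of_real x)"
      by (simp add: powr_def Ln_of_real)
    then have "of_real (exp x) * G (exp x) = exp (of_real x) * exp ((z - 1) * of_real x) / exp (of_real (exp x))"
      by (simp add: G_def exp_of_real)
    also have "\<dots> = exp (z * of_real x) * exp (- of_real (exp x))"
      by (simp add: exp_add[symmetric] exp_minus divide_inverse algebra_simps)
    finally show ?thesis by (simp add: g_def exp_of_real[symmetric])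
  qed
  have range: "range (exp :: real \<Rightarrow> real) = {0<..}"
    by (auto simp: image_iff) (metis exp_ln)
  have cov: "(\<lambda>x. \<bar>exp x\<bar> * f (exp x)) absolutely_integrable_on UNIV \<and>
      integral UNIV (\<lambda>x. \<bar>exp x\<bar> * f (exp x)) = integral {0<..} f"
    if "f absolutely_integrable_on {0<..}" for f :: "real \<Rightarrow> real"
    using has_absolute_integral_change_of_variables_1'[of UNIV exp exp f "integral {0<..} f"] that
    by (auto simp: range inj_on_def intro: DERIV_exp)
  have ReG: "(\<lambda>t. Re (G t)) absolutely_integrable_on {0<..}" and ImG: "(\<lambda>t. Im (G t)) absolutely_integrable_on {0<..}"
    using absolutely_integrable_linear[OF Gi bounded_linear_Re] absolutely_integrable_linear[OF Gi bounded_linear_Im]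
    by (simp_all add: o_def)
  have meas: "g \<in> borel_measurable borel" unfolding g_def by measurable
  have "(\<lambda>x. Re (g x)) absolutely_integrable_on UNIV" "(\<lambda>x. Im (g x)) absolutely_integrable_on UNIV"
    using cov[OF ReG] cov[OF ImG] unfolding gG by simp_all
  then have Reg: "integrable lborel (\<lambda>x. Re (g x))" and Img: "integrable lborel (\<lambda>x. Im (g x))"
    using meas unfolding absolutely_integrable_on_def set_integrable_def
    by (auto simp: integrable_completion)
  have gi: "integrable lborel g"
  proof -
    have "integrable lborel (\<lambda>x. of_real (Re (g x)) + \<i> * of_real (Im (g x)))"
      using Reg Img by (intro Bochner_Integration.integrable_add integrable_mult_right integrable_of_real)
    then show ?thesis by (simp flip: complex_eq)
  qed
  have "Re (\<integral>x. g x \<partial>lborel) = integral {0<..} (\<lambda>t. Re (G t))"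
    using cov[OF ReG] integral_lborel[OF Reg] integral_Re[OF gi] unfolding gG by simp
  also have "\<dots> = Re (Gamma z)" using has_integral_Re[OF Gv] by (simp add: integral_unique)
  finally have R: "Re (\<integral>x. g x \<partial>lborel) = Re (Gamma z)" .
  have "Im (\<integral>x. g x \<partial>lborel) = integral {0<..} (\<lambda>t. Im (G t))"
    using cov[OF ImG] integral_lborel[OF Img] integral_Im[OF gi] unfolding gG by simp
  also have "\<dots> = Im (Gamma z)" using has_integral_Im[OF Gv] by (simp add: integral_unique)
  finally have val: "(\<integral>x. g x \<partial>lborel) = Gamma z" using R by (simp add: complex_eq_iff)
  have shift: "g (ln c + 1 * x) = of_real c powr z * (exp (z * of_real x) * of_real (exp (- (c * exp x))))" for x
    using c by (simp add: g_def powr_def Ln_of_real exp_add ring_distribs)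
  have nz: "of_real c powr z \<noteq> 0" using c by simp
  have "integrable lborel (\<lambda>x. g (ln c + 1 * x))" by (rule lborel_integrable_real_affine[OF gi]) simp
  then show "integrable lborel (\<lambda>x. exp (z * of_real x) * of_real (exp (- (c * exp x))))"
  proof -
    have canc: "of_real c powr (- z) * (of_real c powr z * w) = w" for w :: complex
      using nz by (simp add: powr_minus)
    show ?thesis
      using integrable_mult_right[OF \<open>integrable lborel (\<lambda>x. g (ln c + 1 * x))\<close>, of "of_real c powr (- z)"]
      unfolding shift canc .
  qed
  have "(\<integral>x. g x \<partial>lborel) = (\<integral>x. g (ln c + 1 * x) \<partial>lborel)"
    using lborel_integral_real_affine[of 1 g "ln c"] by simp
  also have "\<dots> = of_real c powr z * (\<integral>x. exp (z * of_real x) * of_real (exp (- (c * exp x))) \<partial>lborel)"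
    unfolding shift by simp
  finally have "Gamma z = of_real c powr z * (\<integral>x. exp (z * of_real x) * of_real (exp (- (c * exp x))) \<partial>lborel)"
    using val by simp
  then show "(\<integral>x. exp (z * of_real x) * of_real (exp (- (c * exp x))) \<partial>lborel) = of_real c powr (- z) * Gamma z"
    using nz by (simp add: powr_minus)
qed

section \<open>The L-series over generators and its Mellin representation\<close>

definition gchi :: "nat \<Rightarrow> gint \<Rightarrow> complex" where
  "gchi k x = (of_gint x / cnj (of_gint x)) ^ (2 * k)"

text \<open>The sum runs over generators instead of ideals, so the four units are divided out. The
  term at 0 vanishes because \<open>0 powr _\<close> is 0, which lets the sum range over the whole
  type.\<close>

definition gseries :: "nat \<Rightarrow> complex \<Rightarrow> complex" where
  "gseries k s = (\<Sum>\<^sub>\<infinity>x. gchi k x * of_nat (gnorm x) powr (- s)) / 4"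

text \<open>The theta series in the variable t = exp x. The exponent 2k + 1/2 is half the weight 4k
  + 1 and makes the kernel even, so that the reflection s -> 1 - s becomes x -> -x.\<close>

definition gkernel :: "nat \<Rightarrow> real \<Rightarrow> complex" where
  "gkernel k x = gtheta (4 * k) (exp x) * of_real (exp ((2 * real k + 1 / 2) * x))"

text \<open>The completed function, defined by an integral that makes sense for all s. The factor
  pi^(2k) / 4 compensates the pi^(-2k) of the Gamma integrals and the four units.\<close>

definition Lam :: "nat \<Rightarrow> complex \<Rightarrow> complex" where
  "Lam k s = of_real (pi ^ (2 * k) / 4) * (\<integral>x. gkernel k x * exp ((s - 1 / 2) * of_real x) \<partial>lborel)"

lemma norm_gchi_le: "cmod (gchi k x) \<le> 1"
  unfolding gchi_def by (simp add: norm_power norm_divide power_le_one)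

lemma norm_gnorm_powr: "cmod (of_nat (gnorm x) powr (- s)) = real (gnorm x) powr (- Re s)"
  using norm_powr_real_powr[of "of_nat (gnorm x)" "- s"] by simp

text \<open>Each term of the theta series has a Gamma integral, and \<alpha>^(4k) / N(\<alpha>)^(2k)
  is the character at \<alpha>. The integrals of the absolute values are a constant times
  N(\<alpha>)^(- Re s), so for Re s > 1 integration and summation may be exchanged.\<close>

lemma gkernel_mellin:
  assumes k: "k \<ge> 1" and s: "Re s > 1"
  shows "integrable lborel (\<lambda>x. gkernel k x * exp ((s - 1 / 2) * of_real x))"
    and "Lam k s = of_real pi powr (- s) * Gamma (s + 2 * of_nat k) * gseries k s"
proof -
  define z where "z = s + 2 * of_nat k"
  have z: "Re z > 0" using s by (simp add: z_def)
  define F where "F \<alpha> x = of_gint \<alpha> ^ (4 * k) * (exp (z * of_real x) * of_real (exp (- (pi * real (gnorm \<alpha>) * exp x))))"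
    for \<alpha> x
  have c: "pi * real (gnorm \<alpha>) > 0" if "\<alpha> \<noteq> 0" for \<alpha> using that gnorm_pos_iff by simp
  have F0: "F 0 x = 0" for x using k by (simp add: F_def)
  have Fi: "integrable lborel (F \<alpha>)" for \<alpha>
  proof (cases "\<alpha> = 0")
    case True
    then show ?thesis by (simp add: F0 [abs_def])
  next
    case False
    show ?thesis unfolding F_def by (intro integrable_mult_right Gamma_exp_integral(1) z c[OF False])
  qed
  have four: "cmod (of_gint \<alpha>) ^ (4 * k) = real (gnorm \<alpha>) ^ (2 * k)" for \<alpha>
    by (simp add: of_nat_gnorm flip: power_mult)
  have normF: "norm (F \<alpha> x) = real (gnorm \<alpha>) ^ (2 * k) *
      (exp (Re z * x) * exp (- (pi * real (gnorm \<alpha>) * exp x)))" for \<alpha> x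
    by (simp add: F_def norm_mult norm_power four)
  define Cst where "Cst = pi powr (- Re z) * Gamma (Re z)"
  have inormF: "(\<integral>x. norm (F \<alpha> x) \<partial>lborel) = Cst * real (gnorm \<alpha>) powr (- Re s)" for \<alpha>
  proof (cases "\<alpha> = 0")
    case True
    then show ?thesis by (simp add: F0)
  next
    case False
    let ?m = "real (gnorm \<alpha>)"
    have m: "?m > 0" using False gnorm_pos_iff by simp
    have "complex_of_real (\<integral>x. exp (Re z * x) * exp (- (pi * ?m * exp x)) \<partial>lborel) =
        (\<integral>x. exp (of_real (Re z) * of_real x) * of_real (exp (- (pi * ?m * exp x))) \<partial>lborel)"
    proof -
      have e: "exp (of_real (Re z) * of_real x) = complex_of_real (exp (Re z * x))" for x
        by (metis exp_of_real of_real_mult)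
      show ?thesis unfolding e unfolding of_real_mult[symmetric] integral_complex_of_real ..
    qed
    also have "\<dots> = of_real (pi * ?m) powr (- of_real (Re z)) * Gamma (of_real (Re z))"
      by (rule Gamma_exp_integral(2)) (use z c[OF False] in auto)
    also have "\<dots> = complex_of_real ((pi * ?m) powr (- Re z) * Gamma (Re z))"
      using c[OF False] by (simp add: powr_of_real[symmetric] Gamma_complex_of_real)
    finally have "(\<integral>x. exp (Re z * x) * exp (- (pi * ?m * exp x)) \<partial>lborel) = (pi * ?m) powr (- Re z) * Gamma (Re z)"
      by (simp only: of_real_eq_iff)
    then have "(\<integral>x. norm (F \<alpha> x) \<partial>lborel) = ?m ^ (2 * k) * ((pi * ?m) powr (- Re z) * Gamma (Re z))"
      unfolding normF by simp
    also have "\<dots> = Cst * (?m powr (2 * real k) * ?m powr (- Re z))"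
      using m by (simp add: Cst_def powr_mult flip: powr_realpow)
    also have "?m powr (2 * real k) * ?m powr (- Re z) = ?m powr (- Re s)"
      by (simp add: powr_add[symmetric] z_def)
    finally show ?thesis .
  qed
  have sum_theta: "((\<lambda>\<alpha>. F \<alpha> x) has_sum gkernel k x * exp ((s - 1 / 2) * of_real x)) UNIV"
    and sm: "(\<lambda>\<alpha>. norm (F \<alpha> x)) summable_on UNIV" for x
  proof -
    have n: "(\<lambda>\<alpha>. exp (- (pi * exp x * real (gnorm \<alpha>))) * cmod (of_gint \<alpha>) ^ (4 * k)) summable_on UNIV"
      by (rule gint_power_exp_summable) simp
    from summable_on_cmult_right[OF this, of "exp (Re z * x)"]
    show "(\<lambda>\<alpha>. norm (F \<alpha> x)) summable_on UNIV"
      unfolding normF four by (simp add: mult_ac)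
    have "(\<lambda>\<alpha>. norm (of_real (exp (- (pi * exp x * real (gnorm \<alpha>)))) * of_gint \<alpha> ^ (4 * k))) summable_on UNIV"
      using n by (simp add: norm_mult norm_power)
    then have "((\<lambda>\<alpha>. of_real (exp (- (pi * exp x * real (gnorm \<alpha>)))) * of_gint \<alpha> ^ (4 * k)) has_sum gtheta (4 * k) (exp x)) UNIV"
      unfolding gtheta_def by (rule has_sum_infsum[OF abs_summable_summable])
    from has_sum_cmult_right[OF this, of "exp (z * of_real x)"]
    have "((\<lambda>\<alpha>. F \<alpha> x) has_sum exp (z * of_real x) * gtheta (4 * k) (exp x)) UNIV"
      unfolding F_def by (simp add: mult_ac)
    moreover have "exp (z * of_real x) * gtheta (4 * k) (exp x) = gkernel k x * exp ((s - 1 / 2) * of_real x)"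
    proof -
      have "exp (z * of_real x) = exp (of_real ((2 * real k + 1 / 2) * x)) * exp ((s - 1 / 2) * of_real x)"
        by (simp add: exp_add[symmetric] z_def algebra_simps)
      then show ?thesis by (simp add: gkernel_def exp_of_real[symmetric] mult_ac)
    qed
    ultimately show "((\<lambda>\<alpha>. F \<alpha> x) has_sum gkernel k x * exp ((s - 1 / 2) * of_real x)) UNIV" by simp
  qed
  have smi: "(\<lambda>\<alpha>. \<integral>x. norm (F \<alpha> x) \<partial>lborel) summable_on UNIV"
    unfolding inormF by (intro summable_on_cmult_right gnorm_powr_summable s)
  have eq: "(\<Sum>\<^sub>\<infinity>\<alpha>. F \<alpha> x) = gkernel k x * exp ((s - 1 / 2) * of_real x)" for x
    by (rule infsumI[OF sum_theta])
  show "integrable lborel (\<lambda>x. gkernel k x * exp ((s - 1 / 2) * of_real x))"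
    using has_sum_integral(1)[OF countable_gint infinite_gint Fi sm smi] unfolding eq .
  have main: "((\<lambda>\<alpha>. \<integral>x. F \<alpha> x \<partial>lborel) has_sum (\<integral>x. gkernel k x * exp ((s - 1 / 2) * of_real x) \<partial>lborel)) UNIV"
    using has_sum_integral(2)[OF countable_gint infinite_gint Fi sm smi] unfolding eq .
  have val: "(\<integral>x. F \<alpha> x \<partial>lborel) = (of_real pi powr (- z) * Gamma z) * (gchi k \<alpha> * of_nat (gnorm \<alpha>) powr (- s))" for \<alpha>
  proof (cases "\<alpha> = 0")
    case True
    then show ?thesis by (simp add: F0)
  next
    case False
    let ?m = "complex_of_real (real (gnorm \<alpha>))"
    have m: "?m \<noteq> 0" using False by simp
    have "(\<integral>x. F \<alpha> x \<partial>lborel) = of_gint \<alpha> ^ (4 * k) * (of_real (pi * real (gnorm \<alpha>)) powr (- z) * Gamma z)"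
      unfolding F_def using Gamma_exp_integral(2)[OF z c[OF False]] by simp
    also have "complex_of_real (pi * real (gnorm \<alpha>)) powr (- z) = of_real pi powr (- z) * ?m powr (- z)"
      by (simp add: powr_times_real)
    also have "?m powr (- z) = ?m powr (- s) / ?m ^ (2 * k)"
    proof -
      have "?m powr (- z) = ?m powr (- s) * ?m powr (- (of_nat (2 * k)))"
        by (simp add: powr_add[symmetric] z_def)
      also have "?m powr (- (of_nat (2 * k))) = 1 / ?m ^ (2 * k)"
        using m powr_nat'[of ?m "2 * k"] by (simp add: powr_minus_divide del: of_nat_mult)
      finally show ?thesis by simp
    qed
    also have "of_gint \<alpha> ^ (4 * k) * (of_real pi powr (- z) * (?m powr (- s) / ?m ^ (2 * k)) * Gamma z) =
        (of_real pi powr (- z) * Gamma z) * (of_gint \<alpha> ^ (4 * k) / ?m ^ (2 * k) * ?m powr (- s))" by simp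
    also have "of_gint \<alpha> ^ (4 * k) / ?m ^ (2 * k) = gchi k \<alpha>"
    proof -
      have "?m = of_gint \<alpha> * cnj (of_gint \<alpha>)" by (simp only: of_nat_gnorm complex_norm_square)
      then have "?m ^ (2 * k) = of_gint \<alpha> ^ (2 * k) * cnj (of_gint \<alpha>) ^ (2 * k)"
        by (simp only: power_mult_distrib)
      moreover have "of_gint \<alpha> ^ (4 * k) = of_gint \<alpha> ^ (2 * k) * of_gint \<alpha> ^ (2 * k)"
        by (simp flip: power_add)
      ultimately show ?thesis using False by (simp add: gchi_def power_divide)
    qed
    finally show ?thesis by simp
  qed
  have "(\<integral>x. gkernel k x * exp ((s - 1 / 2) * of_real x) \<partial>lborel) =
      (\<Sum>\<^sub>\<infinity>\<alpha>. (of_real pi powr (- z) * Gamma z) * (gchi k \<alpha> * of_nat (gnorm \<alpha>) powr (- s)))"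
    using infsumI[OF main] unfolding val by simp
  also have "\<dots> = (of_real pi powr (- z) * Gamma z) * (\<Sum>\<^sub>\<infinity>\<alpha>. gchi k \<alpha> * of_nat (gnorm \<alpha>) powr (- s))"
    by (rule infsum_cmult_right')
  finally have "Lam k s = of_real (pi ^ (2 * k)) * of_real pi powr (- z) * Gamma z * gseries k s"
    unfolding Lam_def gseries_def by simp
  also have "of_real (pi ^ (2 * k)) * complex_of_real pi powr (- z) = of_real pi powr (- s)"
  proof -
    have "complex_of_real (pi ^ (2 * k)) = of_real pi powr (of_nat (2 * k))"
      using powr_nat'[of "of_real pi" "2 * k"] by (simp del: of_nat_mult)
    then show ?thesis by (simp add: powr_add[symmetric] z_def del: of_real_power)
  qed
  finally show "Lam k s = of_real pi powr (- s) * Gamma (s + 2 * of_nat k) * gseries k s" by (simp add: z_def)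
qed

text \<open>Theta inversion for degree 4k: the sign (-1)^(4k) is 1, and the factor t^(4k + 1) is
  split evenly by the exponent in the kernel. This is the source of the functional equation.\<close>

lemma gkernel_minus: "gkernel k (- x) = gkernel k x"
proof -
  have "gtheta (4 * k) (exp (- x)) = of_real (exp x ^ Suc (4 * k)) * gtheta (4 * k) (exp x)"
  proof -
    have "1 / exp (- x) = exp x" by (simp add: exp_minus divide_inverse)
    moreover from this have "1 / exp (- x) ^ Suc (4 * k) = exp x ^ Suc (4 * k)"
      by (metis power_one_over)
    moreover have "(- 1 :: complex) ^ (4 * k) = 1" by (simp add: power_mult)
    ultimately show ?thesis
      using gtheta_inversion[of "exp (- x)" "4 * k"] by (simp only: exp_gt_zero mult_1)
  qed
  moreover have "exp x ^ Suc (4 * k) * exp ((2 * real k + 1 / 2) * (- x)) = exp ((2 * real k + 1 / 2) * x)"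
    by (simp add: exp_of_nat_mult[symmetric] exp_add[symmetric] algebra_simps del: power_Suc)
  moreover have "(of_real a * g) * of_real b = of_real (a * b) * g" for a b :: real and g :: complex
    by simp
  ultimately have "gkernel k (- x) = of_real (exp ((2 * real k + 1 / 2) * x)) * gtheta (4 * k) (exp x)"
    unfolding gkernel_def by metis
  then show ?thesis by (simp only: gkernel_def mult.commute)
qed

text \<open>Measurability is recovered from integrability at s = 2 by multiplying the exponential
  factor away.\<close>

lemma gkernel_measurable:
  assumes "k \<ge> 1"
  shows "gkernel k \<in> borel_measurable borel"
proof -
  have "(\<lambda>x. gkernel k x * exp ((2 - 1 / 2) * of_real x)) \<in> borel_measurable borel"
    using gkernel_mellin(1)[OF assms, of 2] by (auto dest: borel_measurable_integrable)
  then have "(\<lambda>x. (gkernel k x * exp ((2 - 1 / 2) * of_real x)) * exp (- ((2 - 1 / 2) * of_real x))) \<in> borel_measurable borel"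
    by (rule borel_measurable_times) measurable
  then show ?thesis by (simp add: mult.assoc exp_add[symmetric])
qed

lemma gkernel_bound:
  assumes "k \<ge> 1"
  obtains C where "\<And>x. cmod (gkernel k x) \<le> C * exp ((2 * real k + 1 / 2) * \<bar>x\<bar> - x\<^sup>2 / 2)"
proof -
  obtain C where C: "C \<ge> 0" "\<And>t. t \<ge> 1 \<Longrightarrow> cmod (gtheta (4 * k) t) \<le> C * exp (1 - t)"
    using gtheta_bound[of "4 * k"] assms by auto
  have *: "cmod (gkernel k x) \<le> C * exp ((2 * real k + 1 / 2) * \<bar>x\<bar> - x\<^sup>2 / 2)" if "x \<ge> 0" for x
  proof -
    \<comment> \<open>Trades the doubly exponential decay for the Gaussian majorant expected by the
      Laplace transform lemmas.\<close>
    have "1 + x + x\<^sup>2 / 2 \<le> exp x" by (rule exp_lower_Taylor_quadratic[OF that])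
    then have "1 - exp x \<le> - (x\<^sup>2 / 2)" using that by simp
    have "cmod (gkernel k x) = cmod (gtheta (4 * k) (exp x)) * exp ((2 * real k + 1 / 2) * x)"
      by (simp add: gkernel_def norm_mult)
    also have "\<dots> \<le> C * exp (1 - exp x) * exp ((2 * real k + 1 / 2) * x)"
      using that by (intro mult_right_mono C) auto
    also have "\<dots> \<le> C * exp (- (x\<^sup>2 / 2)) * exp ((2 * real k + 1 / 2) * x)"
      using \<open>1 - exp x \<le> - (x\<^sup>2 / 2)\<close> C by (intro mult_right_mono mult_left_mono) auto
    also have "\<dots> = C * exp ((2 * real k + 1 / 2) * \<bar>x\<bar> - x\<^sup>2 / 2)"
      using that by (simp add: mult.assoc exp_add[symmetric])
    finally show ?thesis .
  qed
  have "cmod (gkernel k x) \<le> C * exp ((2 * real k + 1 / 2) * \<bar>x\<bar> - x\<^sup>2 / 2)" for x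
    using *[of x] *[of "- x"] by (cases "x \<ge> 0") (simp_all add: gkernel_minus)
  then show thesis by (rule that)
qed

lemma Lam_holomorphic: "k \<ge> 1 \<Longrightarrow> Lam k holomorphic_on UNIV"
proof -
  assume k: "k \<ge> 1"
  obtain C where C: "\<And>x. cmod (gkernel k x) \<le> C * exp ((2 * real k + 1 / 2) * \<bar>x\<bar> - x\<^sup>2 / 2)"
    by (rule gkernel_bound[OF k]) blast
  have "(\<lambda>w. \<integral>x. gkernel k x * exp (w * of_real x) \<partial>lborel) \<circ> (\<lambda>s. s - 1 / 2) holomorphic_on UNIV"
    by (rule holomorphic_on_compose_gen[OF _ laplace_holomorphic[OF gkernel_measurable[OF k] C]])
      (auto intro!: holomorphic_intros)
  then show ?thesis unfolding Lam_def [abs_def] o_def by (intro holomorphic_intros)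
qed

lemma Lam_strip_bound:
  assumes "k \<ge> 1"
  obtains B where "B > 0" "\<And>s. \<bar>Re s\<bar> \<le> R \<Longrightarrow> cmod (Lam k s) \<le> B"
proof -
  obtain C where C: "\<And>x. cmod (gkernel k x) \<le> C * exp ((2 * real k + 1 / 2) * \<bar>x\<bar> - x\<^sup>2 / 2)"
    by (rule gkernel_bound[OF assms]) blast
  define D where "D = (\<integral>x. norm (gkernel k x) * exp ((R + 1) * \<bar>x\<bar>) \<partial>lborel)"
  have "D \<ge> 0" unfolding D_def by (intro integral_nonneg_AE) auto
  show thesis
  proof (rule that[of "pi ^ (2 * k) / 4 * D + 1"])
    show "pi ^ (2 * k) / 4 * D + 1 > 0" using \<open>D \<ge> 0\<close> by (intro add_nonneg_pos mult_nonneg_nonneg) auto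
    fix s :: complex assume "\<bar>Re s\<bar> \<le> R"
    then have "\<bar>Re (s - 1 / 2)\<bar> \<le> R + 1" by simp
    from laplace_bound[OF gkernel_measurable[OF assms] C this]
    have "cmod (\<integral>x. gkernel k x * exp ((s - 1 / 2) * of_real x) \<partial>lborel) \<le> D"
      unfolding D_def .
    then have "pi ^ (2 * k) / 4 * cmod (\<integral>x. gkernel k x * exp ((s - 1 / 2) * of_real x) \<partial>lborel) \<le> pi ^ (2 * k) / 4 * D"
      by (intro mult_left_mono) auto
    moreover have "cmod (Lam k s) = pi ^ (2 * k) / 4 * cmod (\<integral>x. gkernel k x * exp ((s - 1 / 2) * of_real x) \<partial>lborel)"
      by (simp add: Lam_def norm_mult norm_power)
    ultimately show "cmod (Lam k s) \<le> pi ^ (2 * k) / 4 * D + 1" by linarith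
  qed
qed

lemma Lam_reflect: "Lam k (1 - s) = Lam k s"
proof -
  have "(\<integral>x. gkernel k x * exp ((s - 1 / 2) * of_real x) \<partial>lborel) =
      (\<integral>x. gkernel k (0 + (- 1) * x) * exp ((s - 1 / 2) * of_real (0 + (- 1) * x)) \<partial>lborel)"
    using lborel_integral_real_affine[of "- 1" "\<lambda>x. gkernel k x * exp ((s - 1 / 2) * of_real x)" 0] by simp
  also have "\<dots> = (\<integral>x. gkernel k x * exp ((1 - s - 1 / 2) * of_real x) \<partial>lborel)"
    by (simp add: gkernel_minus algebra_simps)
  finally show ?thesis by (simp add: Lam_def)
qed

lemma Lam_cnj: "Lam k (cnj s) = cnj (Lam k s)"
proof -
  have "cnj (gkernel k x * exp ((s - 1 / 2) * of_real x)) = gkernel k x * exp ((cnj s - 1 / 2) * of_real x)" for x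
    by (simp add: gkernel_def gtheta_cnj exp_cnj)
  then show ?thesis
    unfolding Lam_def complex_cnj_mult Bochner_Integration.integral_cnj[symmetric] by simp
qed

section \<open>Ideals and Gaussian integers\<close>

lemma carrier_gauss_ring: "carrier gauss_ring = range of_gint"
proof (intro equalityI subsetI)
  fix z assume "z \<in> carrier gauss_ring"
  then obtain a b where "Re z = of_int a" "Im z = of_int b"
    by (auto simp: gauss_ring_def elim!: Ints_cases)
  then have "z = of_gint (Gint a b)" by (simp add: complex_eq_iff)
  then show "z \<in> range of_gint" by blast
qed (auto simp: gauss_ring_def)

lemma gauss_ring_sel [simp]:
  "x \<otimes>\<^bsub>gauss_ring\<^esub> y = x * y" "x \<oplus>\<^bsub>gauss_ring\<^esub> y = x + y" "\<zero>\<^bsub>gauss_ring\<^esub> = 0"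
  by (simp_all add: gauss_ring_def)

lemma PIdl_of_gint: "PIdl\<^bsub>gauss_ring\<^esub> (of_gint a) = range (\<lambda>x. of_gint (x * a))"
  by (auto simp: cgenideal_def carrier_gauss_ring)

lemma of_gint_in_PIdl_iff: "of_gint b \<in> PIdl\<^bsub>gauss_ring\<^esub> (of_gint a) \<longleftrightarrow> a dvd b"
proof -
  have "of_gint b \<in> PIdl\<^bsub>gauss_ring\<^esub> (of_gint a) \<longleftrightarrow> (\<exists>x. of_gint b = of_gint (x * a))"
    unfolding PIdl_of_gint by blast
  then show ?thesis by (auto simp: dvd_def mult.commute simp del: of_gint_simps)
qed

text \<open>A nonzero element of least norm generates, since the remainder of any other element on
  division by it lies in the ideal and has smaller norm.\<close>

lemma ideal_gauss_ring_principal: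
  assumes I: "ideal I gauss_ring" "I \<noteq> {0}"
  obtains a where "a \<noteq> 0" "I = PIdl\<^bsub>gauss_ring\<^esub> (of_gint a)"
proof -
  interpret cring gauss_ring by (rule cring_gauss_ring)
  interpret ideal I gauss_ring by (rule I(1))
  have sub: "I \<subseteq> range of_gint" using a_subset by (simp add: carrier_gauss_ring)
  have "0 \<in> I" using additive_subgroup.zero_closed[OF additive_subgroup_axioms] by simp
  then obtain z where z: "z \<in> I" "z \<noteq> 0" using I(2) by blast
  then obtain x where "z = of_gint x" using sub by blast
  then have x: "x \<noteq> 0" "of_gint x \<in> I" using z by auto
  define P where "P n \<longleftrightarrow> (\<exists>x. x \<noteq> 0 \<and> of_gint x \<in> I \<and> gnorm x = n)" for n
  have "P (LEAST n. P n)" by (rule LeastI[of P "gnorm x"]) (use x in \<open>auto simp: P_def\<close>)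
  then obtain a where a: "a \<noteq> 0" "of_gint a \<in> I" "gnorm a = (LEAST n. P n)" by (auto simp: P_def)
  have "a dvd b" if "of_gint b \<in> I" for b
  proof (rule ccontr)
    assume "\<not> a dvd b"
    then have nz: "b mod a \<noteq> 0" by (simp add: mod_eq_0_iff_dvd)
    have "of_gint (- (b div a)) \<otimes>\<^bsub>gauss_ring\<^esub> of_gint a \<in> I"
      by (rule I_l_closed[OF a(2)]) (simp add: carrier_gauss_ring del: of_gint_simps)
    then have "of_gint b \<oplus>\<^bsub>gauss_ring\<^esub> (of_gint (- (b div a)) \<otimes>\<^bsub>gauss_ring\<^esub> of_gint a) \<in> I"
      by (rule a_closed[OF that])
    moreover have "of_gint b \<oplus>\<^bsub>gauss_ring\<^esub> (of_gint (- (b div a)) \<otimes>\<^bsub>gauss_ring\<^esub> of_gint a) = of_gint (b mod a)"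
      by (simp add: modulo_gint_def)
    ultimately have "P (gnorm (b mod a))" using nz unfolding P_def by auto
    then have "gnorm a \<le> gnorm (b mod a)" unfolding a(3) by (rule Least_le)
    moreover have "gnorm (b mod a) < gnorm a"
      using mod_size_less[OF a(1), of b] by (simp add: euclidean_size_gint_def)
    ultimately show False by simp
  qed
  then have "I = PIdl\<^bsub>gauss_ring\<^esub> (of_gint a)"
  proof (intro equalityI subsetI)
    fix z assume "z \<in> I"
    moreover then obtain b where "z = of_gint b" using sub by auto
    ultimately show "z \<in> PIdl\<^bsub>gauss_ring\<^esub> (of_gint a)"
      using \<open>\<And>b. of_gint b \<in> I \<Longrightarrow> a dvd b\<close> by (simp add: of_gint_in_PIdl_iff)
  next
    fix z assume "z \<in> PIdl\<^bsub>gauss_ring\<^esub> (of_gint a)"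
    then obtain x where "z = of_gint (x * a)" unfolding PIdl_of_gint by blast
    then have "z = of_gint x * of_gint a" by simp
    moreover have "of_gint x \<otimes>\<^bsub>gauss_ring\<^esub> of_gint a \<in> I"
      by (rule I_l_closed[OF a(2)]) (simp add: carrier_gauss_ring)
    ultimately show "z \<in> I" by simp
  qed
  with a(1) show thesis by (rule that)
qed

lemma PIdl_of_gint_nonzero_ideal:
  assumes "a \<noteq> 0" shows "PIdl\<^bsub>gauss_ring\<^esub> (of_gint a) \<in> nonzero_ideals"
proof -
  interpret cring gauss_ring by (rule cring_gauss_ring)
  have "ideal (PIdl\<^bsub>gauss_ring\<^esub> (of_gint a)) gauss_ring"
    by (rule cgenideal_ideal) (simp add: carrier_gauss_ring)
  moreover have "of_gint a \<in> PIdl\<^bsub>gauss_ring\<^esub> (of_gint a)" by (simp add: of_gint_in_PIdl_iff)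
  then have "PIdl\<^bsub>gauss_ring\<^esub> (of_gint a) \<noteq> {0}" using assms of_gint_eq_0_iff by blast
  ultimately show ?thesis by (simp add: nonzero_ideals_def)
qed

lemma PIdl_of_gint_eq_iff:
  "PIdl\<^bsub>gauss_ring\<^esub> (of_gint a) = PIdl\<^bsub>gauss_ring\<^esub> (of_gint b) \<longleftrightarrow> a dvd b \<and> b dvd a"
proof
  assume "PIdl\<^bsub>gauss_ring\<^esub> (of_gint a) = PIdl\<^bsub>gauss_ring\<^esub> (of_gint b)"
  then show "a dvd b \<and> b dvd a" by (metis dvd_refl of_gint_in_PIdl_iff)
next
  assume *: "a dvd b \<and> b dvd a"
  have "z \<in> PIdl\<^bsub>gauss_ring\<^esub> (of_gint a) \<longleftrightarrow> z \<in> PIdl\<^bsub>gauss_ring\<^esub> (of_gint b)" for z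
  proof (cases "z \<in> range of_gint")
    case True
    then show ?thesis using * by (auto simp: of_gint_in_PIdl_iff simp del: of_gint_simps intro: dvd_trans)
  next
    case False
    then show ?thesis unfolding PIdl_of_gint by blast
  qed
  then show "PIdl\<^bsub>gauss_ring\<^esub> (of_gint a) = PIdl\<^bsub>gauss_ring\<^esub> (of_gint b)" by blast
qed

lemma card_associates:
  assumes "a \<noteq> 0"
  shows "card {x :: gint. a dvd x \<and> x dvd a} = 4" and "finite {x :: gint. a dvd x \<and> x dvd a}"
proof -
  have eq: "{x. a dvd x \<and> x dvd a} = (\<lambda>u. u * a) ` gunits"
  proof (intro equalityI subsetI)
    fix x assume "x \<in> {x. a dvd x \<and> x dvd a}"
    then have "a dvd x" "x dvd a" by auto
    then obtain u v where uv: "x = a * u" "a = x * v" by (elim dvdE)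
    then have "a * (u * v) = a * 1" by (metis mult.assoc mult_1_right)
    then have "u * v = 1" using assms by (metis mult_left_cancel)
    then have "u dvd 1" by (metis dvd_triv_left)
    then have "u \<in> gunits" by (simp only: gint_dvd_1_iff)
    then show "x \<in> (\<lambda>u. u * a) ` gunits" using uv(1) by (auto simp: mult.commute)
  next
    fix x assume "x \<in> (\<lambda>u. u * a) ` gunits"
    then obtain u where u: "u \<in> gunits" "x = u * a" by blast
    then have "u dvd 1" by (simp only: gint_dvd_1_iff)
    then show "x \<in> {x. a dvd x \<and> x dvd a}" by (simp add: u(2) mult_unit_dvd_iff')
  qed
  have "inj_on (\<lambda>u. u * a) gunits" using assms by (intro inj_onI) simp
  then show "card {x :: gint. a dvd x \<and> x dvd a} = 4" unfolding eq by (simp add: card_image card_gunits)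
  show "finite {x :: gint. a dvd x \<and> x dvd a}" unfolding eq by simp
qed

lemma gseries_summable:
  assumes "Re s > 1"
  shows "(\<lambda>x. norm (gchi k x * of_nat (gnorm x) powr (- s))) summable_on UNIV"
  by (rule summable_on_comparison_test[OF gnorm_powr_summable[OF assms]])
    (auto simp: norm_mult norm_gnorm_powr intro: mult_left_le_one_le norm_gchi_le)

text \<open>The map from nonzero elements to the ideals they generate is onto, with fibres of
  exactly four associates. Grouping the absolutely convergent sum by fibres gives four times the sum
  over ideals.\<close>

lemma hecke_series_eq_gseries:
  assumes s: "Re s > 1"
  shows "hecke_series (int k) s = gseries k s"
proof -
  define f where "f I = Xi (int k) I * ideal_norm I powr (- s)" for I
  define g where "g x = gchi k x * of_nat (gnorm x) powr (- s)" for x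
  define J where "J x = PIdl\<^bsub>gauss_ring\<^esub> (of_gint x)" for x
  have fg: "f (J x) = g x" if "x \<noteq> 0" for x
  proof -
    have c: "of_gint x \<in> carrier gauss_ring" "of_gint x \<noteq> 0" using that by (auto simp: carrier_gauss_ring)
    have "(of_gint x / cnj (of_gint x)) powi (2 * int k) = gchi k x"
      unfolding gchi_def by (metis of_nat_mult of_nat_numeral power_int_of_nat)
    moreover have "of_gint x * cnj (of_gint x) = of_nat (gnorm x)"
      using complex_norm_square[of "of_gint x"] of_nat_gnorm[of x] by (metis of_real_of_nat_eq)
    ultimately show ?thesis unfolding f_def g_def J_def Xi_PIdl[OF c] ideal_norm_PIdl[OF c] by simp
  qed
  define B where "B I = {x. x \<noteq> 0 \<and> J x = I}" for I
  have J: "J x \<in> nonzero_ideals" if "x \<noteq> 0" for x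
    unfolding J_def by (rule PIdl_of_gint_nonzero_ideal[OF that])
  have bij: "bij_betw snd (SIGMA I:nonzero_ideals. B I) (- {0})"
    by (rule bij_betw_byWitness[of _ "\<lambda>x. (J x, x)"]) (auto simp: B_def J)
  have g: "g summable_on (- {0})"
    using abs_summable_summable[OF gseries_summable[OF s, of k]] unfolding g_def
    by (rule summable_on_subset_banach) simp
  then have S: "(\<lambda>p. g (snd p)) summable_on (SIGMA I:nonzero_ideals. B I)"
    using summable_on_reindex_bij_betw[OF bij] by blast
  have fib: "(\<Sum>\<^sub>\<infinity>x\<in>B I. g (snd (I, x))) = 4 * f I" if I: "I \<in> nonzero_ideals" for I
  proof -
    obtain a where a: "a \<noteq> 0" "I = J a"
      using I ideal_gauss_ring_principal[of I] unfolding nonzero_ideals_def J_def by (auto elim: that)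
    have B: "B I = {x. a dvd x \<and> x dvd a}"
      using a by (auto simp: B_def J_def PIdl_of_gint_eq_iff)
    have "(\<Sum>\<^sub>\<infinity>x\<in>B I. g (snd (I, x))) = (\<Sum>x\<in>B I. g x)"
      unfolding B using card_associates(2)[OF a(1)] by simp
    also have "\<dots> = (\<Sum>x\<in>B I. f I)"
      by (intro sum.cong) (auto simp: B_def fg[symmetric])
    also have "\<dots> = 4 * f I" unfolding B using card_associates(1)[OF a(1)] by simp
    finally show ?thesis .
  qed
  have "4 * gseries k s = infsum g UNIV" unfolding gseries_def g_def by simp
  also have "\<dots> = infsum g (- {0})"
    by (rule infsum_cong_neutral) (auto simp: g_def)
  also have "\<dots> = (\<Sum>\<^sub>\<infinity>p\<in>(SIGMA I:nonzero_ideals. B I). g (snd p))"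
    by (rule infsum_reindex_bij_betw[OF bij, symmetric])
  also have "\<dots> = (\<Sum>\<^sub>\<infinity>I\<in>nonzero_ideals. \<Sum>\<^sub>\<infinity>x\<in>B I. g (snd (I, x)))"
    by (rule infsum_Sigma_banach[OF S, symmetric])
  also have "\<dots> = (\<Sum>\<^sub>\<infinity>I\<in>nonzero_ideals. 4 * f I)" by (intro infsum_cong fib)
  also have "\<dots> = 4 * hecke_series (int k) s"
    unfolding hecke_series_def f_def by (rule infsum_cmult_right')
  finally show ?thesis by simp
qed

text \<open>Solving the completed function for the L-function with the entire \<open>rGamma\<close>
  yields an entire function at once, with no poles to discuss.\<close>

definition lfun :: "nat \<Rightarrow> complex \<Rightarrow> complex" where
  "lfun k s = of_real pi powr s * rGamma (s + 2 * of_nat k) * Lam k s"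

lemma lfun_holomorphic: "k \<ge> 1 \<Longrightarrow> lfun k holomorphic_on UNIV"
  unfolding lfun_def [abs_def] by (intro holomorphic_intros Lam_holomorphic) auto

lemma lfun_eq_gseries:
  assumes "k \<ge> 1" "Re s > 1"
  shows "lfun k s = gseries k s"
proof -
  have "s + 2 * of_nat k \<notin> \<int>\<^sub>\<le>\<^sub>0"
  proof
    assume "s + 2 * of_nat k \<in> \<int>\<^sub>\<le>\<^sub>0"
    then obtain n where "s + 2 * of_nat k = - of_nat n" by (auto elim!: nonpos_Ints_cases')
    then have "Re (s + 2 * of_nat k) = - real n" by (metis Re_complex_of_real of_real_minus of_real_of_nat_eq)
    then show False using assms by simp
  qed
  then have "rGamma (s + 2 * of_nat k) * Gamma (s + 2 * of_nat k) = 1"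
    by (simp add: rGamma_inverse_Gamma Gamma_eq_zero_iff)
  moreover have "complex_of_real pi powr s * of_real pi powr (- s) = 1"
    by (simp add: powr_add[symmetric])
  ultimately have "(of_real pi powr s * of_real pi powr (- s)) *
      (rGamma (s + 2 * of_nat k) * Gamma (s + 2 * of_nat k)) * gseries k s = gseries k s" by simp
  then show ?thesis unfolding lfun_def gkernel_mellin(2)[OF assms] by (simp only: mult_ac)
qed

lemma hecke_L_eq_lfun:
  assumes "k \<ge> 1"
  shows "hecke_L (int k) = lfun k"
proof (rule hecke_L_eqI)
  show "lfun k holomorphic_on UNIV" by (rule lfun_holomorphic[OF assms])
  show "lfun k s = hecke_series (int k) s" if "Re s > 1" for s
    using that assms by (simp add: lfun_eq_gseries hecke_series_eq_gseries)
qed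

section \<open>Dirichlet series and non-vanishing on the line Re s = 1\<close>

definition gdir :: "(gint \<Rightarrow> complex) \<Rightarrow> complex \<Rightarrow> complex" where
  "gdir c s = (\<Sum>\<^sub>\<infinity>x. c x * of_nat (gnorm x) powr (- s))"

definition dir_conv :: "(gint \<Rightarrow> complex) \<Rightarrow> bool" where
  "dir_conv c \<longleftrightarrow> (\<forall>\<sigma>>1. (\<lambda>x. cmod (c x) * real (gnorm x) powr (- \<sigma>)) summable_on UNIV)"

lemma dir_convD: "dir_conv c \<Longrightarrow> \<sigma> > 1 \<Longrightarrow> (\<lambda>x. cmod (c x) * real (gnorm x) powr (- \<sigma>)) summable_on UNIV"
  by (simp add: dir_conv_def)

lemma dir_conv_mono:
  assumes "dir_conv c" "\<And>x. cmod (d x) \<le> cmod (c x)"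
  shows "dir_conv d"
  unfolding dir_conv_def
proof (intro allI impI)
  fix \<sigma> :: real assume "\<sigma> > 1"
  show "(\<lambda>x. cmod (d x) * real (gnorm x) powr (- \<sigma>)) summable_on UNIV"
    by (rule summable_on_comparison_test[OF dir_convD[OF assms(1) \<open>\<sigma> > 1\<close>]])
      (auto intro: mult_right_mono assms(2))
qed

lemma dir_conv_bounded: "(\<And>x. cmod (c x) \<le> 1) \<Longrightarrow> dir_conv c"
  by (rule dir_conv_mono[of "\<lambda>_. 1"]) (auto simp: dir_conv_def gnorm_powr_summable)

lemma dir_conv_ln: "dir_conv (\<lambda>x. of_real (ln (real (gnorm x))))"
  unfolding dir_conv_def
proof (intro allI impI)
  fix \<sigma> :: real assume \<sigma>: "\<sigma> > 1"
  \<comment> \<open>Half of the distance to 1 pays for the logarithm, through ln N <= N^a /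
    a.\<close>
  define a where "a = (\<sigma> - 1) / 2"
  have a: "a > 0" "\<sigma> - a > 1" using \<sigma> by (simp_all add: a_def field_simps)
  show "(\<lambda>x. cmod (of_real (ln (real (gnorm x)))) * real (gnorm x) powr (- \<sigma>)) summable_on UNIV"
  proof (rule summable_on_comparison_test)
    show "(\<lambda>x. (1 / a) * real (gnorm x) powr (- (\<sigma> - a))) summable_on UNIV"
      by (intro summable_on_cmult_right gnorm_powr_summable a)
    fix x :: gint
    show "cmod (of_real (ln (real (gnorm x)))) * real (gnorm x) powr (- \<sigma>) \<le> (1 / a) * real (gnorm x) powr (- (\<sigma> - a))"
    proof (cases "x = 0")
      case False
      then have N: "real (gnorm x) \<ge> 1" using gnorm_pos_iff[of x] by simp
      have "ln (real (gnorm x)) \<le> real (gnorm x) powr a / a" by (rule ln_powr_bound[OF N a(1)])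
      then have "ln (real (gnorm x)) * real (gnorm x) powr (- \<sigma>) \<le> (real (gnorm x) powr a / a) * real (gnorm x) powr (- \<sigma>)"
        by (intro mult_right_mono) auto
      also have "\<dots> = (1 / a) * real (gnorm x) powr (- (\<sigma> - a))"
        by (simp add: powr_diff powr_minus field_simps)
      finally show ?thesis using N by simp
    qed simp
  qed auto
qed

lemma gdir_term_norm: "cmod (c x * of_nat (gnorm x) powr (- s)) = cmod (c x) * real (gnorm x) powr (- Re s)"
  by (simp add: norm_mult norm_gnorm_powr)

lemma gdir_has_sum:
  assumes "dir_conv c" "Re s > 1"
  shows "((\<lambda>x. c x * of_nat (gnorm x) powr (- s)) has_sum gdir c s) UNIV"
  unfolding gdir_def
proof (rule has_sum_infsum, rule abs_summable_summable)
  show "(\<lambda>x. norm (c x * of_nat (gnorm x) powr (- s))) summable_on UNIV"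
    unfolding gdir_term_norm by (rule dir_convD) (use assms in auto)
qed

lemma of_nat_powr_exp: "n > 0 \<Longrightarrow> (of_nat n :: complex) powr z = exp (z * of_real (ln (real n)))"
  using Ln_of_real[of "real n"] by (simp add: powr_def)

text \<open>In the shift w the series at s + w is an exponential sum with frequencies - ln N, so
  \<open>exp_sum_sums\<close> gives its Taylor expansion, and the derivative is the linear
  coefficient.\<close>

lemma gdir_deriv:
  assumes c: "dir_conv c" and s: "Re s > 1"
  shows "(gdir c has_field_derivative - gdir (\<lambda>x. of_real (ln (real (gnorm x))) * c x) s) (at s)"
proof -
  define c' where "c' x = c x * of_nat (gnorm x) powr (- s)" for x
  define b where "b x = - complex_of_real (ln (real (gnorm x)))" for x
  define r where "r = (Re s - 1) / 2"
  have r: "r > 0" "Re s - r > 1" using s by (simp_all add: r_def field_simps)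
  have tm: "c x * of_nat (gnorm x) powr (- (s + w)) = c' x * exp (b x * w)" for x w
  proof (cases "x = 0")
    case False
    then have "gnorm x > 0" by (simp add: gnorm_pos_iff)
    then show ?thesis
      unfolding c'_def b_def by (simp only: of_nat_powr_exp mult.assoc exp_add[symmetric]) (simp add: algebra_simps)
  qed (simp add: c'_def)
  have sm: "(\<lambda>x. norm (c' x) * exp (norm (b x) * norm w)) summable_on UNIV" if "norm w \<le> r" for w
  proof (rule summable_on_comparison_test)
    show "(\<lambda>x. cmod (c x) * real (gnorm x) powr (- (Re s - r))) summable_on UNIV"
      by (rule dir_convD[OF c r(2)])
    fix x :: gint
    show "norm (c' x) * exp (norm (b x) * norm w) \<le> cmod (c x) * real (gnorm x) powr (- (Re s - r))"
    proof (cases "x = 0")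
      case False
      then have N: "real (gnorm x) \<ge> 1" using gnorm_pos_iff[of x] by simp
      have "exp (norm (b x) * norm w) \<le> exp (ln (real (gnorm x)) * r)"
        using N that by (simp add: b_def mult_left_mono)
      also have "\<dots> = real (gnorm x) powr r" using False by (simp add: powr_def mult.commute)
      finally have "norm (c' x) * exp (norm (b x) * norm w) \<le>
          (cmod (c x) * real (gnorm x) powr (- Re s)) * real (gnorm x) powr r"
        unfolding c'_def gdir_term_norm by (intro mult_left_mono) auto
      also have "\<dots> = cmod (c x) * real (gnorm x) powr (- (Re s - r))"
        by (simp add: mult.assoc powr_add[symmetric])
      finally show ?thesis .
    qed (simp add: c'_def)
  qed auto
  define A where "A j = (\<Sum>\<^sub>\<infinity>x. c' x * b x ^ j) / fact j" for j
  have sums: "(\<lambda>j. A j * w ^ j) sums gdir c (s + w)" if "norm w \<le> r" for w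
    using exp_sum_sums(1)[OF sm[OF that]] unfolding A_def gdir_def tm .
  have "((\<lambda>w. \<Sum>j. A j * w ^ j) has_field_derivative (\<Sum>j. diffs A j * 0 ^ j)) (at 0)"
  proof (rule termdiffs_strong)
    show "summable (\<lambda>j. A j * of_real r ^ j)" using sums[of "of_real r"] r(1) by (auto simp: sums_iff)
    show "norm (0 :: complex) < norm (complex_of_real r)" using r(1) by simp
  qed
  also have "(\<Sum>j. diffs A j * 0 ^ j) = A 1" by (subst powser_zero) (simp add: diffs_def)
  finally have "((\<lambda>w. gdir c (s + w)) has_field_derivative A 1) (at 0)"
  proof (rule DERIV_cong_ev[THEN iffD1, rotated -1])
    have "eventually (\<lambda>w. w \<in> ball 0 r) (nhds (0 :: complex))"
      by (rule eventually_nhds_in_open) (use r(1) in auto)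
    then show "eventually (\<lambda>w. (\<Sum>j. A j * w ^ j) = gdir c (s + w)) (nhds 0)"
      by eventually_elim (use sums in \<open>auto simp: sums_iff\<close>)
  qed auto
  then have "(gdir c has_field_derivative A 1) (at (0 + s))"
    by (subst DERIV_shift) (simp add: add.commute)
  moreover have "A 1 = - gdir (\<lambda>x. of_real (ln (real (gnorm x))) * c x) s"
  proof -
    have "A 1 = (\<Sum>\<^sub>\<infinity>x. - (of_real (ln (real (gnorm x))) * c x * of_nat (gnorm x) powr (- s)))"
      unfolding A_def c'_def b_def by (simp add: mult_ac)
    also have "\<dots> = - gdir (\<lambda>x. of_real (ln (real (gnorm x))) * c x) s"
      unfolding gdir_def by (rule infsum_uminus)
    finally show ?thesis .
  qed
  ultimately show ?thesis by simp
qed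

section \<open>The logarithm and the logarithmic derivative as Dirichlet series\<close>

lemma gchi_mult: "gchi k (x * y) = gchi k x * gchi k y"
  by (simp add: gchi_def power_mult_distrib[symmetric])

lemma of_nat_gnorm_mult_powr:
  "(of_nat (gnorm (x * y)) :: complex) powr s = of_nat (gnorm x) powr s * of_nat (gnorm y) powr s"
  using powr_times_real[of "of_nat (gnorm x)" "of_nat (gnorm y)" s] by (simp add: gnorm_mult)

lemma dir_conv_gchi: "dir_conv (gchi k)"
  by (rule dir_conv_bounded) (rule norm_gchi_le)

lemma norm_gmangoldt_gchi_le: "cmod (of_real (gmangoldt x) * gchi k x) \<le> cmod (of_real (ln (real (gnorm x))))"
proof (cases "x = 0")
  case True
  then show ?thesis by (simp add: gmangoldt_def)
next
  case False
  have "cmod (of_real (gmangoldt x) * gchi k x) \<le> gmangoldt x * 1"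
    unfolding norm_mult using norm_gchi_le[of k x] gmangoldt_nonneg[of x] by (intro mult_mono) auto
  also have "\<dots> \<le> ln (real (gnorm x))" using gmangoldt_le[OF False] by simp
  also have "\<dots> \<le> cmod (of_real (ln (real (gnorm x))))" by simp
  finally show ?thesis .
qed

lemma dir_conv_gmangoldt: "dir_conv (\<lambda>x. of_real (gmangoldt x) * gchi k x)"
  by (rule dir_conv_mono[OF dir_conv_ln]) (rule norm_gmangoldt_gchi_le)

text \<open>Since the character is completely multiplicative, the product collects, for each y, the
  sum of \<open>gmangoldt\<close> over the divisors of y, which is 4 ln N(y). The point 0 is removed
  beforehand so that divisor sets are finite.\<close>

lemma gdir_gmangoldt_convolution:
  assumes s: "Re s > 1"
  shows "gdir (\<lambda>x. of_real (gmangoldt x) * gchi k x) s * gdir (gchi k) s =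
           4 * gdir (\<lambda>x. of_real (ln (real (gnorm x))) * gchi k x) s"
proof -
  define f where "f x = of_real (gmangoldt x) * gchi k x * of_nat (gnorm x) powr (- s)" for x
  define g where "g x = gchi k x * of_nat (gnorm x) powr (- s)" for x
  define A where "A = - {0 :: gint}"
  have f: "(f has_sum gdir (\<lambda>x. of_real (gmangoldt x) * gchi k x) s) A"
    using gdir_has_sum[OF dir_conv_gmangoldt s, of k]
    by (rule has_sum_cong_neutral[THEN iffD1, rotated -1]) (auto simp: f_def A_def)
  have g: "(g has_sum gdir (gchi k) s) A"
    using gdir_has_sum[OF dir_conv_gchi s, of k]
    by (rule has_sum_cong_neutral[THEN iffD1, rotated -1]) (auto simp: g_def A_def)
  have nf: "(\<lambda>x. norm (f x)) summable_on A" and ng: "(\<lambda>x. norm (g x)) summable_on A"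
  proof -
    have "(\<lambda>x. norm (f x)) summable_on UNIV"
      using dir_convD[OF dir_conv_gmangoldt s, of k] unfolding f_def norm_mult norm_gnorm_powr .
    then show "(\<lambda>x. norm (f x)) summable_on A" by (rule summable_on_subset_banach) simp
    have "(\<lambda>x. norm (g x)) summable_on UNIV"
      using dir_convD[OF dir_conv_gchi s, of k] unfolding g_def norm_mult norm_gnorm_powr .
    then show "(\<lambda>x. norm (g x)) summable_on A" by (rule summable_on_subset_banach) simp
  qed
  have fg_sm: "(\<lambda>(x, y). f x * g y) summable_on A \<times> A"
  proof (rule abs_summable_summable, rule summable_on_SigmaI)
    show "((\<lambda>y. norm (case (x, y) of (x, y) \<Rightarrow> f x * g y)) has_sum norm (f x) * infsum (\<lambda>y. norm (g y)) A) A" for x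
      unfolding prod.case norm_mult by (intro has_sum_cmult_right has_sum_infsum ng)
    show "(\<lambda>x. norm (f x) * infsum (\<lambda>y. norm (g y)) A) summable_on A"
      by (intro summable_on_cmult_left nf)
  qed auto
  have fg: "((\<lambda>(x, y). f x * g y) has_sum (gdir (\<lambda>x. of_real (gmangoldt x) * gchi k x) s * gdir (gchi k) s)) (A \<times> A)"
    by (rule has_sum_SigmaI[OF _ has_sum_cmult_left[OF f] fg_sm])
      (use has_sum_cmult_right[OF g] in auto)
  define D where "D = (SIGMA y:A. {d. d dvd y})"
  define h where "h = (\<lambda>(y, d). of_real (gmangoldt d) * gchi k y * of_nat (gnorm y) powr (- s))"
  \<comment> \<open>Reindexes pairs of factors by the product together with its first
    factor.\<close>
  have bij: "bij_betw (\<lambda>(x, y). (x * y, x)) (A \<times> A) D"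
  proof (rule bij_betw_byWitness[of _ "\<lambda>(y, d). (d, y div d)"])
    show "\<forall>p\<in>A \<times> A. (case case p of (x, y) \<Rightarrow> (x * y, x) of (y, d) \<Rightarrow> (d, y div d)) = p"
      by (auto simp: A_def)
    show "\<forall>q\<in>D. (case case q of (y, d) \<Rightarrow> (d, y div d) of (x, y) \<Rightarrow> (x * y, x)) = q"
      by (auto simp: D_def A_def)
    show "(\<lambda>(x, y). (x * y, x)) ` (A \<times> A) \<subseteq> D" by (auto simp: D_def A_def)
    show "(\<lambda>(y, d). (d, y div d)) ` D \<subseteq> A \<times> A" by (auto simp: D_def A_def dvd_div_eq_0_iff)
  qed
  have "(h has_sum (gdir (\<lambda>x. of_real (gmangoldt x) * gchi k x) s * gdir (gchi k) s)) D"
  proof (rule has_sum_reindex_bij_betw[OF bij, THEN iffD1])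
    have "(\<lambda>p. h (case p of (x, y) \<Rightarrow> (x * y, x))) = (\<lambda>(x, y). f x * g y)"
      by (auto simp: h_def f_def g_def gchi_mult of_nat_gnorm_mult_powr mult_ac)
    with fg show "((\<lambda>p. h (case p of (x, y) \<Rightarrow> (x * y, x))) has_sum
        gdir (\<lambda>x. of_real (gmangoldt x) * gchi k x) s * gdir (gchi k) s) (A \<times> A)" by simp
  qed
  then have "((\<lambda>y. 4 * (of_real (ln (real (gnorm y))) * gchi k y * of_nat (gnorm y) powr (- s))) has_sum
      (gdir (\<lambda>x. of_real (gmangoldt x) * gchi k x) s * gdir (gchi k) s)) A"
    unfolding D_def
  proof (rule has_sum_SigmaD)
    fix y assume "y \<in> A"
    then have y: "y \<noteq> 0" by (simp add: A_def)
    have "(\<Sum>d | d dvd y. h (y, d)) = (\<Sum>d | d dvd y. of_real (gmangoldt d) * (gchi k y * of_nat (gnorm y) powr (- s)))"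
      by (simp add: h_def mult.assoc)
    also have "\<dots> = of_real (\<Sum>d | d dvd y. gmangoldt d) * (gchi k y * of_nat (gnorm y) powr (- s))"
      unfolding of_real_sum sum_distrib_right ..
    also have "\<dots> = 4 * (of_real (ln (real (gnorm y))) * gchi k y * of_nat (gnorm y) powr (- s))"
      unfolding sum_gmangoldt_divisors[OF y] by simp
    finally show "((\<lambda>d. h (y, d)) has_sum 4 * (of_real (ln (real (gnorm y))) * gchi k y * of_nat (gnorm y) powr (- s))) {d. d dvd y}"
      using finite_gint_divisors[OF y] by (intro has_sum_finiteI) auto
  qed
  moreover have "((\<lambda>y. 4 * (of_real (ln (real (gnorm y))) * gchi k y * of_nat (gnorm y) powr (- s))) has_sum
      4 * gdir (\<lambda>x. of_real (ln (real (gnorm x))) * gchi k x) s) A"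
  proof -
    have "dir_conv (\<lambda>x. of_real (ln (real (gnorm x))) * gchi k x)"
      by (rule dir_conv_mono[OF dir_conv_ln]) (simp add: norm_mult mult_left_le norm_gchi_le)
    from has_sum_cmult_right[OF gdir_has_sum[OF this s], of 4] show ?thesis
      by (rule has_sum_cong_neutral[THEN iffD1, rotated -1]) (auto simp: A_def)
  qed
  ultimately show ?thesis by (rule has_sum_unique)
qed

definition gmang_series :: "nat \<Rightarrow> complex \<Rightarrow> complex" where
  "gmang_series k s = gdir (\<lambda>x. of_real (gmangoldt x) * gchi k x) s / 4"

text \<open>The Dirichlet series of the logarithm of the L-function. At units the denominator ln 1
  is 0, and the quotient takes the value 0 that is wanted there.\<close>

definition glog :: "nat \<Rightarrow> complex \<Rightarrow> complex" where
  "glog k s = gdir (\<lambda>x. of_real (gmangoldt x / ln (real (gnorm x))) * gchi k x) s / 4"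

lemma gseries_gdir: "gseries k s = gdir (gchi k) s / 4"
  by (simp add: gseries_def gdir_def)

lemma gseries_deriv:
  assumes s: "Re s > 1"
  shows "(gseries k has_field_derivative - gmang_series k s * gseries k s) (at s)"
proof -
  have "((\<lambda>s. gdir (gchi k) s / 4) has_field_derivative
      - gdir (\<lambda>x. of_real (ln (real (gnorm x))) * gchi k x) s / 4) (at s)"
    by (rule DERIV_cdivide[OF gdir_deriv[OF dir_conv_gchi s]])
  moreover have "gdir (\<lambda>x. of_real (ln (real (gnorm x))) * gchi k x) s / 4 = gmang_series k s * gseries k s"
    using gdir_gmangoldt_convolution[OF s, of k] by (simp add: gmang_series_def gseries_gdir)
  ultimately show ?thesis unfolding gseries_gdir [abs_def] by simp
qed

lemma gmang_ratio: "gmangoldt x / ln (real (gnorm x)) \<in> {0..1}"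
proof (cases "x = 0 \<or> gnorm x = 1")
  case False
  then have "ln (real (gnorm x)) > 0" using gnorm_pos_iff[of x] by simp
  then show ?thesis using gmangoldt_nonneg[of x] gmangoldt_le[of x] False by (auto simp: divide_simps)
qed (auto simp: gmangoldt_def)

lemma norm_gmang_ratio_le: "cmod (of_real (gmangoldt x / ln (real (gnorm x))) * gchi k x) \<le> 1"
  unfolding norm_mult norm_of_real using gmang_ratio[of x] norm_gchi_le[of k x]
  by (intro mult_le_one) auto

lemma dir_conv_gmang_ratio: "dir_conv (\<lambda>x. of_real (gmangoldt x / ln (real (gnorm x))) * gchi k x)"
  by (rule dir_conv_bounded) (rule norm_gmang_ratio_le)

lemma glog_deriv:
  assumes s: "Re s > 1"
  shows "(glog k has_field_derivative - gmang_series k s) (at s)"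
proof -
  have "of_real (ln (real (gnorm x))) * (of_real (gmangoldt x / ln (real (gnorm x))) * gchi k x) =
      of_real (gmangoldt x) * gchi k x" for x
  proof (cases "ln (real (gnorm x)) = 0")
    case True
    then have "gmangoldt x = 0"
      using gmangoldt_nonneg[of x] gmangoldt_le[of x] by (cases "x = 0") (auto simp: gmangoldt_def)
    then show ?thesis by simp
  qed simp
  then have "(gdir (\<lambda>x. of_real (gmangoldt x / ln (real (gnorm x))) * gchi k x) has_field_derivative
      - gdir (\<lambda>x. of_real (gmangoldt x) * gchi k x) s) (at s)"
    using gdir_deriv[OF dir_conv_gmang_ratio s, of k] by (simp only:)
  from DERIV_cdivide[OF this, of 4] show ?thesis
    unfolding glog_def [abs_def] gmang_series_def by simp
qed

text \<open>The units have norm 1 and all other nonzero elements norm at least 2, so far to the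
  right only the units remain. This normalizes the constant of integration in the logarithm.\<close>

lemma gdir_tail:
  assumes c: "\<And>x. cmod (c x) \<le> 1" and n: "n \<ge> 2"
  shows "cmod (gdir c (of_nat n) - (\<Sum>u\<in>gunits. c u)) \<le> (1/2) ^ (n - 2) * (\<Sum>\<^sub>\<infinity>x. real (gnorm x) powr (- 2))"
proof -
  define t where "t x = c x * of_nat (gnorm x) powr (- of_nat n)" for x
  have conv: "dir_conv c" by (rule dir_conv_bounded[OF c])
  have "(t has_sum gdir c (of_nat n)) UNIV"
    unfolding t_def by (rule gdir_has_sum[OF conv]) (use n in simp)
  then have T: "t summable_on UNIV" "infsum t UNIV = gdir c (of_nat n)"
    by (auto intro: has_sum_imp_summable infsumI)
  have "infsum t UNIV = infsum t (gunits \<union> - gunits)" by simp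
  also have "\<dots> = infsum t gunits + infsum t (- gunits)"
    by (rule infsum_Un_disjoint) (simp_all add: summable_on_subset_banach[OF T(1)])
  also have "infsum t gunits = (\<Sum>u\<in>gunits. c u)"
    by (simp add: t_def gunits_gnorm)
  finally have "gdir c (of_nat n) - (\<Sum>u\<in>gunits. c u) = infsum t (- gunits)" using T by simp
  also have "cmod \<dots> \<le> (1/2) ^ (n - 2) * (\<Sum>\<^sub>\<infinity>x\<in>- gunits. real (gnorm x) powr (- 2))"
  proof (rule norm_infsum_le)
    show "(t has_sum infsum t (- gunits)) (- gunits)"
      by (rule has_sum_infsum[OF summable_on_subset_banach[OF T(1)]]) simp
    show "((\<lambda>x. (1/2) ^ (n - 2) * real (gnorm x) powr (- 2)) has_sum
        (1/2) ^ (n - 2) * (\<Sum>\<^sub>\<infinity>x\<in>- gunits. real (gnorm x) powr (- 2))) (- gunits)"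
      by (intro has_sum_cmult_right has_sum_infsum summable_on_subset_banach[OF gnorm_powr_summable[of 2]]) simp_all
    fix x assume x: "x \<in> - gunits"
    show "cmod (t x) \<le> (1/2) ^ (n - 2) * real (gnorm x) powr (- 2)"
    proof (cases "x = 0")
      case False
      then have N: "real (gnorm x) \<ge> 2" using gnorm_pos_iff[of x] x gnorm_1_cases[of x] by force
      have "cmod (t x) \<le> 1 * real (gnorm x) powr (- real n)"
        unfolding t_def gdir_term_norm using c by (intro mult_mono) auto
      also have "\<dots> = real (gnorm x) powr (- real (n - 2)) * real (gnorm x) powr (- 2)"
        using n by (simp add: powr_add[symmetric] of_nat_diff)
      also have "\<dots> \<le> 2 powr (- real (n - 2)) * real (gnorm x) powr (- 2)"
        using N by (intro mult_right_mono powr_mono2') auto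
      also have "2 powr (- real (n - 2)) = (1/2 :: real) ^ (n - 2)"
        by (simp add: powr_minus powr_realpow power_one_over inverse_eq_divide)
      finally show ?thesis .
    qed (simp add: t_def)
  qed
  also have "\<dots> \<le> (1/2) ^ (n - 2) * (\<Sum>\<^sub>\<infinity>x. real (gnorm x) powr (- 2))"
    by (intro mult_left_mono infsum_mono_neutral gnorm_powr_summable
        summable_on_subset_banach[OF gnorm_powr_summable[of 2]]) auto
  finally show ?thesis .
qed

lemma gdir_limit:
  assumes c: "\<And>x. cmod (c x) \<le> 1"
  shows "(\<lambda>n. gdir c (of_nat n)) \<longlonglongrightarrow> (\<Sum>u\<in>gunits. c u)"
proof (rule LIM_zero_cancel, rule Lim_null_comparison)
  show "eventually (\<lambda>n. norm (gdir c (of_nat n) - (\<Sum>u\<in>gunits. c u)) \<le>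
      (1/2) ^ (n - 2) * (\<Sum>\<^sub>\<infinity>x. real (gnorm x) powr (- 2))) sequentially"
    using eventually_ge_at_top[of 2] by eventually_elim (rule gdir_tail[OF c])
  have "(\<lambda>n. (1/2 :: real) ^ (n - 2)) \<longlonglongrightarrow> 0"
    by (rule LIMSEQ_offset[of _ 2]) (simp add: LIMSEQ_power_zero)
  from tendsto_mult_left_zero[OF this]
  show "(\<lambda>n. (1/2) ^ (n - 2) * (\<Sum>\<^sub>\<infinity>x. real (gnorm x) powr (- 2))) \<longlonglongrightarrow> 0" .
qed

lemma gchi_unit: "u \<in> gunits \<Longrightarrow> gchi k u = 1"
proof -
  assume "u \<in> gunits"
  then have "(of_gint u / cnj (of_gint u))\<^sup>2 = 1"
    by (auto simp: gunits_def of_gint_def complex_eq_iff power2_eq_square Re_divide Im_divide)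
  then show ?thesis by (simp add: gchi_def power_mult)
qed

text \<open>The quotient of the two sides has derivative 0 in the half-plane, and its value tends to
  1 along the positive integers. It yields nonvanishing for Re s > 1 without an Euler
  product.\<close>

theorem gseries_eq_exp:
  assumes s: "Re s > 1"
  shows "gseries k s = exp (glog k s)"
proof -
  define F where "F s = gseries k s * exp (- glog k s)" for s
  have "(F has_field_derivative 0) (at s)" if "Re s > 1" for s
    unfolding F_def using gseries_deriv[OF that, of k] glog_deriv[OF that, of k]
    by (auto intro!: derivative_eq_intros simp: algebra_simps)
  then have "(F has_field_derivative 0) (at s within {s. Re s > 1})" if "Re s > 1" for s
    using that has_field_derivative_at_within by blast
  moreover have "convex {s. Re s > 1}" by (rule convex_halfspace_Re_gt)
  ultimately obtain c where c: "\<And>s. Re s > 1 \<Longrightarrow> F s = c"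
    using has_field_derivative_zero_constant[of "{s. Re s > 1}" F] by auto
  have "(\<lambda>n. gdir (gchi k) (of_nat n) / 4 * exp (- (gdir (\<lambda>x. of_real (gmangoldt x / ln (real (gnorm x))) * gchi k x) (of_nat n) / 4)))
     \<longlonglongrightarrow> (\<Sum>u\<in>gunits. gchi k u) / 4 * exp (- ((\<Sum>u\<in>gunits. of_real (gmangoldt u / ln (real (gnorm u))) * gchi k u) / 4))"
    by (intro tendsto_intros gdir_limit norm_gchi_le norm_gmang_ratio_le) auto
  moreover have "(\<Sum>u\<in>gunits. gchi k u) = 4" by (simp add: gchi_unit card_gunits)
  moreover have "(\<Sum>u\<in>gunits. of_real (gmangoldt u / ln (real (gnorm u))) * gchi k u) = 0"
    by (intro sum.neutral) (simp add: gunits_gnorm)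
  ultimately have "(\<lambda>n. F (of_nat n)) \<longlonglongrightarrow> 1"
    by (simp add: F_def gseries_gdir glog_def)
  moreover have "(\<lambda>n. F (of_nat n)) \<longlonglongrightarrow> c"
  proof (rule tendsto_eventually)
    show "eventually (\<lambda>n. F (of_nat n) = c) sequentially"
      using eventually_gt_at_top[of 1] by eventually_elim (rule c, simp)
  qed
  ultimately have "c = 1" using LIMSEQ_unique by blast
  then have "gseries k s * exp (- glog k s) = 1" using c[OF s] by (simp add: F_def)
  then have "gseries k s * exp (- glog k s) * exp (glog k s) = exp (glog k s)" by simp
  then show ?thesis by (simp add: mult.assoc exp_add[symmetric])
qed

text \<open>With z the phase of the character value times N^(-i t), the terms combine to 3 + 4 Re z
  + Re (z^2) = 2 (1 + Re z)^2. Squaring z doubles both k and t, which is why the third factor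
  belongs to 2k. For k = 0 the series is the Dedekind zeta function of the Gaussian field.\<close>

lemma three_four_one:
  assumes \<sigma>: "\<sigma> > 1"
  shows "1 \<le> cmod (gseries 0 (of_real \<sigma>)) ^ 3 * cmod (gseries k (Complex \<sigma> t)) ^ 4 * cmod (gseries (2 * k) (Complex \<sigma> (2 * t)))"
proof -
  define a where "a x = gmangoldt x / ln (real (gnorm x))" for x
  define T where "T k s x = of_real (a x) * gchi k x * of_nat (gnorm x) powr (- s)" for k s x
  have T: "((\<lambda>x. Re (T k s x)) has_sum Re (4 * glog k s)) UNIV" if "Re s > 1" for k s
    using has_sum_Re[OF gdir_has_sum[OF dir_conv_gmang_ratio that, of k]]
    unfolding T_def a_def glog_def by simp
  have "((\<lambda>x. 3 * Re (T 0 (of_real \<sigma>) x) + 4 * Re (T k (Complex \<sigma> t) x) + Re (T (2 * k) (Complex \<sigma> (2 * t)) x)) has_sum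
      (3 * Re (4 * glog 0 (of_real \<sigma>)) + 4 * Re (4 * glog k (Complex \<sigma> t)) + Re (4 * glog (2 * k) (Complex \<sigma> (2 * t))))) UNIV"
    by (intro has_sum_add has_sum_cmult_right T) (use \<sigma> in auto)
  then have "0 \<le> 3 * Re (4 * glog 0 (of_real \<sigma>)) + 4 * Re (4 * glog k (Complex \<sigma> t)) + Re (4 * glog (2 * k) (Complex \<sigma> (2 * t)))"
  proof (rule has_sum_nonneg)
    fix x :: gint
    show "0 \<le> 3 * Re (T 0 (of_real \<sigma>) x) + 4 * Re (T k (Complex \<sigma> t) x) + Re (T (2 * k) (Complex \<sigma> (2 * t)) x)"
    proof (cases "x = 0")
      case True
      then show ?thesis by (simp add: T_def)
    next
      case False
      define N where "N = real (gnorm x)"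
      have N: "N > 0" using False by (simp add: N_def gnorm_pos_iff)
      define z where "z = gchi k x * cis (- t * ln N)"
      define r where "r = a x * N powr (- \<sigma>)"
      have "a x \<ge> 0" using gmang_ratio[of x] by (simp add: a_def)
      then have r: "r \<ge> 0" by (simp add: r_def)
      have pw: "(of_nat (gnorm x) :: complex) powr (- Complex \<sigma> u) = of_real (N powr (- \<sigma>)) * cis (- u * ln N)" for u
      proof -
        have "(of_nat (gnorm x) :: complex) powr (- Complex \<sigma> u) = exp (- Complex \<sigma> u * of_real (ln N))"
          unfolding N_def by (rule of_nat_powr_exp) (use N in \<open>simp add: N_def\<close>)
        also have "- Complex \<sigma> u * of_real (ln N) = of_real (- \<sigma> * ln N) + \<i> * of_real (- u * ln N)"
          by (simp add: complex_eq_iff)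
        finally have e: "(of_nat (gnorm x) :: complex) powr (- Complex \<sigma> u) =
            exp (of_real (- \<sigma> * ln N)) * exp (\<i> * of_real (- u * ln N))" by (simp only: exp_add)
        have "exp (complex_of_real (- \<sigma> * ln N)) = of_real (exp (- \<sigma> * ln N))" by (rule exp_of_real)
        moreover have "exp (- \<sigma> * ln N) = N powr (- \<sigma>)" using N by (simp add: powr_def)
        ultimately show ?thesis unfolding e cis_conv_exp by simp
      qed
      have "cmod z = 1"
      proof -
        have "cmod (of_gint x / cnj (of_gint x)) = 1" using False by (simp add: norm_divide)
        then show ?thesis by (simp add: z_def norm_mult gchi_def norm_power)
      qed
      then have z1: "(Re z)\<^sup>2 + (Im z)\<^sup>2 = 1" by (metis cmod_power2 power_one)
      have "gchi (2 * k) x = gchi k x ^ 2" by (simp add: gchi_def mult_ac flip: power_mult)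
      moreover have "cis (- (2 * t) * ln N) = cis (- t * ln N) ^ 2"
        unfolding power2_eq_square cis_mult by (simp add: algebra_simps)
      ultimately have z2: "gchi (2 * k) x * cis (- (2 * t) * ln N) = z ^ 2" by (simp add: z_def power_mult_distrib)
      have "T k (Complex \<sigma> t) x = of_real r * z" unfolding T_def pw r_def z_def by simp
      moreover have "T (2 * k) (Complex \<sigma> (2 * t)) x = of_real r * z ^ 2"
        unfolding T_def pw r_def z2[symmetric] by simp
      moreover have "T 0 (of_real \<sigma>) x = of_real r"
      proof -
        have "complex_of_real \<sigma> = Complex \<sigma> 0" by (simp add: complex_of_real_def)
        then show ?thesis unfolding T_def r_def using pw[of 0] by (simp add: gchi_def)
      qed
      ultimately have "3 * Re (T 0 (of_real \<sigma>) x) + 4 * Re (T k (Complex \<sigma> t) x) + Re (T (2 * k) (Complex \<sigma> (2 * t)) x) =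
          r * (3 + 4 * Re z + ((Re z)\<^sup>2 - (Im z)\<^sup>2))" by (simp add: algebra_simps power2_eq_square)
      also have "3 + 4 * Re z + ((Re z)\<^sup>2 - (Im z)\<^sup>2) = 2 * (1 + Re z)\<^sup>2"
        using z1 by (simp add: power2_eq_square algebra_simps)
      finally show ?thesis using r by simp
    qed
  qed
  then have "0 \<le> 3 * Re (glog 0 (of_real \<sigma>)) + 4 * Re (glog k (Complex \<sigma> t)) + Re (glog (2 * k) (Complex \<sigma> (2 * t)))"
    by simp
  then have "1 \<le> exp (3 * Re (glog 0 (of_real \<sigma>)) + 4 * Re (glog k (Complex \<sigma> t)) + Re (glog (2 * k) (Complex \<sigma> (2 * t))))"
    by simp
  also have "\<dots> = cmod (gseries 0 (of_real \<sigma>)) ^ 3 * cmod (gseries k (Complex \<sigma> t)) ^ 4 * cmod (gseries (2 * k) (Complex \<sigma> (2 * t)))"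
    using \<sigma> by (simp add: gseries_eq_exp exp_add flip: exp_of_nat_mult)
  finally show ?thesis .
qed

lemma gseries_0_bound:
  assumes "\<sigma> > 1"
  shows "cmod (gseries 0 (of_real \<sigma>)) \<le> 3 * (1 + 1 / (2 * \<sigma> - 2))"
proof -
  have "cmod (gdir (gchi 0) (of_real \<sigma>)) \<le> (\<Sum>\<^sub>\<infinity>x. real (gnorm x) powr (- \<sigma>))"
  proof (rule norm_infsum_le)
    show "((\<lambda>x. gchi 0 x * of_nat (gnorm x) powr (- of_real \<sigma>)) has_sum gdir (gchi 0) (of_real \<sigma>)) UNIV"
      by (rule gdir_has_sum[OF dir_conv_gchi]) (use assms in simp)
    show "((\<lambda>x. real (gnorm x) powr (- \<sigma>)) has_sum (\<Sum>\<^sub>\<infinity>x. real (gnorm x) powr (- \<sigma>))) UNIV"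
      by (intro has_sum_infsum gnorm_powr_summable assms)
    show "cmod (gchi 0 x * of_nat (gnorm x) powr (- of_real \<sigma>)) \<le> real (gnorm x) powr (- \<sigma>)" for x
      unfolding gdir_term_norm by (simp add: gchi_def)
  qed
  also have "\<dots> \<le> 12 * (1 + 1 / (2 * \<sigma> - 2))" by (rule gnorm_powr_infsum_le[OF assms])
  finally show ?thesis by (simp add: gseries_gdir norm_divide)
qed

text \<open>A zero at 1 + i t would give the product in \<open>three_four_one\<close> at most three
  factors 1 / (\<sigma> - 1) against four factors \<sigma> - 1, so it would tend to 0. The third
  factor stays bounded since \<open>lfun (2 * k)\<close> is entire.\<close>

theorem lfun_nonzero_line_1:
  assumes k: "k \<ge> 1"
  shows "lfun k (Complex 1 t) \<noteq> 0"
proof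
  assume zero: "lfun k (Complex 1 t) = 0"
  define p where "p \<sigma> = Complex \<sigma> t" for \<sigma>
  have hol: "lfun j holomorphic_on UNIV" if "j \<ge> 1" for j by (rule lfun_holomorphic[OF that])
  obtain d where d: "(lfun k has_field_derivative d) (at (Complex 1 t))"
    using hol[OF k] by (meson UNIV_I field_differentiable_def holomorphic_on_imp_differentiable_at open_UNIV)
  have limC: "((\<lambda>\<sigma>. Complex \<sigma> u) \<longlongrightarrow> Complex 1 u) (at_right 1)" for u
    by (intro tendsto_Complex tendsto_intros)
  have ne: "eventually (\<lambda>\<sigma>. Complex \<sigma> t \<noteq> Complex 1 t) (at_right (1::real))"
    by (rule eventually_at_right_less[THEN eventually_mono]) auto
  have "((\<lambda>z. (lfun k z - lfun k (Complex 1 t)) / (z - Complex 1 t)) \<longlongrightarrow> d) (at (Complex 1 t))"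
    using d by (simp add: has_field_derivative_iff)
  then have "((\<lambda>\<sigma>. (lfun k (Complex \<sigma> t) - lfun k (Complex 1 t)) / (Complex \<sigma> t - Complex 1 t)) \<longlongrightarrow> d) (at_right 1)"
    by (rule filterlim_compose) (use limC[of t] ne in \<open>simp add: filterlim_at\<close>)
  moreover have "Complex \<sigma> t - Complex 1 t = of_real (\<sigma> - 1)" for \<sigma> by (simp add: complex_eq_iff)
  ultimately have q: "((\<lambda>\<sigma>. lfun k (Complex \<sigma> t) / of_real (\<sigma> - 1)) \<longlongrightarrow> d) (at_right 1)"
    using zero by simp
  have "isCont (lfun (2 * k)) (Complex 1 (2 * t))"
    using hol[of "2 * k"] k holomorphic_on_imp_continuous_on continuous_on_eq_continuous_at open_UNIV by fastforce
  then have l2: "((\<lambda>\<sigma>. lfun (2 * k) (Complex \<sigma> (2 * t))) \<longlongrightarrow> lfun (2 * k) (Complex 1 (2 * t))) (at_right 1)"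
    using limC isCont_tendsto_compose by blast
  \<comment> \<open>The upper bound for the product of \<open>three_four_one\<close>, rearranged as
    quantities with finite limits times one remaining \<sigma> - 1.\<close>
  have "((\<lambda>\<sigma>. (3 * ((\<sigma> - 1) + 1 / 2)) ^ 3 * cmod (lfun k (Complex \<sigma> t) / of_real (\<sigma> - 1)) ^ 4 *
      cmod (lfun (2 * k) (Complex \<sigma> (2 * t))) * (\<sigma> - 1)) \<longlongrightarrow>
      (3 * ((1 - 1) + 1 / 2)) ^ 3 * cmod d ^ 4 * cmod (lfun (2 * k) (Complex 1 (2 * t))) * (1 - 1)) (at_right 1)"
    by (intro tendsto_intros q l2) auto
  then have "((\<lambda>\<sigma>. (3 * ((\<sigma> - 1) + 1 / 2)) ^ 3 * cmod (lfun k (Complex \<sigma> t) / of_real (\<sigma> - 1)) ^ 4 *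
      cmod (lfun (2 * k) (Complex \<sigma> (2 * t))) * (\<sigma> - 1)) \<longlongrightarrow> 0) (at_right (1::real))" by simp
  then have "eventually (\<lambda>\<sigma>. (3 * ((\<sigma> - 1) + 1 / 2)) ^ 3 * cmod (lfun k (Complex \<sigma> t) / of_real (\<sigma> - 1)) ^ 4 *
      cmod (lfun (2 * k) (Complex \<sigma> (2 * t))) * (\<sigma> - 1) < 1) (at_right (1::real))"
    by (rule order_tendstoD) simp
  moreover have "eventually (\<lambda>\<sigma>. \<sigma> > 1) (at_right (1::real))" by (rule eventually_at_right_less)
  ultimately have "eventually (\<lambda>\<sigma>. False) (at_right (1::real))"
  proof eventually_elim
    case (elim \<sigma>)
    define e where "e = \<sigma> - 1"
    have e: "e > 0" using elim by (simp add: e_def)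
    have "1 \<le> cmod (gseries 0 (of_real \<sigma>)) ^ 3 * cmod (gseries k (Complex \<sigma> t)) ^ 4 * cmod (gseries (2 * k) (Complex \<sigma> (2 * t)))"
      by (rule three_four_one) (use elim in simp)
    also have "\<dots> = cmod (gseries 0 (of_real \<sigma>)) ^ 3 * cmod (lfun k (Complex \<sigma> t)) ^ 4 * cmod (lfun (2 * k) (Complex \<sigma> (2 * t)))"
      using elim k by (simp add: lfun_eq_gseries)
    also have "\<dots> \<le> (3 * (1 + 1 / (2 * \<sigma> - 2))) ^ 3 * cmod (lfun k (Complex \<sigma> t)) ^ 4 * cmod (lfun (2 * k) (Complex \<sigma> (2 * t)))"
      using gseries_0_bound[of \<sigma>] elim by (intro mult_right_mono power_mono) auto
    also have "(3 * (1 + 1 / (2 * \<sigma> - 2))) = (3 * (e + 1 / 2)) / e"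
      using e by (simp add: e_def field_simps)
    also have "((3 * (e + 1 / 2)) / e) ^ 3 * cmod (lfun k (Complex \<sigma> t)) ^ 4 * cmod (lfun (2 * k) (Complex \<sigma> (2 * t))) =
        (3 * (e + 1 / 2)) ^ 3 * cmod (lfun k (Complex \<sigma> t) / of_real e) ^ 4 * cmod (lfun (2 * k) (Complex \<sigma> (2 * t))) * e"
      using e by (simp add: norm_divide power_divide field_simps eval_nat_numeral)
    also have "\<dots> < 1" using elim by (simp add: e_def)
    finally show False by simp
  qed
  then show False by (simp add: trivial_limit_at_right_real)
qed

lemma lfun_nonzero_right:
  assumes "k \<ge> 1" "Re s \<ge> 1"
  shows "lfun k s \<noteq> 0"
proof (cases "Re s > 1")
  case True
  then show ?thesis using assms by (simp add: lfun_eq_gseries gseries_eq_exp)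
next
  case False
  then have "s = Complex 1 (Im s)" using assms by (simp add: complex_eq_iff)
  then show ?thesis using lfun_nonzero_line_1[OF assms(1)] by metis
qed

section \<open>Positivity of the logarithmic derivative\<close>

text \<open>Harnack's inequality for functions with positive real part, by the Schwarz lemma. It is
  the device by which information at the centre of a disc, taken far to the right, is carried close
  to the critical line.\<close>

lemma pos_real_part_bound:
  assumes hol: "f holomorphic_on ball a R" and pos: "\<And>z. z \<in> ball a R \<Longrightarrow> Re (f z) > 0"
    and z: "dist a z \<le> r" "r < R" and r: "r \<ge> 0"
  shows "cmod (f z) \<le> cmod (f a) * ((R + r) / (R - r))"
proof -
  have R: "R > 0" using z r by simp
  have a: "a \<in> ball a R" using R by simp
  \<comment> \<open>The Cayley transform maps the right half-plane to the unit disc and the value f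
    a to 0.\<close>
  define g where "g w = (f (a + of_real R * w) - f a) / (f (a + of_real R * w) + cnj (f a))" for w
  have im: "a + of_real R * w \<in> ball a R" if "cmod w < 1" for w
    using that R by (simp add: dist_norm norm_mult)
  have den: "f (a + of_real R * w) + cnj (f a) \<noteq> 0" if "cmod w < 1" for w
  proof -
    have "Re (f (a + of_real R * w) + cnj (f a)) > 0" using pos[OF im[OF that]] pos[OF a] by simp
    then show ?thesis by (metis zero_complex.simps(1) less_irrefl)
  qed
  have comp: "(\<lambda>w. f (a + of_real R * w)) holomorphic_on ball 0 1"
  proof -
    have "(\<lambda>w. a + of_real R * w) holomorphic_on ball 0 1" by (intro holomorphic_intros)
    then have "f \<circ> (\<lambda>w. a + of_real R * w) holomorphic_on ball 0 1"
      by (rule holomorphic_on_compose_gen[OF _ hol]) (use im in auto)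
    then show ?thesis by (simp add: o_def)
  qed
  have ghol: "g holomorphic_on ball 0 1"
    unfolding g_def by (intro holomorphic_intros comp) (use den in auto)
  have glt: "cmod (g w) < 1" if "cmod w < 1" for w
  proof -
    let ?u = "f (a + of_real R * w)" and ?v = "f a"
    have "Re ?u > 0" "Re ?v > 0" using pos[OF im[OF that]] pos[OF a] by auto
    then have "(cmod (?u - ?v))\<^sup>2 < (cmod (?u + cnj ?v))\<^sup>2"
      unfolding cmod_power2 using mult_pos_pos[of "Re ?u" "Re ?v"]
      by (simp add: power2_eq_square algebra_simps)
    then have "cmod (?u - ?v) < cmod (?u + cnj ?v)" by (rule power_less_imp_less_base) simp
    then show ?thesis unfolding g_def norm_divide using den[OF that] by simp
  qed
  define w where "w = (z - a) / of_real R"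
  have wR: "a + of_real R * w = z" using R by (simp add: w_def)
  have wr: "cmod w \<le> r / R" using z(1) R by (simp add: w_def norm_divide dist_norm norm_minus_commute divide_right_mono)
  have w1: "cmod w < 1" using wr z(2) R by (simp add: order_le_less_trans)
  have gw: "cmod (g w) \<le> cmod w"
    by (rule Schwarz_Lemma(1)[OF ghol _ glt w1]) (auto simp: g_def)
  have gz: "cmod (g w) \<le> r / R" using gw wr by simp
  have g1: "r / R < 1" using z(2) R by simp
  have g0: "1 - g w \<noteq> 0" using glt[OF w1] by auto
  have "g w * (f z + cnj (f a)) = f z - f a"
    using den[OF w1] unfolding wR[symmetric] g_def by simp
  then have "f z * (1 - g w) = f a + cnj (f a) * g w" by (simp add: algebra_simps)
  then have "cmod (f z) * cmod (1 - g w) = cmod (f a + cnj (f a) * g w)" by (metis norm_mult)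
  also have "\<dots> \<le> cmod (f a) + cmod (f a) * cmod (g w)"
    by (metis norm_triangle_ineq norm_mult complex_mod_cnj)
  also have "\<dots> \<le> cmod (f a) * (1 + r / R)"
    using mult_left_mono[OF gz, of "cmod (f a)"] by (simp add: distrib_left)
  finally have 1: "cmod (f z) * cmod (1 - g w) \<le> cmod (f a) * (1 + r / R)" .
  have "1 - r / R \<le> cmod (1 - g w)"
    using gz norm_triangle_ineq2[of 1 "g w"] by simp
  then have "cmod (f z) * (1 - r / R) \<le> cmod (f z) * cmod (1 - g w)"
    by (intro mult_left_mono) auto
  with 1 have "cmod (f z) * (1 - r / R) \<le> cmod (f a) * (1 + r / R)" by simp
  then have "cmod (f z) \<le> cmod (f a) * (1 + r / R) / (1 - r / R)"
    using g1 by (simp add: pos_le_divide_eq)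
  also have "\<dots> = cmod (f a) * ((R + r) / (R - r))"
    using R z(2) by (simp add: field_simps)
  finally show ?thesis .
qed

lemma power_growth_bound:
  assumes e: "e > 0"
  shows "\<exists>Y. \<forall>y\<ge>Y. C * (1 + y * sqrt y) + M \<le> e * y\<^sup>2"
proof -
  have "filterlim (\<lambda>y::real. e * y\<^sup>2 - (C * (1 + y * sqrt y) + M)) at_top at_top"
    using e by real_asymp
  then have "eventually (\<lambda>y. e * y\<^sup>2 - (C * (1 + y * sqrt y) + M) \<ge> 0) at_top"
    unfolding filterlim_at_top by blast
  then show ?thesis unfolding eventually_at_top_linorder by auto
qed

text \<open>The auxiliary factor \<open>exp (e s^2)\<close> decays on vertical lines faster than the admissible growth.\<close>

lemma phragmen_lindelof_strip:
  assumes hol: "f holomorphic_on S" and S: "open S" "{s. a \<le> Re s \<and> Re s \<le> b} \<subseteq> S"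
    and left: "\<And>s. Re s = a \<Longrightarrow> cmod (f s) \<le> 1" and right: "\<And>s. Re s = b \<Longrightarrow> cmod (f s) \<le> 1"
    and growth: "\<And>s. a \<le> Re s \<Longrightarrow> Re s \<le> b \<Longrightarrow> cmod (f s) \<le> exp (C * (1 + \<bar>Im s\<bar> * sqrt \<bar>Im s\<bar>))"
    and s: "a \<le> Re s" "Re s \<le> b"
  shows "cmod (f s) \<le> 1"
proof -
  define M where "M = (max \<bar>a\<bar> \<bar>b\<bar>)\<^sup>2"
  have xM: "(Re z)\<^sup>2 \<le> M" if "a \<le> Re z" "Re z \<le> b" for z
    unfolding M_def by (rule power2_le_iff_abs_le[THEN iffD2]) (use that in auto)
  have main: "cmod (f s) * exp (e * ((Re s)\<^sup>2 - (Im s)\<^sup>2)) \<le> exp (e * M)" if e: "e > 0" for e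
  proof -
    define g where "g z = f z * exp (of_real e * z\<^sup>2)" for z
    have ng: "cmod (g z) = cmod (f z) * exp (e * ((Re z)\<^sup>2 - (Im z)\<^sup>2))" for z
      by (simp add: g_def norm_mult power2_eq_square)
    obtain Y0 where Y0: "\<And>y. y \<ge> Y0 \<Longrightarrow> C * (1 + y * sqrt y) + 0 \<le> e * y\<^sup>2"
      using power_growth_bound[OF e] by blast
    \<comment> \<open>Tall enough to enclose s and to let the auxiliary factor absorb the growth on
      the horizontal edges.\<close>
    define Y where "Y = max (max Y0 1) (\<bar>Im s\<bar> + 1)"
    define K where "K = cbox (Complex a (- Y)) (Complex b Y)"
    have K: "z \<in> K \<longleftrightarrow> a \<le> Re z \<and> Re z \<le> b \<and> \<bar>Im z\<bar> \<le> Y" for z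
      by (auto simp: K_def in_cbox_complex_iff)
    have KS: "K \<subseteq> S" using K S(2) by auto
    have g_hol: "g holomorphic_on S" unfolding g_def by (intro holomorphic_intros hol)
    have le: "exp (e * ((Re z)\<^sup>2 - (Im z)\<^sup>2)) \<le> exp (e * M)" if "a \<le> Re z" "Re z \<le> b" for z
    proof -
      have "(Re z)\<^sup>2 - (Im z)\<^sup>2 \<le> M" using xM[OF that] zero_le_power2[of "Im z"] by linarith
      then show ?thesis using e by (simp add: mult_left_mono)
    qed
    have "cmod (g s) \<le> exp (e * M)"
    proof (rule maximum_modulus_frontier[of g K])
      show "g holomorphic_on interior K"
        by (rule holomorphic_on_subset[OF g_hol]) (use KS interior_subset in blast)
      show "continuous_on (closure K) g"
        using holomorphic_on_imp_continuous_on[OF g_hol] KS unfolding K_def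
        by (auto intro: continuous_on_subset)
      show "bounded K" by (simp add: K_def)
      show "s \<in> K" using s by (simp add: K Y_def)
      fix z assume "z \<in> frontier K"
      then have zK: "z \<in> K" and zb: "z \<notin> box (Complex a (- Y)) (Complex b Y)"
        unfolding K_def frontier_cbox by auto
      have "\<not> (a < Re z \<and> Re z < b \<and> - Y < Im z \<and> Im z < Y)"
        using zb by (simp add: in_box_complex_iff)
      moreover have "a \<le> Re z" "Re z \<le> b" "\<bar>Im z\<bar> \<le> Y" using zK K by auto
      ultimately consider "Re z = a" | "Re z = b" | "\<bar>Im z\<bar> = Y" by linarith
      then show "cmod (g z) \<le> exp (e * M)"
      proof cases
        case 1
        have "cmod (g z) \<le> 1 * exp (e * M)"
          unfolding ng using left[OF 1] le[of z] zK K by (intro mult_mono) auto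
        then show ?thesis by simp
      next
        case 2
        have "cmod (g z) \<le> 1 * exp (e * M)"
          unfolding ng using right[OF 2] le[of z] zK K by (intro mult_mono) auto
        then show ?thesis by simp
      next
        case 3
        have ab: "a \<le> Re z" "Re z \<le> b" using zK K by auto
        have "cmod (g z) \<le> exp (C * (1 + Y * sqrt Y)) * exp (e * ((Re z)\<^sup>2 - (Im z)\<^sup>2))"
          unfolding ng using growth[OF ab] 3 by (intro mult_right_mono) auto
        also have "\<dots> = exp (C * (1 + Y * sqrt Y) + e * ((Re z)\<^sup>2 - (Im z)\<^sup>2))" by (simp add: exp_add)
        also have "(Im z)\<^sup>2 = Y\<^sup>2" using 3 by (metis power2_abs)
        also have "exp (C * (1 + Y * sqrt Y) + e * ((Re z)\<^sup>2 - Y\<^sup>2)) \<le> exp (e * M)"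
        proof -
          have "C * (1 + Y * sqrt Y) \<le> e * Y\<^sup>2" using Y0[of Y] by (simp add: Y_def)
          moreover have "e * (Re z)\<^sup>2 \<le> e * M" using xM[OF ab] e by simp
          ultimately show ?thesis by (simp add: algebra_simps)
        qed
        finally show ?thesis .
      qed
    qed
    then show ?thesis by (simp only: ng)
  qed
  have "((\<lambda>e. cmod (f s) * exp (e * ((Re s)\<^sup>2 - (Im s)\<^sup>2))) \<longlongrightarrow> cmod (f s) * exp (0 * ((Re s)\<^sup>2 - (Im s)\<^sup>2))) (at_right 0)"
    and "((\<lambda>e. exp (e * M)) \<longlongrightarrow> exp (0 * M)) (at_right 0)" by (intro tendsto_intros)+
  moreover have "eventually (\<lambda>e. cmod (f s) * exp (e * ((Re s)\<^sup>2 - (Im s)\<^sup>2)) \<le> exp (e * M)) (at_right 0)"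
    using eventually_at_right_less by eventually_elim (rule main)
  ultimately have "cmod (f s) * exp (0 * ((Re s)\<^sup>2 - (Im s)\<^sup>2)) \<le> exp (0 * M)"
    by (intro tendsto_le[OF trivial_limit_at_right_real])
  then show ?thesis by simp
qed

text \<open>The squared modulus is differentiable everywhere, zeros of G included, and links
  monotonicity of |G| in the real direction with the sign of Re (G'/G).\<close>

lemma norm_square_deriv:
  assumes "G holomorphic_on UNIV"
  shows "((\<lambda>x. (cmod (G (Complex x y)))\<^sup>2) has_real_derivative
           2 * Re (deriv G (Complex x y) * cnj (G (Complex x y)))) (at x)"
proof -
  have "(G has_field_derivative deriv G (Complex x y)) (at (Complex x y))"
    using assms by (meson UNIV_I holomorphic_derivI open_UNIV)
  moreover have "((\<lambda>x. Complex x y) has_vector_derivative 1) (at x)"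
  proof -
    have "((\<lambda>x. of_real x + \<i> * of_real y) has_vector_derivative 1) (at x)"
      by (auto intro!: derivative_eq_intros)
    then show ?thesis by (simp add: Complex_eq)
  qed
  ultimately have v: "((\<lambda>x. G (Complex x y)) has_vector_derivative 1 * deriv G (Complex x y)) (at x)"
    using field_vector_diff_chain_at[of "\<lambda>x. Complex x y" 1 x G] by (simp add: o_def)
  have R: "((\<lambda>x. Re (G (Complex x y))) has_real_derivative Re (deriv G (Complex x y))) (at x)"
    and I: "((\<lambda>x. Im (G (Complex x y))) has_real_derivative Im (deriv G (Complex x y))) (at x)"
    using bounded_linear.has_vector_derivative[OF bounded_linear_Re v]
      bounded_linear.has_vector_derivative[OF bounded_linear_Im v]
    by (simp_all add: has_real_derivative_iff_has_vector_derivative)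
  have "((\<lambda>x. (Re (G (Complex x y)))\<^sup>2 + (Im (G (Complex x y)))\<^sup>2) has_real_derivative
      2 * Re (deriv G (Complex x y) * cnj (G (Complex x y)))) (at x)"
    by (rule DERIV_cong[OF DERIV_add[OF DERIV_power[OF R, of 2] DERIV_power[OF I, of 2]]])
      (simp add: algebra_simps)
  then show ?thesis by (simp add: cmod_power2)
qed

lemma Re_log_deriv: "G \<noteq> 0 \<Longrightarrow> Re (D / G) = Re (D * cnj G) / (cmod G)\<^sup>2"
  by (simp add: Re_divide cmod_power2)

text \<open>On the disc about c + i T that touches the critical line G has no zeros, so it has a
  logarithm there, and ln B + 1 - log G has positive real part. Harnack's inequality propagates the
  lower bound from the centre, with the same order of growth.\<close>

lemma growth_lower_bound:
  assumes hol: "G holomorphic_on UNIV" and nz: "\<And>s. Re s > 1 / 2 \<Longrightarrow> G s \<noteq> 0"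
    and c: "c > 1 / 2" and B: "B \<ge> 1" "\<And>s. 1 / 2 \<le> Re s \<Longrightarrow> Re s \<le> 2 * c \<Longrightarrow> cmod (G s) \<le> B"
    and C: "C \<ge> 0" "\<And>T. cmod (G (Complex c T)) \<ge> exp (- C * (1 + \<bar>T\<bar> * sqrt \<bar>T\<bar>))"
    and \<delta>: "\<delta> > 0"
  obtains C' where "C' \<ge> 0" "\<And>s. 1 / 2 + \<delta> \<le> Re s \<Longrightarrow> Re s \<le> c \<Longrightarrow>
     cmod (G s) \<ge> exp (- C' * (1 + \<bar>Im s\<bar> * sqrt \<bar>Im s\<bar>))"
proof -
  define R where "R = c - 1 / 2"
  \<comment> \<open>The Harnack factor for radius R - \<delta> inside R. For \<delta> > R no s
    satisfies the constraints, and the maximum keeps q nonnegative in that case as well.\<close>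
  define q where "q = max 0 ((R + (R - \<delta>)) / (R - (R - \<delta>)))"
  define A where "A = 2 * ln B + 1 + pi + C"
  have A: "A \<ge> 0" using B C by (simp add: A_def)
  have "cmod (G s) \<ge> exp (- (A * q) * (1 + \<bar>Im s\<bar> * sqrt \<bar>Im s\<bar>))" if s: "1 / 2 + \<delta> \<le> Re s" "Re s \<le> c" for s
  proof -
    define T where "T = Im s"
    define w where "w = 1 + \<bar>T\<bar> * sqrt \<bar>T\<bar>"
    have w: "w \<ge> 1" by (simp add: w_def)
    define a where "a = Complex c T"
    have ball: "1 / 2 < Re z \<and> Re z < 2 * c" if "z \<in> ball a R" for z
    proof -
      have "\<bar>Re (a - z)\<bar> < R" using that abs_Re_le_cmod[of "a - z"] by (simp add: dist_norm)
      then show ?thesis using c by (auto simp: a_def R_def abs_less_iff)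
    qed
    have R: "R > 0" using c by (simp add: R_def)
    have "\<exists>g. g holomorphic_on ball a R \<and> (\<forall>z\<in>ball a R. G z = exp (g z))"
      using contractible_imp_holomorphic_log[of G "ball a R"] holomorphic_on_subset[OF hol] nz ball
      by (metis convex_ball convex_imp_contractible subset_UNIV)
    then obtain g0 where g0: "g0 holomorphic_on ball a R" "\<And>z. z \<in> ball a R \<Longrightarrow> G z = exp (g0 z)" by blast
    define g where "g z = g0 z - g0 a + Ln (G a)" for z
    have aR: "a \<in> ball a R" using R by simp
    have Ga: "G a \<noteq> 0" using nz ball[OF aR] by blast
    have g: "g holomorphic_on ball a R" "\<And>z. z \<in> ball a R \<Longrightarrow> G z = exp (g z)"
      using g0 Ga aR unfolding g_def by (auto intro!: holomorphic_intros simp: exp_add exp_diff)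
    define f where "f z = of_real (ln B + 1) - g z" for z
    have Re_g: "Re (g z) = ln (cmod (G z))" if "z \<in> ball a R" for z
      using g(2)[OF that] by simp
    have pos: "Re (f z) > 0" if "z \<in> ball a R" for z
    proof -
      have "cmod (G z) \<le> B" using B(2)[of z] ball[OF that] by simp
      then have "ln (cmod (G z)) \<le> ln B" using nz[of z] ball[OF that] by (simp add: ln_mono)
      then show ?thesis using Re_g[OF that] by (simp add: f_def)
    qed
    have fa: "cmod (f a) \<le> A * w"
    proof -
      have ga: "g a = Ln (G a)" by (simp add: g_def)
      have up: "ln (cmod (G a)) \<le> ln B"
        using B(2)[of a] ball[OF aR] Ga by (simp add: ln_mono)
      have "- (C * w) \<le> ln (cmod (G a))"
        using C(2)[of T] Ga unfolding a_def w_def by (simp add: ln_ge_iff)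
      then have "\<bar>ln (cmod (G a))\<bar> \<le> ln B + C * w"
        using up B(1) C(1) w by (smt (verit) ln_ge_zero mult_nonneg_nonneg)
      moreover have "cmod (Ln (G a)) \<le> \<bar>ln (cmod (G a))\<bar> + pi"
        using cmod_le[of "Ln (G a)"] Im_Ln_le_pi[OF Ga] mpi_less_Im_Ln[OF Ga] Re_Ln[OF Ga] by (simp add: abs_le_iff)
      moreover have "cmod (f a) \<le> \<bar>ln B + 1\<bar> + cmod (Ln (G a))"
        unfolding f_def ga by (metis norm_triangle_ineq4 norm_of_real)
      ultimately have "cmod (f a) \<le> (2 * ln B + 1 + pi) * 1 + C * w" using B(1) by simp
      also have "\<dots> \<le> (2 * ln B + 1 + pi) * w + C * w"
        using w B(1) by (intro add_right_mono mult_left_mono) auto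
      finally show ?thesis by (simp add: A_def algebra_simps)
    qed
    have d: "dist a s \<le> R - \<delta>"
    proof -
      have "a - s = of_real (c - Re s)" by (simp add: a_def T_def complex_eq_iff)
      then have "dist a s = \<bar>c - Re s\<bar>" by (simp only: dist_norm norm_of_real)
      then show ?thesis using s by (simp add: R_def)
    qed
    have r0: "R - \<delta> \<ge> 0" using d by (meson dist_not_less_zero linorder_not_less order_trans zero_le_dist)
    have fhol: "f holomorphic_on ball a R" unfolding f_def by (intro holomorphic_intros g)
    have "cmod (f s) \<le> cmod (f a) * ((R + (R - \<delta>)) / (R - (R - \<delta>)))"
      by (rule pos_real_part_bound[OF fhol pos d _ r0]) (use \<delta> in auto)
    also have "\<dots> \<le> (A * w) * q"
      using fa A w \<delta> r0 by (intro mult_mono) (auto simp: q_def)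
    finally have "cmod (f s) \<le> A * q * w" by (simp add: mult_ac)
    then have "Re (f s) \<le> A * q * w" using complex_Re_le_cmod[of "f s"] by linarith
    moreover have sR: "s \<in> ball a R" using d \<delta> by simp
    ultimately have "ln (cmod (G s)) \<ge> - (A * q * w)" using Re_g[OF sR] ln_ge_zero[OF B(1)] by (simp add: f_def)
    then have "exp (- (A * q * w)) \<le> cmod (G s)"
      using nz[of s] ball[OF sR] by (simp add: ln_ge_iff)
    then show ?thesis by (simp add: w_def T_def)
  qed
  moreover have "A * q \<ge> 0" using A by (simp add: q_def)
  ultimately show thesis using that by blast
qed

text \<open>For \<open>Q s = G (s - \<delta>) / G (s + \<delta>)\<close> the symmetry of \<open>G\<close> gives \<open>|Q| = 1\<close> on the line
  \<open>Re s = 1/2\<close>, so by Phragmen-Lindelof \<open>|G (x + i y)|\<close> increases with \<open>x\<close>. This replaces the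
  Hadamard product.\<close>

theorem Re_log_deriv_nonneg:
  assumes hol: "G holomorphic_on UNIV" and nz: "\<And>s. Re s > 1 / 2 \<Longrightarrow> G s \<noteq> 0"
    and sym: "\<And>s. cmod (G (1 - cnj s)) = cmod (G s)"
    and strip: "\<And>R. \<exists>B. \<forall>s. \<bar>Re s\<bar> \<le> R \<longrightarrow> cmod (G s) \<le> B"
    and c: "c \<ge> 2"
    and C: "C \<ge> 0" "\<And>T. cmod (G (Complex c T)) \<ge> exp (- C * (1 + \<bar>T\<bar> * sqrt \<bar>T\<bar>))"
    and right: "\<And>s. Re s \<ge> c - 2 \<Longrightarrow> Re s > 1 / 2 \<Longrightarrow> Re (deriv G s / G s) \<ge> 0"
    and s: "Re s > 1 / 2"
  shows "Re (deriv G s / G s) \<ge> 0"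
proof (cases "Re s \<ge> c - 2")
  case True
  then show ?thesis using right s by blast
next
  case False
  define x y where "x = Re s" and "y = Im s"
  have sxy: "s = Complex x y" by (simp add: x_def y_def)
  define \<phi> where "\<phi> u = (cmod (G (Complex u y)))\<^sup>2" for u
  have c3: "c - 2 > 1 / 2" using False s by simp
  obtain B0 where B0: "\<And>s. \<bar>Re s\<bar> \<le> 2 * c \<Longrightarrow> cmod (G s) \<le> B0" using strip by blast
  define B where "B = max 1 B0"
  have B: "B \<ge> 1" "\<And>s. \<bar>Re s\<bar> \<le> 2 * c \<Longrightarrow> cmod (G s) \<le> B" using B0 by (auto simp: B_def le_max_iff_disj)
  have mono: "cmod (G (Complex (x - \<delta>) y)) \<le> cmod (G (Complex (x + \<delta>) y))" if \<delta>: "\<delta> > 0" "\<delta> < 1 / 2" for \<delta>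
  proof -
    obtain C' where C': "C' \<ge> 0" "\<And>s. 1 / 2 + \<delta> \<le> Re s \<Longrightarrow> Re s \<le> c \<Longrightarrow>
       cmod (G s) \<ge> exp (- C' * (1 + \<bar>Im s\<bar> * sqrt \<bar>Im s\<bar>))"
      by (rule growth_lower_bound[OF hol nz _ B(1) _ C \<delta>(1)]) (use c B(2) in auto)
    define Q where "Q s = G (s - of_real \<delta>) / G (s + of_real \<delta>)" for s
    define S where "S = {s. Re s > 1 / 2 - \<delta>}"
    have shift: "(\<lambda>s. G (s + z)) holomorphic_on A" for z A
    proof -
      have "(\<lambda>s. s + z) holomorphic_on A" by (intro holomorphic_intros)
      then have "G \<circ> (\<lambda>s. s + z) holomorphic_on A" by (rule holomorphic_on_compose_gen[OF _ hol]) simp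
      then show ?thesis by (simp add: o_def)
    qed
    have Qhol: "Q holomorphic_on S"
      unfolding Q_def using shift[of "- of_real \<delta>"] shift[of "of_real \<delta>"] nz
      by (intro holomorphic_on_divide) (auto simp: S_def)
    have "cmod (Q s) \<le> 1"
    proof (rule phragmen_lindelof_strip[OF Qhol])
      show "open S" unfolding S_def by (rule open_halfspace_Re_gt)
      show "{s. 1 / 2 \<le> Re s \<and> Re s \<le> c - 1} \<subseteq> S" using \<delta> by (auto simp: S_def)
      show "cmod (Q z) \<le> 1" if z: "Re z = 1 / 2" for z
      proof -
        have "z - of_real \<delta> = 1 - cnj (z + of_real \<delta>)" using z by (simp add: complex_eq_iff)
        then have "cmod (G (z - of_real \<delta>)) = cmod (G (z + of_real \<delta>))" using sym by metis
        then show ?thesis by (simp add: Q_def norm_divide)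
      qed
      \<comment> \<open>On the right edge the positivity assumed for Re s >= c - 2 makes |G|
        nondecreasing; as \<delta> < 1/2, both shifted points lie in that range.\<close>
      show "cmod (Q z) \<le> 1" if z: "Re z = c - 1" for z
      proof -
        have "(cmod (G (Complex (c - 1 - \<delta>) (Im z))))\<^sup>2 \<le> (cmod (G (Complex (c - 1 + \<delta>) (Im z))))\<^sup>2"
        proof (rule DERIV_nonneg_imp_nondecreasing[where f = "\<lambda>x. (cmod (G (Complex x (Im z))))\<^sup>2"])
          fix u assume u: "c - 1 - \<delta> \<le> u" "u \<le> c - 1 + \<delta>"
          have "Re (deriv G (Complex u (Im z)) / G (Complex u (Im z))) \<ge> 0"
            by (rule right) (use u \<delta> c3 in auto)
          moreover have "G (Complex u (Im z)) \<noteq> 0" by (rule nz) (use u \<delta> c3 in auto)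
          ultimately have "Re (deriv G (Complex u (Im z)) * cnj (G (Complex u (Im z)))) \<ge> 0"
            by (simp add: Re_log_deriv zero_le_divide_iff del: complex_cnj_zero_iff)
          then show "\<exists>d. ((\<lambda>x. (cmod (G (Complex x (Im z))))\<^sup>2) has_real_derivative d) (at u) \<and> 0 \<le> d"
            by (intro exI[of _ "2 * Re (deriv G (Complex u (Im z)) * cnj (G (Complex u (Im z))))"] conjI
                norm_square_deriv[OF hol]) simp
        qed (use \<delta> in auto)
        then have "cmod (G (Complex (c - 1 - \<delta>) (Im z))) \<le> cmod (G (Complex (c - 1 + \<delta>) (Im z)))"
          by (rule power2_le_imp_le) simp
        moreover have "z - of_real \<delta> = Complex (c - 1 - \<delta>) (Im z)" "z + of_real \<delta> = Complex (c - 1 + \<delta>) (Im z)"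
          using z by (auto simp: complex_eq_iff)
        moreover have "G (z + of_real \<delta>) \<noteq> 0" by (rule nz) (use z c \<delta> in auto)
        ultimately show ?thesis by (simp add: Q_def norm_divide)
      qed
      show "cmod (Q z) \<le> exp ((ln B + C') * (1 + \<bar>Im z\<bar> * sqrt \<bar>Im z\<bar>))"
        if z: "1 / 2 \<le> Re z" "Re z \<le> c - 1" for z
      proof -
        define w where "w = 1 + \<bar>Im z\<bar> * sqrt \<bar>Im z\<bar>"
        have w: "w \<ge> 1" by (simp add: w_def)
        have "cmod (G (z - of_real \<delta>)) \<le> B" by (rule B(2)) (use z \<delta> c in auto)
        also have "B = exp (ln B * 1)" using B by simp
        also have "\<dots> \<le> exp (ln B * w)" using w B(1) by (subst exp_le_cancel_iff) (intro mult_left_mono, auto)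
        finally have 1: "cmod (G (z - of_real \<delta>)) \<le> exp (ln B * w)" .
        have 2: "cmod (G (z + of_real \<delta>)) \<ge> exp (- C' * w)"
          using C'(2)[of "z + of_real \<delta>"] z \<delta> by (simp add: w_def)
        have "cmod (Q z) \<le> exp (ln B * w) / exp (- C' * w)"
          unfolding Q_def norm_divide using 1 2 by (intro frac_le) auto
        also have "\<dots> = exp ((ln B + C') * w)" by (simp add: exp_diff[symmetric] algebra_simps)
        finally show ?thesis by (simp add: w_def)
      qed
    qed (use False s in auto)
    moreover have "G (s + of_real \<delta>) \<noteq> 0" by (rule nz) (use s \<delta> in auto)
    ultimately have "cmod (G (s - of_real \<delta>)) \<le> cmod (G (s + of_real \<delta>))"
      by (simp add: Q_def norm_divide divide_le_eq_1)
    moreover have "s - of_real \<delta> = Complex (x - \<delta>) y" "s + of_real \<delta> = Complex (x + \<delta>) y"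
      by (auto simp: complex_eq_iff x_def y_def)
    ultimately show ?thesis by simp
  qed
  have D: "(\<phi> has_real_derivative 2 * Re (deriv G s * cnj (G s))) (at x)"
    unfolding \<phi>_def sxy by (rule norm_square_deriv[OF hol])
  \<comment> \<open>A negative derivative of \<open>\<phi>\<close> at x would contradict the
    symmetric comparison of \<open>\<phi> (x - h)\<close> and \<open>\<phi> (x + h)\<close> for
    small h.\<close>
  have "Re (deriv G s * cnj (G s)) \<ge> 0"
  proof (rule ccontr)
    assume "\<not> ?thesis"
    then have neg: "2 * Re (deriv G s * cnj (G s)) < 0" by simp
    obtain d1 where d1: "d1 > 0" "\<And>h. 0 < h \<Longrightarrow> h < d1 \<Longrightarrow> \<phi> x > \<phi> (x + h)"
      using DERIV_neg_dec_right[OF D neg] by auto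
    obtain d2 where d2: "d2 > 0" "\<And>h. 0 < h \<Longrightarrow> h < d2 \<Longrightarrow> \<phi> x < \<phi> (x - h)"
      using DERIV_neg_dec_left[OF D neg] by auto
    define h where "h = min (min d1 d2) (1 / 2) / 2"
    have h: "h > 0" "h < d1" "h < d2" "h < 1 / 2" using d1 d2 by (auto simp: h_def min_def)
    have "\<phi> (x - h) \<le> \<phi> (x + h)"
      unfolding \<phi>_def by (intro power_mono mono h) auto
    then show False using d1(2)[OF h(1,2)] d2(2)[OF h(1,3)] by simp
  qed
  then show ?thesis using nz[OF s] by (simp add: Re_log_deriv del: complex_cnj_zero_iff)
qed

section \<open>Perron integrals and the Fejer kernel\<close>

lemma has_integral_vertical:
  assumes F: "\<And>s. s \<in> S \<Longrightarrow> (F has_field_derivative f s) (at s)"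
    and S: "\<And>t. t \<in> {c..d} \<Longrightarrow> Complex x t \<in> S" and cd: "c \<le> d"
  shows "((\<lambda>t. f (Complex x t)) has_integral - \<i> * (F (Complex x d) - F (Complex x c))) {c..d}"
proof -
  have "((\<lambda>t. \<i> * f (Complex x t)) has_integral (F (Complex x d) - F (Complex x c))) {c..d}"
  proof (rule fundamental_theorem_of_calculus[OF cd])
    fix t assume t: "t \<in> {c..d}"
    have "((\<lambda>t. of_real x + \<i> * of_real t) has_vector_derivative \<i>) (at t)"
      by (auto intro!: derivative_eq_intros)
    then have "((\<lambda>t. Complex x t) has_vector_derivative \<i>) (at t)" by (simp add: Complex_eq)
    then have "((\<lambda>t. F (Complex x t)) has_vector_derivative \<i> * f (Complex x t)) (at t)"
      using field_vector_diff_chain_at[of "\<lambda>t. Complex x t" \<i> t F "f (Complex x t)"] F[OF S[OF t]]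
      by (simp add: o_def)
    then show "((\<lambda>t. F (Complex x t)) has_vector_derivative \<i> * f (Complex x t)) (at t within {c..d})"
      by (rule has_vector_derivative_at_within)
  qed
  from has_integral_mult_right[OF this, of "- \<i>"] show ?thesis
    by (simp add: mult.assoc[symmetric])
qed

text \<open>Cauchy's theorem for a rectangle through a primitive on a convex domain: the two
  vertical integrals differ by the increments of the primitive along the horizontal edges.\<close>

lemma vertical_shift:
  assumes hol: "f holomorphic_on S" and S: "open S" "convex S"
    and strip: "{s. a \<le> Re s \<and> Re s \<le> b} \<subseteq> S" and ab: "a \<le> b" and T: "T \<ge> 0"
    and M: "\<And>s. a \<le> Re s \<Longrightarrow> Re s \<le> b \<Longrightarrow> \<bar>Im s\<bar> = T \<Longrightarrow> cmod (f s) \<le> M"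
  shows "cmod (integral {- T..T} (\<lambda>t. f (Complex b t)) - integral {- T..T} (\<lambda>t. f (Complex a t))) \<le> 2 * (b - a) * M"
proof -
  obtain F where F: "\<And>s. s \<in> S \<Longrightarrow> (F has_field_derivative f s) (at s)"
    using holomorphic_convex_primitive'[OF S(2,1) hol] S(1) by (metis at_within_open)
  have I: "integral {- T..T} (\<lambda>t. f (Complex x t)) = - \<i> * (F (Complex x T) - F (Complex x (- T)))"
    if "a \<le> x" "x \<le> b" for x
    by (rule integral_unique, rule has_integral_vertical[OF F]) (use strip that T in auto)
  have seg: "cmod (F (Complex b y) - F (Complex a y)) \<le> M * (b - a)" if y: "\<bar>y\<bar> = T" for y
  proof -
    have "cmod (F (Complex b y) - F (Complex a y)) \<le> M * cmod (Complex b y - Complex a y)"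
    proof (rule field_differentiable_bound)
      let ?K = "{s. a \<le> Re s} \<inter> {s. Re s \<le> b} \<inter> {s. Im s \<ge> y} \<inter> {s. Im s \<le> y}"
      show "convex ?K"
        by (intro convex_Int convex_halfspace_Re_ge convex_halfspace_Re_le convex_halfspace_Im_ge convex_halfspace_Im_le)
      show "(F has_field_derivative f z) (at z within ?K)" if "z \<in> ?K" for z
        using F[of z] strip that by (auto intro: has_field_derivative_at_within)
      show "cmod (f z) \<le> M" if "z \<in> ?K" for z using M[of z] that y by auto
    qed (use ab in auto)
    moreover have "Complex b y - Complex a y = of_real (b - a)" by (simp add: complex_eq_iff)
    ultimately show ?thesis using ab by (simp add: abs_of_nonneg del: of_real_diff)
  qed
  have "integral {- T..T} (\<lambda>t. f (Complex b t)) - integral {- T..T} (\<lambda>t. f (Complex a t)) =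
      - \<i> * ((F (Complex b T) - F (Complex a T)) - (F (Complex b (- T)) - F (Complex a (- T))))"
    unfolding I[OF order_refl ab] I[OF ab order_refl] by (simp add: algebra_simps)
  also have "cmod \<dots> = cmod ((F (Complex b T) - F (Complex a T)) - (F (Complex b (- T)) - F (Complex a (- T))))"
    by (simp add: norm_mult)
  also have "\<dots> \<le> M * (b - a) + M * (b - a)"
    by (rule norm_triangle_le_diff) (use seg[of T] seg[of "- T"] T in auto)
  finally show ?thesis by (simp add: algebra_simps)
qed

lemma integral_symmetric_limit:
  fixes g :: "real \<Rightarrow> complex"
  assumes g: "integrable lborel g"
  shows "(\<lambda>n. integral {- real n..real n} g) \<longlonglongrightarrow> (\<integral>t. g t \<partial>lborel)"
proof -
  have "(\<lambda>n. \<integral>t. indicator {- real n..real n} t *\<^sub>R g t \<partial>lborel) \<longlonglongrightarrow> (\<integral>t. g t \<partial>lborel)"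
  proof (rule integral_dominated_convergence[where w = "\<lambda>t. norm (g t)"])
    show "AE t in lborel. (\<lambda>n. indicator {- real n..real n} t *\<^sub>R g t) \<longlonglongrightarrow> g t"
    proof (rule AE_I2, rule tendsto_eventually)
      fix t :: real
      show "eventually (\<lambda>n. indicator {- real n..real n} t *\<^sub>R g t = g t) sequentially"
        using eventually_ge_at_top[of "nat \<lceil>\<bar>t\<bar>\<rceil>"]
        by eventually_elim (auto simp: indicator_def nat_le_iff ceiling_le_iff abs_le_iff)
    qed
  qed (use g in \<open>auto simp: indicator_def intro!: borel_measurable_integrable\<close>)
  moreover have "(\<integral>t. indicator {- real n..real n} t *\<^sub>R g t \<partial>lborel) = integral {- real n..real n} g" for n
  proof -
    have "set_integrable lborel {- real n..real n} g"
      unfolding set_integrable_def by (rule integrable_mult_indicator[OF _ g]) simp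
    from set_borel_integral_eq_integral(2)[OF this] show ?thesis unfolding set_lebesgue_integral_def .
  qed
  ultimately show ?thesis by simp
qed

lemma inverse_square_integrable:
  assumes c: "c > 0"
  shows "integrable lborel (\<lambda>t. 1 / (c\<^sup>2 + t\<^sup>2))" and "(\<integral>t. 1 / (c\<^sup>2 + t\<^sup>2) \<partial>lborel) = pi / c"
    and "T \<ge> 0 \<Longrightarrow> integral {- T..T} (\<lambda>t. 1 / (c\<^sup>2 + t\<^sup>2)) = 2 / c * arctan (T / c)"
proof -
  have D: "((\<lambda>t. arctan (t / c) / c) has_real_derivative 1 / (c\<^sup>2 + t\<^sup>2)) (at t)" for t
  proof -
    have "((\<lambda>t. arctan (t / c) / c) has_real_derivative inverse (1 + (t / c)\<^sup>2) * (1 / c) / c) (at t)"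
      using c by (auto intro!: derivative_eq_intros)
    moreover have "1 + (t / c)\<^sup>2 = (c\<^sup>2 + t\<^sup>2) / c\<^sup>2" using c by (simp add: field_simps)
    then have "inverse (1 + (t / c)\<^sup>2) * (1 / c) / c = 1 / (c\<^sup>2 + t\<^sup>2)"
      using c by (simp add: power2_eq_square)
    ultimately show ?thesis by simp
  qed
  have eq: "1 / (c\<^sup>2 + (0 + c * t)\<^sup>2) = (1 / c\<^sup>2) * inverse (1 + t\<^sup>2)" for t
    using c by (simp add: power_mult_distrib field_simps)
  have "integrable lborel (\<lambda>t. inverse (1 + t\<^sup>2) :: real)" and "(\<integral>t. inverse (1 + t\<^sup>2) \<partial>lborel) = pi"
    using integrable_inverse_1_plus_square LBINT_inverse_1_plus_square
    by (simp_all add: set_integrable_def interval_lebesgue_integral_def set_lebesgue_integral_def einterval_def)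
  then have i: "integrable lborel (\<lambda>t. 1 / (c\<^sup>2 + (0 + c * t)\<^sup>2))"
    and v: "(\<integral>t. 1 / (c\<^sup>2 + (0 + c * t)\<^sup>2) \<partial>lborel) = pi / c\<^sup>2"
    unfolding eq by auto
  show I: "integrable lborel (\<lambda>t. 1 / (c\<^sup>2 + t\<^sup>2))"
    using i lborel_integrable_real_affine_iff[of c "\<lambda>t. 1 / (c\<^sup>2 + t\<^sup>2)" 0] c by simp
  show "(\<integral>t. 1 / (c\<^sup>2 + t\<^sup>2) \<partial>lborel) = pi / c"
    using lborel_integral_real_affine[of c "\<lambda>t. 1 / (c\<^sup>2 + t\<^sup>2)" 0] c v by (simp add: power2_eq_square)
  show "integral {- T..T} (\<lambda>t. 1 / (c\<^sup>2 + t\<^sup>2)) = 2 / c * arctan (T / c)" if "T \<ge> 0" for T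
  proof (rule integral_unique)
    have "((\<lambda>t. 1 / (c\<^sup>2 + t\<^sup>2)) has_integral (arctan (T / c) / c - arctan (- T / c) / c)) {- T..T}"
      by (rule fundamental_theorem_of_calculus)
        (use that has_field_derivative_at_within[OF D] in \<open>auto simp flip: has_real_derivative_iff_has_vector_derivative\<close>)
    then show "((\<lambda>t. 1 / (c\<^sup>2 + t\<^sup>2)) has_integral (2 / c * arctan (T / c))) {- T..T}"
      by (simp add: arctan_minus)
  qed
qed

text \<open>Formulated with symmetric truncations, so that decay on the horizontal segments is the
  condition for moving the line, and the value l is computed where the integral converges
  absolutely.\<close>

lemma line_integral_eq:
  assumes hol: "f holomorphic_on S" and S: "open S" "convex S"
    and strip: "{s. a \<le> Re s \<and> Re s \<le> b} \<subseteq> S" and ab: "a \<le> b"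
    and lim: "(\<lambda>n. integral {- real n..real n} (\<lambda>t. f (Complex b t))) \<longlonglongrightarrow> l"
    and M: "\<And>n s. n \<ge> 1 \<Longrightarrow> a \<le> Re s \<Longrightarrow> Re s \<le> b \<Longrightarrow> \<bar>Im s\<bar> = real n \<Longrightarrow> cmod (f s) \<le> M n"
    and M0: "M \<longlonglongrightarrow> 0"
  shows "(\<lambda>n. integral {- real n..real n} (\<lambda>t. f (Complex a t))) \<longlonglongrightarrow> l"
proof -
  have "(\<lambda>n. integral {- real n..real n} (\<lambda>t. f (Complex b t)) - integral {- real n..real n} (\<lambda>t. f (Complex a t))) \<longlonglongrightarrow> 0"
  proof (rule Lim_null_comparison)
    show "eventually (\<lambda>n. cmod (integral {- real n..real n} (\<lambda>t. f (Complex b t)) -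
        integral {- real n..real n} (\<lambda>t. f (Complex a t))) \<le> 2 * (b - a) * M n) sequentially"
      using eventually_ge_at_top[of 1]
      by eventually_elim (rule vertical_shift[OF hol S strip ab], use M in auto)
    show "(\<lambda>n. 2 * (b - a) * M n) \<longlonglongrightarrow> 0" using tendsto_mult_right_zero[OF M0] by simp
  qed
  from tendsto_diff[OF lim this] show ?thesis by simp
qed

section \<open>The Perron kernel with a double pole\<close>

lemma Complex_continuous [continuous_intros]: "continuous_on A (\<lambda>t. Complex c t)"
  by (subst Complex_eq) (intro continuous_intros)

lemma norm_Complex_sq: "cmod ((Complex c t)\<^sup>2) = c\<^sup>2 + t\<^sup>2"
  by (simp add: norm_power cmod_power2)

definition perron_term :: "real \<Rightarrow> complex \<Rightarrow> complex" where
  "perron_term u z = exp (of_real u * z) / z\<^sup>2"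

lemma perron_term_norm: "cmod (perron_term u (Complex c t)) = exp (u * c) * (1 / (c\<^sup>2 + t\<^sup>2))"
  by (simp add: perron_term_def norm_divide norm_Complex_sq)

lemma perron_term_integrable:
  assumes "c \<noteq> 0"
  shows "integrable lborel (\<lambda>t. perron_term u (Complex c t))"
proof (rule Bochner_Integration.integrable_bound)
  have "integrable lborel (\<lambda>t. 1 / (\<bar>c\<bar>\<^sup>2 + t\<^sup>2))" by (rule inverse_square_integrable(1)) (use assms in simp)
  then show "integrable lborel (\<lambda>t. exp (u * c) * (1 / (c\<^sup>2 + t\<^sup>2)))"
    by (intro integrable_mult_right) simp
  have "continuous_on UNIV (\<lambda>t. perron_term u (Complex c t))"
    unfolding perron_term_def by (intro continuous_intros) (use assms in \<open>simp add: Complex_eq_0\<close>)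
  then show "(\<lambda>t. perron_term u (Complex c t)) \<in> borel_measurable lborel"
    by (simp add: borel_measurable_continuous_onI)
qed (simp add: perron_term_norm)

definition perron :: "real \<Rightarrow> real \<Rightarrow> complex" where
  "perron c u = (\<integral>t. perron_term u (Complex c t) \<partial>lborel)"

lemma perron_reflect: "perron (- c) u = perron c (- u)"
proof -
  have eq: "perron_term u (Complex (- c) (0 + (- 1) * t)) = perron_term (- u) (Complex c t)" for t
  proof -
    have "Complex (- c) (0 + (- 1) * t) = - Complex c t" by (simp add: complex_eq_iff)
    then show ?thesis by (simp only: perron_term_def) simp
  qed
  have "perron (- c) u = (\<integral>t. perron_term u (Complex (- c) (0 + (- 1) * t)) \<partial>lborel)"
    unfolding perron_def using lborel_integral_real_affine[of "- 1" "\<lambda>t. perron_term u (Complex (- c) t)" 0] by simp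
  then show ?thesis by (simp only: eq perron_def)
qed

text \<open>For u <= 0 the line can be pushed to the right without limit, where the integral is at
  most pi / c'.\<close>

lemma perron_nonpos:
  assumes c: "c > 0" and u: "u \<le> 0"
  shows "perron c u = 0"
proof -
  have eq: "perron c u = perron c' u" if c': "c' \<ge> c" for c'
  proof -
    have "(\<lambda>n. integral {- real n..real n} (\<lambda>t. perron_term u (Complex c t))) \<longlonglongrightarrow> perron c' u"
    proof (rule line_integral_eq[where S = "{z. Re z > 0}" and b = c' and M = "\<lambda>n. 1 / (real n)\<^sup>2"])
      show "perron_term u holomorphic_on {z. Re z > 0}"
        unfolding perron_term_def by (intro holomorphic_intros) auto
      show "(\<lambda>n. integral {- real n..real n} (\<lambda>t. perron_term u (Complex c' t))) \<longlonglongrightarrow> perron c' u"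
        unfolding perron_def by (intro integral_symmetric_limit perron_term_integrable) (use c c' in auto)
      show "cmod (perron_term u s) \<le> 1 / (real n)\<^sup>2"
        if "n \<ge> 1" "c \<le> Re s" "Re s \<le> c'" "\<bar>Im s\<bar> = real n" for n s
      proof -
        have "cmod (perron_term u s) = exp (u * Re s) * (1 / ((Re s)\<^sup>2 + (Im s)\<^sup>2))"
          using perron_term_norm[of u "Re s" "Im s"] by simp
        also have "(Im s)\<^sup>2 = (real n)\<^sup>2" using that(4) by (metis power2_abs)
        also have "exp (u * Re s) * (1 / ((Re s)\<^sup>2 + (real n)\<^sup>2)) \<le> 1 * (1 / (real n)\<^sup>2)"
          using u c that by (intro mult_mono divide_left_mono) (auto simp: mult_nonpos_nonneg add_nonneg_pos)
        finally show ?thesis by simp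
      qed
      show "(\<lambda>n. 1 / (real n)\<^sup>2) \<longlonglongrightarrow> 0" by real_asymp
    qed (use c c' in \<open>auto simp: open_halfspace_Re_gt convex_halfspace_Re_gt\<close>)
    moreover have "(\<lambda>n. integral {- real n..real n} (\<lambda>t. perron_term u (Complex c t))) \<longlonglongrightarrow> perron c u"
      unfolding perron_def by (intro integral_symmetric_limit perron_term_integrable) (use c in auto)
    ultimately show ?thesis using LIMSEQ_unique by blast
  qed
  have bd: "cmod (perron c u) \<le> pi / c'" if c': "c' \<ge> c" for c'
  proof -
    have c'0: "c' > 0" using c c' by simp
    have "cmod (perron c' u) \<le> (\<integral>t. cmod (perron_term u (Complex c' t)) \<partial>lborel)"
      unfolding perron_def by (rule integral_norm_bound)
    also have "\<dots> = exp (u * c') * (pi / c')"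
      unfolding perron_term_norm by (simp only: integral_mult_right_zero inverse_square_integrable(2)[OF c'0])
    also have "\<dots> \<le> 1 * (pi / c')"
      using u c'0 by (intro mult_right_mono) (auto simp: mult_nonpos_nonneg)
    finally show ?thesis using eq[OF c'] by simp
  qed
  have "((\<lambda>c'. pi / c') \<longlongrightarrow> 0) at_top" by real_asymp
  moreover have "eventually (\<lambda>c'. cmod (perron c u) \<le> pi / c') at_top"
    using eventually_ge_at_top[of c] by eventually_elim (rule bd)
  ultimately have "cmod (perron c u) \<le> 0"
    by (intro tendsto_lowerbound) auto
  then show ?thesis by simp
qed

text \<open>The residue u at the double pole is isolated by subtraction: (exp (u z) - 1 - u z) / z^2
  is entire, so its integrals over the lines c and -c agree in the limit. The subtracted u / z
  contributes arctangents that add up to 2 pi u, and all other Perron integrals vanish by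
  \<open>perron_nonpos\<close> and reflection.\<close>

lemma perron_nonneg:
  assumes c: "c > 0" and u: "u \<ge> 0"
  shows "perron c u = of_real (2 * pi * u)"
proof -
  \<comment> \<open>Two successive divided differences at 0, each of them entire again.\<close>
  define g1 where "g1 z = (if z = 0 then deriv (\<lambda>z. exp (of_real u * z)) 0 else (exp (of_real u * z) - exp (of_real u * 0)) / (z - 0))" for z :: complex
  define g2 where "g2 z = (if z = 0 then deriv g1 0 else (g1 z - g1 0) / (z - 0))" for z
  have h1: "g1 holomorphic_on UNIV"
    unfolding g1_def by (rule pole_lemma) (auto intro!: holomorphic_intros)
  have h2: "g2 holomorphic_on UNIV"
    unfolding g2_def by (rule pole_lemma[OF h1]) auto
  have "((\<lambda>z. exp (of_real u * z)) has_field_derivative of_real u) (at (0::complex))"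
    by (auto intro!: derivative_eq_intros)
  then have g10: "g1 0 = of_real u" by (simp add: g1_def DERIV_imp_deriv)
  have g2: "g2 z = perron_term u z - perron_term 0 z - of_real u / z" if "z \<noteq> 0" for z
    using that by (simp add: g2_def g10) (simp add: g1_def perron_term_def field_simps power2_eq_square)
  have nz: "Complex c t \<noteq> 0" "Complex (- c) t \<noteq> 0" for t using c by (auto simp: complex_eq_iff)
  have pi: "(\<lambda>t. perron_term v (Complex b t)) integrable_on {- real n..real n}" if "b \<noteq> 0" for v b n
  proof (rule integrable_continuous_real)
    show "continuous_on {- real n..real n} (\<lambda>t. perron_term v (Complex b t))"
      unfolding perron_term_def by (intro continuous_intros) (use that in \<open>simp add: Complex_eq_0\<close>)
  qed
  have li: "(\<lambda>t. of_real u / Complex b t) integrable_on {- real n..real n}" if "b \<noteq> 0" for b n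
    by (rule integrable_continuous_real) (use that in \<open>auto intro!: continuous_intros simp: complex_eq_iff\<close>)
  have I: "integral {- real n..real n} (\<lambda>t. g2 (Complex b t)) =
      integral {- real n..real n} (\<lambda>t. perron_term u (Complex b t)) - integral {- real n..real n} (\<lambda>t. perron_term 0 (Complex b t))
      - integral {- real n..real n} (\<lambda>t. of_real u / Complex b t)" if b: "b \<noteq> 0" for b n
  proof -
    have "Complex b t \<noteq> 0" for t using b by (auto simp: complex_eq_iff)
    then have "(\<lambda>t. g2 (Complex b t)) = (\<lambda>t. perron_term u (Complex b t) - perron_term 0 (Complex b t) - of_real u / Complex b t)"
      using g2 by auto
    then show ?thesis
      by (simp add: Henstock_Kurzweil_Integration.integral_diff pi li b integrable_diff)
  qed
  have lin: "integral {- real n..real n} (\<lambda>t. of_real u / Complex c t) - integral {- real n..real n} (\<lambda>t. of_real u / Complex (- c) t) =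
      of_real (4 * u * arctan (real n / c))" for n
  proof -
    have "integral {- real n..real n} (\<lambda>t. of_real u / Complex c t) - integral {- real n..real n} (\<lambda>t. of_real u / Complex (- c) t) =
        integral {- real n..real n} (\<lambda>t. of_real u / Complex c t - of_real u / Complex (- c) t)"
      using li c by (intro Henstock_Kurzweil_Integration.integral_diff[symmetric]) auto
    also have "(\<lambda>t. of_real u / Complex c t - of_real u / Complex (- c) t) = (\<lambda>t. complex_of_real ((2 * u * c) * (1 / (c\<^sup>2 + t\<^sup>2))))"
    proof
      fix t
      have "of_real u / Complex b t = Complex (u * b / (b\<^sup>2 + t\<^sup>2)) (- u * t / (b\<^sup>2 + t\<^sup>2))" for b
        by (simp add: complex_eq_iff Re_divide Im_divide)
      then show "of_real u / Complex c t - of_real u / Complex (- c) t = complex_of_real ((2 * u * c) * (1 / (c\<^sup>2 + t\<^sup>2)))"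
        by (simp add: complex_eq_iff mult_ac)
    qed
    also have "integral {- real n..real n} (\<lambda>t. complex_of_real ((2 * u * c) * (1 / (c\<^sup>2 + t\<^sup>2)))) =
        of_real ((2 * u * c) * (2 / c * arctan (real n / c)))"
    proof (rule integral_unique, rule has_integral_of_real)
      have "(\<lambda>t. 1 / (c\<^sup>2 + t\<^sup>2)) integrable_on {- real n..real n}"
        by (rule integrable_continuous_real)
          (use c in \<open>auto intro!: continuous_intros simp: add_pos_nonneg less_imp_neq[THEN not_sym]\<close>)
      then have "((\<lambda>t. 1 / (c\<^sup>2 + t\<^sup>2)) has_integral (2 / c * arctan (real n / c))) {- real n..real n}"
        using inverse_square_integrable(3)[OF c, of "real n"] by (simp add: has_integral_integral)
      then show "((\<lambda>t. (2 * u * c) * (1 / (c\<^sup>2 + t\<^sup>2))) has_integral (2 * u * c) * (2 / c * arctan (real n / c))) {- real n..real n}"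
        by (rule has_integral_mult_right)
    qed
    finally show ?thesis using c by simp
  qed
  have "(\<lambda>n. integral {- real n..real n} (\<lambda>t. g2 (Complex c t)) - integral {- real n..real n} (\<lambda>t. g2 (Complex (- c) t))) \<longlonglongrightarrow> 0"
  proof (rule Lim_null_comparison)
    define M where "M n = (exp (u * c) + 1 + u * (c + real n)) / (real n)\<^sup>2" for n
    show "eventually (\<lambda>n. cmod (integral {- real n..real n} (\<lambda>t. g2 (Complex c t)) -
        integral {- real n..real n} (\<lambda>t. g2 (Complex (- c) t))) \<le> 2 * (c - - c) * M n) sequentially"
      using eventually_ge_at_top[of 1]
    proof eventually_elim
      case (elim n)
      show ?case
      proof (rule vertical_shift[OF h2])
        fix s assume s: "- c \<le> Re s" "Re s \<le> c" "\<bar>Im s\<bar> = real n"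
        have s0: "s \<noteq> 0" using s elim by auto
        have sn: "cmod s \<ge> real n" using s(3) abs_Im_le_cmod[of s] by simp
        have "cmod s \<le> \<bar>Re s\<bar> + \<bar>Im s\<bar>" by (rule cmod_le)
        also have "\<dots> \<le> c + real n" using s by (auto simp: abs_le_iff)
        finally have sc: "cmod s \<le> c + real n" .
        have "g2 s = (exp (of_real u * s) - 1 - of_real u * s) / s\<^sup>2"
          unfolding g2[OF s0] perron_term_def diff_divide_distrib using s0 by (simp add: power2_eq_square)
        then have "cmod (g2 s) = cmod (exp (of_real u * s) - 1 - of_real u * s) / (cmod s)\<^sup>2"
          by (simp add: norm_divide norm_power)
        also have "\<dots> \<le> (exp (u * c) + 1 + u * (c + real n)) / (real n)\<^sup>2"
        proof (intro frac_le)
          have "cmod (exp (of_real u * s) - 1 - of_real u * s) \<le> cmod (exp (of_real u * s)) + cmod 1 + cmod (of_real u * s)"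
            by (metis (no_types) add_right_mono norm_triangle_ineq4 order_trans)
          also have "\<dots> \<le> exp (u * c) + 1 + u * (c + real n)"
            using u s sc by (auto simp: norm_mult intro!: add_mono mult_left_mono)
          finally show "cmod (exp (of_real u * s) - 1 - of_real u * s) \<le> exp (u * c) + 1 + u * (c + real n)" .
          show "(real n)\<^sup>2 \<le> (cmod s)\<^sup>2" using sn by (intro power_mono) auto
        qed (use elim u c in auto)
        finally show "cmod (g2 s) \<le> M n" by (simp add: M_def)
      qed (use c in auto)
    qed
    show "(\<lambda>n. 2 * (c - - c) * M n) \<longlonglongrightarrow> 0" unfolding M_def by real_asymp
  qed
  also have "(\<lambda>n. integral {- real n..real n} (\<lambda>t. g2 (Complex c t)) - integral {- real n..real n} (\<lambda>t. g2 (Complex (- c) t))) =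
      (\<lambda>n. (integral {- real n..real n} (\<lambda>t. perron_term u (Complex c t)) - integral {- real n..real n} (\<lambda>t. perron_term 0 (Complex c t)))
        - (integral {- real n..real n} (\<lambda>t. perron_term u (Complex (- c) t)) - integral {- real n..real n} (\<lambda>t. perron_term 0 (Complex (- c) t)))
        - of_real (4 * u * arctan (real n / c)))"
  proof
    fix n
    show "integral {- real n..real n} (\<lambda>t. g2 (Complex c t)) - integral {- real n..real n} (\<lambda>t. g2 (Complex (- c) t)) =
      (integral {- real n..real n} (\<lambda>t. perron_term u (Complex c t)) - integral {- real n..real n} (\<lambda>t. perron_term 0 (Complex c t)))
        - (integral {- real n..real n} (\<lambda>t. perron_term u (Complex (- c) t)) - integral {- real n..real n} (\<lambda>t. perron_term 0 (Complex (- c) t)))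
        - of_real (4 * u * arctan (real n / c))"
      unfolding lin[symmetric] using I[of c n] I[of "- c" n] c by (simp add: algebra_simps)
  qed
  finally have lim0: "(\<lambda>n. (integral {- real n..real n} (\<lambda>t. perron_term u (Complex c t)) - integral {- real n..real n} (\<lambda>t. perron_term 0 (Complex c t)))
        - (integral {- real n..real n} (\<lambda>t. perron_term u (Complex (- c) t)) - integral {- real n..real n} (\<lambda>t. perron_term 0 (Complex (- c) t)))
        - of_real (4 * u * arctan (real n / c))) \<longlonglongrightarrow> 0" .
  have P: "(\<lambda>n. integral {- real n..real n} (\<lambda>t. perron_term v (Complex b t))) \<longlonglongrightarrow> perron b v" if "b \<noteq> 0" for b v
    unfolding perron_def by (intro integral_symmetric_limit perron_term_integrable that)
  have "(\<lambda>n. arctan (real n / c)) \<longlonglongrightarrow> pi / 2" using c by real_asymp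
  then have "(\<lambda>n. (integral {- real n..real n} (\<lambda>t. perron_term u (Complex c t)) - integral {- real n..real n} (\<lambda>t. perron_term 0 (Complex c t)))
        - (integral {- real n..real n} (\<lambda>t. perron_term u (Complex (- c) t)) - integral {- real n..real n} (\<lambda>t. perron_term 0 (Complex (- c) t)))
        - of_real (4 * u * arctan (real n / c))) \<longlonglongrightarrow>
      (perron c u - perron c 0) - (perron (- c) u - perron (- c) 0) - of_real (4 * u * (pi / 2))"
    by (intro tendsto_intros P) (use c in auto)
  with lim0 have "(perron c u - perron c 0) - (perron (- c) u - perron (- c) 0) - of_real (4 * u * (pi / 2)) = 0"
    using LIMSEQ_unique by blast
  moreover have "perron (- c) u = 0" "perron (- c) 0 = 0" "perron c 0 = 0"
    using perron_nonpos[OF c] u by (simp_all add: perron_reflect)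
  ultimately show ?thesis by simp
qed

lemma perron_eq: "c > 0 \<Longrightarrow> perron c u = of_real (2 * pi * max u 0)"
  using perron_nonpos[of c u] perron_nonneg[of c u] by (cases "u \<ge> 0") (auto simp: max_def)

text \<open>Symmetry about a forces the derivative at a to vanish, so a zero at a can be divided out
  twice. This serves both the completed function at 1/2 and the kernel at 0.\<close>

lemma even_double_zero:
  assumes f: "f holomorphic_on UNIV" and ev: "\<And>s. f (2 * a - s) = f s" and f0: "f a = (0 :: complex)"
  obtains G where "G holomorphic_on UNIV" "\<And>s. f s = (s - a)\<^sup>2 * G s"
proof -
  define g1 where "g1 z = (if z = a then deriv f a else (f z - f a) / (z - a))" for z
  define g2 where "g2 z = (if z = a then deriv g1 a else (g1 z - g1 a) / (z - a))" for z
  have h1: "g1 holomorphic_on UNIV" unfolding g1_def by (rule pole_lemma[OF f]) auto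
  have h2: "g2 holomorphic_on UNIV" unfolding g2_def by (rule pole_lemma[OF h1]) auto
  have d: "(f has_field_derivative deriv f a) (at a)" using f by (meson UNIV_I holomorphic_derivI open_UNIV)
  have "((\<lambda>s. f (2 * a - s)) has_field_derivative deriv f a * (- 1)) (at a)"
  proof (rule DERIV_chain2[where g = "\<lambda>s. 2 * a - s"])
    show "(f has_field_derivative deriv f a) (at (2 * a - a))" using d by simp
  qed (auto intro!: derivative_eq_intros)
  then have "(f has_field_derivative deriv f a * (- 1)) (at a)" unfolding ev .
  then have "deriv f a = deriv f a * (- 1)" by (rule DERIV_unique[OF d])
  then have "2 * deriv f a = 0" by (simp only: mult_2 mult_minus_right mult_1_right eq_neg_iff_add_eq_0)
  then have g1a: "g1 a = 0" by (simp add: g1_def)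
  have eq: "f s = (s - a)\<^sup>2 * g2 s" for s
  proof (cases "s = a")
    case False
    then have "g2 s = f s / (s - a) / (s - a)" using g1a f0 by (simp add: g2_def) (simp add: g1_def)
    then show ?thesis using False by (simp add: power2_eq_square)
  qed (simp add: f0)
  show thesis by (rule that[OF h2 eq])
qed

text \<open>The squared sinc (sin (L t / 2) / (L t / 2))^2, written so that it is a combination of
  exponentials; its Fourier transform is a triangle supported on [-L, L].\<close>

definition fejer :: "real \<Rightarrow> real \<Rightarrow> real" where
  "fejer L t = (if t = 0 then 1 else 2 * (1 - cos (L * t)) / (L * t)\<^sup>2)"

lemma fejer_nonneg: "fejer L t \<ge> 0"
  by (simp add: fejer_def)

lemma fejer_le:
  assumes "t \<noteq> 0" shows "fejer L t \<le> 4 / (L\<^sup>2 * t\<^sup>2)"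
proof -
  have "2 * (1 - c) \<le> 4" if "- 1 \<le> c" for c :: real using that by simp
  from this[OF cos_ge_minus_one] have "2 * (1 - cos (L * t)) \<le> 4" .
  then show ?thesis using assms by (simp add: fejer_def power_mult_distrib divide_right_mono)
qed

text \<open>Taylor's formula to fourth order: cos x <= 1 - x^2 / 2 + x^4 / 24.\<close>

lemma fejer_ge:
  assumes "L > 0" shows "fejer L t \<ge> 1 - L\<^sup>2 * t\<^sup>2 / 12"
proof (cases "t = 0")
  case False
  define x where "x = L * t"
  have x: "x \<noteq> 0" using False assms by (simp add: x_def)
  obtain y where y: "cos x = (\<Sum>m<4. cos_coeff m * x ^ m) + cos (y + 1 / 2 * real 4 * pi) / fact 4 * x ^ 4"
    using Maclaurin_cos_expansion[of x 4] by blast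
  have "(\<Sum>m<4. g m) = g 0 + g 1 + g 2 + g 3" for g :: "nat \<Rightarrow> real"
    by (simp add: eval_nat_numeral)
  then have "(\<Sum>m<4. cos_coeff m * x ^ m) = 1 - x\<^sup>2 / 2"
    by (simp add: cos_coeff_def)
  moreover have "cos (y + 1 / 2 * real 4 * pi) / fact 4 * x ^ 4 \<le> 1 / fact 4 * x ^ 4"
    by (intro mult_right_mono divide_right_mono) auto
  ultimately have "cos x \<le> 1 - x\<^sup>2 / 2 + x ^ 4 / 24" using y by (simp add: fact_numeral)
  then have "x\<^sup>2 * (1 - x\<^sup>2 / 12) \<le> 2 * (1 - cos x)" by (simp add: algebra_simps power2_eq_square power4_eq_xxxx)
  then have "1 - x\<^sup>2 / 12 \<le> 2 * (1 - cos x) / x\<^sup>2" using x by (simp add: pos_le_divide_eq mult.commute)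
  then show ?thesis using False by (simp add: fejer_def x_def power_mult_distrib)
qed (simp add: fejer_def)

text \<open>The entire function (exp (L z) + exp (- L z) - 2) / (L z)^2. On the imaginary axis it is
  the Fejer kernel, and off 0 it is a combination of three Perron kernels, which makes its integrals
  on shifted lines explicit.\<close>

lemma fejer_kernel_exists:
  assumes L: "L > 0"
  obtains K where "K holomorphic_on UNIV"
    "\<And>z. z \<noteq> 0 \<Longrightarrow> K z = (perron_term L z + perron_term (- L) z - 2 * perron_term 0 z) / of_real (L\<^sup>2)"
    "\<And>t. K (Complex 0 t) = of_real (fejer L t)"
proof -
  define f where "f z = (exp (of_real L * z) + exp (- of_real L * z) - 2) / of_real (L\<^sup>2)" for z :: complex
  obtain K where K: "K holomorphic_on UNIV" "\<And>z. f z = (z - 0)\<^sup>2 * K z"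
  proof (rule even_double_zero[of f 0])
    show "f holomorphic_on UNIV" unfolding f_def by (intro holomorphic_intros) (use L in auto)
  qed (auto simp: f_def)
  have Kz: "K z = (perron_term L z + perron_term (- L) z - 2 * perron_term 0 z) / of_real (L\<^sup>2)" if "z \<noteq> 0" for z
  proof -
    have "K z = f z / z\<^sup>2" using K(2)[of z] that by simp
    then show ?thesis unfolding f_def perron_term_def using that L
      by (simp add: add_divide_distrib diff_divide_distrib mult.commute)
  qed
  have Kt: "K (Complex 0 t) = of_real (fejer L t)" if t: "t \<noteq> 0" for t
  proof -
    have z: "Complex 0 t = \<i> * of_real t" by (simp add: complex_eq_iff)
    have "f (Complex 0 t) = of_real ((2 * cos (L * t) - 2) / L\<^sup>2)"
    proof -
      have "exp (of_real L * Complex 0 t) = cis (L * t)" "exp (- of_real L * Complex 0 t) = cis (- (L * t))"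
        unfolding z cis_conv_exp by (simp_all add: mult_ac)
      then show ?thesis by (simp add: f_def complex_eq_iff)
    qed
    moreover have "(Complex 0 t)\<^sup>2 = of_real (- (t\<^sup>2))" by (simp add: z power_mult_distrib)
    ultimately have "of_real ((2 * cos (L * t) - 2) / L\<^sup>2) = of_real (- (t\<^sup>2)) * K (Complex 0 t)"
      using K(2)[of "Complex 0 t"] by simp
    then have "K (Complex 0 t) = of_real ((2 * cos (L * t) - 2) / L\<^sup>2) / of_real (- (t\<^sup>2))"
      using t by (simp add: field_simps)
    also have "\<dots> = of_real (fejer L t)"
      unfolding of_real_divide[symmetric] of_real_eq_iff
    proof -
      show "(2 * cos (L * t) - 2) / L\<^sup>2 / - t\<^sup>2 = fejer L t"
        using t L unfolding fejer_def power_mult_distrib by (simp add: divide_simps)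
    qed
    finally show ?thesis .
  qed
  \<comment> \<open>The value at the removable singularity is obtained as a limit along the
    imaginary axis.\<close>
  have "K (Complex 0 0) = 1"
  proof -
    have "isCont K (Complex 0 0)"
      using K(1) holomorphic_on_imp_continuous_on continuous_on_eq_continuous_at by blast
    moreover have "((\<lambda>t. Complex 0 t) \<longlongrightarrow> Complex 0 0) (at_right 0)" by (intro tendsto_Complex tendsto_intros)
    ultimately have "((\<lambda>t. K (Complex 0 t)) \<longlongrightarrow> K (Complex 0 0)) (at_right 0)"
      by (rule isCont_tendsto_compose)
    then have "((\<lambda>t. complex_of_real (fejer L t)) \<longlongrightarrow> K (Complex 0 0)) (at_right 0)"
      by (rule Lim_transform_eventually) (use eventually_at_right_less[of 0] in eventually_elim, simp add: Kt)
    moreover have "((\<lambda>t. fejer L t) \<longlongrightarrow> 1) (at_right 0)"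
    proof (rule Lim_transform_eventually)
      show "((\<lambda>t. 2 * (1 - cos (L * t)) / (L * t)\<^sup>2) \<longlongrightarrow> 1) (at_right 0)"
      proof (rule filterlim_compose[where g = "\<lambda>x. 2 * (1 - cos x) / x\<^sup>2" and f = "\<lambda>t. L * t"])
        show "((\<lambda>x::real. 2 * (1 - cos x) / x\<^sup>2) \<longlongrightarrow> 1) (at_right 0)" by real_asymp
        show "filterlim (\<lambda>t. L * t) (at_right 0) (at_right 0)" using L by real_asymp
      qed
      show "eventually (\<lambda>t. 2 * (1 - cos (L * t)) / (L * t)\<^sup>2 = fejer L t) (at_right 0)"
        using eventually_at_right_less[of 0] by eventually_elim (simp add: fejer_def)
    qed
    then have "((\<lambda>t. complex_of_real (fejer L t)) \<longlongrightarrow> of_real 1) (at_right 0)" by (rule tendsto_of_real)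
    ultimately show ?thesis using tendsto_unique trivial_limit_at_right_real by fastforce
  qed
  then have "K (Complex 0 t) = of_real (fejer L t)" for t using Kt by (cases "t = 0") (auto simp: fejer_def)
  with K(1) Kz show thesis by (rule that)
qed

lemma fejer_continuous: "L > 0 \<Longrightarrow> continuous_on A (fejer L)"
proof -
  assume L: "L > 0"
  obtain K where K: "K holomorphic_on UNIV" "\<And>t. K (Complex 0 t) = of_real (fejer L t)"
    by (rule fejer_kernel_exists[OF L]) blast
  have "continuous_on A (\<lambda>t. Re (K (Complex 0 t)))"
    by (intro continuous_intros continuous_on_compose2[OF holomorphic_on_imp_continuous_on[OF K(1)]]) auto
  then show ?thesis unfolding K(2) by simp
qed

lemma fejer_integrable_on: "L > 0 \<Longrightarrow> fejer L integrable_on {a..b}"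
  by (intro integrable_continuous_real fejer_continuous)

section \<open>Integrals of the Fejer kernel\<close>

lemma perron_term_le:
  assumes "0 \<le> Re s" "Re s \<le> c" "\<bar>Im s\<bar> = T" "T > 0" "\<bar>v\<bar> \<le> L"
  shows "cmod (perron_term v s) \<le> exp (L * c) / T\<^sup>2"
proof -
  have "cmod (perron_term v s) = exp (v * Re s) * (1 / ((Re s)\<^sup>2 + (Im s)\<^sup>2))"
    using perron_term_norm[of v "Re s" "Im s"] by simp
  also have "(Im s)\<^sup>2 = T\<^sup>2" using assms(3) by (metis power2_abs)
  finally have eq: "cmod (perron_term v s) = exp (v * Re s) * (1 / ((Re s)\<^sup>2 + T\<^sup>2))" .
  have "v * Re s \<le> \<bar>v\<bar> * Re s" using assms(1) by (intro mult_right_mono) auto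
  also have "\<dots> \<le> L * c" using assms by (intro mult_mono) auto
  finally have "exp (v * Re s) * (1 / ((Re s)\<^sup>2 + T\<^sup>2)) \<le> exp (L * c) * (1 / T\<^sup>2)"
    using assms by (intro mult_mono divide_left_mono) (auto simp: add_nonneg_pos)
  with eq show ?thesis by simp
qed

context
  fixes L :: real and K :: "complex \<Rightarrow> complex"
  assumes L: "L > 0" and hol: "K holomorphic_on UNIV"
    and K: "\<And>z. z \<noteq> 0 \<Longrightarrow> K z = (perron_term L z + perron_term (- L) z - 2 * perron_term 0 z) / of_real (L\<^sup>2)"
    and K0: "\<And>t. K (Complex 0 t) = of_real (fejer L t)"
begin

lemma fejer_kernel_bound:
  assumes "0 \<le> Re s" "Re s \<le> c" "\<bar>Im s\<bar> = T" "T > 0"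
  shows "cmod (K s) \<le> 4 * exp (L * c) / (L\<^sup>2 * T\<^sup>2)"
proof -
  have "s \<noteq> 0" using assms by auto
  then have "cmod (K s) = cmod (perron_term L s + perron_term (- L) s - 2 * perron_term 0 s) / L\<^sup>2"
    by (simp add: K norm_divide norm_power)
  also have "\<dots> \<le> (exp (L * c) / T\<^sup>2 + exp (L * c) / T\<^sup>2 + 2 * (exp (L * c) / T\<^sup>2)) / L\<^sup>2"
  proof (intro divide_right_mono)
    have "cmod (perron_term L s + perron_term (- L) s - 2 * perron_term 0 s) \<le>
        cmod (perron_term L s) + cmod (perron_term (- L) s) + cmod (2 * perron_term 0 s)"
      by (meson add_mono_thms_linordered_semiring(3) norm_triangle_ineq norm_triangle_ineq4 order_trans)
    also have "\<dots> \<le> exp (L * c) / T\<^sup>2 + exp (L * c) / T\<^sup>2 + 2 * (exp (L * c) / T\<^sup>2)"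
      using perron_term_le[OF assms, of L L] perron_term_le[OF assms, of "- L" L] perron_term_le[OF assms, of 0 L] L
      unfolding norm_mult by (intro add_mono) simp_all
    finally show "cmod (perron_term L s + perron_term (- L) s - 2 * perron_term 0 s) \<le>
      exp (L * c) / T\<^sup>2 + exp (L * c) / T\<^sup>2 + 2 * (exp (L * c) / T\<^sup>2)" .
  qed simp
  also have "\<dots> = 4 * exp (L * c) / (L\<^sup>2 * T\<^sup>2)" by (simp add: field_simps)
  finally show ?thesis .
qed

text \<open>Multiplication by exp (- x z) shifts the parameters of the three Perron kernels by x.
  For x >= 0 only max (L - x) 0 remains, which is the weight L - ln N of the prime sum with its
  cutoff at e^L.\<close>

lemma fejer_kernel_twist:
  assumes c: "c > 0"
  shows "integrable lborel (\<lambda>t. exp (- of_real x * Complex c t) * K (Complex c t))"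
    and "(\<integral>t. exp (- of_real x * Complex c t) * K (Complex c t) \<partial>lborel) =
      of_real (2 * pi / L\<^sup>2 * (max (L - x) 0 + max (- L - x) 0 - 2 * max (- x) 0))"
proof -
  have nz: "Complex c t \<noteq> 0" for t using c by (simp add: Complex_eq_0)
  have tw: "exp (- of_real x * z) * perron_term v z = perron_term (v - x) z" for v z
    by (simp add: perron_term_def exp_add[symmetric] ring_distribs)
  have eq: "exp (- of_real x * Complex c t) * K (Complex c t) =
      (perron_term (L - x) (Complex c t) + perron_term (- L - x) (Complex c t) - 2 * perron_term (- x) (Complex c t)) / of_real (L\<^sup>2)" for t
    unfolding K[OF nz] times_divide_eq_right ring_distribs
    by (simp only: tw mult.left_commute[of _ 2]) simp
  have i: "integrable lborel (\<lambda>t. perron_term v (Complex c t))" for v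
    by (rule perron_term_integrable) (use c in simp)
  show "integrable lborel (\<lambda>t. exp (- of_real x * Complex c t) * K (Complex c t))"
    unfolding eq by (intro Bochner_Integration.integrable_diff Bochner_Integration.integrable_add
        integrable_mult_right i Bochner_Integration.integrable_divide)
  have "(\<integral>t. exp (- of_real x * Complex c t) * K (Complex c t) \<partial>lborel) =
      (perron c (L - x) + perron c (- L - x) - 2 * perron c (- x)) / of_real (L\<^sup>2)"
    unfolding eq perron_def using i by simp
  then show "(\<integral>t. exp (- of_real x * Complex c t) * K (Complex c t) \<partial>lborel) =
      of_real (2 * pi / L\<^sup>2 * (max (L - x) 0 + max (- L - x) 0 - 2 * max (- x) 0))"
    unfolding perron_eq[OF c] by (simp add: field_simps)
qed

text \<open>The total integral is evaluated on the line Re z = 1 and equals 2 pi / L; truncation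
  only lowers it, as the kernel is nonnegative.\<close>

lemma fejer_integral_le:
  assumes "T \<ge> 0"
  shows "integral {- T..T} (fejer L) \<le> 2 * pi / L"
proof -
  have "(\<lambda>n. integral {- real n..real n} (\<lambda>t. K (Complex 0 t))) \<longlonglongrightarrow> of_real (2 * pi / L)"
  proof (rule line_integral_eq[where S = UNIV and b = 1 and M = "\<lambda>n. 4 * exp (L * 1) / (L\<^sup>2 * (real n)\<^sup>2)"])
    have "(\<integral>t. K (Complex 1 t) \<partial>lborel) = of_real (2 * pi / L)" "integrable lborel (\<lambda>t. K (Complex 1 t))"
      using fejer_kernel_twist[of 1 0] L by (simp_all add: max_def power2_eq_square)
    then show "(\<lambda>n. integral {- real n..real n} (\<lambda>t. K (Complex 1 t))) \<longlonglongrightarrow> of_real (2 * pi / L)"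
      by (metis integral_symmetric_limit)
    show "cmod (K s) \<le> 4 * exp (L * 1) / (L\<^sup>2 * (real n)\<^sup>2)"
      if "n \<ge> 1" "0 \<le> Re s" "Re s \<le> 1" "\<bar>Im s\<bar> = real n" for n s
      by (rule fejer_kernel_bound) (use that in auto)
    show "(\<lambda>n. 4 * exp (L * 1) / (L\<^sup>2 * (real n)\<^sup>2)) \<longlonglongrightarrow> 0" using L by real_asymp
  qed (use hol in auto)
  moreover have "integral {- real n..real n} (\<lambda>t. K (Complex 0 t)) = of_real (integral {- real n..real n} (fejer L))" for n
    unfolding K0 using fejer_integrable_on[OF L]
    by (intro integral_unique has_integral_of_real) (simp add: has_integral_integral)
  ultimately have "(\<lambda>n. complex_of_real (integral {- real n..real n} (fejer L))) \<longlonglongrightarrow> of_real (2 * pi / L)" by simp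
  then have lim: "(\<lambda>n. integral {- real n..real n} (fejer L)) \<longlonglongrightarrow> 2 * pi / L"
    using tendsto_of_real_iff by blast
  show ?thesis
  proof (rule tendsto_lowerbound[OF lim])
    show "eventually (\<lambda>n. integral {- T..T} (fejer L) \<le> integral {- real n..real n} (fejer L)) sequentially"
      using eventually_ge_at_top[of "nat \<lceil>T\<rceil>"]
    proof eventually_elim
      case (elim n)
      then have "T \<le> real n" by (simp add: nat_le_iff ceiling_le_iff)
      then show ?case
        by (intro integral_subset_le fejer_integrable_on[OF L]) (auto simp: fejer_nonneg)
    qed
  qed simp
qed

text \<open>For |t| <= 1 the square root is at most 1. Beyond, the kernel is at most 4 / (L t)^2,
  and the integral of t^(-3/2) from 1 on is at most 2, which gives 8 / L^2 on each side.\<close>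

lemma fejer_sqrt_integral_le:
  assumes T: "T \<ge> 1"
  shows "integral {- T..T} (\<lambda>t. sqrt \<bar>t\<bar> * fejer L t) \<le> 2 * pi / L + 16 / L\<^sup>2"
proof -
  define g where "g t = sqrt \<bar>t\<bar> * fejer L t" for t
  have gi: "g integrable_on {a..b}" for a b
    unfolding g_def by (intro integrable_continuous_real continuous_intros fejer_continuous L)
  have g_even: "g (- t) = g t" for t by (simp add: g_def fejer_def)
  have out: "integral {1..T} g \<le> 8 / L\<^sup>2"
  proof -
    have I: "((\<lambda>t. 4 / L\<^sup>2 * t powr (- 3 / 2)) has_integral (- 8 / L\<^sup>2 * T powr (- 1 / 2) - (- 8 / L\<^sup>2 * 1 powr (- 1 / 2)))) {1..T}"
    proof (rule fundamental_theorem_of_calculus[OF T])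
      fix t assume "t \<in> {1..T}"
      then have "t > 0" by simp
      then have "((\<lambda>t. - 8 / L\<^sup>2 * t powr (- 1 / 2)) has_real_derivative - 8 / L\<^sup>2 * ((- 1 / 2) * t powr (- 1 / 2 - 1))) (at t)"
        by (intro DERIV_cmult has_real_derivative_powr)
      moreover have "- 8 / L\<^sup>2 * ((- 1 / 2) * t powr (- 1 / 2 - 1)) = 4 / L\<^sup>2 * t powr (- 3 / 2)" by simp
      ultimately have "((\<lambda>t. - 8 / L\<^sup>2 * t powr (- 1 / 2)) has_real_derivative 4 / L\<^sup>2 * t powr (- 3 / 2)) (at t)"
        by (rule DERIV_cong)
      then show "((\<lambda>t. - 8 / L\<^sup>2 * t powr (- 1 / 2)) has_vector_derivative 4 / L\<^sup>2 * t powr (- 3 / 2)) (at t within {1..T})"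
        unfolding has_real_derivative_iff_has_vector_derivative by (rule has_vector_derivative_at_within)
    qed
    have "integral {1..T} g \<le> integral {1..T} (\<lambda>t. 4 / L\<^sup>2 * t powr (- 3 / 2))"
    proof (rule Henstock_Kurzweil_Integration.integral_le[OF gi has_integral_integrable[OF I]])
      fix t assume "t \<in> {1..T}"
      then have t: "t \<ge> 1" by simp
      have "g t \<le> sqrt t * (4 / (L\<^sup>2 * t\<^sup>2))"
        unfolding g_def using t fejer_le[of t L] fejer_nonneg[of L t] by (intro mult_mono) auto
      also have "\<dots> = 4 / L\<^sup>2 * (t powr (1 / 2) / t powr 2)" using t by (simp add: powr_half_sqrt powr_numeral)
      also have "t powr (1 / 2) / t powr 2 = t powr (- 3 / 2)" by (subst powr_diff[symmetric]) simp
      finally show "g t \<le> 4 / L\<^sup>2 * t powr (- 3 / 2)" .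
    qed
    also have "\<dots> = 8 / L\<^sup>2 - 8 / L\<^sup>2 * T powr (- 1 / 2)" unfolding integral_unique[OF I] by simp
    also have "\<dots> \<le> 8 / L\<^sup>2" by simp
    finally show ?thesis .
  qed
  have mid: "integral {- 1..1} g \<le> 2 * pi / L"
  proof -
    have "integral {- 1..1} g \<le> integral {- 1..1} (fejer L)"
    proof (rule Henstock_Kurzweil_Integration.integral_le[OF gi fejer_integrable_on[OF L]])
      fix t :: real assume "t \<in> {- 1..1}"
      then have "\<bar>t\<bar> \<le> 1" by (auto simp: abs_le_iff)
      then have "sqrt \<bar>t\<bar> \<le> 1" by (metis real_sqrt_le_mono real_sqrt_one)
      then show "g t \<le> fejer L t" unfolding g_def using fejer_nonneg by (simp add: mult_left_le_one_le)
    qed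
    also have "\<dots> \<le> 2 * pi / L" using fejer_integral_le[of 1] by simp
    finally show ?thesis .
  qed
  have neg: "integral {- T..- 1} g = integral {1..T} g"
    using Henstock_Kurzweil_Integration.integral_reflect_real[of T 1 g] by (simp add: g_even)
  have "integral {- T..T} g = integral {- T..- 1} g + integral {- 1..T} g"
    by (rule Henstock_Kurzweil_Integration.integral_combine[symmetric]) (use T gi in auto)
  also have "integral {- 1..T} g = integral {- 1..1} g + integral {1..T} g"
    by (rule Henstock_Kurzweil_Integration.integral_combine[symmetric]) (use T gi in auto)
  finally show ?thesis using out mid neg unfolding g_def by simp
qed

end

section \<open>An upper bound for the order of vanishing\<close>

lemma norm_Digamma_le:
  assumes "x \<ge> 1"
  shows "cmod (Digamma (Complex x y)) \<le> \<bar>Digamma x\<bar> + zeta32 * sqrt \<bar>y\<bar>"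
proof -
  have "cmod (Digamma (Complex x y)) \<le> cmod (of_real (Digamma x)) + cmod (Digamma (Complex x y) - of_real (Digamma x))"
    by (rule norm_triangle_sub)
  then show ?thesis using norm_Digamma_diff_le[OF assms, of y] by simp
qed

lemma one_le_growth: "\<bar>T\<bar> \<le> 1 + \<bar>T\<bar> * sqrt \<bar>T\<bar>" "1 \<le> 1 + \<bar>T\<bar> * sqrt \<bar>T\<bar>" for T :: real
proof -
  show "1 \<le> 1 + \<bar>T\<bar> * sqrt \<bar>T\<bar>" by simp
  show "\<bar>T\<bar> \<le> 1 + \<bar>T\<bar> * sqrt \<bar>T\<bar>"
  proof (cases "\<bar>T\<bar> \<le> 1")
    case True
    then show ?thesis using \<open>1 \<le> 1 + \<bar>T\<bar> * sqrt \<bar>T\<bar>\<close> by linarith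
  next
    case False
    then have "1 \<le> sqrt \<bar>T\<bar>" by simp
    then have "\<bar>T\<bar> * 1 \<le> \<bar>T\<bar> * sqrt \<bar>T\<bar>" by (intro mult_left_mono) auto
    then show ?thesis by linarith
  qed
qed

text \<open>The logarithm of Gamma is followed along the vertical segment from the real point x,
  with its derivative bounded by \<open>norm_Digamma_le\<close>. The resulting order 3/2 is cruder
  than Stirling's formula but below the admissible order 2.\<close>

lemma norm_Gamma_ge:
  assumes x: "x \<ge> 1"
  obtains C where "C \<ge> 0" "\<And>T. cmod (Gamma (Complex x T)) \<ge> exp (- C * (1 + \<bar>T\<bar> * sqrt \<bar>T\<bar>))"
proof -
  define C where "C = cmod (ln_Gamma (Complex x 0)) + \<bar>Digamma x\<bar> + zeta32"
  have C0: "C \<ge> 0" using zeta32_nonneg by (simp add: C_def)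
  have "cmod (Gamma (Complex x T)) \<ge> exp (- C * (1 + \<bar>T\<bar> * sqrt \<bar>T\<bar>))" for T
  proof -
    define g where "g = 1 + \<bar>T\<bar> * sqrt \<bar>T\<bar>"
    have g: "\<bar>T\<bar> \<le> g" "1 \<le> g" "\<bar>T\<bar> * sqrt \<bar>T\<bar> \<le> g" using one_le_growth[of T] by (simp_all add: g_def)
    define S where "S = closed_segment (Complex x 0) (Complex x T)"
    have S: "\<exists>t. z = Complex x t \<and> \<bar>t\<bar> \<le> \<bar>T\<bar>" if z: "z \<in> S" for z
    proof -
      obtain u where u: "0 \<le> u" "u \<le> 1" "z = (1 - u) *\<^sub>R Complex x 0 + u *\<^sub>R Complex x T"
        using z by (auto simp: S_def closed_segment_def)
      then have "z = Complex x (u * T)" by (simp add: complex_eq_iff algebra_simps)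
      moreover have "\<bar>u * T\<bar> \<le> \<bar>T\<bar>" using u by (simp add: abs_mult mult_left_le_one_le)
      ultimately show ?thesis by blast
    qed
    have "cmod (ln_Gamma (Complex x T) - ln_Gamma (Complex x 0)) \<le>
        (\<bar>Digamma x\<bar> + zeta32 * sqrt \<bar>T\<bar>) * cmod (Complex x T - Complex x 0)"
    proof (rule field_differentiable_bound[where S = S and f' = Digamma])
      show "convex S" unfolding S_def by (rule convex_closed_segment)
      show "Complex x T \<in> S" "Complex x 0 \<in> S" by (auto simp: S_def)
      fix z assume "z \<in> S"
      then obtain t where t: "z = Complex x t" "\<bar>t\<bar> \<le> \<bar>T\<bar>" using S by blast
      have "z \<notin> \<real>\<^sub>\<le>\<^sub>0" using t x by (auto simp: complex_nonpos_Reals_iff)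
      then show "(ln_Gamma has_field_derivative Digamma z) (at z within S)"
        by (rule has_field_derivative_at_within[OF has_field_derivative_ln_Gamma_complex])
      have "cmod (Digamma z) \<le> \<bar>Digamma x\<bar> + zeta32 * sqrt \<bar>t\<bar>" unfolding t by (rule norm_Digamma_le[OF x])
      also have "\<dots> \<le> \<bar>Digamma x\<bar> + zeta32 * sqrt \<bar>T\<bar>"
        using t zeta32_nonneg by (intro add_left_mono mult_left_mono) auto
      finally show "cmod (Digamma z) \<le> \<bar>Digamma x\<bar> + zeta32 * sqrt \<bar>T\<bar>" .
    qed
    also have "cmod (Complex x T - Complex x 0) = \<bar>T\<bar>"
      by (simp add: cmod_def)
    also have "(\<bar>Digamma x\<bar> + zeta32 * sqrt \<bar>T\<bar>) * \<bar>T\<bar> = \<bar>Digamma x\<bar> * \<bar>T\<bar> + zeta32 * (\<bar>T\<bar> * sqrt \<bar>T\<bar>)"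
      by (simp add: algebra_simps)
    also have "\<dots> \<le> \<bar>Digamma x\<bar> * g + zeta32 * g"
      using g zeta32_nonneg by (intro add_mono mult_left_mono) auto
    finally have d: "cmod (ln_Gamma (Complex x T) - ln_Gamma (Complex x 0)) \<le> \<bar>Digamma x\<bar> * g + zeta32 * g" .
    have "cmod (ln_Gamma (Complex x T)) \<le> cmod (ln_Gamma (Complex x 0)) + cmod (ln_Gamma (Complex x T) - ln_Gamma (Complex x 0))"
      by (rule norm_triangle_sub)
    also have "cmod (ln_Gamma (Complex x 0)) \<le> cmod (ln_Gamma (Complex x 0)) * g"
      using mult_left_mono[OF g(2), of "cmod (ln_Gamma (Complex x 0))"] by simp
    also note d
    finally have "cmod (ln_Gamma (Complex x T)) \<le> C * g" by (simp add: C_def algebra_simps)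
    moreover have "- Re (ln_Gamma (Complex x T)) \<le> cmod (ln_Gamma (Complex x T))"
      using abs_Re_le_cmod[of "ln_Gamma (Complex x T)"] by linarith
    ultimately have re: "- (C * g) \<le> Re (ln_Gamma (Complex x T))" by linarith
    have "Complex x T \<notin> \<int>\<^sub>\<le>\<^sub>0" using x by (auto simp: complex_eq_iff elim!: nonpos_Ints_cases)
    then have "cmod (Gamma (Complex x T)) = exp (Re (ln_Gamma (Complex x T)))" by (simp add: Gamma_complex_altdef)
    with re show ?thesis by (simp add: g_def)
  qed
  with C0 show thesis by (rule that)
qed

section \<open>Bounds in the region of absolute convergence and the factor at 1/2\<close>

lemma norm_gdir_le:
  assumes c: "dir_conv c" and s: "Re s \<ge> \<sigma>" "\<sigma> > 1"
  shows "cmod (gdir c s) \<le> (\<Sum>\<^sub>\<infinity>x. cmod (c x) * real (gnorm x) powr (- \<sigma>))"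
proof (rule norm_infsum_le)
  show "((\<lambda>x. c x * of_nat (gnorm x) powr (- s)) has_sum gdir c s) UNIV"
    by (rule gdir_has_sum[OF c]) (use s in simp)
  show "((\<lambda>x. cmod (c x) * real (gnorm x) powr (- \<sigma>)) has_sum (\<Sum>\<^sub>\<infinity>x. cmod (c x) * real (gnorm x) powr (- \<sigma>))) UNIV"
    by (rule has_sum_infsum[OF dir_convD[OF c s(2)]])
  fix x
  have "real (gnorm x) powr (- Re s) \<le> real (gnorm x) powr (- \<sigma>)"
  proof (cases "gnorm x = 0")
    case False
    then have "real (gnorm x) \<ge> 1" by linarith
    then show ?thesis using s by (intro powr_mono) auto
  qed simp
  then show "cmod (c x * of_nat (gnorm x) powr (- s)) \<le> cmod (c x) * real (gnorm x) powr (- \<sigma>)"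
    unfolding gdir_term_norm by (rule mult_left_mono) simp
qed

lemma gmang_series_bounded:
  obtains M where "M \<ge> 0" "\<And>s. Re s \<ge> 2 \<Longrightarrow> cmod (gmang_series k s) \<le> M"
proof -
  let ?c = "\<lambda>x. of_real (gmangoldt x) * gchi k x"
  define M where "M = (\<Sum>\<^sub>\<infinity>x. cmod (?c x) * real (gnorm x) powr (- 2)) / 4"
  have "M \<ge> 0" unfolding M_def by (intro divide_nonneg_nonneg infsum_nonneg) auto
  moreover have "cmod (gmang_series k s) \<le> M" if "Re s \<ge> 2" for s
    using norm_gdir_le[OF dir_conv_gmangoldt that, of k] by (simp add: gmang_series_def M_def norm_divide)
  ultimately show thesis by (rule that)
qed

lemma gseries_lower_bound:
  obtains M where "M \<ge> 0" "\<And>s. Re s \<ge> 2 \<Longrightarrow> cmod (gseries k s) \<ge> exp (- M)"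
proof -
  let ?c = "\<lambda>x. of_real (gmangoldt x / ln (real (gnorm x))) * gchi k x"
  define M where "M = (\<Sum>\<^sub>\<infinity>x. cmod (?c x) * real (gnorm x) powr (- 2)) / 4"
  have "M \<ge> 0" unfolding M_def by (intro divide_nonneg_nonneg infsum_nonneg) auto
  moreover have "cmod (gseries k s) \<ge> exp (- M)" if s: "Re s \<ge> 2" for s
  proof -
    have "cmod (glog k s) \<le> M"
      using norm_gdir_le[OF dir_conv_gmang_ratio s, of k] by (simp add: glog_def M_def norm_divide)
    then have "- M \<le> Re (glog k s)" using abs_Re_le_cmod[of "glog k s"] by linarith
    then show ?thesis using gseries_eq_exp[of s k] s by simp
  qed
  ultimately show thesis by (rule that)
qed

lemma lfun_eq_0_iff: "k \<ge> 1 \<Longrightarrow> Re s > 0 \<Longrightarrow> lfun k s = 0 \<longleftrightarrow> Lam k s = 0"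
proof -
  assume "k \<ge> 1" "Re s > 0"
  then have "s + 2 * of_nat k \<notin> \<int>\<^sub>\<le>\<^sub>0" by (auto simp: complex_eq_iff elim!: nonpos_Ints_cases)
  then show ?thesis by (simp add: lfun_def rGamma_eq_zero_iff)
qed

lemma lfun_log_deriv:
  assumes k: "k \<ge> 1" and s: "Re s > 1"
  shows "deriv (lfun k) s / lfun k s = - gmang_series k s"
proof -
  have op: "open {s. Re s > 1}" by (rule open_halfspace_Re_gt)
  have "(lfun k has_field_derivative - gmang_series k s * gseries k s) (at s)"
    by (rule has_field_derivative_transform_within_open[OF gseries_deriv[OF s] op])
      (use s lfun_eq_gseries[OF k] in auto)
  then have "deriv (lfun k) s = - gmang_series k s * lfun k s"
    using lfun_eq_gseries[OF k s] by (simp add: DERIV_imp_deriv)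
  then show ?thesis using lfun_nonzero_right[OF k, of s] s by simp
qed

text \<open>By the functional equation a zero at 1/2 has order at least 2, and exactly (s - 1/2)^2
  is split off. G may still vanish at 1/2; later only its zeros to the right of the critical line
  are excluded.\<close>

lemma completed_factor:
  assumes k: "k \<ge> 1"
  obtains G m where "G holomorphic_on UNIV" "m = (if lfun k (1 / 2) = 0 then 2 else 0 :: nat)"
    "\<And>s. Lam k s = (s - 1 / 2) ^ m * G s"
proof (cases "lfun k (1 / 2) = 0")
  case True
  then have "Lam k (1 / 2) = 0" using lfun_eq_0_iff[OF k, of "1 / 2"] by simp
  moreover have "Lam k (2 * (1 / 2) - s) = Lam k s" for s using Lam_reflect[of k s] by simp
  ultimately obtain G where "G holomorphic_on UNIV" "\<And>s. Lam k s = (s - 1 / 2)\<^sup>2 * G s"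
    using even_double_zero[OF Lam_holomorphic[OF k], of "1 / 2"] by blast
  then show thesis using that[of G 2] True by simp
next
  case False
  then show thesis using that[of "Lam k" 0] Lam_holomorphic[OF k] by simp
qed

text \<open>The prime side at the line Re s = 1/2 + \<delta>, with the triangular weight of the
  Fejer kernel. For \<delta> > 0 the line avoids the zeros; \<delta> = 0 is reached as a limit of
  this finite sum.\<close>

definition weight_sum :: "nat \<Rightarrow> real \<Rightarrow> real \<Rightarrow> real" where
  "weight_sum k L \<delta> = (\<Sum>x | x \<noteq> 0 \<and> real (gnorm x) \<le> exp L.
     gmangoldt x * Re (gchi k x) * real (gnorm x) powr (- (1 / 2) - \<delta>) * (L - ln (real (gnorm x))))"

context
  fixes k m :: nat and G :: "complex \<Rightarrow> complex"
  assumes k: "k \<ge> 1" and nz: "\<And>s. Re s > 1 / 2 \<Longrightarrow> lfun k s \<noteq> 0"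
    and G: "G holomorphic_on UNIV" and m: "m = 0 \<or> m = 2"
    and LG: "\<And>s. Lam k s = (s - 1 / 2) ^ m * G s"
begin

lemma G_nonzero: "Re s > 1 / 2 \<Longrightarrow> G s \<noteq> 0"
  using nz[of s] lfun_eq_0_iff[OF k, of s] LG[of s] by auto

lemma G_log_deriv:
  assumes s: "Re s > 1 / 2"
  shows "deriv G s / G s = - of_real (ln pi) + Digamma (s + 2 * of_nat k) + deriv (lfun k) s / lfun k s - of_nat m / (s - 1 / 2)"
proof -
  define E where "E z = exp (z * of_real (ln pi))" for z :: complex
  define R where "R z = rGamma (z + 2 * of_nat k)" for z :: complex
  define P where "P z = (z - 1 / 2) ^ m" for z :: complex
  have s0: "s - 1 / 2 \<noteq> 0"
  proof
    assume "s - 1 / 2 = 0"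
    then have "Re (s - 1 / 2) = 0" by (simp only: zero_complex.sel)
    then show False using s by simp
  qed
  have lf: "lfun k z = E z * R z * (P z * G z)" for z
    unfolding lfun_def LG E_def R_def P_def by (simp add: powr_def Ln_of_real mult_ac)
  have np: "s + 2 * of_nat k \<notin> \<int>\<^sub>\<le>\<^sub>0" using s by (auto simp: complex_eq_iff elim!: nonpos_Ints_cases)
  have dE: "(E has_field_derivative E s * of_real (ln pi)) (at s)"
    unfolding E_def by (auto intro!: derivative_eq_intros)
  have dR: "(R has_field_derivative R s * (- Digamma (s + 2 * of_nat k))) (at s)"
    unfolding R_def using np by (auto intro!: derivative_eq_intros)
  have dP: "(P has_field_derivative P s * (of_nat m / (s - 1 / 2))) (at s)"
  proof -
    have "(P has_field_derivative of_nat m * (s - 1 / 2) ^ (m - 1)) (at s)"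
      unfolding P_def by (auto intro!: derivative_eq_intros)
    moreover have "of_nat m * (s - 1 / 2) ^ (m - 1) = P s * (of_nat m / (s - 1 / 2))"
      using m s0 by (auto simp: P_def power2_eq_square)
    ultimately show ?thesis by simp
  qed
  have dG: "(G has_field_derivative deriv G s) (at s)" using G by (meson UNIV_I holomorphic_derivI open_UNIV)
  have Gs: "G s \<noteq> 0" by (rule G_nonzero[OF s])
  have "(lfun k has_field_derivative E s * R s * (P s * deriv G s + P s * (of_nat m / (s - 1 / 2)) * G s) +
      (E s * (R s * (- Digamma (s + 2 * of_nat k))) + E s * of_real (ln pi) * R s) * (P s * G s)) (at s)"
    unfolding lf[abs_def] by (rule DERIV_mult'[OF DERIV_mult'[OF dE dR] DERIV_mult'[OF dP dG]])
  then have "deriv (lfun k) s = E s * R s * (P s * deriv G s + P s * (of_nat m / (s - 1 / 2)) * G s) +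
      (E s * (R s * (- Digamma (s + 2 * of_nat k))) + E s * of_real (ln pi) * R s) * (P s * G s)"
    by (rule DERIV_imp_deriv)
  also have "\<dots> = lfun k s * (deriv G s / G s + of_nat m / (s - 1 / 2) - Digamma (s + 2 * of_nat k) + of_real (ln pi))"
  proof -
    have id: "e * r * (p * (g * w) + p * v * g) + (e * (r * (- D)) + e * l * r) * (p * g) = e * r * (p * g) * (w + v - D + l)"
      for e r p g w v D l :: complex by (simp add: algebra_simps)
    show ?thesis unfolding lf id[symmetric] using Gs by simp
  qed
  finally show ?thesis using nz[OF s] by simp
qed

text \<open>The functional equation and the reality of the kernel give this for \<open>Lam\<close>,
  and |s - 1/2| is invariant under the reflection. The point 1/2, where the factor may vanish, is
  fixed by it.\<close>

lemma G_symmetric: "cmod (G (1 - cnj s)) = cmod (G s)"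
proof (cases "s = 1 / 2")
  case True
  have "1 - cnj s = s" unfolding True by simp
  then show ?thesis by simp
next
  case False
  have "cmod (Lam k (1 - cnj s)) = cmod (Lam k s)" unfolding Lam_reflect Lam_cnj by simp
  moreover have "cmod (1 - cnj s - 1 / 2) = cmod (s - 1 / 2)"
  proof -
    have "1 - cnj s - 1 / 2 = - cnj (s - 1 / 2)" by simp
    then show ?thesis by (simp only: norm_minus_cancel complex_mod_cnj)
  qed
  ultimately show ?thesis using False unfolding LG norm_mult norm_power by simp
qed

lemma G_strip_bound: "\<exists>B. \<forall>s. \<bar>Re s\<bar> \<le> R \<longrightarrow> cmod (G s) \<le> B"
proof -
  obtain B where B: "B > 0" "\<And>s. \<bar>Re s\<bar> \<le> R \<Longrightarrow> cmod (Lam k s) \<le> B" using Lam_strip_bound[OF k, of R] by blast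
  have "compact (G ` cball (1 / 2) 1)"
    by (intro compact_continuous_image holomorphic_on_imp_continuous_on holomorphic_on_subset[OF G]) auto
  then have "bounded (G ` cball (1 / 2) 1)" by (rule compact_imp_bounded)
  then obtain B' where B': "\<And>s. s \<in> cball (1 / 2) 1 \<Longrightarrow> cmod (G s) \<le> B'" unfolding bounded_iff by blast
  have "cmod (G s) \<le> max B B'" if "\<bar>Re s\<bar> \<le> R" for s
  proof (cases "s \<in> cball (1 / 2) 1")
    case True
    then show ?thesis using B' by (simp add: max.coboundedI2)
  next
    case False
    then have "cmod (s - 1 / 2) \<ge> 1" by (simp add: dist_norm norm_minus_commute)
    then have "1 * cmod (G s) \<le> cmod (s - 1 / 2) ^ m * cmod (G s)" by (intro mult_right_mono one_le_power) auto
    also have "\<dots> = cmod (Lam k s)" by (simp add: LG norm_mult norm_power)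
    also have "\<dots> \<le> B" by (rule B(2)[OF that])
    finally show ?thesis by simp
  qed
  then show ?thesis by blast
qed

text \<open>For Re s = c the Gamma factor is bounded below by \<open>norm_Gamma_ge\<close> and the
  L-function by its convergent logarithm; dividing by (s - 1/2)^m costs at most exp (2 (c +
  |T|)).\<close>

lemma G_lower_bound:
  assumes c: "c \<ge> 2"
  obtains C where "C \<ge> 0" "\<And>T. cmod (G (Complex c T)) \<ge> exp (- C * (1 + \<bar>T\<bar> * sqrt \<bar>T\<bar>))"
proof -
  obtain C1 where C1: "C1 \<ge> 0" "\<And>T. cmod (Gamma (Complex (c + 2 * real k) T)) \<ge> exp (- C1 * (1 + \<bar>T\<bar> * sqrt \<bar>T\<bar>))"
    using norm_Gamma_ge[of "c + 2 * real k"] c by auto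
  obtain M where M: "M \<ge> 0" "\<And>s. Re s \<ge> 2 \<Longrightarrow> cmod (gseries k s) \<ge> exp (- M)" using gseries_lower_bound by blast
  have lp: "ln pi \<ge> 0" using pi_gt3 by simp
  define C where "C = C1 + c * ln pi + M + 2 * c + 2"
  have C0: "C \<ge> 0" using C1 M c lp by (simp add: C_def)
  have "cmod (G (Complex c T)) \<ge> exp (- C * (1 + \<bar>T\<bar> * sqrt \<bar>T\<bar>))" for T
  proof -
    define g where "g = 1 + \<bar>T\<bar> * sqrt \<bar>T\<bar>"
    define s where "s = Complex c T"
    have g: "\<bar>T\<bar> \<le> g" "1 \<le> g" using one_le_growth[of T] by (simp_all add: g_def)
    have res: "Re s > 1" "Re s \<ge> 2" using c by (simp_all add: s_def)
    have sk: "s + 2 * of_nat k = Complex (c + 2 * real k) T" by (simp add: s_def complex_eq_iff)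
    have "cmod (Lam k s) = pi powr (- c) * cmod (Gamma (s + 2 * of_nat k)) * cmod (gseries k s)"
      unfolding gkernel_mellin(2)[OF k res(1)] norm_mult using norm_powr_real_powr[of "of_real pi" "- s"] by (simp add: s_def)
    also have "\<dots> \<ge> exp (- (c * ln pi)) * exp (- C1 * g) * exp (- M)"
    proof -
      have "pi powr (- c) = exp (- (c * ln pi))" by (simp add: powr_def)
      then show ?thesis unfolding sk using C1(2)[of T] M(2)[OF res(2)]
        by (intro mult_mono) (auto simp: g_def)
    qed
    finally have 1: "exp (- (c * ln pi) - C1 * g - M) \<le> cmod (Lam k s)" by (simp add: exp_diff exp_minus divide_inverse)
    have sb: "cmod (s - 1 / 2) \<le> exp (c + \<bar>T\<bar>)"
    proof -
      have "cmod (s - 1 / 2) \<le> \<bar>Re (s - 1 / 2)\<bar> + \<bar>Im (s - 1 / 2)\<bar>" by (rule cmod_le)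
      also have "\<dots> \<le> c + \<bar>T\<bar>" using c by (simp add: s_def)
      also have "\<dots> \<le> exp (c + \<bar>T\<bar>)" using exp_ge_add_one_self[of "c + \<bar>T\<bar>"] by linarith
      finally show ?thesis .
    qed
    have "cmod (s - 1 / 2) ^ m \<le> exp (c + \<bar>T\<bar>) ^ m" by (rule power_mono[OF sb]) simp
    also have "\<dots> \<le> exp (c + \<bar>T\<bar>) ^ 2" using m c by (intro power_increasing) auto
    also have "\<dots> = exp (2 * (c + \<bar>T\<bar>))" by (rule exp_double[symmetric])
    finally have 2: "cmod (s - 1 / 2) ^ m \<le> exp (2 * (c + \<bar>T\<bar>))" .
    have "exp (- (c * ln pi) - C1 * g - M) \<le> cmod (s - 1 / 2) ^ m * cmod (G s)"
      using 1 by (simp add: LG norm_mult norm_power)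
    also have "\<dots> \<le> exp (2 * (c + \<bar>T\<bar>)) * cmod (G s)" by (rule mult_right_mono[OF 2]) simp
    finally have "exp (- (2 * (c + \<bar>T\<bar>))) * exp (- (c * ln pi) - C1 * g - M) \<le>
        exp (- (2 * (c + \<bar>T\<bar>))) * (exp (2 * (c + \<bar>T\<bar>)) * cmod (G s))" by (rule mult_left_mono) simp
    then have 3: "exp (- (2 * (c + \<bar>T\<bar>)) + (- (c * ln pi) - C1 * g - M)) \<le> cmod (G s)"
      unfolding mult.assoc[symmetric] exp_add[symmetric] by simp
    have "c * ln pi \<le> c * ln pi * g" "M \<le> M * g" "2 * c \<le> 2 * c * g"
      using g M c lp mult_left_mono[OF g(2), of "c * ln pi"] mult_left_mono[OF g(2), of M] mult_left_mono[OF g(2), of "2 * c"] by auto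
    then have "- C * g \<le> - (2 * (c + \<bar>T\<bar>)) + (- (c * ln pi) - C1 * g - M)"
      using g(1) by (simp add: C_def algebra_simps)
    then have "exp (- C * g) \<le> exp (- (2 * (c + \<bar>T\<bar>)) + (- (c * ln pi) - C1 * g - M))" by simp
    also note 3
    finally show ?thesis unfolding g_def s_def .
  qed
  with C0 show thesis by (rule that)
qed

lemma G_log_deriv_right:
  assumes M: "cmod (gmang_series k s) \<le> M" and s: "Re s \<ge> 2"
  shows "cmod (deriv G s / G s + of_real (ln pi) - Digamma (s + 2 * of_nat k)) \<le> M + 2"
proof -
  have "deriv G s / G s + of_real (ln pi) - Digamma (s + 2 * of_nat k) = - gmang_series k s - of_nat m / (s - 1 / 2)"
    using G_log_deriv[of s] lfun_log_deriv[OF k, of s] s by simp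
  also have "cmod \<dots> \<le> cmod (- gmang_series k s) + cmod (of_nat m / (s - 1 / 2))" by (rule norm_triangle_ineq4)
  also have "cmod (of_nat m / (s - 1 / 2)) \<le> 2"
  proof -
    have "1 \<le> cmod (s - 1 / 2)" using s abs_Re_le_cmod[of "s - 1 / 2"] by simp
    then have "cmod (of_nat m / (s - 1 / 2)) \<le> 2 / 1"
      unfolding norm_divide using m by (intro frac_le) auto
    then show ?thesis by simp
  qed
  finally show ?thesis using M by simp
qed

text \<open>Far to the right the digamma term exceeds ln pi and all bounded terms, because it tends
  to infinity. This supplies the right-hand boundary condition of
  \<open>Re_log_deriv_nonneg\<close>.\<close>

lemma G_log_deriv_nonneg:
  assumes s: "Re s > 1 / 2"
  shows "Re (deriv G s / G s) \<ge> 0"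
proof -
  obtain M where M: "M \<ge> 0" "\<And>s. Re s \<ge> 2 \<Longrightarrow> cmod (gmang_series k s) \<le> M" using gmang_series_bounded by blast
  obtain x0 where x0: "x0 > 0" "\<And>x. x \<ge> x0 \<Longrightarrow> Digamma x \<ge> ln pi + M + 2" using Digamma_at_top by blast
  \<comment> \<open>Ensures that Re z >= c - 2 implies both Re z >= 2 and Re z >= x0.\<close>
  define c where "c = x0 + 4"
  have c: "c \<ge> 2" using x0 by (simp add: c_def)
  obtain C where C: "C \<ge> 0" "\<And>T. cmod (G (Complex c T)) \<ge> exp (- C * (1 + \<bar>T\<bar> * sqrt \<bar>T\<bar>))"
    using G_lower_bound[OF c] by blast
  show ?thesis
  proof (rule Re_log_deriv_nonneg[OF G G_nonzero G_symmetric G_strip_bound c C _ s])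
    fix z assume z: "Re z \<ge> c - 2"
    then have z2: "Re z \<ge> 2" "Re z + 2 * real k \<ge> x0" using x0 by (auto simp: c_def)
    have "z + 2 * of_nat k = Complex (Re z + 2 * real k) (Im z)" by (simp add: complex_eq_iff)
    then have "Re (Digamma (z + 2 * of_nat k)) \<ge> Digamma (Re z + 2 * real k)"
      using Re_Digamma_ge[of "Re z + 2 * real k" "Im z"] z2 by simp
    moreover have "Digamma (Re z + 2 * real k) \<ge> ln pi + M + 2" by (rule x0(2)[OF z2(2)])
    moreover have "\<bar>Re (deriv G z / G z + of_real (ln pi) - Digamma (z + 2 * of_nat k))\<bar> \<le> M + 2"
      using abs_Re_le_cmod G_log_deriv_right[OF M(2) z2(1)] order_trans z2(1) by blast
    ultimately show "Re (deriv G z / G z) \<ge> 0" by simp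
  qed
qed

lemma G_log_deriv_horizontal:
  assumes c: "c \<ge> 2" and d: "0 < \<delta>" "\<delta> < 1"
  obtains A where "A \<ge> 0" "\<And>s. 1 / 2 + \<delta> \<le> Re s \<Longrightarrow> Re s \<le> c \<Longrightarrow> cmod (deriv G s / G s) \<le> A * (1 + sqrt \<bar>Im s\<bar>)"
proof -
  obtain M where M: "M \<ge> 0" "\<And>s. Re s \<ge> 2 \<Longrightarrow> cmod (gmang_series k s) \<le> M" using gmang_series_bounded by blast
  define R r where "R = c - 1 / 2" and "r = c - 1 / 2 - \<delta>"
  have Rr: "0 \<le> r" "r < R" using c d by (auto simp: R_def r_def)
  define q where "q = (R + r) / (R - r)"
  have q: "q \<ge> 0" using Rr by (simp add: q_def)
  define A0 where "A0 = ln pi + \<bar>Digamma (c + 2 * real k)\<bar> + zeta32 + M + 3"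
  have lp: "ln pi \<ge> 0" using pi_gt3 by simp
  have A0: "A0 \<ge> 0" using lp M zeta32_nonneg by (simp add: A0_def)
  have "cmod (deriv G s / G s) \<le> (A0 * q + 1) * (1 + sqrt \<bar>Im s\<bar>)" if s: "1 / 2 + \<delta> \<le> Re s" "Re s \<le> c" for s
  proof -
    define T where "T = Im s"
    define f where "f z = deriv G z / G z + 1" for z
    have re: "Re z > 1 / 2" if "z \<in> ball (Complex c T) R" for z
    proof -
      have "c - Re z \<le> cmod (Complex c T - z)" using abs_Re_le_cmod[of "Complex c T - z"] by simp
      then show ?thesis using that by (simp add: dist_norm R_def)
    qed
    have h1: "cmod (f s) \<le> cmod (f (Complex c T)) * ((R + r) / (R - r))"
    proof (rule pos_real_part_bound[where f = f and z = s, OF _ _ _ Rr(2,1)])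
      show "f holomorphic_on ball (Complex c T) R" unfolding f_def
      proof (intro holomorphic_intros)
        show "G z \<noteq> 0" if "z \<in> ball (Complex c T) R" for z using G_nonzero re[OF that] by blast
      qed (use holomorphic_on_subset[OF G] in auto)
      show "Re (f z) > 0" if "z \<in> ball (Complex c T) R" for z
        using G_log_deriv_nonneg[OF re[OF that]] by (simp add: f_def)
      have "Complex c T - s = of_real (c - Re s)" by (simp add: T_def complex_eq_iff)
      then have "cmod (Complex c T - s) = \<bar>c - Re s\<bar>" by (simp only: norm_of_real)
      then show "dist (Complex c T) s \<le> r" using s by (simp add: dist_norm r_def)
    qed
    have h2: "cmod (f (Complex c T)) \<le> A0 * (1 + sqrt \<bar>T\<bar>)"
    proof -
      let ?z = "Complex c T"
      let ?D = "Digamma (?z + 2 * of_nat k)"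
      have zk: "?z + 2 * of_nat k = Complex (c + 2 * real k) T" by (simp add: complex_eq_iff)
      have D: "cmod ?D \<le> \<bar>Digamma (c + 2 * real k)\<bar> + zeta32 * sqrt \<bar>T\<bar>" unfolding zk by (rule norm_Digamma_le) (use c in simp)
      have e: "cmod (deriv G ?z / G ?z + of_real (ln pi) - ?D) \<le> M + 2" by (rule G_log_deriv_right) (use M c in auto)
      have "f ?z = (deriv G ?z / G ?z + of_real (ln pi) - ?D) + (of_real (1 - ln pi) + ?D)" by (simp add: f_def)
      also have "cmod \<dots> \<le> cmod (deriv G ?z / G ?z + of_real (ln pi) - ?D) + cmod (of_real (1 - ln pi) + ?D)"
        by (rule norm_triangle_ineq)
      also have "cmod (of_real (1 - ln pi) + ?D) \<le> cmod (of_real (1 - ln pi)) + cmod ?D" by (rule norm_triangle_ineq)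
      also have "cmod (complex_of_real (1 - ln pi)) \<le> 1 + ln pi" unfolding norm_of_real using lp by (intro abs_leI) linarith+
      finally have "cmod (f ?z) \<le> M + 3 + ln pi + \<bar>Digamma (c + 2 * real k)\<bar> + zeta32 * sqrt \<bar>T\<bar>" using D e by linarith
      also have "\<dots> \<le> A0 + A0 * sqrt \<bar>T\<bar>"
      proof (intro add_mono mult_right_mono)
        show "M + 3 + ln pi + \<bar>Digamma (c + 2 * real k)\<bar> \<le> A0" "zeta32 \<le> A0" using M lp zeta32_nonneg by (auto simp: A0_def)
      qed simp
      finally show ?thesis by (simp add: distrib_left)
    qed
    have "cmod (f s) \<le> A0 * (1 + sqrt \<bar>T\<bar>) * q"
      using order_trans[OF h1[folded q_def] mult_right_mono[OF h2 q]] .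
    moreover have "cmod (deriv G s / G s) \<le> cmod (f s) + 1"
      using norm_triangle_ineq4[of "f s" 1] by (simp add: f_def)
    ultimately have "cmod (deriv G s / G s) \<le> A0 * (1 + sqrt \<bar>T\<bar>) * q + 1" by linarith
    also have "\<dots> \<le> A0 * (1 + sqrt \<bar>T\<bar>) * q + (1 + sqrt \<bar>T\<bar>)" by simp
    finally show ?thesis by (simp add: T_def algebra_simps)
  qed
  moreover have "A0 * q + 1 \<ge> 0" using A0 q by simp
  ultimately show thesis using that by blast
qed

lemma lfun_log_deriv_horizontal:
  assumes c: "c \<ge> 2" and d: "0 < \<delta>" "\<delta> < 1"
  obtains A where "A \<ge> 0" "\<And>s. 1 / 2 + \<delta> \<le> Re s \<Longrightarrow> Re s \<le> c \<Longrightarrow> cmod (deriv (lfun k) s / lfun k s) \<le> A * (1 + sqrt \<bar>Im s\<bar>)"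
proof -
  obtain A where A: "A \<ge> 0" "\<And>s. 1 / 2 + \<delta> \<le> Re s \<Longrightarrow> Re s \<le> c \<Longrightarrow> cmod (deriv G s / G s) \<le> A * (1 + sqrt \<bar>Im s\<bar>)"
    using G_log_deriv_horizontal[OF c d] by blast
  have "compact ((Digamma :: real \<Rightarrow> real) ` {2..c + 2 * real k})"
    by (intro compact_continuous_image continuous_on_Polygamma) (auto elim!: nonpos_Ints_cases)
  then have "bounded ((Digamma :: real \<Rightarrow> real) ` {2..c + 2 * real k})" by (rule compact_imp_bounded)
  then obtain D where D: "\<And>x. x \<in> {2..c + 2 * real k} \<Longrightarrow> \<bar>Digamma x\<bar> \<le> D"
    unfolding bounded_iff real_norm_def by blast
  have "\<bar>Digamma (2::real)\<bar> \<le> D" using D[of 2] c by auto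
  then have D0: "D \<ge> 0" by linarith
  have lp: "ln pi \<ge> 0" using pi_gt3 by simp
  define B where "B = A + ln pi + D + zeta32 + 2 / \<delta>"
  have "B \<ge> 0" using A lp D0 d zeta32_nonneg by (simp add: B_def)
  moreover have "cmod (deriv (lfun k) s / lfun k s) \<le> B * (1 + sqrt \<bar>Im s\<bar>)" if s: "1 / 2 + \<delta> \<le> Re s" "Re s \<le> c" for s
  proof -
    have k1: "real k \<ge> 1" using k by simp
    have sk: "s + 2 * of_nat k = Complex (Re s + 2 * real k) (Im s)" by (simp add: complex_eq_iff)
    have "cmod (Digamma (s + 2 * of_nat k)) \<le> \<bar>Digamma (Re s + 2 * real k)\<bar> + zeta32 * sqrt \<bar>Im s\<bar>"
      unfolding sk by (rule norm_Digamma_le) (use s d k1 in linarith)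
    moreover have "\<bar>Digamma (Re s + 2 * real k)\<bar> \<le> D" by (rule D) (use s d k1 in auto)
    moreover have "cmod (of_nat m / (s - 1 / 2)) \<le> 2 / \<delta>"
    proof -
      have "\<delta> \<le> cmod (s - 1 / 2)" using s abs_Re_le_cmod[of "s - 1 / 2"] by simp
      then show ?thesis unfolding norm_divide using m d by (intro frac_le) auto
    qed
    moreover have "cmod (deriv (lfun k) s / lfun k s) =
        cmod (deriv G s / G s + of_real (ln pi) - Digamma (s + 2 * of_nat k) + of_nat m / (s - 1 / 2))"
      using G_log_deriv[of s] s d by (intro arg_cong[where f = cmod]) simp
    moreover have "cmod (deriv G s / G s + of_real (ln pi) - Digamma (s + 2 * of_nat k) + of_nat m / (s - 1 / 2)) \<le>
        cmod (deriv G s / G s) + cmod (complex_of_real (ln pi)) + cmod (Digamma (s + 2 * of_nat k)) + cmod (of_nat m / (s - 1 / 2))"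
      by (intro order_trans[OF norm_triangle_ineq] order_trans[OF norm_triangle_ineq4] add_mono order_refl)
    moreover have "cmod (complex_of_real (ln pi)) = ln pi" unfolding norm_of_real using lp by linarith
    ultimately have "cmod (deriv (lfun k) s / lfun k s) \<le> A * (1 + sqrt \<bar>Im s\<bar>) + ln pi + (D + zeta32 * sqrt \<bar>Im s\<bar>) + 2 / \<delta>"
      using A(2)[OF s] by linarith
    also have "\<dots> = (A + ln pi + D + 2 / \<delta>) + (A + zeta32) * sqrt \<bar>Im s\<bar>" by (simp add: algebra_simps)
    also have "\<dots> \<le> B + B * sqrt \<bar>Im s\<bar>"
    proof (intro add_mono mult_right_mono)
      have "0 \<le> 2 / \<delta>" using d by simp
      then show "A + zeta32 \<le> B" unfolding B_def using lp D0 by linarith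
      show "A + ln pi + D + 2 / \<delta> \<le> B" unfolding B_def using zeta32_nonneg by linarith
    qed simp
    finally show ?thesis by (simp add: distrib_left)
  qed
  ultimately show thesis by (rule that)
qed

text \<open>The integrand is moved to Re s = 2, where the Dirichlet series may be integrated
  termwise; the kernel removes all norms above e^L, leaving a finite sum. The constant is 2 pi / L^2
  from the kernel times 1/4 from the four generators of an ideal. The horizontal segments are
  controlled by the bound of order sqrt |t| against the decay t^(-2) of the kernel.\<close>

lemma lfun_log_deriv_integral:
  assumes d: "0 < \<delta>" "\<delta> < 1" and L: "L > 0"
  shows "(\<lambda>n. Re (integral {- real n..real n} (\<lambda>t. deriv (lfun k) (Complex (1 / 2 + \<delta>) t) / lfun k (Complex (1 / 2 + \<delta>) t) * of_real (fejer L t))))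
     \<longlonglongrightarrow> - (pi / (2 * L\<^sup>2)) * weight_sum k L \<delta>"
proof -
  obtain K where K: "K holomorphic_on UNIV"
    "\<And>z. z \<noteq> 0 \<Longrightarrow> K z = (perron_term L z + perron_term (- L) z - 2 * perron_term 0 z) / of_real (L\<^sup>2)"
    "\<And>t. K (Complex 0 t) = of_real (fejer L t)"
    using fejer_kernel_exists[OF L] by blast
  have twist: "integrable lborel (\<lambda>t. exp (- of_real x * Complex c t) * K (Complex c t))"
      "(\<integral>t. exp (- of_real x * Complex c t) * K (Complex c t) \<partial>lborel) =
      of_real (2 * pi / L\<^sup>2 * (max (L - x) 0 + max (- L - x) 0 - 2 * max (- x) 0))" if "c > 0" for x c
    using that by (rule fejer_kernel_twist[OF L K, rotated], simp)+
  have Kbound: "cmod (K s) \<le> 4 * exp (L * c) / (L\<^sup>2 * T\<^sup>2)" if "0 \<le> Re s" "Re s \<le> c" "\<bar>Im s\<bar> = T" "T > 0" for s c T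
    using that by (intro fejer_kernel_bound[OF L K])
  define b where "b = 3 / 2 - \<delta>"
  have b: "b > 0" using d by (simp add: b_def)
  define f where "f s = deriv (lfun k) s / lfun k s * K (s - of_real (1 / 2 + \<delta>))" for s
  define a where "a x = of_real (gmangoldt x) * gchi k x" for x
  define W where "W x = a x * of_real (real (gnorm x) powr (- (1 / 2) - \<delta>))" for x
  define g where "g x t = a x * of_nat (gnorm x) powr (- Complex 2 t) * K (Complex b t)" for x t
  define V where "V x = 2 * pi / L\<^sup>2 * max (L - ln (real (gnorm x))) 0" for x
  have dc: "dir_conv a" unfolding a_def by (rule dir_conv_gmangoldt)
  have g_eq: "g x t = W x * (exp (- of_real (ln (real (gnorm x))) * Complex b t) * K (Complex b t))" for x t
  proof (cases "gnorm x = 0")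
    case False
    have "- Complex 2 t * of_real (ln (real (gnorm x))) =
        of_real ((- (1 / 2) - \<delta>) * ln (real (gnorm x))) + (- of_real (ln (real (gnorm x))) * Complex b t)"
      by (simp add: complex_eq_iff b_def algebra_simps)
    then have "(of_nat (gnorm x) :: complex) powr (- Complex 2 t) =
        of_real (exp ((- (1 / 2) - \<delta>) * ln (real (gnorm x)))) * exp (- of_real (ln (real (gnorm x))) * Complex b t)"
      using False by (simp only: of_nat_powr_exp[of "gnorm x"] exp_add exp_of_real neq0_conv)
    moreover have "exp ((- (1 / 2) - \<delta>) * ln (real (gnorm x))) = real (gnorm x) powr (- (1 / 2) - \<delta>)"
      using False by (simp add: powr_def)
    ultimately show ?thesis by (simp add: g_def W_def mult_ac)
  qed (simp add: g_def W_def)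
  have g_int: "integrable lborel (g x)" for x
    unfolding g_eq[abs_def] by (intro integrable_mult_right twist(1)[OF b])
  have g_integral: "(\<integral>t. g x t \<partial>lborel) = W x * of_real (V x)" for x
  proof (cases "gnorm x = 0")
    case True
    then show ?thesis by (simp add: g_def W_def)
  next
    case False
    then have "real (gnorm x) \<ge> 1" by linarith
    then have "ln (real (gnorm x)) \<ge> 0" by (rule ln_ge_zero)
    then have "max (L - ln (real (gnorm x))) 0 + max (- L - ln (real (gnorm x))) 0 - 2 * max (- ln (real (gnorm x))) 0 =
        max (L - ln (real (gnorm x))) 0" using L by simp
    then show ?thesis unfolding g_eq integral_mult_right_zero twist(2)[OF b] V_def by simp
  qed
  have g_norm: "norm (g x t) = (cmod (a x) * real (gnorm x) powr (- 2)) * cmod (K (Complex b t))" for x t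
    unfolding g_def norm_mult norm_gnorm_powr by simp
  have sm: "(\<lambda>x. norm (g x t)) summable_on UNIV" for t
    unfolding g_norm by (intro summable_on_cmult_left dir_convD[OF dc]) simp
  have smi: "(\<lambda>x. \<integral>t. norm (g x t) \<partial>lborel) summable_on UNIV"
    unfolding g_norm integral_mult_right_zero by (intro summable_on_cmult_left dir_convD[OF dc]) simp
  note hs = has_sum_integral[OF countable_gint infinite_gint g_int sm smi]
  have f_eq: "f (Complex 2 t) = - (1 / 4) * (\<Sum>\<^sub>\<infinity>x. g x t)" for t
  proof -
    have "(\<Sum>\<^sub>\<infinity>x. g x t) = gdir a (Complex 2 t) * K (Complex b t)"
      unfolding g_def gdir_def by (rule infsum_cmult_left')
    moreover have "deriv (lfun k) (Complex 2 t) / lfun k (Complex 2 t) = - (gdir a (Complex 2 t) / 4)"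
      using lfun_log_deriv[OF k, of "Complex 2 t"] by (simp add: gmang_series_def a_def[abs_def])
    moreover have "Complex 2 t - of_real (1 / 2 + \<delta>) = Complex b t" by (simp add: complex_eq_iff b_def)
    ultimately show ?thesis by (simp add: f_def)
  qed
  define F where "F = {x. x \<noteq> 0 \<and> real (gnorm x) \<le> exp L}"
  have finF: "finite F"
  proof (rule finite_subset)
    show "F \<subseteq> {x. gnorm x \<le> nat \<lfloor>exp L\<rfloor>}" by (auto simp: F_def le_nat_floor)
  qed (rule finite_gnorm_le)
  have "(\<Sum>\<^sub>\<infinity>x. W x * of_real (V x)) = (\<Sum>\<^sub>\<infinity>x\<in>F. W x * of_real (V x))"
  proof (rule infsum_cong_neutral)
    fix x assume "x \<in> UNIV - F"
    then consider "x = 0" | "x \<noteq> 0" "real (gnorm x) > exp L" by (auto simp: F_def not_le)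
    then show "W x * of_real (V x) = 0"
    proof cases
      case 1
      then show ?thesis by (simp add: W_def)
    next
      case 2
      then have "ln (real (gnorm x)) \<ge> ln (exp L)" using gnorm_pos_iff[of x] by (subst ln_le_cancel_iff) auto
      then show ?thesis by (simp add: V_def)
    qed
  qed auto
  then have "(\<integral>t. (\<Sum>\<^sub>\<infinity>x. g x t) \<partial>lborel) = (\<Sum>x\<in>F. W x * of_real (V x))"
    using infsumI[OF hs(2)] finF unfolding g_integral by simp
  then have int: "integrable lborel (\<lambda>t. f (Complex 2 t))" "(\<integral>t. f (Complex 2 t) \<partial>lborel) = - (1 / 4) * (\<Sum>x\<in>F. W x * of_real (V x))"
    unfolding f_eq using integrable_mult_right[OF hs(1), of "- (1 / 4)"] by simp_all
  obtain A where A: "A \<ge> 0" "\<And>s. 1 / 2 + \<delta> \<le> Re s \<Longrightarrow> Re s \<le> 2 \<Longrightarrow> cmod (deriv (lfun k) s / lfun k s) \<le> A * (1 + sqrt \<bar>Im s\<bar>)"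
    using lfun_log_deriv_horizontal[OF order_refl d] by blast
  have l1: "lfun k holomorphic_on {s. Re s > 1 / 2}" by (rule holomorphic_on_subset[OF lfun_holomorphic[OF k]]) simp
  note l2 = holomorphic_deriv[OF l1 open_halfspace_Re_gt]
  have "(\<lambda>n. integral {- real n..real n} (\<lambda>t. f (Complex (1 / 2 + \<delta>) t))) \<longlonglongrightarrow> - (1 / 4) * (\<Sum>x\<in>F. W x * of_real (V x))"
  proof (rule line_integral_eq[where S = "{s. Re s > 1 / 2}" and b = 2])
    show "f holomorphic_on {s. Re s > 1 / 2}" unfolding f_def[abs_def]
    proof (rule holomorphic_on_mult[OF holomorphic_on_divide[OF l2 l1]])
      show "(\<lambda>s. K (s - of_real (1 / 2 + \<delta>))) holomorphic_on {s. Re s > 1 / 2}"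
        by (rule holomorphic_on_compose_gen[OF _ K(1), unfolded o_def]) (auto intro!: holomorphic_intros)
      show "lfun k s \<noteq> 0" if "s \<in> {s. Re s > 1 / 2}" for s using nz that by simp
    qed
    show "(\<lambda>n. integral {- real n..real n} (\<lambda>t. f (Complex 2 t))) \<longlonglongrightarrow> - (1 / 4) * (\<Sum>x\<in>F. W x * of_real (V x))"
      using integral_symmetric_limit[OF int(1)] unfolding int(2) .
    show "(\<lambda>n. A * (4 * exp (L * b) / L\<^sup>2) * ((1 + sqrt (real n)) / (real n)\<^sup>2)) \<longlonglongrightarrow> 0"
    proof (rule tendsto_mult_right_zero)
      show "(\<lambda>n. (1 + sqrt (real n)) / (real n)\<^sup>2) \<longlonglongrightarrow> 0" by real_asymp
    qed
    show "open {s. Re s > 1 / 2}" by (rule open_halfspace_Re_gt)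
    show "convex {s. Re s > 1 / 2}" by (rule convex_halfspace_Re_gt)
    fix n s assume n: "n \<ge> (1::nat)" and s: "1 / 2 + \<delta> \<le> Re s" "Re s \<le> 2" "\<bar>Im s\<bar> = real n"
    have "cmod (K (s - of_real (1 / 2 + \<delta>))) \<le> 4 * exp (L * b) / (L\<^sup>2 * (real n)\<^sup>2)"
      by (rule Kbound) (use s n in \<open>auto simp: b_def\<close>)
    moreover have "cmod (deriv (lfun k) s / lfun k s) \<le> A * (1 + sqrt (real n))" using A(2)[OF s(1,2)] s(3) by simp
    ultimately have "cmod (f s) \<le> A * (1 + sqrt (real n)) * (4 * exp (L * b) / (L\<^sup>2 * (real n)\<^sup>2))"
      unfolding f_def norm_mult using A(1) by (intro mult_mono) auto
    then show "cmod (f s) \<le> A * (4 * exp (L * b) / L\<^sup>2) * ((1 + sqrt (real n)) / (real n)\<^sup>2)" by (simp add: mult_ac)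
  qed (use d in auto)
  moreover have "f (Complex (1 / 2 + \<delta>) t) = deriv (lfun k) (Complex (1 / 2 + \<delta>) t) / lfun k (Complex (1 / 2 + \<delta>) t) * of_real (fejer L t)" for t
  proof -
    have "Complex (1 / 2 + \<delta>) t - of_real (1 / 2 + \<delta>) = Complex 0 t" by (simp add: complex_eq_iff)
    then show ?thesis unfolding f_def K(3)[symmetric] by (simp only:)
  qed
  ultimately have "(\<lambda>n. Re (integral {- real n..real n} (\<lambda>t. deriv (lfun k) (Complex (1 / 2 + \<delta>) t) / lfun k (Complex (1 / 2 + \<delta>) t) * of_real (fejer L t))))
     \<longlonglongrightarrow> Re (- (1 / 4) * (\<Sum>x\<in>F. W x * of_real (V x)))"
    by (simp only: tendsto_Re)
  moreover have "Re (- (1 / 4) * (\<Sum>x\<in>F. W x * of_real (V x))) = - (pi / (2 * L\<^sup>2)) * weight_sum k L \<delta>"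
  proof -
    have "Re (W x * of_real (V x)) = 2 * pi / L\<^sup>2 * (gmangoldt x * Re (gchi k x) * real (gnorm x) powr (- (1 / 2) - \<delta>) * (L - ln (real (gnorm x))))"
      if "x \<in> F" for x
    proof -
      have "real (gnorm x) > 0" using that by (simp add: F_def gnorm_pos_iff)
      then have "ln (real (gnorm x)) \<le> ln (exp L)" using that by (subst ln_le_cancel_iff) (auto simp: F_def)
      then have "V x = 2 * pi / L\<^sup>2 * (L - ln (real (gnorm x)))" by (simp add: V_def)
      then show ?thesis by (simp add: W_def a_def)
    qed
    then have "Re (\<Sum>x\<in>F. W x * of_real (V x)) = 2 * pi / L\<^sup>2 * weight_sum k L \<delta>"
      unfolding Re_sum weight_sum_def F_def[symmetric] sum_distrib_left by (intro sum.cong) auto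
    then show ?thesis by simp
  qed
  ultimately show ?thesis by simp
qed

text \<open>The positivity of Re (G'/G), written out by \<open>G_log_deriv\<close>, is multiplied by
  the Fejer kernel and integrated over [-n, n] with n tending to infinity. The factor at 1/2 is kept
  only on [-T, T], where the kernel is at least 1 - (L T)^2 / 12 and the Poisson kernel has mass 2
  arctan (T / \<delta>).\<close>

lemma weighted_inequality:
  assumes d: "0 < \<delta>" "\<delta> \<le> 1 / 2" and L: "L > 0" and T: "T \<ge> 0"
  shows "real m * (1 - L\<^sup>2 * T\<^sup>2 / 12) * (2 * arctan (T / \<delta>)) \<le>
    (2 + ln (real k) + zeta32) * (2 * pi / L) + zeta32 * (16 / L\<^sup>2) - (pi / (2 * L\<^sup>2)) * weight_sum k L \<delta>"
proof -
  define a where "a = 1 / 2 + \<delta>"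
  obtain K where K: "K holomorphic_on UNIV"
    "\<And>z. z \<noteq> 0 \<Longrightarrow> K z = (perron_term L z + perron_term (- L) z - 2 * perron_term 0 z) / of_real (L\<^sup>2)"
    "\<And>t. K (Complex 0 t) = of_real (fejer L t)"
    using fejer_kernel_exists[OF L] by blast
  have fejer_int: "T \<ge> 0 \<Longrightarrow> integral {- T..T} (fejer L) \<le> 2 * pi / L"
    "T \<ge> 1 \<Longrightarrow> integral {- T..T} (\<lambda>t. sqrt \<bar>t\<bar> * fejer L t) \<le> 2 * pi / L + 16 / L\<^sup>2" for T
    by (rule fejer_integral_le[OF L K], simp, simp) (rule fejer_sqrt_integral_le[OF L K], simp, simp)
  define q where "q t = deriv (lfun k) (Complex a t) / lfun k (Complex a t) * of_real (fejer L t)" for t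
  \<comment> \<open>The contribution of the factor (s - 1/2)^m, that is m times the Poisson kernel
    at height \<delta>, weighted by the Fejer kernel.\<close>
  define h where "h t = real m * (\<delta> / (\<delta>\<^sup>2 + t\<^sup>2)) * fejer L t" for t
  have pos: "\<delta>\<^sup>2 + t\<^sup>2 > 0" for t using d by (simp add: add_pos_nonneg)
  have d1: "\<delta> < 1" using d by simp
  have q_int: "q integrable_on {u..v}" for u v unfolding q_def
  proof (intro integrable_continuous_real continuous_intros fejer_continuous L)
    have l1: "lfun k holomorphic_on {s. Re s > 1 / 2}" by (rule holomorphic_on_subset[OF lfun_holomorphic[OF k]]) simp
    note l = l1 holomorphic_deriv[OF l1 open_halfspace_Re_gt]
    show "continuous_on {u..v} (\<lambda>t. deriv (lfun k) (Complex a t))" "continuous_on {u..v} (\<lambda>t. lfun k (Complex a t))"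
      by (rule continuous_on_compose2[OF holomorphic_on_imp_continuous_on[OF l(2)] Complex_continuous],
          use d in \<open>force simp: a_def\<close>,
          rule continuous_on_compose2[OF holomorphic_on_imp_continuous_on[OF l(1)] Complex_continuous],
          use d in \<open>force simp: a_def\<close>)
    show "\<forall>t\<in>{u..v}. lfun k (Complex a t) \<noteq> 0" using nz d by (simp add: a_def)
  qed
  have h_int: "h integrable_on {u..v}" for u v unfolding h_def
    using pos by (intro integrable_continuous_real continuous_intros fejer_continuous L) (auto simp: less_imp_neq[symmetric])
  have h_nonneg: "h t \<ge> 0" for t
    unfolding h_def using d fejer_nonneg[of L t] by simp
  have sq_int: "(\<lambda>t. sqrt \<bar>t\<bar> * fejer L t) integrable_on {u..v}" for u v
    by (intro integrable_continuous_real continuous_intros fejer_continuous L)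
  have "Digamma (a + 2 * real k) \<le> 2 + ln (real k)"
    by (rule Digamma_le_ln) (use d k in \<open>auto simp: a_def\<close>)
  \<comment> \<open>The pointwise inequality; the term - ln pi has the favourable sign and is
    dropped.\<close>
  have h_le: "h t \<le> (2 + ln (real k)) * fejer L t + zeta32 * (sqrt \<bar>t\<bar> * fejer L t) + Re (q t)" for t
  proof -
    define s where "s = Complex a t"
    have s: "Re s > 1 / 2" using d by (simp add: s_def a_def)
    have sk: "s + 2 * of_nat k = Complex (a + 2 * real k) t" by (simp add: s_def complex_eq_iff)
    have "Re (of_nat m / (s - 1 / 2)) = real m * (\<delta> / (\<delta>\<^sup>2 + t\<^sup>2))"
    proof -
      have "s - 1 / 2 = Complex \<delta> t" by (simp add: s_def a_def complex_eq_iff)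
      then show ?thesis by (simp add: Re_divide power2_eq_square)
    qed
    moreover have "0 \<le> Re (- of_real (ln pi) + Digamma (s + 2 * of_nat k) + deriv (lfun k) s / lfun k s - of_nat m / (s - 1 / 2))"
      using G_log_deriv_nonneg[OF s] unfolding G_log_deriv[OF s] .
    moreover have "Re (Digamma (s + 2 * of_nat k)) \<le> 2 + ln (real k) + zeta32 * sqrt \<bar>t\<bar>"
    proof -
      have "cmod (Digamma (Complex (a + 2 * real k) t) - of_real (Digamma (a + 2 * real k))) \<le> zeta32 * sqrt \<bar>t\<bar>"
        by (rule norm_Digamma_diff_le) (use d k in \<open>auto simp: a_def\<close>)
      moreover have "Re (Digamma (Complex (a + 2 * real k) t) - of_real (Digamma (a + 2 * real k))) \<le>
          cmod (Digamma (Complex (a + 2 * real k) t) - of_real (Digamma (a + 2 * real k)))"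
        by (rule complex_Re_le_cmod)
      ultimately show ?thesis unfolding sk using \<open>Digamma (a + 2 * real k) \<le> 2 + ln (real k)\<close> by simp
    qed
    moreover have "ln pi \<ge> 0" using pi_gt3 by simp
    ultimately have "real m * (\<delta> / (\<delta>\<^sup>2 + t\<^sup>2)) \<le> 2 + ln (real k) + zeta32 * sqrt \<bar>t\<bar> + Re (deriv (lfun k) s / lfun k s)"
      unfolding minus_complex.sel plus_complex.sel uminus_complex.sel Re_complex_of_real by linarith
    then have "h t \<le> (2 + ln (real k) + zeta32 * sqrt \<bar>t\<bar> + Re (deriv (lfun k) s / lfun k s)) * fejer L t"
      unfolding h_def by (rule mult_right_mono[OF _ fejer_nonneg])
    moreover have "Re (q t) = Re (deriv (lfun k) s / lfun k s) * fejer L t"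
      unfolding q_def s_def[symmetric] by (simp only: times_complex.sel Re_complex_of_real Im_complex_of_real mult_zero_right diff_zero)
    ultimately show ?thesis by (simp add: algebra_simps)
  qed
  have low: "real m * (1 - L\<^sup>2 * T\<^sup>2 / 12) * (2 * arctan (T / \<delta>)) \<le> integral {- T..T} h"
  proof -
    have I: "((\<lambda>t. 1 / (\<delta>\<^sup>2 + t\<^sup>2)) has_integral (2 / \<delta> * arctan (T / \<delta>))) {- T..T}"
    proof -
      have "(\<lambda>t. 1 / (\<delta>\<^sup>2 + t\<^sup>2)) integrable_on {- T..T}"
        using pos by (intro integrable_continuous_real continuous_intros) (auto simp: less_imp_neq[symmetric])
      then show ?thesis using inverse_square_integrable(3)[OF d(1) T] by (simp add: has_integral_integral)
    qed
    have "real m * (1 - L\<^sup>2 * T\<^sup>2 / 12) * \<delta> * (2 / \<delta> * arctan (T / \<delta>)) \<le> integral {- T..T} h"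
    proof (rule has_integral_le[OF has_integral_mult_right[OF I] integrable_integral[OF h_int]])
      fix t assume "t \<in> {- T..T}"
      then have "\<bar>t\<bar> \<le> T" by (auto simp: abs_le_iff)
      then have "t\<^sup>2 \<le> T\<^sup>2" by (metis abs_ge_zero power2_abs power_mono)
      then have "L\<^sup>2 * t\<^sup>2 / 12 \<le> L\<^sup>2 * T\<^sup>2 / 12" by (intro divide_right_mono mult_left_mono) auto
      then have "1 - L\<^sup>2 * T\<^sup>2 / 12 \<le> fejer L t" using fejer_ge[OF L, of t] by linarith
      then have "real m * (\<delta> / (\<delta>\<^sup>2 + t\<^sup>2)) * (1 - L\<^sup>2 * T\<^sup>2 / 12) \<le> h t"
        unfolding h_def using d by (intro mult_left_mono) auto
      then show "real m * (1 - L\<^sup>2 * T\<^sup>2 / 12) * \<delta> * (1 / (\<delta>\<^sup>2 + t\<^sup>2)) \<le> h t" by (simp add: mult_ac)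
    qed
    moreover have "real m * (1 - L\<^sup>2 * T\<^sup>2 / 12) * \<delta> * (2 / \<delta> * arctan (T / \<delta>)) = real m * (1 - L\<^sup>2 * T\<^sup>2 / 12) * (2 * arctan (T / \<delta>))"
      using d by simp
    ultimately show ?thesis by simp
  qed
  let ?U = "\<lambda>n. (2 + ln (real k) + zeta32) * (2 * pi / L) + zeta32 * (16 / L\<^sup>2) + Re (integral {- real n..real n} q)"
  have lim: "?U \<longlonglongrightarrow> (2 + ln (real k) + zeta32) * (2 * pi / L) + zeta32 * (16 / L\<^sup>2) + - (pi / (2 * L\<^sup>2)) * weight_sum k L \<delta>"
    using lfun_log_deriv_integral[OF d(1) d1 L] unfolding q_def[abs_def] a_def by (intro tendsto_add tendsto_const)
  have "real m * (1 - L\<^sup>2 * T\<^sup>2 / 12) * (2 * arctan (T / \<delta>)) \<le>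
      (2 + ln (real k) + zeta32) * (2 * pi / L) + zeta32 * (16 / L\<^sup>2) + - (pi / (2 * L\<^sup>2)) * weight_sum k L \<delta>"
  proof (rule tendsto_lowerbound[OF lim])
    show "eventually (\<lambda>n. real m * (1 - L\<^sup>2 * T\<^sup>2 / 12) * (2 * arctan (T / \<delta>)) \<le> ?U n) sequentially"
      using eventually_ge_at_top[of "nat \<lceil>T\<rceil>"] eventually_ge_at_top[of 1]
    proof eventually_elim
      case (elim n)
      then have n: "T \<le> real n" "1 \<le> real n" by (auto simp: nat_le_iff ceiling_le_iff)
      note low
      also have "integral {- T..T} h \<le> integral {- real n..real n} h"
        by (rule integral_subset_le) (use n h_int h_nonneg in auto)
      also have "\<dots> \<le> (2 + ln (real k)) * integral {- real n..real n} (fejer L) +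
          zeta32 * integral {- real n..real n} (\<lambda>t. sqrt \<bar>t\<bar> * fejer L t) + Re (integral {- real n..real n} q)"
      proof (rule has_integral_le[OF integrable_integral[OF h_int]])
        show "((\<lambda>t. (2 + ln (real k)) * fejer L t + zeta32 * (sqrt \<bar>t\<bar> * fejer L t) + Re (q t)) has_integral
          (2 + ln (real k)) * integral {- real n..real n} (fejer L) +
          zeta32 * integral {- real n..real n} (\<lambda>t. sqrt \<bar>t\<bar> * fejer L t) + Re (integral {- real n..real n} q)) {- real n..real n}"
          by (intro has_integral_add has_integral_mult_right integrable_integral sq_int fejer_integrable_on L
              has_integral_linear[OF integrable_integral[OF q_int] bounded_linear_Re, unfolded o_def])
      qed (rule h_le)
      also have "\<dots> \<le> (2 + ln (real k)) * (2 * pi / L) + zeta32 * (2 * pi / L + 16 / L\<^sup>2) + Re (integral {- real n..real n} q)"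
        using fejer_int(1)[of "real n"] fejer_int(2)[OF n(2)] k zeta32_nonneg
        by (intro add_mono mult_left_mono) auto
      also have "\<dots> = ?U n" by (simp add: algebra_simps)
      finally show ?case .
    qed
  qed simp
  then show ?thesis by simp
qed

text \<open>With T = sqrt \<delta> and \<delta> tending to 0, T tends to 0 while T / \<delta> tends
  to infinity: the Fejer factor tends to 1 and 2 arctan (T / \<delta>) to pi.\<close>

lemma order_inequality:
  assumes L: "L > 0"
  shows "real m \<le> 2 * (2 + ln (real k) + zeta32) / L + 16 * zeta32 / (pi * L\<^sup>2) - weight_sum k L 0 / (2 * L\<^sup>2)"
proof -
  let ?u = "\<lambda>\<delta>. (2 + ln (real k) + zeta32) * (2 * pi / L) + zeta32 * (16 / L\<^sup>2) - (pi / (2 * L\<^sup>2)) * weight_sum k L \<delta>"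
  let ?l = "\<lambda>\<delta>. real m * (1 - L\<^sup>2 * (sqrt \<delta>)\<^sup>2 / 12) * (2 * arctan (sqrt \<delta> / \<delta>))"
  have ev: "eventually (\<lambda>\<delta>::real. 0 < \<delta> \<and> \<delta> \<le> 1 / 2) (at_right 0)"
    using eventually_at_right[of 0 "1 / 2 :: real"] by (auto intro!: exI[of _ "1 / 2"])
  have "real m * pi \<le> ?u 0"
  proof (rule tendsto_le)
    have "(weight_sum k L \<longlongrightarrow> weight_sum k L 0) (at_right 0)" unfolding weight_sum_def[abs_def]
    proof (rule tendsto_sum)
      fix x :: gint assume "x \<in> {x. x \<noteq> 0 \<and> real (gnorm x) \<le> exp L}"
      then have "real (gnorm x) \<noteq> 0" using gnorm_pos_iff[of x] by auto
      then have "((\<lambda>\<delta>. real (gnorm x) powr (- (1 / 2) - \<delta>)) \<longlongrightarrow> real (gnorm x) powr (- (1 / 2) - 0)) (at_right 0)"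
        by (intro tendsto_powr tendsto_const tendsto_diff tendsto_ident_at)
      then show "((\<lambda>\<delta>. gmangoldt x * Re (gchi k x) * real (gnorm x) powr (- (1 / 2) - \<delta>) * (L - ln (real (gnorm x)))) \<longlongrightarrow>
          gmangoldt x * Re (gchi k x) * real (gnorm x) powr (- (1 / 2) - 0) * (L - ln (real (gnorm x)))) (at_right 0)"
        by (intro tendsto_mult tendsto_const)
    qed
    then show "(?u \<longlongrightarrow> ?u 0) (at_right 0)" by (intro tendsto_diff tendsto_mult tendsto_const)
    have "((\<lambda>\<delta>. (1 - L\<^sup>2 * (sqrt \<delta>)\<^sup>2 / 12)) \<longlongrightarrow> 1) (at_right 0)" by real_asymp
    moreover have "((\<lambda>\<delta>. 2 * arctan (sqrt \<delta> / \<delta>)) \<longlongrightarrow> pi) (at_right 0)" by real_asymp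
    ultimately have "(?l \<longlongrightarrow> real m * 1 * pi) (at_right 0)" by (intro tendsto_mult tendsto_const)
    then show "(?l \<longlongrightarrow> real m * pi) (at_right 0)" by simp
    show "eventually (\<lambda>\<delta>. ?l \<delta> \<le> ?u \<delta>) (at_right 0)"
      using ev by eventually_elim (rule weighted_inequality, use L in auto)
  qed simp
  also have "?u 0 = pi * (2 * (2 + ln (real k) + zeta32) / L + 16 * zeta32 / (pi * L\<^sup>2) - weight_sum k L 0 / (2 * L\<^sup>2))"
    using L by (simp add: field_simps)
  finally show ?thesis by (simp add: mult.commute[of "real m"])
qed

end

theorem order_at_half:
  assumes "k \<ge> 1" "\<And>s. Re s > 1 / 2 \<Longrightarrow> lfun k s \<noteq> 0" "L > 0"
  shows "(if lfun k (1 / 2) = 0 then 2 else 0) \<le>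
    2 * (2 + ln (real k) + zeta32) / L + 16 * zeta32 / (pi * L\<^sup>2) - weight_sum k L 0 / (2 * L\<^sup>2)"
proof -
  obtain G m where G: "G holomorphic_on UNIV" and m: "m = (if lfun k (1 / 2) = 0 then 2 else 0 :: nat)"
    and LG: "\<And>s. Lam k s = (s - 1 / 2) ^ m * G s"
    using completed_factor[OF assms(1)] by metis
  have "m = 0 \<or> m = 2" by (simp add: m)
  from order_inequality[OF assms(1,2) G this LG assms(3)] show ?thesis by (simp add: m split: if_splits)
qed

section \<open>Averaging over the characters\<close>

text \<open>On the axes the quotient of x and its conjugate is 1 or -1, and the exponent is
  even.\<close>

lemma gchi_axis:
  assumes "x \<noteq> 0" "gre x * gim x = 0"
  shows "gchi k x = 1"
proof (cases "gim x = 0")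
  case True
  then have "cnj (of_gint x) = of_gint x" by (simp add: complex_eq_iff)
  then show ?thesis using assms(1) by (simp add: gchi_def)
next
  case False
  then have "gre x = 0" using assms(2) by simp
  then have "cnj (of_gint x) = - of_gint x" by (simp add: complex_eq_iff)
  then show ?thesis using assms(1) by (simp add: gchi_def power_mult)
qed

lemma gmangoldt_unit:
  assumes "u \<in> gunits"
  shows "gmangoldt (u * x) = gmangoldt x"
proof (cases "x = 0")
  case False
  have u: "is_unit u" using assms by (simp add: gint_dvd_1_iff)
  then have "u \<noteq> 0" by auto
  then have "prime_factors (u * x) = prime_factors x"
    using False u by (simp add: prime_factorization_mult prime_factorization_unit)
  then show ?thesis by (simp add: gmangoldt_def)
qed simp

lemma gint_of_nat: "(of_nat d :: gint) = Gint (int d) 0"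
proof -
  have "of_gint (of_nat d) = of_gint (Gint (int d) 0)" unfolding of_gint_of_nat by (simp add: complex_eq_iff)
  then show ?thesis unfolding of_gint_eq_iff .
qed

lemma finite_gnorm_le_real: "finite {x. x \<noteq> 0 \<and> real (gnorm x) \<le> B \<and> P x}"
proof (rule finite_subset)
  show "{x. x \<noteq> 0 \<and> real (gnorm x) \<le> B \<and> P x} \<subseteq> {x. gnorm x \<le> nat \<lfloor>B\<rfloor>}" by (auto simp: le_nat_floor)
qed (rule finite_gnorm_le)

text \<open>The summand of \<open>weight_sum\<close> at \<delta> = 0 without the character, hence
  independent of k.\<close>

definition gweight :: "real \<Rightarrow> gint \<Rightarrow> real" where
  "gweight L x = gmangoldt x * real (gnorm x) powr (- (1 / 2)) * (L - ln (real (gnorm x)))"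

lemma gweight_bounds:
  assumes "x \<noteq> 0" "real (gnorm x) \<le> exp L"
  shows "0 \<le> gweight L x" "gweight L x \<le> L\<^sup>2 * real (gnorm x) powr (- (1 / 2))"
proof -
  have N: "real (gnorm x) \<ge> 1" using assms(1) gnorm_pos_iff[of x] by linarith
  then have l: "0 \<le> ln (real (gnorm x))" by (rule ln_ge_zero)
  have "ln (real (gnorm x)) \<le> ln (exp L)" using assms(2) N by (subst ln_le_cancel_iff) auto
  then have l': "ln (real (gnorm x)) \<le> L" by simp
  show "0 \<le> gweight L x" unfolding gweight_def using l' gmangoldt_nonneg[of x] by simp
  have "gmangoldt x \<le> L" using gmangoldt_le[OF assms(1)] l' by linarith
  then have "gmangoldt x * (L - ln (real (gnorm x))) \<le> L * L"
    using l l' gmangoldt_nonneg[of x] by (intro mult_mono) auto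
  then have "gmangoldt x * (L - ln (real (gnorm x))) * real (gnorm x) powr (- (1 / 2)) \<le> L * L * real (gnorm x) powr (- (1 / 2))"
    by (rule mult_right_mono) simp
  then show "gweight L x \<le> L\<^sup>2 * real (gnorm x) powr (- (1 / 2))" by (simp add: gweight_def power2_eq_square mult_ac)
qed

text \<open>Only the unit multiples of integers d congruent to 3 modulo 4 with d <= e^(L/2) are
  kept. The four units, the factor 2 of \<open>gmangoldt_of_nat_ge\<close> and L - 2 ln d = 2 (L/2 -
  ln d) multiply the estimate with Y = L/2 by 16, and 16 (L^2 / 16 - 7 L / 2) = L^2 - 56 L.\<close>

lemma gweight_axis_sum_ge:
  assumes L: "L \<ge> 0"
  shows "(\<Sum>x | x \<noteq> 0 \<and> real (gnorm x) \<le> exp L \<and> gre x * gim x = 0. gweight L x) \<ge> L\<^sup>2 - 56 * L"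
proof -
  define D where "D = {d::nat. real d \<le> exp (L / 2) \<and> d mod 4 = 3}"
  define A where "A = {x. x \<noteq> 0 \<and> real (gnorm x) \<le> exp L \<and> gre x * gim x = 0}"
  define \<phi> where "\<phi> = (\<lambda>(u :: gint, d :: nat). u * of_nat d)"
  have Dpos: "d > 0" if "d \<in> D" for d using that by (auto simp: D_def intro!: Nat.gr0I)
  have N: "gnorm (u * of_nat d) = d\<^sup>2" if "u \<in> gunits" for u d
  proof -
    have "gnorm (of_nat d) = d\<^sup>2" by (simp add: gint_of_nat gnorm_def nat_power_eq)
    then show ?thesis using gunits_gnorm[OF that] by (simp add: gnorm_mult)
  qed
  have inj: "inj_on \<phi> (gunits \<times> D)"
  proof (rule inj_onI, clarsimp simp: \<phi>_def)
    fix u d u' d' assume h: "u \<in> gunits" "d \<in> D" "u' \<in> gunits" "d' \<in> D" "u * of_nat d = u' * of_nat d'"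
    then have "d\<^sup>2 = d'\<^sup>2" using N by metis
    then have "d = d'" by (simp add: power2_eq_iff)
    moreover have "(of_nat d :: gint) \<noteq> 0" using Dpos[OF h(2)] by (simp add: gint_of_nat zero_gint_def)
    ultimately show "u = u' \<and> d = d'" using h(5) by simp
  qed
  have sub: "\<phi> ` (gunits \<times> D) \<subseteq> A"
  proof (clarsimp simp: \<phi>_def)
    fix u d assume h: "u \<in> gunits" "d \<in> D"
    have "real (gnorm (u * of_nat d)) = real d ^ 2" using N[OF h(1)] by simp
    also have "\<dots> \<le> exp (L / 2) ^ 2" using h(2) by (intro power_mono) (auto simp: D_def)
    also have "\<dots> = exp L" by (simp flip: exp_double)
    finally have 1: "real (gnorm (u * of_nat d)) \<le> exp L" .
    have "gnorm (u * of_nat d) > 0" using N[OF h(1)] Dpos[OF h(2)] by simp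
    then have 2: "u * of_nat d \<noteq> 0" unfolding gnorm_pos_iff .
    have 3: "gre (u * of_nat d) * gim (u * of_nat d) = 0"
      using h(1) unfolding gunits_def gint_of_nat by auto
    show "u * of_nat d \<in> A" unfolding A_def using 1 2 3 by blast
  qed
  have finA: "finite A" unfolding A_def by (rule finite_gnorm_le_real)
  have scale: "L\<^sup>2 - 56 * L \<le> 4 * (4 * S)" if "(L / 2)\<^sup>2 / 4 - 7 * (L / 2) \<le> S" for S
    using that by (simp add: power_divide)
  have "(\<Sum>d\<in>D. mangoldt d / real d * (L / 2 - ln d)) \<ge> (L / 2)\<^sup>2 / 4 - 7 * (L / 2)"
    unfolding D_def by (rule weighted_sum_mangoldt_3_mod_4) (use L in simp)
  then have "L\<^sup>2 - 56 * L \<le> 4 * (4 * (\<Sum>d\<in>D. mangoldt d / real d * (L / 2 - ln d)))"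
    by (rule scale)
  also have "\<dots> = 4 * (\<Sum>d\<in>D. 4 * (mangoldt d / real d * (L / 2 - ln d)))" by (simp only: sum_distrib_left)
  also have "\<dots> = (\<Sum>(u, d)\<in>gunits \<times> D. 4 * (mangoldt d / real d * (L / 2 - ln d)))"
    by (simp add: sum.cartesian_product[symmetric] card_gunits)
  also have "\<dots> \<le> (\<Sum>(u, d)\<in>gunits \<times> D. gweight L (\<phi> (u, d)))"
  proof (rule sum_mono, clarify)
    fix u d assume h: "u \<in> gunits" "d \<in> D"
    have dp: "real d > 0" using Dpos[OF h(2)] by simp
    have "ln (real d) \<le> ln (exp (L / 2))" using h(2) dp by (subst ln_le_cancel_iff) (auto simp: D_def)
    then have nn: "L / 2 - ln (real d) \<ge> 0" by simp
    have g: "gmangoldt (u * of_nat d) \<ge> 2 * mangoldt d"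
      unfolding gmangoldt_unit[OF h(1)] by (rule gmangoldt_of_nat_ge) (use h(2) in \<open>simp add: D_def\<close>)
    have p: "real (gnorm (u * of_nat d)) powr (- (1 / 2)) = 1 / real d"
    proof -
      have "real (d\<^sup>2) powr (1 / 2) = real d" by (subst powr_half_sqrt) simp_all
      then show ?thesis unfolding N[OF h(1)] powr_minus by (simp only: inverse_eq_divide)
    qed
    have l: "ln (real (gnorm (u * of_nat d))) = 2 * ln (real d)"
      unfolding N[OF h(1)] using dp by (simp add: ln_realpow)
    have "4 * (mangoldt d / real d * (L / 2 - ln (real d))) = 2 * mangoldt d * ((1 / real d) * (L - 2 * ln (real d)))"
    proof -
      have "4 * (a / r * y) = 2 * a * ((1 / r) * (2 * y))" for a r y :: real by simp
      moreover have "L - 2 * ln (real d) = 2 * (L / 2 - ln (real d))" by simp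
      ultimately show ?thesis by (simp only:)
    qed
    also have "\<dots> \<le> gmangoldt (u * of_nat d) * ((1 / real d) * (L - 2 * ln (real d)))"
      by (rule mult_right_mono[OF g]) (use nn dp in simp)
    finally show "4 * (mangoldt d / real d * (L / 2 - ln (real d))) \<le> gweight L (\<phi> (u, d))"
      unfolding gweight_def \<phi>_def prod.case p l by (simp only: mult.assoc)
  qed
  also have "\<dots> = (\<Sum>x\<in>\<phi> ` (gunits \<times> D). gweight L x)"
    unfolding sum.reindex[OF inj] by (simp add: case_prod_unfold)
  also have "\<dots> \<le> (\<Sum>x\<in>A. gweight L x)"
    by (rule sum_mono2[OF finA sub]) (use gweight_bounds in \<open>auto simp: A_def\<close>)
  finally show ?thesis unfolding A_def .
qed

text \<open>A geometric sum with ratio w = (z / cnj z)^2 on the unit circle, at most 2 / |1 - w|.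
  For z = a + b i the distance |1 - w| is 4 |a b| / |z|^2, which is positive off the axes.\<close>

lemma gchi_sum_le:
  assumes ab: "gre x * gim x \<noteq> 0"
  shows "\<bar>\<Sum>k=1..K. Re (gchi k x)\<bar> \<le> real (gnorm x) / (2 * \<bar>of_int (gre x * gim x)\<bar>)"
proof (cases "K = 0")
  case False
  define z where "z = of_gint x"
  define w where "w = (z / cnj z)\<^sup>2"
  have z: "z \<noteq> 0" using ab by (auto simp: z_def)
  have nz: "(cmod z)\<^sup>2 > 0" using z by simp
  have "(cnj z)\<^sup>2 - z\<^sup>2 = of_real (- 4 * of_int (gre x * gim x)) * \<i>"
    by (simp add: z_def complex_eq_iff power2_eq_square)
  then have "cmod ((cnj z)\<^sup>2 - z\<^sup>2) = 4 * \<bar>of_int (gre x * gim x)\<bar>" by (simp only: norm_mult norm_of_real norm_ii abs_mult abs_neg_numeral abs_numeral mult_1_right)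
  moreover have "1 - w = ((cnj z)\<^sup>2 - z\<^sup>2) / (cnj z)\<^sup>2" using z by (simp add: w_def power_divide diff_divide_distrib)
  ultimately have cw: "cmod (1 - w) = 4 * \<bar>of_int (gre x * gim x)\<bar> / (cmod z)\<^sup>2"
    by (simp add: norm_divide norm_power)
  have w1: "cmod w = 1" using z by (simp add: w_def norm_power norm_divide)
  have "(1 - w) * (\<Sum>k=1..K. w ^ k) = w ^ 1 - w ^ Suc K" by (rule sum_gp_multiplied) (use False in simp)
  then have "cmod (1 - w) * cmod (\<Sum>k=1..K. w ^ k) = cmod (w ^ 1 - w ^ Suc K)" by (simp only: norm_mult[symmetric])
  also have "\<dots> \<le> cmod (w ^ 1) + cmod (w ^ Suc K)" by (rule norm_triangle_ineq4)
  also have "\<dots> = 2" unfolding norm_power w1 by simp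
  finally have "cmod (\<Sum>k=1..K. w ^ k) \<le> (cmod z)\<^sup>2 / (2 * \<bar>of_int (gre x * gim x)\<bar>)"
    unfolding cw using nz ab by (simp add: field_simps)
  moreover have "(\<Sum>k=1..K. Re (gchi k x)) = Re (\<Sum>k=1..K. w ^ k)"
    by (simp add: gchi_def w_def z_def power_mult)
  ultimately show ?thesis unfolding of_nat_gnorm z_def[symmetric] using abs_Re_le_cmod order_trans by metis
qed simp

section \<open>The contribution of the points off the axes\<close>

lemma sum_inverse_le: "n \<ge> 1 \<Longrightarrow> (\<Sum>a=1..n. 1 / real a) \<le> 1 + ln (real n)"
proof (induction n rule: nat_induct_at_least)
  case (Suc n)
  have "ln (real n / real (Suc n)) \<le> real n / real (Suc n) - 1" by (rule ln_le_minus_one) (use Suc in simp)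
  moreover have "ln (real n / real (Suc n)) = ln (real n) - ln (real (Suc n))" by (rule ln_divide_pos) (use Suc in auto)
  moreover have "real n / real (Suc n) - 1 = - (1 / real (Suc n))" by (simp add: field_simps)
  ultimately have "1 / real (Suc n) \<le> ln (real (Suc n)) - ln (real n)" by linarith
  moreover have "(\<Sum>a=1..Suc n. 1 / real a) = (\<Sum>a=1..n. 1 / real a) + 1 / real (Suc n)" by simp
  ultimately show ?case using Suc.IH by linarith
qed simp

lemma sum_inverse_int_le:
  assumes "n \<ge> 1"
  shows "(\<Sum>a\<in>{- int n..int n} - {0}. 1 / \<bar>real_of_int a\<bar>) \<le> 2 * (1 + ln (real n))"
proof -
  have eq: "{- int n..int n} - {0} = int ` {1..n} \<union> (\<lambda>a. - int a) ` {1..n}"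
  proof (intro subset_antisym subsetI)
    fix a assume a: "a \<in> {- int n..int n} - {0}"
    show "a \<in> int ` {1..n} \<union> (\<lambda>a. - int a) ` {1..n}"
    proof (cases "a > 0")
      case True
      then have "a = int (nat a)" "nat a \<in> {1..n}" using a by auto
      then show ?thesis by blast
    next
      case False
      then have "a = - int (nat (- a))" "nat (- a) \<in> {1..n}" using a by auto
      then show ?thesis by blast
    qed
  qed auto
  have "(\<Sum>a\<in>{- int n..int n} - {0}. 1 / \<bar>real_of_int a\<bar>) =
      (\<Sum>a\<in>int ` {1..n}. 1 / \<bar>real_of_int a\<bar>) + (\<Sum>a\<in>(\<lambda>a. - int a) ` {1..n}. 1 / \<bar>real_of_int a\<bar>)"
    unfolding eq by (rule sum.union_disjoint) auto
  also have "(\<Sum>a\<in>int ` {1..n}. 1 / \<bar>real_of_int a\<bar>) = (\<Sum>a=1..n. 1 / real a)"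
    by (subst sum.reindex) (auto simp: inj_on_def)
  also have "(\<Sum>a\<in>(\<lambda>a. - int a) ` {1..n}. 1 / \<bar>real_of_int a\<bar>) = (\<Sum>a=1..n. 1 / real a)"
    by (subst sum.reindex) (auto simp: inj_on_def)
  finally show ?thesis using sum_inverse_le[OF assms] by simp
qed

text \<open>The root of the norm is at most |a| + |b|, so each term is at most 1 / |a| + 1 / |b|.
  Over the square of half-side e^(L/2) this separates into a number of points times a harmonic
  sum.\<close>

lemma off_axis_sum_le:
  assumes L: "L \<ge> 0"
  shows "(\<Sum>x | x \<noteq> 0 \<and> real (gnorm x) \<le> exp L \<and> gre x * gim x \<noteq> 0. sqrt (real (gnorm x)) / \<bar>of_int (gre x * gim x)\<bar>)
    \<le> 4 * exp (L / 2) * (2 + L)"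
proof -
  define n where "n = nat \<lfloor>exp (L / 2)\<rfloor>"
  define I where "I = {- int n..int n} - {0}"
  define B where "B = {x. x \<noteq> 0 \<and> real (gnorm x) \<le> exp L \<and> gre x * gim x \<noteq> 0}"
  have e1: "exp (L / 2) \<ge> 1" using L by simp
  then have n1: "n \<ge> 1" by (simp add: n_def le_nat_floor)
  have nX: "real n \<le> exp (L / 2)" using e1 by (simp add: n_def)
  have "ln (real n) \<le> ln (exp (L / 2))" using nX n1 by (subst ln_le_cancel_iff) auto
  then have ln: "ln (real n) \<le> L / 2" by simp
  define h where "h = (\<lambda>(a::int, b::int). 1 / \<bar>real_of_int a\<bar> + 1 / \<bar>real_of_int b\<bar>)"
  define \<phi> where "\<phi> x = (gre x, gim x)" for x
  have inj: "inj_on \<phi> B" by (auto simp: inj_on_def \<phi>_def gint_eq_iff)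
  have mem: "c \<in> I" if "c \<noteq> 0" "c\<^sup>2 \<le> int (gnorm x)" "x \<in> B" for c x
  proof -
    have "(real_of_int \<bar>c\<bar>)\<^sup>2 \<le> real (gnorm x)" using that(2) by (metis of_int_le_iff of_int_of_nat_eq of_int_power power2_abs)
    also have "\<dots> \<le> exp L" using that(3) by (simp add: B_def)
    also have "\<dots> = (exp (L / 2))\<^sup>2" by (simp flip: exp_double)
    finally have "real_of_int \<bar>c\<bar> \<le> exp (L / 2)" by (rule power2_le_imp_le) simp
    then have "\<bar>c\<bar> \<le> \<lfloor>exp (L / 2)\<rfloor>" by (simp add: le_floor_iff)
    then show ?thesis using that(1) by (auto simp: I_def n_def)
  qed
  have gn: "int (gnorm x) = (gre x)\<^sup>2 + (gim x)\<^sup>2" for x by (simp add: gnorm_def)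
  have sub: "\<phi> ` B \<subseteq> I \<times> I"
  proof (clarsimp simp: \<phi>_def)
    fix x assume x: "x \<in> B"
    then have "gre x \<noteq> 0" "gim x \<noteq> 0" by (auto simp: B_def)
    then show "gre x \<in> I \<and> gim x \<in> I" using mem[OF _ _ x] by (simp add: gn)
  qed
  have "(\<Sum>x\<in>B. sqrt (real (gnorm x)) / \<bar>of_int (gre x * gim x)\<bar>) \<le> (\<Sum>x\<in>B. h (\<phi> x))"
  proof (rule sum_mono)
    fix x assume x: "x \<in> B"
    define a b where "a = \<bar>real_of_int (gre x)\<bar>" and "b = \<bar>real_of_int (gim x)\<bar>"
    have ab: "a > 0" "b > 0" using x by (auto simp: a_def b_def B_def)
    have "real (gnorm x) = a\<^sup>2 + b\<^sup>2" by (simp add: gnorm_def a_def b_def)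
    also have "\<dots> \<le> (a + b)\<^sup>2" using ab by (simp add: power2_sum)
    finally have "sqrt (real (gnorm x)) \<le> a + b" using ab by (simp add: real_le_lsqrt)
    then have "sqrt (real (gnorm x)) / (a * b) \<le> (a + b) / (a * b)" using ab by (intro divide_right_mono) auto
    also have "\<dots> = 1 / a + 1 / b" using ab by (simp add: field_simps)
    finally show "sqrt (real (gnorm x)) / \<bar>of_int (gre x * gim x)\<bar> \<le> h (\<phi> x)"
      by (simp add: h_def \<phi>_def a_def b_def abs_mult)
  qed
  also have "\<dots> = (\<Sum>p\<in>\<phi> ` B. h p)" unfolding sum.reindex[OF inj] by simp
  also have "\<dots> \<le> (\<Sum>p\<in>I \<times> I. h p)" by (rule sum_mono2[OF _ sub]) (auto simp: h_def I_def)
  also have "\<dots> = 2 * (real (card I) * (\<Sum>a\<in>I. 1 / \<bar>real_of_int a\<bar>))"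
    unfolding h_def sum.cartesian_product[symmetric] by (simp add: sum.distrib sum_distrib_left)
  also have "card I = 2 * n" by (simp add: I_def)
  also have "2 * (real (2 * n) * (\<Sum>a\<in>I. 1 / \<bar>real_of_int a\<bar>)) \<le> 2 * (2 * exp (L / 2) * (2 * (1 + L / 2)))"
  proof (intro mult_left_mono mult_mono)
    show "(\<Sum>a\<in>I. 1 / \<bar>real_of_int a\<bar>) \<le> 2 * (1 + L / 2)"
      using sum_inverse_int_le[OF n1] unfolding I_def[symmetric] by (rule order_trans) (use ln in simp)
    show "0 \<le> (\<Sum>a\<in>I. 1 / \<bar>real_of_int a\<bar>)" by (rule sum_nonneg) simp
  qed (use nX in auto)
  also have "\<dots> = 4 * exp (L / 2) * (2 + L)" by (simp add: algebra_simps)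
  finally show ?thesis unfolding B_def .
qed

text \<open>The axes contribute the same amount for every k. Off the axes the weight L^2 N^(-1/2)
  times the bound N / (2 |a b|) for the sum over k leaves sqrt N / |a b|, whose total does not
  depend on K.\<close>

lemma weight_sum_average:
  assumes L: "L > 0"
  shows "(\<Sum>k=1..K. weight_sum k L 0) \<ge> real K * (L\<^sup>2 - 56 * L) - 2 * L\<^sup>2 * (exp (L / 2) * (2 + L))"
proof -
  define A where "A = {x. x \<noteq> 0 \<and> real (gnorm x) \<le> exp L \<and> gre x * gim x = 0}"
  define B where "B = {x. x \<noteq> 0 \<and> real (gnorm x) \<le> exp L \<and> gre x * gim x \<noteq> 0}"
  have fin: "finite A" "finite B" unfolding A_def B_def by (rule finite_gnorm_le_real)+
  have split: "weight_sum k L 0 = (\<Sum>x\<in>A. gweight L x) + (\<Sum>x\<in>B. gweight L x * Re (gchi k x))" for k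
  proof -
    have AB: "{x. x \<noteq> 0 \<and> real (gnorm x) \<le> exp L} = A \<union> B" by (auto simp: A_def B_def)
    have "weight_sum k L 0 = (\<Sum>x\<in>A \<union> B. gweight L x * Re (gchi k x))"
      unfolding weight_sum_def AB gweight_def by (intro sum.cong) (auto simp: mult_ac)
    also have "\<dots> = (\<Sum>x\<in>A. gweight L x * Re (gchi k x)) + (\<Sum>x\<in>B. gweight L x * Re (gchi k x))"
      by (rule sum.union_disjoint[OF fin]) (auto simp: A_def B_def)
    also have "(\<Sum>x\<in>A. gweight L x * Re (gchi k x)) = (\<Sum>x\<in>A. gweight L x)"
      by (intro sum.cong refl) (simp add: A_def gchi_axis)
    finally show ?thesis .
  qed
  have "\<bar>\<Sum>k=1..K. \<Sum>x\<in>B. gweight L x * Re (gchi k x)\<bar> = \<bar>\<Sum>x\<in>B. gweight L x * (\<Sum>k=1..K. Re (gchi k x))\<bar>"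
    unfolding sum_distrib_left by (subst sum.swap) simp
  also have "\<dots> \<le> (\<Sum>x\<in>B. \<bar>gweight L x * (\<Sum>k=1..K. Re (gchi k x))\<bar>)" by (rule sum_abs)
  also have "\<dots> \<le> (\<Sum>x\<in>B. L\<^sup>2 / 2 * (sqrt (real (gnorm x)) / \<bar>of_int (gre x * gim x)\<bar>))"
  proof (rule sum_mono)
    fix x assume x: "x \<in> B"
    define N where "N = real (gnorm x)"
    have N: "N > 0" using x gnorm_pos_iff[of x] by (simp add: B_def N_def)
    define d where "d = \<bar>real_of_int (gre x * gim x)\<bar>"
    have d: "d > 0" using x by (auto simp: d_def B_def)
    note w = gweight_bounds[of x L, folded N_def]
    have "\<bar>gweight L x * (\<Sum>k=1..K. Re (gchi k x))\<bar> \<le> (L\<^sup>2 * N powr (- (1 / 2))) * (N / (2 * d))"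
      unfolding abs_mult using gchi_sum_le[of x K, folded N_def d_def] x w
      by (intro mult_mono) (auto simp: B_def N_def)
    also have "N powr (- (1 / 2)) * N = sqrt N"
    proof -
      have "N powr (- (1 / 2)) * N = N powr (- (1 / 2)) * N powr 1" using N by simp
      also have "\<dots> = N powr (1 / 2)" by (simp only: powr_add[symmetric]) simp
      finally show ?thesis using N by (simp add: powr_half_sqrt)
    qed
    then have "(L\<^sup>2 * N powr (- (1 / 2))) * (N / (2 * d)) = L\<^sup>2 / 2 * (sqrt N / d)" by (simp add: mult_ac)
    finally show "\<bar>gweight L x * (\<Sum>k=1..K. Re (gchi k x))\<bar> \<le> L\<^sup>2 / 2 * (sqrt (real (gnorm x)) / \<bar>of_int (gre x * gim x)\<bar>)"
      by (simp add: N_def d_def)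
  qed
  also have "\<dots> = L\<^sup>2 / 2 * (\<Sum>x\<in>B. sqrt (real (gnorm x)) / \<bar>of_int (gre x * gim x)\<bar>)" by (rule sum_distrib_left[symmetric])
  also have "\<dots> \<le> L\<^sup>2 / 2 * (4 * exp (L / 2) * (2 + L))"
    unfolding B_def by (intro mult_left_mono off_axis_sum_le) (use L in auto)
  finally have B: "\<bar>\<Sum>k=1..K. \<Sum>x\<in>B. gweight L x * Re (gchi k x)\<bar> \<le> 2 * L\<^sup>2 * (exp (L / 2) * (2 + L))" by (simp add: mult_ac)
  have "real K * (L\<^sup>2 - 56 * L) \<le> real K * (\<Sum>x\<in>A. gweight L x)"
    unfolding A_def by (intro mult_left_mono gweight_axis_sum_ge) (use L in auto)
  moreover have "(\<Sum>k=1..K. weight_sum k L 0) = real K * (\<Sum>x\<in>A. gweight L x) + (\<Sum>k=1..K. \<Sum>x\<in>B. gweight L x * Re (gchi k x))"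
    unfolding split by (simp add: sum.distrib)
  ultimately show ?thesis using B by linarith
qed

text \<open>Summing \<open>order_at_half\<close> over k: division by 2 L^2 turns the axis term L^2 -
  56 L into the saving 1/2 - 28 / L and the off-axis error into exp (L / 2) (2 + L).\<close>

lemma vanishing_count_le:
  assumes nz: "\<And>k s. k \<ge> 1 \<Longrightarrow> Re s > 1 / 2 \<Longrightarrow> lfun k s \<noteq> 0" and L: "L > 0" and K: "K \<ge> 1"
  shows "2 * real (card {k \<in> {1..K}. lfun k (1 / 2) = 0}) \<le>
    real K * (2 * (2 + ln (real K) + zeta32) / L + 16 * zeta32 / (pi * L\<^sup>2) - 1 / 2 + 28 / L) + exp (L / 2) * (2 + L)"
proof -
  define U where "U = 2 * (2 + ln (real K) + zeta32) / L + 16 * zeta32 / (pi * L\<^sup>2)"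
  have "2 * real (card {k \<in> {1..K}. lfun k (1 / 2) = 0}) = (\<Sum>k=1..K. if lfun k (1 / 2) = 0 then 2 else 0)"
    by (simp add: sum.If_cases Int_def)
  also have "\<dots> \<le> (\<Sum>k=1..K. U - weight_sum k L 0 / (2 * L\<^sup>2))"
  proof (rule sum_mono)
    fix k assume k: "k \<in> {1..K}"
    have "(if lfun k (1 / 2) = 0 then 2 else 0) \<le>
        2 * (2 + ln (real k) + zeta32) / L + 16 * zeta32 / (pi * L\<^sup>2) - weight_sum k L 0 / (2 * L\<^sup>2)"
      by (rule order_at_half) (use k nz L in auto)
    also have "\<dots> \<le> U - weight_sum k L 0 / (2 * L\<^sup>2)"
    proof -
      have "2 * (2 + ln (real k) + zeta32) / L \<le> 2 * (2 + ln (real K) + zeta32) / L"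
        using k L by (intro divide_right_mono) auto
      then show ?thesis by (simp add: U_def)
    qed
    finally show "(if lfun k (1 / 2) = 0 then 2 else 0) \<le> U - weight_sum k L 0 / (2 * L\<^sup>2)" .
  qed
  also have "\<dots> = real K * U - (\<Sum>k=1..K. weight_sum k L 0) / (2 * L\<^sup>2)"
    by (simp add: sum_subtractf sum_divide_distrib)
  also have "\<dots> \<le> real K * U - (real K * (L\<^sup>2 - 56 * L) - 2 * L\<^sup>2 * (exp (L / 2) * (2 + L))) / (2 * L\<^sup>2)"
    using weight_sum_average[OF L, of K] by (intro diff_left_mono divide_right_mono) auto
  also have "\<dots> = real K * (U - 1 / 2 + 28 / L) + exp (L / 2) * (2 + L)"
    using L by (simp add: field_simps power2_eq_square)
  finally show ?thesis by (simp add: U_def)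
qed

theorem corollary1p3:
  assumes GRH: "\<And>(k::nat) s. k \<ge> 1 \<Longrightarrow> 0 < Re s \<Longrightarrow> Re s < 1 \<Longrightarrow> hecke_L (int k) s = 0
                  \<Longrightarrow> Re s = 1 / 2"
  shows "\<exists>e :: nat \<Rightarrow> real. e \<in> o(\<lambda>_. 1) \<and>
           (\<forall>K\<ge>1. 1 / real K * real (card {k \<in> {1..K}. hecke_L (int k) (1 / 2) \<noteq> 0}) \<ge> 3 / 4 + e K)"
proof -
  \<comment> \<open>The hypothesis covers the open strip; for Re s >= 1 nonvanishing is
    unconditional.\<close>
  have nz: "lfun k s \<noteq> 0" if k: "k \<ge> 1" and s: "Re s > 1 / 2" for k s
  proof (cases "Re s \<ge> 1")
    case True
    then show ?thesis using lfun_nonzero_right[OF k] by blast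
  next
    case False
    then show ?thesis using GRH[OF k, of s] s by (auto simp: hecke_L_eq_lfun[OF k])
  qed
  define r where "r K = 1 / real K * real (card {k \<in> {1..K}. hecke_L (int k) (1 / 2) \<noteq> 0})" for K :: nat
  \<comment> \<open>With this choice the inequality holds for every K >= 1, and all that remains is
    that e tends to 0.\<close>
  define e where "e K = min 0 (r K - 3 / 4)" for K
  \<comment> \<open>Here exp (L x / 2) = x / (ln x)^2, so the off-axis error divided by x is of
    order 1 / ln x, while 2 ln x / L x still tends to 1. Hence u tends to 1 - 1/2, and the
    proportion of zeros is at most half of that.\<close>
  define L where "L x = 2 * ln x - 4 * ln (ln x)" for x :: real
  define u where "u x = 2 * (2 + ln x + zeta32) / L x + 16 * zeta32 / (pi * (L x)\<^sup>2) - 1 / 2 + 28 / L x +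
    exp (L x / 2) * (2 + L x) / x" for x
  have ulim: "(u \<longlongrightarrow> 1 / 2) at_top" unfolding u_def[abs_def] L_def by real_asymp
  have Lpos: "eventually (\<lambda>x. L x > 0) at_top" unfolding L_def by real_asymp
  have low: "r K \<ge> 1 - u (real K) / 2" if K: "K \<ge> 1" and L0: "L (real K) > 0" for K
  proof -
    have "{1..K} = {k \<in> {1..K}. hecke_L (int k) (1 / 2) \<noteq> 0} \<union> {k \<in> {1..K}. lfun k (1 / 2) = 0}"
      by (auto simp: hecke_L_eq_lfun)
    moreover have "card ({k \<in> {1..K}. hecke_L (int k) (1 / 2) \<noteq> 0} \<union> {k \<in> {1..K}. lfun k (1 / 2) = 0}) =
        card {k \<in> {1..K}. hecke_L (int k) (1 / 2) \<noteq> 0} + card {k \<in> {1..K}. lfun k (1 / 2) = 0}"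
      by (rule card_Un_disjoint) (auto simp: hecke_L_eq_lfun)
    ultimately have "card {1..K} = card {k \<in> {1..K}. hecke_L (int k) (1 / 2) \<noteq> 0} + card {k \<in> {1..K}. lfun k (1 / 2) = 0}"
      by (simp only:)
    then have c: "real K = real (card {k \<in> {1..K}. hecke_L (int k) (1 / 2) \<noteq> 0}) + real (card {k \<in> {1..K}. lfun k (1 / 2) = 0})"
      by simp
    have "2 * real (card {k \<in> {1..K}. lfun k (1 / 2) = 0}) \<le> real K * u (real K)"
    proof -
      have "real K * u (real K) = real K * (2 * (2 + ln (real K) + zeta32) / L (real K) + 16 * zeta32 / (pi * (L (real K))\<^sup>2) - 1 / 2 + 28 / L (real K)) +
          real K * (exp (L (real K) / 2) * (2 + L (real K)) / real K)" unfolding u_def by (rule distrib_left)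
      also have "real K * (exp (L (real K) / 2) * (2 + L (real K)) / real K) = exp (L (real K) / 2) * (2 + L (real K))"
        using K by simp
      finally show ?thesis using vanishing_count_le[OF nz L0 K] by (simp only:)
    qed
    with c have "real K * (1 - u (real K) / 2) \<le> real (card {k \<in> {1..K}. hecke_L (int k) (1 / 2) \<noteq> 0})"
      by (simp add: algebra_simps)
    then show ?thesis using K by (simp add: r_def field_simps)
  qed
  have "e \<longlonglongrightarrow> 0"
  proof (rule tendsto_sandwich[where f = "\<lambda>K. min 0 (1 / 4 - u (real K) / 2)" and h = "\<lambda>_. 0"])
    have "(\<lambda>K. min 0 (1 / 4 - u (real K) / 2)) \<longlonglongrightarrow> min 0 (1 / 4 - 1 / 2 / 2)"
      by (intro tendsto_intros filterlim_compose[OF ulim filterlim_real_sequentially]) simp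
    then show "(\<lambda>K. min 0 (1 / 4 - u (real K) / 2)) \<longlonglongrightarrow> 0" by simp
    have "eventually (\<lambda>K. L (real K) > 0) sequentially"
      using Lpos filterlim_real_sequentially by (rule eventually_compose_filterlim)
    then show "eventually (\<lambda>K. min 0 (1 / 4 - u (real K) / 2) \<le> e K) sequentially"
      using eventually_ge_at_top[of 1]
    proof eventually_elim
      case (elim K)
      then show ?case using low[of K] by (simp add: e_def min_def)
    qed
  qed (auto simp: e_def)
  then have "e \<in> o(\<lambda>_. 1)" by (intro smalloI_tendsto) simp_all
  moreover have "\<forall>K\<ge>1. r K \<ge> 3 / 4 + e K" by (auto simp: e_def)
  ultimately show ?thesis unfolding r_def by blast
qed

end
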